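(* Let $p\ge1$ be a real number and let $m\ge2$ be a fixed integer. Let $X_1,X_2,\dots$ be i.i.d. real random variables and let $h:\mathbb R^m\to\mathbb R$ be a fixed symmetric Borel-measurable function such that: (Mean zero) $\mathbb E[h(X_1,\dots,X_m)]=0$; (Moment condition) $\mathbb E\bigl[|h(X_1,\dots,X_m)|^{p+2}\bigr]<\infty$; (Non-degeneracy condition) $\mathbb E[g(X_1)^2]>0$, where $g(x):=\mathbb E[h(X_1,\dots,X_m)\mid X_1=x]$. Let $$W_n:=\frac1{\sigma_n}\sum_{1\le i_1<\cdots<i_m\le n}h(X_{i_1},\dots,X_{i_m}),\qquad \sigma_n^2:=\operatorname{Var}\Bigl(\sum_{1\le i_1<\cdots<i_m\le n}h(X_{i_1},\dots,X_{i_m})\Bigr).$$ Then, as $n\to\infty$, $$\mathcal W_p(\mathcal L(W_n),\mathcal N(0,1))=\mathcal O(n^{-1/2}).$$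
   Context: $\mathcal L(Y)$ is the distribution of $Y$; $\mathcal W_p(\nu,\mu):=\inf_\gamma(\mathbb E_{(X,Y)\sim\gamma}|X-Y|^p)^{1/p}$ over all couplings $\gamma$ of $\nu,\mu$. *)

theory Defs
  imports "HOL-Probability.Probability"
begin

definition couplings :: "real measure \<Rightarrow> real measure \<Rightarrow> (real \<times> real) measure set" where
  "couplings \<nu> \<mu> = {\<gamma>. sets \<gamma> = sets (borel \<Otimes>\<^sub>M borel)
     \<and> distr \<gamma> borel fst = \<nu> \<and> distr \<gamma> borel snd = \<mu>}"

(* The p-th root on [0, \<infinity>]; the case distinction is needed because enn2real \<infinity> = 0. *)
definition ennroot :: "real \<Rightarrow> ennreal \<Rightarrow> ennreal" where
  "ennroot p a = (if a = \<infinity> then \<infinity> else ennreal (enn2real a powr (1 / p)))"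

definition wasserstein :: "real \<Rightarrow> real measure \<Rightarrow> real measure \<Rightarrow> ennreal" where
  "wasserstein p \<nu> \<mu> =
     (INF \<gamma>\<in>couplings \<nu> \<mu>. ennroot p (\<integral>\<^sup>+ (x, y). ennreal (\<bar>x - y\<bar> powr p) \<partial>\<gamma>))"

(* A kernel on R^m is a function h on the product space PiM {..<m} (\<lambda>_. borel), so coordinates
   are numbered 0, ..., m - 1 and arguments of h are extensional functions on {..<m}. *)
definition symmetric_kernel :: "nat \<Rightarrow> ((nat \<Rightarrow> real) \<Rightarrow> real) \<Rightarrow> bool" where
  "symmetric_kernel m h \<longleftrightarrow>
     (\<forall>\<pi> x. \<pi> permutes {..<m} \<longrightarrow> x \<in> {..<m} \<rightarrow>\<^sub>E UNIV \<longrightarrow> h (\<lambda>j\<in>{..<m}. x (\<pi> j)) = h x)"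

(* Index tuples 1 \<le> i_1 < ... < i_m \<le> n; the component i_k is i (k - 1). *)
definition increasing_tuples :: "nat \<Rightarrow> nat \<Rightarrow> (nat \<Rightarrow> nat) set" where
  "increasing_tuples m n = {i \<in> {..<m} \<rightarrow>\<^sub>E {1..n}. strict_mono_on {..<m} i}"

definition U_sum ::
  "(nat \<Rightarrow> 'a \<Rightarrow> real) \<Rightarrow> ((nat \<Rightarrow> real) \<Rightarrow> real) \<Rightarrow> nat \<Rightarrow> nat \<Rightarrow> 'a \<Rightarrow> real" where
  "U_sum X h m n \<omega> = (\<Sum>i\<in>increasing_tuples m n. h (\<lambda>j\<in>{..<m}. X (i j) \<omega>))"

definition U_sigma ::
  "'a measure \<Rightarrow> (nat \<Rightarrow> 'a \<Rightarrow> real) \<Rightarrow> ((nat \<Rightarrow> real) \<Rightarrow> real) \<Rightarrow> nat \<Rightarrow> nat \<Rightarrow> real" where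
  "U_sigma M X h m n = sqrt (prob_space.variance M (U_sum X h m n))"

definition W ::
  "'a measure \<Rightarrow> (nat \<Rightarrow> 'a \<Rightarrow> real) \<Rightarrow> ((nat \<Rightarrow> real) \<Rightarrow> real) \<Rightarrow> nat \<Rightarrow> nat \<Rightarrow> 'a \<Rightarrow> real" where
  "W M X h m n \<omega> = U_sum X h m n \<omega> / U_sigma M X h m n"

(* g is a version of x \<mapsto> E[Y | Z = x], i.e. g is Borel and g(Z) = E[Y | \<sigma>(Z)] almost surely. *)
definition cond_exp_given ::
  "'a measure \<Rightarrow> ('a \<Rightarrow> real) \<Rightarrow> ('a \<Rightarrow> real) \<Rightarrow> (real \<Rightarrow> real) \<Rightarrow> bool" where
  "cond_exp_given M Y Z g \<longleftrightarrow> g \<in> borel_measurable borel \<and>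
     (AE \<omega> in M. g (Z \<omega>) = real_cond_exp M (vimage_algebra (space M) Z borel) Y \<omega>)"

end

theory Submission
  imports Defs
begin

text \<open>
  Hoeffding's projection replaces the U-statistic by a multiple of the i.i.d. sum of
  \<open>ghat (X k)\<close>, where \<open>ghat\<close> is the conditional expectation of the kernel given one argument.
  In the moment of even order \<open>2r\<close> of the remainder, a product of \<open>2r\<close> residuals has mean zero
  unless each index tuple shares at least two indices with the other tuples; such a family involves
  at most \<open>2r(m - 1)\<close> indices, so the remainder is \<open>O(n\<^sup>m\<^sup>-\<^sup>1)\<close> in \<open>L\<^sup>p\<close>, smaller by
  \<open>n\<^sup>-\<^sup>1\<^sup>/\<^sup>2\<close> than the projection.

  It remains to couple an unnormalised i.i.d. sum with a Gaussian variable at bounded \<open>L\<^sup>p\<close> cost.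
  Truncate the summands at \<open>sqrt n\<close>, add an independent Gaussian of fixed variance, and first
  exchange each summand for one with the same third moment, taking over a fixed part of its variance
  into the Gaussian; then, with Gaussian noise of variance of order \<open>n\<close> present, exchange the
  summands for Gaussian ones. The cost of an exchange is read off from the distribution functions:
  if both \<open>F\<close> and \<open>G\<close> increase at least like the integral of \<open>w\<close>, then the \<open>p\<close>-th power of the
  transport cost is at most the integral of \<open>\<bar>F - G\<bar>\<^sup>p w\<^sup>1\<^sup>-\<^sup>p\<close>. The costs are summable along the chain.
\<close>

section \<open>Transport cost of quantile couplings\<close>

text \<open>Minkowski's inequality adds the p-th roots of the transport costs, so these roots have
  to be summable along the chain. One exchange at noise variance v with matching third moments moves
  the distribution function by O(v^(-3/2)) times a Gaussian profile; with only two matching moments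
  it would be O(v^(-1)), and the sum over v ~ k would grow like log n. The second chain affords
  O(v^(-1)), since there v is of order n in each of n steps. The first chain alters a summand only
  on a fixed bounded set, so large values of the new summand \<eta> enter just through the changed
  noise variance. Their share is v^(-1/2) P(|\<eta>| > sqrt v)^(1/p), which Markov's inequality of
  order p + 2 bounds by a multiple of v^(-1-1/p): summable for every p. The cost of an exchange must
  not depend on the rest of the sum. This is achieved by choosing w as a mixture over the same law
  as the bound on F - G, because f^p w^(1-p) is jointly convex and homogeneous in (f, w), so mixing
  does not increase the integral.\<close>

lemma powr_tangent_nonpos:
  fixes r x :: real
  assumes "r \<le> 0" "x > 0"
  shows "1 + r * (x - 1) \<le> x powr r"
proof -
  have "r * (x - 1) \<le> r * ln x"
    using assms ln_le_minus_one[of x] by (intro mult_left_mono_neg) auto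
  moreover have "1 + r * ln x \<le> exp (r * ln x)" by (rule exp_ge_add_one_self)
  ultimately have "1 + r * (x - 1) \<le> exp (r * ln x)" by linarith
  then show ?thesis using assms by (simp add: powr_def)
qed

lemma powr_tangent_ge_1:
  fixes p x :: real
  assumes "p \<ge> 1" "x \<ge> 0"
  shows "1 + p * (x - 1) \<le> x powr p"
proof (cases "x = 0")
  case False
  then have x: "x > 0" using assms by simp
  \<comment> \<open>At 1/x the logarithm inequality reads ln x \<ge> 1 - 1/x. It is used with the
    exponent p - 1, and multiplication by x restores the exponent p.\<close>
  have "ln (1/x) \<le> 1/x - 1" using x by (intro ln_le_minus_one) auto
  then have "ln x \<ge> 1 - 1/x" using x by (simp add: ln_div)
  then have "(p - 1) * (1 - 1/x) \<le> (p - 1) * ln x" using assms by (intro mult_left_mono) auto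
  moreover have "1 + (p - 1) * ln x \<le> exp ((p - 1) * ln x)" by (rule exp_ge_add_one_self)
  ultimately have "1 + (p - 1) * (1 - 1/x) \<le> exp ((p - 1) * ln x)" by linarith
  then have "1 + (p - 1) * (1 - 1/x) \<le> x powr (p - 1)" using x by (simp add: powr_def)
  then have "x * (1 + (p - 1) * (1 - 1/x)) \<le> x * x powr (p - 1)"
    using x by (intro mult_left_mono) auto
  also have "x * x powr (p - 1) = x powr p" using x by (simp add: powr_diff)
  also have "x * (1 + (p - 1) * (1 - 1/x)) = 1 + p * (x - 1)" using x by (simp add: field_simps)
  finally show ?thesis .
qed (use assms in auto)

lemma powr_tangent:
  fixes p s t :: real
  assumes "p \<ge> 1" "s > 0" "t \<ge> 0"
  shows "s powr p + p * s powr (p - 1) * (t - s) \<le> t powr p"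
proof -
  have "s powr p * (1 + p * (t / s - 1)) \<le> s powr p * (t / s) powr p"
    using assms by (intro mult_left_mono powr_tangent_ge_1) auto
  also have "\<dots> = t powr p" using assms by (simp add: powr_divide)
  also have "s powr p * (1 + p * (t / s - 1)) = s powr p + p * s powr (p - 1) * (t - s)"
    using assms by (simp add: powr_diff field_simps)
  finally show ?thesis .
qed

lemma powr_convex_comb:
  fixes p a b x y :: real
  assumes p: "p \<ge> 1" and ab: "a \<ge> 0" "b \<ge> 0" "a + b = 1" and xy: "x \<ge> 0" "y \<ge> 0"
  shows "(a * x + b * y) powr p \<le> a * x powr p + b * y powr p"
proof (cases "a * x + b * y = 0")
  case True
  then show ?thesis using assms by simp
next
  case False
  define s where "s = a * x + b * y"
  have s: "s > 0" using False assms unfolding s_def by (smt (verit) mult_nonneg_nonneg)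
  have "a * (s powr p + p * s powr (p - 1) * (x - s)) + b * (s powr p + p * s powr (p - 1) * (y - s))
        \<le> a * x powr p + b * y powr p"
    using assms s by (intro add_mono mult_left_mono powr_tangent) auto
  also have "a * (s powr p + p * s powr (p - 1) * (x - s)) + b * (s powr p + p * s powr (p - 1) * (y - s))
     = (a + b) * s powr p + p * s powr (p - 1) * ((a * x + b * y) - (a + b) * s)"
    by (simp add: algebra_simps)
  also have "\<dots> = s powr p" using assms by (simp add: s_def)
  finally show ?thesis by (simp add: s_def)
qed

lemma powr_add_le:
  fixes p x y :: real
  assumes "p \<ge> 1" "x \<ge> 0" "y \<ge> 0"
  shows "(x + y) powr p \<le> 2 powr (p - 1) * (x powr p + y powr p)"
proof -
  have "(x + y) powr p = 2 powr p * ((1/2) * x + (1/2) * y) powr p"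
    using assms by (simp add: powr_mult[symmetric])
  also have "\<dots> \<le> 2 powr p * ((1/2) * x powr p + (1/2) * y powr p)"
    using assms by (intro mult_left_mono powr_convex_comb) auto
  also have "\<dots> = 2 powr (p - 1) * (x powr p + y powr p)" by (simp add: powr_diff field_simps)
  finally show ?thesis .
qed

text \<open>Minkowski's inequality, phrased with upper bounds a^p and b^p in place of norms:
  convexity of t^p with the weights a/(a+b) and b/(a+b) makes it a pointwise inequality, and no norm
  that might vanish has to be divided by.\<close>

lemma nn_integral_powr_triangle:
  fixes f g :: "'a \<Rightarrow> real" and p a b :: real
  assumes p: "p \<ge> 1" and [measurable]: "f \<in> borel_measurable M" "g \<in> borel_measurable M"
    and ab: "a > 0" "b > 0"
    and f: "(\<integral>\<^sup>+x. ennreal (\<bar>f x\<bar> powr p) \<partial>M) \<le> ennreal (a powr p)"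
    and g: "(\<integral>\<^sup>+x. ennreal (\<bar>g x\<bar> powr p) \<partial>M) \<le> ennreal (b powr p)"
  shows "(\<integral>\<^sup>+x. ennreal (\<bar>f x + g x\<bar> powr p) \<partial>M) \<le> ennreal ((a + b) powr p)"
proof -
  define A where "A = (a + b) powr p * (a / (a + b)) / a powr p"
  define B where "B = (a + b) powr p * (b / (a + b)) / b powr p"
  have AB: "A \<ge> 0" "B \<ge> 0" using ab by (auto simp: A_def B_def)
  have pw: "\<bar>f x + g x\<bar> powr p \<le> A * \<bar>f x\<bar> powr p + B * \<bar>g x\<bar> powr p" for x
  proof -
    have "\<bar>f x + g x\<bar> powr p \<le> (\<bar>f x\<bar> + \<bar>g x\<bar>) powr p"
      using p by (intro powr_mono2) auto
    also have "\<bar>f x\<bar> + \<bar>g x\<bar> = (a + b) * (a / (a + b) * (\<bar>f x\<bar> / a) + b / (a + b) * (\<bar>g x\<bar> / b))"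
    proof -
      have "c * (a / c * (\<bar>f x\<bar> / a) + b / c * (\<bar>g x\<bar> / b)) = \<bar>f x\<bar> + \<bar>g x\<bar>"
        if "c \<noteq> 0" for c using that ab by (simp add: field_simps)
      from this[of "a + b"] show ?thesis using ab by simp
    qed
    also have "\<dots> powr p = (a + b) powr p * (a / (a + b) * (\<bar>f x\<bar> / a) + b / (a + b) * (\<bar>g x\<bar> / b)) powr p"
      using ab by (intro powr_mult)
    also have "\<dots> \<le> (a + b) powr p * (a / (a + b) * (\<bar>f x\<bar> / a) powr p + b / (a + b) * (\<bar>g x\<bar> / b) powr p)"
      using ab p by (intro mult_left_mono powr_convex_comb) (auto simp: add_divide_distrib[symmetric])
    also have "\<dots> = A * \<bar>f x\<bar> powr p + B * \<bar>g x\<bar> powr p"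
      using ab by (simp add: A_def B_def powr_divide algebra_simps)
    finally show ?thesis .
  qed
  have "(\<integral>\<^sup>+x. ennreal (\<bar>f x + g x\<bar> powr p) \<partial>M)
      \<le> (\<integral>\<^sup>+x. ennreal A * ennreal (\<bar>f x\<bar> powr p) + ennreal B * ennreal (\<bar>g x\<bar> powr p) \<partial>M)"
    using AB pw by (intro nn_integral_mono)
      (auto simp: ennreal_mult[symmetric] ennreal_plus[symmetric] simp del: ennreal_plus intro!: ennreal_leI)
  also have "\<dots> = ennreal A * (\<integral>\<^sup>+x. ennreal (\<bar>f x\<bar> powr p) \<partial>M) + ennreal B * (\<integral>\<^sup>+x. ennreal (\<bar>g x\<bar> powr p) \<partial>M)"
    by (simp add: nn_integral_add nn_integral_cmult)
  also have "\<dots> \<le> ennreal A * ennreal (a powr p) + ennreal B * ennreal (b powr p)"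
    using f g by (intro add_mono mult_left_mono) auto
  also have "\<dots> = ennreal (A * a powr p + B * b powr p)"
    using AB by (simp add: ennreal_mult ennreal_plus)
  also have "A * a powr p + B * b powr p = (a + b) powr p * (a / (a + b) + b / (a + b))"
    using ab by (simp add: A_def B_def distrib_left)
  also have "\<dots> = (a + b) powr p" using ab by (simp add: add_divide_distrib[symmetric])
  finally show ?thesis .
qed

text \<open>f^p w^(1-p) is the perspective of the convex function t^p, hence jointly convex and
  homogeneous of degree 1 in (f, w), so Jensen's inequality holds for the pair. In
  \<open>powr\<close> a vanishing base gives 0, where the quotient f^p / w^(p-1) should be infinite;
  the hypothesis \<open>fw\<close> excludes this case.\<close>

lemma integral_powr_ratio_le:
  fixes f w :: "'a \<Rightarrow> real" and p :: real
  assumes p: "p \<ge> 1" and f: "integrable M f" and w: "integrable M w"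
    and f0: "\<And>x. f x \<ge> 0" and w0: "\<And>x. w x \<ge> 0" and fw: "\<And>x. w x = 0 \<Longrightarrow> f x = 0"
  shows "ennreal ((\<integral>x. f x \<partial>M) powr p * (\<integral>x. w x \<partial>M) powr (1 - p))
    \<le> (\<integral>\<^sup>+x. ennreal (f x powr p * w x powr (1 - p)) \<partial>M)"
proof (cases "(\<integral>x. f x \<partial>M) = 0 \<or> (\<integral>x. w x \<partial>M) = 0 \<or> (\<integral>\<^sup>+x. ennreal (f x powr p * w x powr (1 - p)) \<partial>M) = \<infinity>")
  case True
  then show ?thesis using p by auto
next
  case False
  let ?k = "\<lambda>x. f x powr p * w x powr (1 - p)"
  define W where "W = (\<integral>x. w x \<partial>M)"
  define s where "s = (\<integral>x. f x \<partial>M) / W"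
  have [measurable]: "f \<in> borel_measurable M" "w \<in> borel_measurable M" using f w by auto
  have Wp: "W > 0" using False w0 by (simp add: W_def less_le)
  have F0: "(\<integral>x. f x \<partial>M) > 0" using False f0 by (simp add: less_le)
  then have s: "s > 0" using Wp by (simp add: s_def)
  have k: "integrable M ?k"
    using False by (intro integrableI_nonneg) (auto simp: top.not_eq_extremum)
  \<comment> \<open>Tangent of t^p at the quotient \<open>s\<close> of the two integrals, multiplied
    by \<open>w\<close>. The linear term integrates to 0, which leaves s^p W.\<close>
  have pw: "s powr p * w x + p * s powr (p - 1) * (f x - s * w x) \<le> ?k x" for x
  proof (cases "w x = 0")
    case True
    then show ?thesis using fw[of x] by simp
  next
    case False
    then have wx: "w x > 0" using w0[of x] by simp
    have "w x * (s powr p + p * s powr (p - 1) * (f x / w x - s)) \<le> w x * (f x / w x) powr p"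
      using wx f0[of x] s p by (intro mult_left_mono powr_tangent) auto
    also have "\<dots> = ?k x" using wx f0[of x] by (simp add: powr_divide powr_diff)
    also have "w x * (s powr p + p * s powr (p - 1) * (f x / w x - s)) = s powr p * w x + p * s powr (p - 1) * (f x - s * w x)"
      using wx by (simp add: field_simps)
    finally show ?thesis .
  qed
  have "(\<integral>x. s powr p * w x + p * s powr (p - 1) * (f x - s * w x) \<partial>M) \<le> (\<integral>x. ?k x \<partial>M)"
    using f w k pw by (intro integral_mono) auto
  also have "(\<integral>x. s powr p * w x + p * s powr (p - 1) * (f x - s * w x) \<partial>M)
     = s powr p * W + p * s powr (p - 1) * ((\<integral>x. f x \<partial>M) - s * W)"
    using f w by (simp add: W_def)
  also have "\<dots> = s powr p * W" using Wp by (simp add: s_def)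
  also have "\<dots> = (\<integral>x. f x \<partial>M) powr p * W powr (1 - p)"
    using Wp F0 by (simp add: s_def powr_divide powr_diff)
  finally have "ennreal ((\<integral>x. f x \<partial>M) powr p * W powr (1 - p)) \<le> ennreal (\<integral>x. ?k x \<partial>M)"
    by (intro ennreal_leI)
  also have "\<dots> = (\<integral>\<^sup>+x. ennreal (?k x) \<partial>M)"
    using k by (intro nn_integral_eq_integral[symmetric]) auto
  finally show ?thesis by (simp add: W_def)
qed

section \<open>Quantile functions on the open unit interval\<close>

definition unit_measure :: "real measure" where
  "unit_measure = restrict_space lborel {0<..<1}"

lemma space_unit_measure: "space unit_measure = {0<..<1}"
  by (simp add: unit_measure_def space_restrict_space)

lemma prob_space_unit_measure: "prob_space unit_measure"
  unfolding unit_measure_def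
  by (auto simp: space_restrict_space emeasure_restrict_space intro!: prob_spaceI)

lemma measurable_unit_measure: "f \<in> borel_measurable borel \<Longrightarrow> f \<in> borel_measurable unit_measure"
  unfolding unit_measure_def by (intro measurable_restrict_space1) auto

text \<open>The generalised inverse is meaningful for 0 < u < 1 only: elsewhere the set may be empty
  or unbounded below, and \<open>Inf\<close> takes an unspecified value. Hence
  \<open>unit_measure\<close> omits both endpoints.\<close>

definition quantile :: "real measure \<Rightarrow> real \<Rightarrow> real" where
  "quantile \<mu> u = Inf {x. u \<le> cdf \<mu> x}"

lemma quantile_le_iff:
  assumes "real_distribution \<mu>" "u \<in> {0<..<1}"
  shows "quantile \<mu> u \<le> x \<longleftrightarrow> u \<le> cdf \<mu> x"
proof -
  interpret cdf_distribution \<mu> using assms(1) by (simp add: cdf_distribution_def)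
  show ?thesis unfolding quantile_def using pseudoinverse[of u x] assms(2) by simp
qed

lemma measurable_quantile [measurable]:
  assumes "real_distribution \<mu>"
  shows "quantile \<mu> \<in> borel_measurable unit_measure"
proof -
  interpret cdf_distribution \<mu> using assms(1) by (simp add: cdf_distribution_def)
  have "sets unit_measure = sets (restrict_space borel {0<..<1})"
    unfolding unit_measure_def by (intro sets_restrict_space_cong) auto
  then show ?thesis unfolding quantile_def[abs_def]
    using measurable_CI measurable_cong_sets by blast
qed

lemma distr_quantile:
  assumes "real_distribution \<mu>"
  shows "distr unit_measure borel (quantile \<mu>) = \<mu>"
proof -
  interpret cdf_distribution \<mu> using assms(1) by (simp add: cdf_distribution_def)
  show ?thesis unfolding quantile_def[abs_def] unit_measure_def by (rule distr_I_eq_M)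
qed

text \<open>Every x below the quantile has a value smaller than u, so by continuity the value at the
  quantile does not exceed u either. A jump could overshoot u.\<close>

lemma cdf_quantile:
  assumes \<mu>: "real_distribution \<mu>" and u: "u \<in> {0<..<1}" and cont: "isCont (cdf \<mu>) (quantile \<mu> u)"
  shows "cdf \<mu> (quantile \<mu> u) = u"
proof (rule antisym)
  show "u \<le> cdf \<mu> (quantile \<mu> u)" using quantile_le_iff[OF \<mu> u] by blast
  have "(cdf \<mu> \<longlongrightarrow> cdf \<mu> (quantile \<mu> u)) (at_left (quantile \<mu> u))"
    using cont by (simp add: isCont_def filterlim_at_split)
  moreover have "eventually (\<lambda>x. cdf \<mu> x \<le> u) (at_left (quantile \<mu> u))"
    unfolding eventually_at_filter
    by (intro always_eventually) (use quantile_le_iff[OF \<mu> u] in \<open>metis lessThan_iff linorder_not_le less_imp_le\<close>)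
  ultimately show "cdf \<mu> (quantile \<mu> u) \<le> u"
    by (intro tendsto_upperbound) auto
qed

text \<open>\<open>ennreal\<close> sends negative values to 0, so the right side integrates the
  positive part. Applied below to a tangent line that may become negative.\<close>

lemma ennreal_integral_le_nn_integral:
  fixes f :: "'a \<Rightarrow> real"
  assumes "integrable M f"
  shows "ennreal (\<integral>x. f x \<partial>M) \<le> (\<integral>\<^sup>+x. ennreal (f x) \<partial>M)"
proof -
  have "ennreal (\<integral>x. f x \<partial>M) \<le> ennreal (\<integral>x. max 0 (f x) \<partial>M)"
    using assms by (intro ennreal_leI integral_mono) auto
  also have "\<dots> = (\<integral>\<^sup>+x. ennreal (max 0 (f x)) \<partial>M)"
    using assms by (intro nn_integral_eq_integral[symmetric]) auto
  also have "\<dots> = (\<integral>\<^sup>+x. ennreal (f x) \<partial>M)"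
    by (intro nn_integral_cong) (simp add: max_def ennreal_neg)
  finally show ?thesis .
qed

text \<open>The factor (F - G)^(p-1) is at least \<omega>^(p-1) on the whole interval, where
  \<omega> is the integral of \<open>w\<close> over it, and by convexity of t^(1-p) the mean of
  w^(1-p) is at least (\<omega>/(b-a))^(1-p). All powers of \<omega> cancel in the product, which
  leaves (b-a)^p.\<close>

lemma quantile_gap_powr_le:
  fixes w F G :: "real \<Rightarrow> real" and p a b :: real
  assumes p: "p \<ge> 1" and [measurable]: "w \<in> borel_measurable borel" "F \<in> borel_measurable borel" "G \<in> borel_measurable borel"
    and w0: "\<And>x. w x > 0"
    and int_w: "\<And>c d. set_integrable lborel {c..d} w"
    and F: "\<And>c d. c \<le> d \<Longrightarrow> (LBINT x:{c..d}. w x) \<le> F d - F c"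
    and G: "\<And>c d. c \<le> d \<Longrightarrow> (LBINT x:{c..d}. w x) \<le> G d - G c"
    and ab: "a < b" and eq: "G b \<le> F a"
  shows "ennreal ((b - a) powr p)
    \<le> (\<integral>\<^sup>+x\<in>{a..<b}. ennreal ((F x - G x) powr (p - 1) * w x powr (1 - p)) \<partial>lborel)"
proof -
  define J where "J c d = (LBINT x:{c..d}. w x)" for c d
  have J0: "J c d \<ge> 0" for c d
    unfolding J_def set_lebesgue_integral_def using w0
    by (intro integral_nonneg_AE AE_I2) (auto simp: indicator_def less_imp_le)
  have J_add: "J a b = J a x + J x b" if "x \<in> {a..<b}" for x
  proof -
    have "{a..b} = {a..x} \<union> {x..b}" using that by auto
    then show ?thesis unfolding J_def using AE_lborel_singleton[of x] int_w
      by (auto intro!: set_integral_Un_AE)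
  qed
  define \<omega> where "\<omega> = J a b"
  \<comment> \<open>On the way from a to x the function F has grown by the integral over [a, x], and
    from x to b the function G has still to grow by the integral over [x, b]. As G b \<le> F a, the
    gap at x is at least the whole integral, wherever x lies.\<close>
  have gap: "\<omega> \<le> F x - G x" if "x \<in> {a..<b}" for x
    using F[of a x] G[of x b] that eq J_add[OF that] by (auto simp: \<omega>_def J_def)
  have \<omega>0: "\<omega> > 0"
  proof -
    have "\<omega> \<noteq> 0"
    proof
      assume "\<omega> = 0"
      then have "AE x in lborel. indicator {a..b} x *\<^sub>R w x = 0"
        using int_w[of a b] w0 unfolding \<omega>_def J_def set_lebesgue_integral_def set_integrable_def
        by (subst (asm) integral_nonneg_eq_0_iff_AE) (auto simp: indicator_def less_imp_le)
      then have "AE x in lborel. x \<notin> {a..b}"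
        by eventually_elim (use w0 in \<open>metis indicator_simps(1) less_irrefl scaleR_one\<close>)
      then have "{a..b} \<in> null_sets lborel"
        by (subst (asm) AE_iff_null_sets[symmetric]) auto
      then show False using ab by auto
    qed
    then show ?thesis using J0[of a b] by (simp add: \<omega>_def less_le)
  qed
  let ?R = "\<integral>\<^sup>+x\<in>{a..<b}. ennreal ((F x - G x) powr (p - 1) * w x powr (1 - p)) \<partial>lborel"
  define s where "s = \<omega> / (b - a)"
  have s: "s > 0" using \<omega>0 ab by (simp add: s_def)
  \<comment> \<open>Tangent of t^(1-p) at the mean \<open>s\<close> of \<open>w\<close>, times
    \<omega>^(p-1). Being affine in \<open>w\<close> it has an explicit integral, whether or not
    w^(1-p) is integrable.\<close>
  define k where "k = (\<lambda>x. \<omega> powr (p - 1) * (s powr (1 - p) + (1 - p) * s powr (- p) * (w x - s)))"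
  have kle: "k x \<le> (F x - G x) powr (p - 1) * w x powr (1 - p)" if "x \<in> {a..<b}" for x
  proof -
    have "s powr (1 - p) * (1 + (1 - p) * (w x / s - 1)) \<le> s powr (1 - p) * (w x / s) powr (1 - p)"
      using s w0[of x] p by (intro mult_left_mono powr_tangent_nonpos) auto
    also have "\<dots> = w x powr (1 - p)" using s w0[of x] by (simp add: powr_divide)
    also have "s powr (1 - p) * (1 + (1 - p) * (w x / s - 1)) = s powr (1 - p) + (1 - p) * s powr (- p) * (w x - s)"
    proof -
      have "s powr (1 - p) = s * s powr (- p)" using s by (simp add: powr_diff powr_minus field_simps)
      then show ?thesis using s by (simp add: field_simps)
    qed
    finally have "k x \<le> \<omega> powr (p - 1) * w x powr (1 - p)"
      unfolding k_def by (intro mult_left_mono) auto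
    also have "\<dots> \<le> (F x - G x) powr (p - 1) * w x powr (1 - p)"
      using gap[OF that] \<omega>0 p by (intro mult_right_mono powr_mono2) auto
    finally show ?thesis .
  qed
  have [measurable]: "k \<in> borel_measurable borel" unfolding k_def by (intro borel_measurable_times borel_measurable_add borel_measurable_diff borel_measurable_const assms)
  have ik: "integrable lborel (\<lambda>x. indicator {a..b} x *\<^sub>R w x)"
    using int_w[of a b] by (simp add: set_integrable_def)
  define c0 c1 where "c0 = \<omega> powr (p - 1) * (s powr (1 - p) - (1 - p) * s powr (- p) * s)"
    and "c1 = \<omega> powr (p - 1) * (1 - p) * s powr (- p)"
  have k_eq: "k x = c0 + c1 * w x" for x
    unfolding k_def c0_def c1_def by (simp add: algebra_simps)
  have keq: "indicator {a..b} x *\<^sub>R k x = c0 * indicator {a..b} x + c1 * (indicator {a..b} x *\<^sub>R w x)" for x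
    unfolding k_eq by (simp add: algebra_simps)
  have ic: "integrable lborel (\<lambda>x. c0 * indicator {a..b} x :: real)"
    by (intro integrable_mult_right integrable_real_indicator) (simp_all add: ab less_imp_le)
  have ik': "integrable lborel (\<lambda>x. c1 * (indicator {a..b} x *\<^sub>R w x))"
    using ik by (rule integrable_mult_right)
  have ik'': "integrable lborel (\<lambda>x. indicator {a..b} x *\<^sub>R k x)"
    unfolding keq using ic ik' by (rule Bochner_Integration.integrable_add)
  have "(\<integral>x. indicator {a..b} x *\<^sub>R k x \<partial>lborel) = c0 * (b - a) + c1 * \<omega>"
    unfolding keq Bochner_Integration.integral_add[OF ic ik'] integral_mult_right_zero \<omega>_def J_def set_lebesgue_integral_def
    using ab by simp
  also have "\<dots> = \<omega> powr (p - 1) * s powr (1 - p) * (b - a)"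
  proof -
    have \<omega>_eq: "\<omega> = s * (b - a)" using ab by (simp add: s_def)
    have "c0 * (b - a) + c1 * \<omega> = (c0 + c1 * s) * (b - a)"
      by (subst \<omega>_eq) (simp add: algebra_simps)
    also have "c0 + c1 * s = \<omega> powr (p - 1) * s powr (1 - p)"
      by (simp add: c0_def c1_def algebra_simps)
    finally show ?thesis .
  qed
  also have "\<dots> = \<omega> powr (p - 1) * \<omega> powr (1 - p) * (b - a) powr (p - 1) * (b - a) powr 1"
    using ab \<omega>0 by (simp add: s_def powr_divide powr_minus[of "b - a" "p - 1", simplified] field_simps)
  also have "\<dots> = (b - a) powr p"
    using ab \<omega>0 by (simp add: powr_diff)
  finally have "ennreal ((b - a) powr p) = ennreal (\<integral>x. indicator {a..b} x *\<^sub>R k x \<partial>lborel)" by simp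
  also have "\<dots> \<le> (\<integral>\<^sup>+x. ennreal (indicator {a..b} x *\<^sub>R k x) \<partial>lborel)"
    using ik'' by (rule ennreal_integral_le_nn_integral)
  also have "\<dots> \<le> ?R"
  proof (rule nn_integral_mono_AE)
    show "AE x in lborel. ennreal (indicator {a..b} x *\<^sub>R k x)
        \<le> ennreal ((F x - G x) powr (p - 1) * w x powr (1 - p)) * indicator {a..<b} x"
      using AE_lborel_singleton[of b]
    proof eventually_elim
      case (elim x)
      show ?case
      proof (cases "x \<in> {a..<b}")
        case True
        then show ?thesis using kle[OF True] by (simp add: ennreal_leI)
      next
        case False
        then have "x \<notin> {a..b}" using elim by auto
        then show ?thesis by simp
      qed
    qed
  qed
  finally show ?thesis .
qed

lemma real_distribution_cdf_measurable:
  assumes "real_distribution \<mu>"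
  shows "cdf \<mu> \<in> borel_measurable borel"
proof -
  interpret cdf_distribution \<mu> using assms(1) by (simp add: cdf_distribution_def)
  show ?thesis by (rule measurable_C)
qed

text \<open>For a fixed level u both distribution functions equal u at their own quantile, so
  \<open>quantile_gap_powr_le\<close> bounds the p-th power of the distance by an integral between
  the two quantiles. Integrating over u and exchanging the integrals turns the interval of points x
  into an interval of levels u.\<close>

theorem nn_integral_quantile_diff_le:
  fixes w :: "real \<Rightarrow> real" and p :: real
  assumes p: "p \<ge> 1" and \<mu>: "real_distribution \<mu>" and \<nu>: "real_distribution \<nu>"
    and w[measurable]: "w \<in> borel_measurable borel" and w0: "\<And>x. w x > 0"
    and int_w: "\<And>c d. set_integrable lborel {c..d} w"
    and F: "\<And>c d. c \<le> d \<Longrightarrow> (LBINT x:{c..d}. w x) \<le> cdf \<mu> d - cdf \<mu> c"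
    and G: "\<And>c d. c \<le> d \<Longrightarrow> (LBINT x:{c..d}. w x) \<le> cdf \<nu> d - cdf \<nu> c"
    and contF: "\<And>x. isCont (cdf \<mu>) x" and contG: "\<And>x. isCont (cdf \<nu>) x"
  shows "(\<integral>\<^sup>+u. ennreal (\<bar>quantile \<mu> u - quantile \<nu> u\<bar> powr p) \<partial>unit_measure)
    \<le> (\<integral>\<^sup>+x. ennreal (\<bar>cdf \<mu> x - cdf \<nu> x\<bar> powr p * w x powr (1 - p)) \<partial>lborel)"
proof -
  interpret U: prob_space unit_measure by (rule prob_space_unit_measure)
  interpret P: pair_sigma_finite unit_measure lborel
    by (intro pair_sigma_finite.intro U.sigma_finite_measure_axioms lborel.sigma_finite_measure_axioms)
  have [measurable]: "cdf \<mu> \<in> borel_measurable borel" "cdf \<nu> \<in> borel_measurable borel"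
    using \<mu> \<nu> by (auto intro: real_distribution_cdf_measurable)
  define D where "D = (\<lambda>x. \<bar>cdf \<mu> x - cdf \<nu> x\<bar> powr (p - 1) * w x powr (1 - p))"
  have [measurable]: "D \<in> borel_measurable borel"
    unfolding D_def by measurable
  \<comment> \<open>\<open>S (u, x)\<close> says that u lies between the two values at x. By
    \<open>quantile_le_iff\<close> the same x are those between the two quantiles of level
    u.\<close>
  define S where "S = (\<lambda>(u::real, x). (u \<le> cdf \<mu> x \<and> cdf \<nu> x < u) \<or> (u \<le> cdf \<nu> x \<and> cdf \<mu> x < u))"
  have S[measurable]: "Measurable.pred (unit_measure \<Otimes>\<^sub>M lborel) S"
  proof -
    have [measurable]: "fst \<in> borel_measurable (unit_measure \<Otimes>\<^sub>M lborel)"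
      using measurable_compose[OF measurable_fst measurable_unit_measure[OF measurable_ident]] by simp
    show ?thesis unfolding S_def case_prod_beta by measurable
  qed
  have pw: "ennreal (\<bar>quantile \<mu> u - quantile \<nu> u\<bar> powr p)
      \<le> (\<integral>\<^sup>+x. ennreal (D x) * indicator {z. S z} (u, x) \<partial>lborel)" if u: "u \<in> {0<..<1}" for u
  proof -
    note q\<mu> = quantile_le_iff[OF \<mu> u] and q\<nu> = quantile_le_iff[OF \<nu> u]
    note c\<mu> = cdf_quantile[OF \<mu> u contF] and c\<nu> = cdf_quantile[OF \<nu> u contG]
    consider "quantile \<mu> u = quantile \<nu> u" | "quantile \<mu> u < quantile \<nu> u" | "quantile \<nu> u < quantile \<mu> u"
      by linarith
    then show ?thesis
    proof cases
      case 1
      then show ?thesis using p by simp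
    next
      case 2
      have "ennreal ((quantile \<nu> u - quantile \<mu> u) powr p) \<le> (\<integral>\<^sup>+x\<in>{quantile \<mu> u..<quantile \<nu> u}.
          ennreal ((cdf \<mu> x - cdf \<nu> x) powr (p - 1) * w x powr (1 - p)) \<partial>lborel)"
        by (intro quantile_gap_powr_le p w w0 int_w F G 2) (auto simp: c\<mu> c\<nu>)
      also have "\<dots> \<le> (\<integral>\<^sup>+x. ennreal (D x) * indicator {z. S z} (u, x) \<partial>lborel)"
      proof (intro nn_integral_mono)
        fix x
        show "ennreal ((cdf \<mu> x - cdf \<nu> x) powr (p - 1) * w x powr (1 - p)) * indicator {quantile \<mu> u..<quantile \<nu> u} x
          \<le> ennreal (D x) * indicator {z. S z} (u, x)"
          using q\<mu>[of x] q\<nu>[of x] by (cases "x \<in> {quantile \<mu> u..<quantile \<nu> u}") (auto simp: D_def S_def not_le)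
      qed
      finally show ?thesis using 2 by (simp add: abs_minus_commute)
    next
      case 3
      have "ennreal ((quantile \<mu> u - quantile \<nu> u) powr p) \<le> (\<integral>\<^sup>+x\<in>{quantile \<nu> u..<quantile \<mu> u}.
          ennreal ((cdf \<nu> x - cdf \<mu> x) powr (p - 1) * w x powr (1 - p)) \<partial>lborel)"
        by (intro quantile_gap_powr_le p w w0 int_w F G 3) (auto simp: c\<mu> c\<nu>)
      also have "\<dots> \<le> (\<integral>\<^sup>+x. ennreal (D x) * indicator {z. S z} (u, x) \<partial>lborel)"
      proof (intro nn_integral_mono)
        fix x
        show "ennreal ((cdf \<nu> x - cdf \<mu> x) powr (p - 1) * w x powr (1 - p)) * indicator {quantile \<nu> u..<quantile \<mu> u} x
          \<le> ennreal (D x) * indicator {z. S z} (u, x)"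
          using q\<mu>[of x] q\<nu>[of x] by (cases "x \<in> {quantile \<nu> u..<quantile \<mu> u}") (auto simp: D_def S_def not_le)
      qed
      finally show ?thesis using 3 by simp
    qed
  qed
  \<comment> \<open>The levels u that belong to a given x fill an interval of length |F - G|, which
    supplies the power missing in (F - G)^(p-1).\<close>
  have len: "(\<integral>\<^sup>+u. indicator {z. S z} (u, x) \<partial>unit_measure) \<le> ennreal \<bar>cdf \<mu> x - cdf \<nu> x\<bar>" for x
  proof -
    let ?A = "{min (cdf \<mu> x) (cdf \<nu> x)..max (cdf \<mu> x) (cdf \<nu> x)}"
    have "(\<integral>\<^sup>+u. indicator {z. S z} (u, x) \<partial>unit_measure) \<le> (\<integral>\<^sup>+u. indicator ?A u \<partial>unit_measure)"
      by (intro nn_integral_mono) (auto simp: S_def indicator_def)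
    also have "\<dots> \<le> (\<integral>\<^sup>+u. indicator ?A u \<partial>lborel)"
      unfolding unit_measure_def by (subst nn_integral_restrict_space) (simp, intro nn_integral_mono, simp split: split_indicator)
    also have "\<dots> = ennreal \<bar>cdf \<mu> x - cdf \<nu> x\<bar>"
      by (auto simp: min_def max_def abs_if)
    finally show ?thesis .
  qed
  have "(\<integral>\<^sup>+u. ennreal (\<bar>quantile \<mu> u - quantile \<nu> u\<bar> powr p) \<partial>unit_measure)
     \<le> (\<integral>\<^sup>+u. (\<integral>\<^sup>+x. ennreal (D x) * indicator {z. S z} (u, x) \<partial>lborel) \<partial>unit_measure)"
    by (intro nn_integral_mono pw) (simp add: space_unit_measure)
  also have "\<dots> = (\<integral>\<^sup>+x. (\<integral>\<^sup>+u. ennreal (D x) * indicator {z. S z} (u, x) \<partial>unit_measure) \<partial>lborel)"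
    by (rule P.Fubini'[symmetric]) measurable
  also have "\<dots> = (\<integral>\<^sup>+x. ennreal (D x) * (\<integral>\<^sup>+u. indicator {z. S z} (u, x) \<partial>unit_measure) \<partial>lborel)"
    by (intro nn_integral_cong nn_integral_cmult) measurable
  also have "\<dots> \<le> (\<integral>\<^sup>+x. ennreal (D x) * ennreal \<bar>cdf \<mu> x - cdf \<nu> x\<bar> \<partial>lborel)"
    by (intro nn_integral_mono mult_left_mono len) auto
  also have "\<dots> = (\<integral>\<^sup>+x. ennreal (\<bar>cdf \<mu> x - cdf \<nu> x\<bar> powr p * w x powr (1 - p)) \<partial>lborel)"
  proof (intro nn_integral_cong)
    fix x
    have "\<bar>cdf \<mu> x - cdf \<nu> x\<bar> powr (p - 1) * \<bar>cdf \<mu> x - cdf \<nu> x\<bar> = \<bar>cdf \<mu> x - cdf \<nu> x\<bar> powr p"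
      using p by (cases "cdf \<mu> x = cdf \<nu> x") (simp_all add: powr_diff)
    then show "ennreal (D x) * ennreal \<bar>cdf \<mu> x - cdf \<nu> x\<bar> = ennreal (\<bar>cdf \<mu> x - cdf \<nu> x\<bar> powr p * w x powr (1 - p))"
      by (simp add: D_def ennreal_mult[symmetric] algebra_simps)
  qed
  finally show ?thesis .
qed

section \<open>Gaussian kernels\<close>

definition Gphi :: "real \<Rightarrow> real \<Rightarrow> real" where
  "Gphi v z = normal_density 0 (sqrt v) z"

definition GPhi :: "real \<Rightarrow> real \<Rightarrow> real" where
  "GPhi v z = cdf (density lborel std_normal_density) (z / sqrt v)"

text \<open>Derivatives of \<open>GPhi v\<close> in the space variable, of order up to 4. The last
  equation is the fourth derivative; for larger indices it is a mere default.\<close>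

fun Gder :: "real \<Rightarrow> nat \<Rightarrow> real \<Rightarrow> real" where
  "Gder v 0 z = GPhi v z"
| "Gder v (Suc 0) z = Gphi v z"
| "Gder v (Suc (Suc 0)) z = - (z / v) * Gphi v z"
| "Gder v (Suc (Suc (Suc 0))) z = (z\<^sup>2 / v\<^sup>2 - 1 / v) * Gphi v z"
| "Gder v (Suc (Suc (Suc (Suc n)))) z = (3 * z / v\<^sup>2 - z ^ 3 / v ^ 3) * Gphi v z"

lemma Gphi_eq: "v > 0 \<Longrightarrow> Gphi v z = exp (- z\<^sup>2 / (2 * v)) / (sqrt (2 * pi) * sqrt v)"
  by (simp add: Gphi_def normal_density_def real_sqrt_mult)

lemma Gphi_pos: "v > 0 \<Longrightarrow> Gphi v z > 0"
  by (simp add: Gphi_def normal_density_pos)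

lemma measurable_Gphi [measurable]: "Gphi v \<in> borel_measurable borel"
  by (simp add: Gphi_def[abs_def])

lemma DERIV_std_normal_cdf:
  "(cdf (density lborel std_normal_density) has_real_derivative std_normal_density x) (at x)"
proof -
  let ?N = "density lborel std_normal_density"
  interpret N: prob_space ?N by (rule prob_space_normal_density) simp
  interpret N: real_distribution ?N
    by (simp add: real_distribution_def real_distribution_axioms_def N.prob_space_axioms)
  \<comment> \<open>On a bounded window around x the distribution function is a constant plus an
    integral of the density with fixed lower limit, to which the fundamental theorem of calculus
    applies.\<close>
  have eq: "cdf ?N y = cdf ?N (x - 1) + integral {x - 1..y} std_normal_density" if "y \<in> {x - 1..x + 1}" for y
  proof -
    have int: "set_integrable lborel {x - 1..y} std_normal_density"
      unfolding set_integrable_def by (intro integrable_mult_indicator) auto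
    have "measure ?N {x - 1<..y} = integral {x - 1..y} std_normal_density"
    proof -
      have "emeasure ?N {x - 1<..y} = (\<integral>\<^sup>+t\<in>{x - 1<..y}. ennreal (std_normal_density t) \<partial>lborel)"
        by (simp add: emeasure_density)
      also have "\<dots> = (\<integral>\<^sup>+t. ennreal (indicator {x - 1..y} t *\<^sub>R std_normal_density t) \<partial>lborel)"
        using AE_lborel_singleton[of "x - 1"]
        by (intro nn_integral_cong_AE) (auto simp: indicator_def)
      also have "\<dots> = ennreal (LBINT t:{x - 1..y}. std_normal_density t)"
        unfolding set_lebesgue_integral_def using int
        by (intro nn_integral_eq_integral) (auto simp: set_integrable_def)
      also have "(LBINT t:{x - 1..y}. std_normal_density t) = integral {x - 1..y} std_normal_density"
        using int by (rule set_borel_integral_eq_integral)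
      finally have "emeasure ?N {x - 1<..y} = ennreal (integral {x - 1..y} std_normal_density)" .
      moreover have "integral {x - 1..y} std_normal_density \<ge> 0"
        by (intro integral_nonneg set_borel_integral_eq_integral(1)[OF int]) auto
      ultimately show ?thesis by (rule measure_eq_emeasure_eq_ennreal[rotated])
    qed
    then show ?thesis using N.cdf_diff_eq[of "x - 1" y] that
      by (cases "y = x - 1") auto
  qed
  have "((\<lambda>y. integral {x - 1..y} std_normal_density) has_real_derivative std_normal_density x) (at x within {x - 1..x + 1})"
    by (intro integral_has_real_derivative) (auto simp: normal_density_def intro!: continuous_intros)
  then have "((\<lambda>y. cdf ?N (x - 1) + integral {x - 1..y} std_normal_density) has_real_derivative std_normal_density x) (at x within {x - 1..x + 1})"
    by (auto intro!: derivative_eq_intros)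
  then have "(cdf ?N has_real_derivative std_normal_density x) (at x within {x - 1..x + 1})"
    by (rule has_field_derivative_transform_within[where d=1]) (auto intro!: eq[symmetric])
  then show ?thesis by (simp add: at_within_Icc_at)
qed

lemma pos_real_square:
  assumes "(v::real) > 0"
  obtains s where "s > 0" "v = s\<^sup>2" "sqrt v = s"
  using that[of "sqrt v"] assms by simp

lemma DERIV_GPhi:
  assumes "v > 0"
  shows "(GPhi v has_real_derivative Gphi v z) (at z)"
proof -
  obtain s where s: "s > 0" "v = s\<^sup>2" "sqrt v = s" using assms by (rule pos_real_square)
  have "((\<lambda>z. cdf (density lborel std_normal_density) (z / s)) has_real_derivative
     std_normal_density (z / s) * (1 / s)) (at z)"
    using s by (intro DERIV_chain2[OF DERIV_std_normal_cdf]) (auto intro!: derivative_eq_intros)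
  also have "std_normal_density (z / s) * (1 / s) = Gphi v z"
    using s by (simp add: Gphi_eq normal_density_def power_divide)
  finally show ?thesis unfolding GPhi_def[abs_def] s(3) .
qed

text \<open>Heat equation: the derivative in the variance is half the second space derivative. In an
  exchange the variance taken from a summand is a second-order effect in space, and its gain by the
  noise a first-order effect in \<open>v\<close>; this identity makes the two cancel.\<close>

lemma DERIV_GPhi_var:
  assumes "v > 0"
  shows "((\<lambda>v. GPhi v z) has_real_derivative Gder v 2 z / 2) (at v)"
proof -
  obtain s where s: "s > 0" "v = s\<^sup>2" "sqrt v = s" using assms by (rule pos_real_square)
  have "((\<lambda>v. z / sqrt v) has_real_derivative - z / (2 * s ^ 3)) (at v)"
    using s by (auto intro!: derivative_eq_intros simp: field_simps power2_eq_square power3_eq_cube)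
  then have "((\<lambda>v. cdf (density lborel std_normal_density) (z / sqrt v)) has_real_derivative
     std_normal_density (z / sqrt v) * (- z / (2 * s ^ 3))) (at v)"
    by (rule DERIV_chain2[OF DERIV_std_normal_cdf])
  also have "std_normal_density (z / sqrt v) * (- z / (2 * s ^ 3)) = Gder v 2 z / 2"
    unfolding s(3) using s
    by (simp add: Gphi_eq normal_density_def power_divide numeral_2_eq_2 power2_eq_square power3_eq_cube mult_ac)
  finally show ?thesis by (simp add: GPhi_def[abs_def])
qed

lemma DERIV_Gphi:
  assumes "v > 0"
  shows "(Gphi v has_real_derivative - (z / v) * Gphi v z) (at z)"
proof -
  have eq: "Gphi v = (\<lambda>z. exp (- z\<^sup>2 / (2 * v)) / (sqrt (2 * pi) * sqrt v))"
    using Gphi_eq[OF assms] by auto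
  show ?thesis unfolding eq using assms by (auto intro!: derivative_eq_intros simp: field_simps)
qed

lemma DERIV_Gphi_var:
  assumes "v > 0"
  shows "((\<lambda>v. Gphi v z) has_real_derivative Gder v 3 z / 2) (at v)"
proof -
  obtain s where s: "s > 0" "v = s\<^sup>2" "sqrt v = s" using assms by (rule pos_real_square)
  define E where "E = exp (- z\<^sup>2 / (2 * v))"
  have d1: "((\<lambda>v. exp (- z\<^sup>2 / (2 * v))) has_real_derivative (z\<^sup>2 / (2 * v\<^sup>2)) * E) (at v)"
    unfolding E_def using assms by (auto intro!: derivative_eq_intros simp: field_simps power2_eq_square)
  have d2: "((\<lambda>v. 1 / (sqrt (2 * pi) * sqrt v)) has_real_derivative - 1 / (sqrt (2 * pi) * 2 * s ^ 3)) (at v)"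
    using s by (auto intro!: derivative_eq_intros simp: field_simps power2_eq_square power3_eq_cube)
  have "((\<lambda>v. exp (- z\<^sup>2 / (2 * v)) * (1 / (sqrt (2 * pi) * sqrt v))) has_real_derivative
      E * (- 1 / (sqrt (2 * pi) * 2 * s ^ 3)) + (z\<^sup>2 / (2 * v\<^sup>2)) * E * (1 / (sqrt (2 * pi) * sqrt v))) (at v)"
    using DERIV_mult[OF d1 d2] by (simp add: E_def algebra_simps)
  also have "E * (- 1 / (sqrt (2 * pi) * 2 * s ^ 3)) + (z\<^sup>2 / (2 * v\<^sup>2)) * E * (1 / (sqrt (2 * pi) * sqrt v)) = Gder v 3 z / 2"
    unfolding numeral_3_eq_3 Gder.simps Gphi_eq[OF assms] s(3) E_def[symmetric]
    unfolding s(2) using s(1) by (simp add: field_simps power2_eq_square power3_eq_cube)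
  finally have "((\<lambda>v. exp (- z\<^sup>2 / (2 * v)) * (1 / (sqrt (2 * pi) * sqrt v))) has_real_derivative Gder v 3 z / 2) (at v)" .
  then show ?thesis
    by (rule has_field_derivative_transform_within[where d=v]) (use assms in \<open>auto simp: Gphi_eq dist_real_def\<close>)
qed

lemma DERIV_Gder:
  assumes "v > 0" "n < 4"
  shows "(Gder v n has_real_derivative Gder v (Suc n) z) (at z)"
proof -
  note D = DERIV_GPhi[OF assms(1)] DERIV_Gphi[OF assms(1)]
  have d0: "Gder v 0 = GPhi v" "Gder v (Suc 0) = Gphi v" "Gder v (Suc (Suc 0)) = (\<lambda>z. - (z / v) * Gphi v z)"
    "Gder v (Suc (Suc (Suc 0))) = (\<lambda>z. (z\<^sup>2 / v\<^sup>2 - 1 / v) * Gphi v z)" by auto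
  have 1: "((\<lambda>z. - (z / v) * Gphi v z) has_real_derivative Gder v (Suc (Suc (Suc 0))) z) (at z)"
    using assms by (auto intro!: derivative_eq_intros D simp: field_simps power2_eq_square)
  have h2: "((\<lambda>z. (z\<^sup>2 / v\<^sup>2 - 1 / v) * Gphi v z) has_real_derivative Gder v (Suc (Suc (Suc (Suc 0)))) z) (at z)"
    using assms by (auto intro!: derivative_eq_intros D simp: field_simps power2_eq_square power3_eq_cube)
  from assms(2) consider "n = 0" | "n = Suc 0" | "n = Suc (Suc 0)" | "n = Suc (Suc (Suc 0))" by linarith
  then show ?thesis
  proof cases
    case 3 show ?thesis unfolding 3 d0(3) by (rule 1)
  next
    case 4 show ?thesis unfolding 4 d0(4) by (rule h2)
  next
    case 2 show ?thesis unfolding 2 d0(2) using D(2) by (simp only: Gder.simps)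
  qed (simp_all add: d0 D)
qed

lemma DERIV_Gder_var:
  assumes "v > 0" "n < 3"
  shows "((\<lambda>v. Gder v n z) has_real_derivative Gder v (Suc (Suc n)) z / 2) (at v)"
proof -
  have 1: "((\<lambda>v. - (z / v) * Gphi v z) has_real_derivative Gder v (Suc (Suc (Suc (Suc 0)))) z / 2) (at v)"
    using assms by (auto intro!: derivative_eq_intros DERIV_Gphi_var
        simp: numeral_3_eq_3 field_simps power2_eq_square power3_eq_cube)
  consider "n = 0" | "n = Suc 0" | "n = Suc (Suc 0)" using assms(2) by linarith
  then show ?thesis
  proof cases
    case 3 show ?thesis unfolding 3 using 1 by simp
  qed (use DERIV_Gphi_var[of v z] DERIV_GPhi_var[of v z] assms(1) in \<open>simp_all add: numeral_3_eq_3 numeral_2_eq_2\<close>)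
qed

section \<open>Domination of the Gaussian derivatives by one profile\<close>

text \<open>
  Slightly wider than the Gaussian density, so that it dominates all derivatives of nearby Gaussian
  kernels, but still with \<open>psi\<^sup>p Gphi\<^sup>1\<^sup>-\<^sup>p\<close> integrable.\<close>

definition psi :: "real \<Rightarrow> real \<Rightarrow> real \<Rightarrow> real" where
  "psi p v z = exp (- (1 - 1 / (2 * p)) * z\<^sup>2 / (2 * v)) / sqrt v"

lemma psi_pos: "v > 0 \<Longrightarrow> psi p v z > 0"
  by (simp add: psi_def)

lemma measurable_psi [measurable]: "psi p v \<in> borel_measurable borel"
  unfolding psi_def[abs_def] by measurable

text \<open>What remains of psi^p Gphi^(1-p) after the normal density of variance 2v is split
  off.\<close>

definition psi_const :: "real \<Rightarrow> real" where
  "psi_const p = (2 * pi) powr ((p - 1) / 2) * sqrt (4 * pi)"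

lemma psi_const_pos: "psi_const p > 0"
  by (simp add: psi_const_def)

text \<open>With a = z^2/(2v) the exponents -(p - 1/2) a of psi^p and -(1 - p) a of Gphi^(1-p) add
  up to -a/2. The margin 1/(2p) in \<open>psi\<close> is chosen for this purpose: half of the
  Gaussian decay survives for every p.\<close>

lemma psi_powr_Gphi_powr:
  assumes "v > 0" "p \<ge> 1"
  shows "psi p v z powr p * Gphi v z powr (1 - p) = psi_const p * normal_density 0 (sqrt (2 * v)) z"
proof -
  define a where "a = z\<^sup>2 / (2 * v)"
  have h1: "psi p v z powr p = exp (- (p - 1 / 2) * a) * v powr (- p / 2)"
    using assms by (simp add: psi_def a_def powr_divide powr_minus powr_half_sqrt[symmetric] powr_powr exp_powr_real field_simps)
  have h2: "Gphi v z powr (1 - p) = exp (- (1 - p) * a) * (2 * pi) powr ((p - 1) / 2) * v powr ((p - 1) / 2)"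
  proof -
    have "Gphi v z = exp (- a) * ((2 * pi) powr (- (1/2)) * v powr (- (1/2)))"
      using assms by (simp add: Gphi_eq a_def powr_minus powr_half_sqrt field_simps)
    moreover have "(x * (y * w)) powr (1 - p) = x powr (1 - p) * (y powr (1 - p) * w powr (1 - p))" for x y w :: real
      by (simp add: powr_mult)
    ultimately have "Gphi v z powr (1 - p) = exp (- a) powr (1 - p) * (((2 * pi) powr (- (1/2))) powr (1 - p) * (v powr (- (1/2))) powr (1 - p))"
      by simp
    moreover have "- (1/2) * (1 - p) = (p - 1) / 2" by (simp add: field_simps)
    ultimately have "Gphi v z powr (1 - p) = exp (- a) powr (1 - p) * ((2 * pi) powr ((p - 1) / 2) * v powr ((p - 1) / 2))"
      by (simp only: powr_powr)
    moreover have "exp (- a) powr (1 - p) = exp (- (1 - p) * a)"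
      by (simp add: exp_powr_real algebra_simps)
    ultimately show ?thesis by simp
  qed
  have h3: "v powr (- p / 2) * v powr ((p - 1) / 2) = 1 / sqrt v"
  proof -
    have "- p / 2 + (p - 1) / 2 = - (1 / 2)" by (simp add: field_simps)
    then have "v powr (- p / 2) * v powr ((p - 1) / 2) = v powr (- (1 / 2))" by (simp only: powr_add[symmetric])
    then show ?thesis using assms by (simp add: powr_minus_divide powr_half_sqrt)
  qed
  have h4: "exp (- (p - 1 / 2) * a) * exp (- (1 - p) * a) = exp (- a / 2)"
    by (simp add: exp_add[symmetric] algebra_simps)
  have "psi p v z powr p * Gphi v z powr (1 - p)
      = (exp (- (p - 1 / 2) * a) * exp (- (1 - p) * a)) * (2 * pi) powr ((p - 1) / 2) * (v powr (- p / 2) * v powr ((p - 1) / 2))"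
    unfolding h1 h2 by (simp only: mult_ac)
  also have "\<dots> = exp (- a / 2) * (2 * pi) powr ((p - 1) / 2) * (1 / sqrt v)"
    unfolding h3 h4 ..
  also have "\<dots> = psi_const p * normal_density 0 (sqrt (2 * v)) z"
    using assms by (simp add: psi_const_def normal_density_def a_def real_sqrt_mult field_simps)
  finally show ?thesis .
qed

text \<open>The value depends neither on \<open>v\<close> nor on the centre \<open>a\<close>, so one
  constant serves all components of a mixture and all steps of a chain.\<close>

lemma nn_integral_psi:
  assumes "v > 0" "p \<ge> 1"
  shows "(\<integral>\<^sup>+z. ennreal (psi p v (z - a) powr p * Gphi v (z - a) powr (1 - p)) \<partial>lborel) = ennreal (psi_const p)"
proof -
  have "(\<integral>\<^sup>+z. ennreal (psi p v (z - a) powr p * Gphi v (z - a) powr (1 - p)) \<partial>lborel)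
     = (\<integral>\<^sup>+z. ennreal (psi p v z powr p * Gphi v z powr (1 - p)) \<partial>lborel)"
    by (subst (2) nn_integral_real_affine[where c=1 and t="-a"]) auto
  also have "\<dots> = (\<integral>\<^sup>+z. ennreal (psi_const p) * ennreal (normal_density 0 (sqrt (2 * v)) z) \<partial>lborel)"
    using assms psi_const_pos[of p] by (simp add: psi_powr_Gphi_powr ennreal_mult less_imp_le)
  also have "\<dots> = ennreal (psi_const p) * emeasure (density lborel (normal_density 0 (sqrt (2 * v)))) UNIV"
    by (subst nn_integral_cmult) (auto simp: emeasure_density)
  also have "\<dots> = ennreal (psi_const p)"
    using prob_space.emeasure_space_1[OF prob_space_normal_density[of "sqrt (2 * v)" 0]] assms by simp
  finally show ?thesis .
qed

text \<open>In the variable y = (z - a)/sqrt u the derivative is u^(-n/2) times a polynomial of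
  degree at most 3 times a Gaussian density. Three losses in the exponent have to be paid for: the
  polynomial, the larger variance \<open>u\<close> and the shift \<open>a\<close>. Each takes a
  fraction e = 1/(6p), and 3e is exactly the margin of \<open>psi\<close>.\<close>

lemma Gder_bound_by_psi:
  assumes p: "p \<ge> 1" and K: "K \<ge> 0"
  shows "\<exists>C>0. \<forall>v u a z n. v > 0 \<longrightarrow> v \<le> u \<longrightarrow> u \<le> (1 + 1 / (6 * p)) * v \<longrightarrow> \<bar>a\<bar> \<le> K * sqrt v \<longrightarrow> n \<le> 3
    \<longrightarrow> \<bar>Gder u (Suc n) (z - a)\<bar> \<le> C * v powr (- real n / 2) * psi p v z"
proof -
  define e where "e = 1 / (6 * p)"
  have e: "0 < e" "e \<le> 1/6" "1 - 3 * e = 1 - 1 / (2 * p)" using p by (auto simp: e_def field_simps)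
  \<comment> \<open>The 3 belongs to the bound 3 (1 + |y|)^3 for the polynomials, the first
    exponential to 3|y| \<le> 9/(2e) + e y^2/2, and the second to completing the square in the
    shift.\<close>
  define C where "C = 3 * exp (9 / (2 * e)) * exp (K\<^sup>2 / (2 * e))"
  have "\<bar>Gder u (Suc n) (z - a)\<bar> \<le> C * v powr (- real n / 2) * psi p v z"
    if v: "v > 0" and vu: "v \<le> u" and uv: "u \<le> (1 + e) * v" and a: "\<bar>a\<bar> \<le> K * sqrt v" and n: "n \<le> 3" for v u a z n
  proof -
    have u: "u > 0" using v vu by simp
    obtain s where s: "s > 0" "u = s\<^sup>2" "sqrt u = s" using u by (rule pos_real_square)
    define y where "y = (z - a) / s"
    have ys: "z - a = y * s" using s by (simp add: y_def)
    have phi: "Gphi u (z - a) = exp (- y\<^sup>2 / 2) / (sqrt (2 * pi) * s)"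
      unfolding Gphi_eq[OF u] s(3) unfolding s(2) ys using s(1) by (simp add: power_mult_distrib)
    define P where "P = \<bar>Gder u (Suc n) (z - a)\<bar> * s ^ n / Gphi u (z - a)"
    have gp: "Gphi u (z - a) > 0" using u by (rule Gphi_pos)
    have P_le: "P \<le> 3 * (1 + \<bar>y\<bar>) ^ 3"
    proof -
      have A: "t ^ 2 \<le> (1 + t) ^ 3" "t \<le> (1 + t) ^ 3" "1 \<le> (1 + t) ^ 3" "t ^ 3 + t * 3 \<le> 3 * (1 + t) ^ 3"
        if "t \<ge> 0" for t :: real
        using that by (simp_all add: power3_eq_cube power2_eq_square algebra_simps)
      note y1 = A[OF abs_ge_zero[of y]]
      consider "n = 0" | "n = Suc 0" | "n = Suc (Suc 0)" | "n = Suc (Suc (Suc 0))" using n by linarith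
      then show ?thesis
      proof cases
        case 1
        then have "P = 1" using gp by (simp add: P_def)
        then show ?thesis using y1 by linarith
      next
        case 2
        have "P = \<bar>y\<bar>" unfolding P_def 2 Gder.simps abs_mult unfolding ys s(2) using gp s(1)
          by (simp add: ys s(2) power2_eq_square abs_mult)
        then show ?thesis using y1 by linarith
      next
        case 3
        have eq: "(y * s)\<^sup>2 / (s\<^sup>2)\<^sup>2 - 1 / s\<^sup>2 = (y\<^sup>2 - 1) / s\<^sup>2"
          using s(1) by (simp add: field_simps power2_eq_square)
        have "P = \<bar>y\<^sup>2 - 1\<bar>" unfolding P_def 3 Gder.simps abs_mult unfolding ys s(2) eq using gp s(1)
          by (simp add: ys s(2) abs_mult power2_eq_square)
        also have "\<dots> \<le> \<bar>y\<bar> ^ 2 + 1" by (simp add: abs_le_iff)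
        finally show ?thesis using y1(1,3) by linarith
      next
        case 4
        have eq: "3 * (y * s) / (s\<^sup>2)\<^sup>2 - (y * s) ^ 3 / (s\<^sup>2) ^ 3 = (3 * y - y ^ 3) / s ^ 3"
          using s(1) by (simp add: field_simps power2_eq_square power3_eq_cube)
        have "P = \<bar>3 * y - y ^ 3\<bar>" unfolding P_def 4 Gder.simps abs_mult unfolding ys s(2) eq using gp s(1)
          by (simp add: ys s(2) abs_mult power3_eq_cube)
        also have "\<dots> \<le> 3 * \<bar>y\<bar> + \<bar>y\<bar> ^ 3" using abs_triangle_ineq4[of "3 * y" "y ^ 3"] by (simp add: abs_mult power_abs)
        finally show ?thesis using y1 by linarith
      qed
    qed
    have "(1 + \<bar>y\<bar>) ^ 3 \<le> exp \<bar>y\<bar> ^ 3" by (intro power_mono exp_ge_add_one_self) auto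
    also have "\<dots> = exp (3 * \<bar>y\<bar>)" by (simp add: exp_of_nat_mult[symmetric])
    also have "3 * \<bar>y\<bar> \<le> 9 / (2 * e) + e * y\<^sup>2 / 2"
    proof -
      have "0 \<le> (e * \<bar>y\<bar> - 3)\<^sup>2 / (2 * e)" using e by simp
      also have "\<dots> = e * y\<^sup>2 / 2 - 3 * \<bar>y\<bar> + 9 / (2 * e)"
        using e by (simp add: power2_eq_square field_simps)
      finally show ?thesis by simp
    qed
    finally have pol: "(1 + \<bar>y\<bar>) ^ 3 \<le> exp (9 / (2 * e) + e * y\<^sup>2 / 2)" by simp
    \<comment> \<open>Completing the square gives (z - a)^2 \<ge> (1 - e) z^2 - a^2/e. The factor 1
      - e left over by the polynomial and the division by 1 + e for the variance turn 1 - e into (1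
      - e)^2/(1 + e), which is at least 1 - 3e.\<close>
    have ex: "- (1 - e) * y\<^sup>2 / 2 \<le> - (1 - 3 * e) * z\<^sup>2 / (2 * v) + K\<^sup>2 / (2 * e)"
    proof -
      have a2: "a\<^sup>2 \<le> K\<^sup>2 * v"
        using power_mono[OF a, of 2] v by (simp add: power_mult_distrib)
      have "0 \<le> (e * z - a)\<^sup>2 / e" using e by simp
      also have "\<dots> = e * z\<^sup>2 - 2 * z * a + a\<^sup>2 / e" using e by (simp add: power2_eq_square field_simps)
      finally have "2 * z * a \<le> e * z\<^sup>2 + a\<^sup>2 / e" by simp
      moreover have "(z - a)\<^sup>2 = z\<^sup>2 + a\<^sup>2 - 2 * z * a" by (rule power2_diff)
      moreover have "(1 - e) * z\<^sup>2 = z\<^sup>2 - e * z\<^sup>2" by (simp add: algebra_simps)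
      moreover have "0 \<le> a\<^sup>2" by simp
      ultimately have za: "(1 - e) * z\<^sup>2 - a\<^sup>2 / e \<le> (z - a)\<^sup>2" by linarith
      moreover have "a\<^sup>2 / e \<le> K\<^sup>2 * v / e" using a2 e by (simp add: divide_right_mono)
      ultimately have "(1 - e) * z\<^sup>2 - K\<^sup>2 * v / e \<le> (z - a)\<^sup>2" by linarith
      also have "(z - a)\<^sup>2 = y\<^sup>2 * u" by (simp add: ys s(2) power_mult_distrib)
      also have "\<dots> \<le> y\<^sup>2 * ((1 + e) * v)" using uv by (intro mult_left_mono) auto
      finally have "(1 - e) * ((1 - e) * z\<^sup>2 - K\<^sup>2 * v / e) \<le> (1 - e) * (y\<^sup>2 * ((1 + e) * v))"
        using e by (intro mult_left_mono) auto
      then have "(1 - e) * ((1 - e) * z\<^sup>2 - K\<^sup>2 * v / e) / (1 + e) \<le> (1 - e) * y\<^sup>2 * v"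
        using e by (subst pos_divide_le_eq) (simp_all add: mult_ac)
      moreover have "(1 - 3 * e) * z\<^sup>2 \<le> (1 - e) * (1 - e) / (1 + e) * z\<^sup>2"
        using e by (intro mult_right_mono) (auto simp: field_simps)
      moreover have "(1 - e) / (1 + e) * (K\<^sup>2 * v / e) \<le> 1 * (K\<^sup>2 * v / e)"
        using e v by (intro mult_right_mono) (auto simp: field_simps)
      moreover have "(1 - e) * ((1 - e) * z\<^sup>2 - Q) / (1 + e) = (1 - e) * (1 - e) / (1 + e) * z\<^sup>2 - (1 - e) / (1 + e) * Q" for Q
      proof -
        have "c * (c * x - Q) / d = c * c / d * x - c / d * Q" for c d x :: real
          by (simp add: right_diff_distrib diff_divide_distrib)
        then show ?thesis .
      qed
      ultimately have "(1 - 3 * e) * z\<^sup>2 - K\<^sup>2 * v / e \<le> (1 - e) * y\<^sup>2 * v"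
        by (smt (verit))
      then have "((1 - 3 * e) * z\<^sup>2 - K\<^sup>2 * v / e) / (2 * v) \<le> (1 - e) * y\<^sup>2 * v / (2 * v)"
        using v by (intro divide_right_mono) auto
      then have "((1 - 3 * e) * z\<^sup>2 / v - K\<^sup>2 / e) / 2 \<le> (1 - e) * y\<^sup>2 / 2"
        using v by (simp add: diff_divide_distrib)
      moreover have "- (1 - e) * y\<^sup>2 / 2 = - ((1 - e) * y\<^sup>2 / 2)"
        "- (1 - 3 * e) * z\<^sup>2 / (2 * v) + K\<^sup>2 / (2 * e) = - (((1 - 3 * e) * z\<^sup>2 / v - K\<^sup>2 / e) / 2)"
        by (simp_all only: mult_minus_left minus_divide_left[symmetric] diff_divide_distrib divide_divide_eq_left mult.commute)
      ultimately show ?thesis by linarith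
    qed
    have "\<bar>Gder u (Suc n) (z - a)\<bar> = P * Gphi u (z - a) / s ^ n" using gp s by (simp add: P_def)
    also have "\<dots> \<le> (3 * exp (9 / (2 * e) + e * y\<^sup>2 / 2)) * Gphi u (z - a) / s ^ n"
      using P_le pol gp s by (intro divide_right_mono mult_right_mono) auto
    also have "\<dots> = 3 * exp (9 / (2 * e)) * (exp (- (1 - e) * y\<^sup>2 / 2) / (sqrt (2 * pi) * s)) / s ^ n"
      by (simp add: phi exp_add[symmetric] algebra_simps diff_divide_distrib)
    also have "\<dots> \<le> 3 * exp (9 / (2 * e)) * (exp (- (1 - e) * y\<^sup>2 / 2) / (1 * sqrt v)) / sqrt v ^ n"
    proof -
      have sv: "sqrt v \<le> s" using vu s(3) real_sqrt_le_mono by metis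
      have "1 \<le> sqrt (2 * pi)" using pi_gt3 by simp
      then have "exp (- (1 - e) * y\<^sup>2 / 2) / (sqrt (2 * pi) * s) \<le> exp (- (1 - e) * y\<^sup>2 / 2) / (1 * sqrt v)"
        using sv v s by (intro divide_left_mono mult_mono) auto
      moreover have "sqrt v ^ n \<le> s ^ n" using sv v by (intro power_mono) auto
      ultimately show ?thesis using v s by (intro frac_le[OF _ mult_left_mono]) auto
    qed
    finally have step: "\<bar>Gder u (Suc n) (z - a)\<bar> \<le> 3 * exp (9 / (2 * e)) * (exp (- (1 - e) * y\<^sup>2 / 2) / (1 * sqrt v)) / sqrt v ^ n" .
    have ee: "exp (- (1 - e) * y\<^sup>2 / 2) / sqrt v \<le> exp (- (1 - 3 * e) * z\<^sup>2 / (2 * v) + K\<^sup>2 / (2 * e)) / sqrt v"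
      using iffD2[OF exp_le_cancel_iff ex] v by (rule divide_right_mono[OF _ order.strict_implies_order[OF real_sqrt_gt_zero]])
    have "3 * exp (9 / (2 * e)) * (exp (- (1 - e) * y\<^sup>2 / 2) / (1 * sqrt v)) / sqrt v ^ n \<le> 3 * exp (9 / (2 * e)) * (exp (- (1 - 3 * e) * z\<^sup>2 / (2 * v) + K\<^sup>2 / (2 * e)) / sqrt v) / sqrt v ^ n"
      using v ee by (intro divide_right_mono[OF mult_left_mono]) auto
    note step2 = this
    note step
    also note step2
    also have "\<dots> = C * (1 / sqrt v ^ n) * psi p v z"
      unfolding exp_add C_def psi_def e(3)[symmetric] by (simp add: algebra_simps)
    also have "1 / sqrt v ^ n = v powr (- real n / 2)"
      using v by (simp add: powr_half_sqrt[symmetric] powr_powr powr_realpow[symmetric] powr_minus_divide[symmetric] field_simps)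
    finally show ?thesis .
  qed
  then show ?thesis using e by (intro exI[of _ C]) (auto simp: C_def e_def)
qed

section \<open>Expansions in the space variable and in the variance\<close>

lemma Gder_taylor:
  assumes v: "v > 0" and n: "n + k \<le> 4" and k: "k > 0"
    and B: "\<And>a. \<bar>a\<bar> \<le> \<bar>x\<bar> \<Longrightarrow> \<bar>Gder v (n + k) (z - a)\<bar> \<le> B"
  shows "\<bar>Gder v n (z - x) - (\<Sum>m<k. Gder v (n + m) z / fact m * (- x) ^ m)\<bar> \<le> B / fact k * \<bar>x\<bar> ^ k"
proof (cases "x = 0")
  case True
  have "(\<Sum>m<k. Gder v (n + m) z / fact m * (- x) ^ m) = (\<Sum>m\<in>{0}. Gder v (n + m) z / fact m * (- x) ^ m)"
    using k True by (intro sum.mono_neutral_right) auto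
  then show ?thesis using True k by (simp add: zero_power)
next
  case False
  have "\<exists>t. (if z - x < z then z - x < t \<and> t < z else z < t \<and> t < z - x) \<and>
     Gder v n (z - x) = (\<Sum>m<k. Gder v (n + m) z / fact m * ((z - x) - z) ^ m) + Gder v (n + k) t / fact k * ((z - x) - z) ^ k"
    using k v n False by (intro Taylor[where a="min z (z - x)" and b="max z (z - x)"]) (auto intro!: DERIV_Gder)
  then obtain t where t: "if z - x < z then z - x < t \<and> t < z else z < t \<and> t < z - x"
    and eq: "Gder v n (z - x) = (\<Sum>m<k. Gder v (n + m) z / fact m * (- x) ^ m) + Gder v (n + k) t / fact k * (- x) ^ k"
    by auto
  have "\<bar>Gder v (n + k) (z - (z - t))\<bar> \<le> B" using t by (intro B) (auto split: if_splits)
  then have "\<bar>Gder v (n + k) t / fact k * (- x) ^ k\<bar> \<le> B / fact k * \<bar>x\<bar> ^ k"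
    by (auto simp: abs_mult power_abs intro!: mult_right_mono divide_right_mono)
  then show ?thesis unfolding eq by simp
qed

lemma Gder_var_diff_le:
  assumes v: "v > 0" and s: "s \<ge> 0" and n: "n < 3"
    and B: "\<And>u. v \<le> u \<Longrightarrow> u \<le> v + s \<Longrightarrow> \<bar>Gder u (Suc (Suc n)) z\<bar> \<le> B"
  shows "\<bar>Gder (v + s) n z - Gder v n z\<bar> \<le> s * B"
proof (cases "s = 0")
  case False
  then have "\<exists>t>v. t < v + s \<and> Gder (v + s) n z - Gder v n z = (v + s - v) * (Gder t (Suc (Suc n)) z / 2)"
    using s v n by (intro MVT2) (auto intro!: DERIV_Gder_var)
  then obtain t where t: "v < t" "t < v + s" "Gder (v + s) n z - Gder v n z = s * (Gder t (Suc (Suc n)) z / 2)" by auto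
  have "\<bar>Gder t (Suc (Suc n)) z\<bar> / 2 \<le> B" using B[of t] t by auto
 then have "s * (\<bar>Gder t (Suc (Suc n)) z\<bar> / 2) \<le> s * B" using s by (intro mult_left_mono)
  moreover have "\<bar>Gder (v + s) n z - Gder v n z\<bar> = s * (\<bar>Gder t (Suc (Suc n)) z\<bar> / 2)"
    unfolding t(3) using s by (simp add: abs_mult)
  ultimately show ?thesis by linarith
qed simp

text \<open>The heat equation trades each derivative in the variance for two in space, so the
  second-order remainder in \<open>s\<close> is governed by the fourth space derivative.\<close>

lemma GPhi_var_taylor:
  assumes v: "v > 0" and s: "s \<ge> 0"
    and B: "\<And>u. v \<le> u \<Longrightarrow> u \<le> v + s \<Longrightarrow> \<bar>Gder u 4 z\<bar> \<le> B"
  shows "\<bar>Gder (v + s) 0 z - Gder v 0 z - s / 2 * Gder v 2 z\<bar> \<le> s\<^sup>2 * B"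
proof (cases "s = 0")
  case False
  then have "\<exists>t>v. t < v + s \<and> Gder (v + s) 0 z - Gder v 0 z = (v + s - v) * (Gder t (Suc (Suc 0)) z / 2)"
  proof (intro MVT2)
    fix u assume "v \<le> u" "u \<le> v + s"
    then show "((\<lambda>a. Gder a 0 z) has_real_derivative Gder u (Suc (Suc 0)) z / 2) (at u)"
      using v by (intro DERIV_Gder_var) auto
  qed (use s False in auto)
  then obtain t where t: "v < t" "t < v + s" "Gder (v + s) 0 z - Gder v 0 z = s * (Gder t 2 z / 2)"
    by (auto simp: numeral_2_eq_2)
  have "\<bar>Gder (v + (t - v)) 2 z - Gder v 2 z\<bar> \<le> (t - v) * B"
    using t v B by (intro Gder_var_diff_le) (auto simp: numeral_eq_Suc)
  also have "\<dots> \<le> s * B" using t B[of v] s by (intro mult_right_mono) auto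
  finally have "s / 2 * \<bar>Gder t 2 z - Gder v 2 z\<bar> \<le> s / 2 * (s * B)" using s by (intro mult_left_mono) auto
  moreover have "Gder (v + s) 0 z - Gder v 0 z - s / 2 * Gder v 2 z = s / 2 * (Gder t 2 z - Gder v 2 z)"
    unfolding t(3) by (simp add: algebra_simps)
  then have "\<bar>Gder (v + s) 0 z - Gder v 0 z - s / 2 * Gder v 2 z\<bar> = \<bar>s / 2 * (Gder t 2 z - Gder v 2 z)\<bar>"
    by (simp only:)
  moreover have "\<bar>s / 2 * (Gder t 2 z - Gder v 2 z)\<bar> = s / 2 * \<bar>Gder t 2 z - Gder v 2 z\<bar>"
    using s by (simp add: abs_mult)
  moreover have "s / 2 * (s * B) \<le> s\<^sup>2 * B" using s B[of v] by (simp add: power2_eq_square)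
  ultimately show ?thesis by linarith
qed simp

text \<open>Mixed difference, of first order in the variance and of second order in the shift
  \<open>x\<close>: again four space derivatives in all. The term linear in \<open>x\<close> is kept
  explicit because its mean vanishes for a centred summand.\<close>

lemma Gder_increment_shift:
  assumes v: "v > 0" and s: "s \<ge> 0"
    and B: "\<And>u a. v \<le> u \<Longrightarrow> u \<le> v + s \<Longrightarrow> \<bar>a\<bar> \<le> \<bar>x\<bar> \<Longrightarrow> \<bar>Gder u 4 (z - a)\<bar> \<le> B"
  shows "\<bar>(GPhi (v + s) (z - x) - GPhi v (z - x)) - (GPhi (v + s) z - GPhi v z) + x * (Gphi (v + s) z - Gphi v z)\<bar>
    \<le> s * B * x\<^sup>2"
proof (cases "x = 0")
  case False
  define diff where "diff m t = Gder (v + s) m t - Gder v m t" for m t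
  have "\<exists>t. (if z - x < z then z - x < t \<and> t < z else z < t \<and> t < z - x) \<and>
     diff 0 (z - x) = (\<Sum>m<2. diff m z / fact m * ((z - x) - z) ^ m) + diff 2 t / fact 2 * ((z - x) - z) ^ 2"
    using v s False by (intro Taylor[where a="min z (z - x)" and b="max z (z - x)"])
      (auto simp: diff_def intro!: DERIV_diff DERIV_Gder)
  then obtain t where t: "if z - x < z then z - x < t \<and> t < z else z < t \<and> t < z - x"
    and eq: "diff 0 (z - x) = diff 0 z - x * diff 1 z + diff 2 t / 2 * x\<^sup>2"
    by (auto simp: numeral_2_eq_2)
  have "\<bar>diff 2 t\<bar> \<le> s * B" unfolding diff_def
  proof (rule Gder_var_diff_le[OF v s])
    fix u assume "v \<le> u" "u \<le> v + s"
    then have "\<bar>Gder u 4 (z - (z - t))\<bar> \<le> B" using t by (intro B) (auto split: if_splits)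
    then show "\<bar>Gder u (Suc (Suc 2)) t\<bar> \<le> B" by (simp add: numeral_eq_Suc)
  qed simp
  then have "\<bar>diff 2 t\<bar> * x\<^sup>2 \<le> s * B * x\<^sup>2" by (intro mult_right_mono) auto
  moreover have "0 \<le> \<bar>diff 2 t\<bar> * x\<^sup>2" by simp
  moreover have "\<bar>diff 2 t / 2 * x\<^sup>2\<bar> = \<bar>diff 2 t\<bar> * x\<^sup>2 / 2" by (simp add: abs_mult)
  ultimately have "\<bar>diff 2 t / 2 * x\<^sup>2\<bar> \<le> s * B * x\<^sup>2" by linarith
  then show ?thesis using eq by (simp add: diff_def)
qed (simp add: Gder.simps)

lemma GPhi_nonneg: "GPhi v z \<ge> 0" and GPhi_le_1: "GPhi v z \<le> 1"
proof -
  interpret N: prob_space "density lborel std_normal_density" by (rule prob_space_normal_density) simp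
  show "GPhi v z \<ge> 0" "GPhi v z \<le> 1" by (simp_all add: GPhi_def cdf_def)
qed

lemma measurable_GPhi [measurable]: "GPhi v \<in> borel_measurable borel"
proof -
  interpret N: prob_space "density lborel std_normal_density" by (rule prob_space_normal_density) simp
  have "real_distribution (density lborel std_normal_density)"
    by (simp add: real_distribution_def real_distribution_axioms_def N.prob_space_axioms)
  from real_distribution_cdf_measurable[OF this] show ?thesis
    unfolding GPhi_def[abs_def] by measurable
qed

section \<open>Exchange of one summand\<close>

definition gsmooth :: "real measure \<Rightarrow> real \<Rightarrow> real measure" where
  "gsmooth \<beta> v = convolution \<beta> (density lborel (normal_density 0 (sqrt v)))"

lemma real_distribution_convolution:
  assumes "real_distribution \<alpha>" "real_distribution \<beta>"
  shows "real_distribution (convolution \<alpha> \<beta>)"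
proof -
  interpret a: real_distribution \<alpha> by fact
  interpret b: real_distribution \<beta> by fact
  interpret pair_prob_space \<alpha> \<beta> ..
  show ?thesis unfolding convolution_def
    by (intro real_distribution_distr) measurable
qed

lemma real_distribution_normal:
  assumes "v > 0"
  shows "real_distribution (density lborel (normal_density 0 (sqrt v)))"
  using prob_space_normal_density[of "sqrt v" 0] assms
  by (simp add: real_distribution_def real_distribution_axioms_def)

lemma real_distribution_gsmooth:
  assumes "real_distribution \<beta>" "v > 0"
  shows "real_distribution (gsmooth \<beta> v)"
  unfolding gsmooth_def by (intro real_distribution_convolution real_distribution_normal assms)

lemma emeasure_normal_atMost:
  assumes "v > 0"
  shows "emeasure (density lborel (normal_density 0 (sqrt v))) {..x} = ennreal (GPhi v x)"
proof -
  interpret N: prob_space "density lborel std_normal_density" by (rule prob_space_normal_density) simp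
  obtain s where s: "s > 0" "v = s\<^sup>2" "sqrt v = s" using assms by (rule pos_real_square)
  have "emeasure (density lborel (normal_density 0 (sqrt v))) {..x}
     = (\<integral>\<^sup>+t. ennreal (normal_density 0 s t) * indicator {..x} t \<partial>lborel)"
    by (simp add: emeasure_density s(3))
  also have "\<dots> = ennreal s * (\<integral>\<^sup>+t. ennreal (normal_density 0 s (s * t)) * indicator {..x} (s * t) \<partial>lborel)"
    using s(1) by (subst nn_integral_real_affine[where c=s and t=0]) auto
  also have "\<dots> = (\<integral>\<^sup>+t. ennreal s * (ennreal (normal_density 0 s (s * t)) * indicator {..x} (s * t)) \<partial>lborel)"
    by (rule nn_integral_cmult[symmetric]) measurable
  also have "\<dots> = (\<integral>\<^sup>+t. ennreal (std_normal_density t) * indicator {..x / s} t \<partial>lborel)"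
  proof (intro nn_integral_cong)
    fix t
    have "s * normal_density 0 s (s * t) = std_normal_density t"
      using s(1) by (simp add: normal_density_def power_mult_distrib real_sqrt_mult)
    moreover have "indicator {..x} (s * t) = (indicator {..x / s} t :: ennreal)"
      using s(1) by (simp add: indicator_def field_simps)
    ultimately show "ennreal s * (ennreal (normal_density 0 s (s * t)) * indicator {..x} (s * t))
       = ennreal (std_normal_density t) * indicator {..x / s} t"
      using s(1) by (simp add: mult.assoc[symmetric] ennreal_mult[symmetric])
  qed
  also have "\<dots> = emeasure (density lborel std_normal_density) {..x / s}"
    by (simp add: emeasure_density)
  also have "\<dots> = ennreal (GPhi v x)" by (simp add: GPhi_def cdf_def N.emeasure_eq_measure s(3))
  finally show ?thesis .
qed

lemma cdf_gsmooth:
  assumes \<beta>: "real_distribution \<beta>" and v: "v > 0"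
  shows "cdf (gsmooth \<beta> v) y = (\<integral>t. GPhi v (y - t) \<partial>\<beta>)"
proof -
  interpret b: real_distribution \<beta> by fact
  interpret N: real_distribution "density lborel (normal_density 0 (sqrt v))" by (rule real_distribution_normal[OF v])
  have [measurable]: "(\<lambda>t. GPhi v (y - t)) \<in> borel_measurable \<beta>"
    by (simp add: measurable_cong_sets[OF b.events_eq_borel refl])
  have "emeasure (gsmooth \<beta> v) {..y} = (\<integral>\<^sup>+t. emeasure (density lborel (normal_density 0 (sqrt v))) {a. a + t \<in> {..y}} \<partial>\<beta>)"
    unfolding gsmooth_def by (rule convolution_emeasure) (auto simp: b.finite_measure_axioms N.finite_measure_axioms)
  also have "\<dots> = (\<integral>\<^sup>+t. ennreal (GPhi v (y - t)) \<partial>\<beta>)"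
  proof (intro nn_integral_cong)
    fix t
    have "{a. a + t \<in> {..y}} = {..y - t}" by auto
    then show "emeasure (density lborel (normal_density 0 (sqrt v))) {a. a + t \<in> {..y}} = ennreal (GPhi v (y - t))"
      using emeasure_normal_atMost[OF v] by simp
  qed
  also have "\<dots> = ennreal (\<integral>t. GPhi v (y - t) \<partial>\<beta>)"
    by (intro nn_integral_eq_integral b.integrable_const_bound[where B=1]) (auto simp: GPhi_nonneg GPhi_le_1)
  finally show ?thesis
    by (simp add: cdf_def measure_def integral_nonneg_AE GPhi_nonneg)
qed

lemma isCont_cdf_gsmooth:
  assumes \<beta>: "real_distribution \<beta>" and v: "v > 0"
  shows "isCont (cdf (gsmooth \<beta> v)) y"
proof -
  interpret b: real_distribution \<beta> by fact
  interpret N: real_distribution "density lborel (normal_density 0 (sqrt v))" by (rule real_distribution_normal[OF v])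
  interpret g: real_distribution "gsmooth \<beta> v" by (rule real_distribution_gsmooth[OF \<beta> v])
  have "emeasure (gsmooth \<beta> v) {y} = (\<integral>\<^sup>+t. emeasure (density lborel (normal_density 0 (sqrt v))) {a. a + t \<in> {y}} \<partial>\<beta>)"
    unfolding gsmooth_def by (rule convolution_emeasure) (auto simp: b.finite_measure_axioms N.finite_measure_axioms)
  also have "\<dots> = (\<integral>\<^sup>+t. 0 \<partial>\<beta>)"
  proof (intro nn_integral_cong)
    fix t
    have "{a. a + t \<in> {y}} = {y - t}" by auto
    moreover have "emeasure (density lborel (normal_density 0 (sqrt v))) {y - t} = 0"
      using AE_lborel_singleton[of "y - t"]
      by (subst emeasure_density) (auto simp: nn_integral_0_iff_AE indicator_def)
    ultimately show "emeasure (density lborel (normal_density 0 (sqrt v))) {a. a + t \<in> {y}} = 0" by simp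
  qed
  finally show ?thesis by (simp add: g.isCont_cdf measure_def)
qed

lemma Gphi_le: "v > 0 \<Longrightarrow> Gphi v z \<le> 1 / sqrt v"
proof -
  assume v: "v > 0"
  have "1 \<le> sqrt (2 * pi)" using pi_gt3 by simp
  then have "exp (- z\<^sup>2 / (2 * v)) / (sqrt (2 * pi) * sqrt v) \<le> 1 / (1 * sqrt v)"
    using v by (intro frac_le mult_mono) auto
  then show ?thesis using v by (simp add: Gphi_eq)
qed

lemma psi_le:
  assumes "v > 0" "p \<ge> 1"
  shows "psi p v z \<le> 1 / sqrt v"
proof -
  have "- (1 - 1 / (2 * p)) * z\<^sup>2 / (2 * v) \<le> 0"
    using assms by (intro divide_nonpos_pos mult_nonpos_nonneg) auto
  then show ?thesis using assms by (auto simp: psi_def intro!: divide_right_mono)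
qed

lemma nn_integral_Gphi_Icc:
  assumes v: "v > 0" and cd: "c \<le> d"
  shows "(\<integral>\<^sup>+x\<in>{c..d}. ennreal (Gphi v (x - t)) \<partial>lborel) = ennreal (GPhi v (d - t) - GPhi v (c - t))"
  using v cd
  by (intro nn_integral_FTC_Icc) (auto simp: less_imp_le[OF Gphi_pos[OF v]] intro!: DERIV_chain2[OF DERIV_GPhi, THEN DERIV_cong] derivative_eq_intros)

context prob_space
begin

text \<open>For k = 1 this is the density of \<open>S\<close> plus independent Gaussian noise of
  variance \<open>v\<close>; for the indicator of an event it is the part of that density which the
  event contributes.\<close>

definition gmix :: "('a \<Rightarrow> real) \<Rightarrow> ('a \<Rightarrow> real) \<Rightarrow> real \<Rightarrow> real \<Rightarrow> real" where
  "gmix k S v y = (\<integral>b. k b * Gphi v (y - S b) \<partial>M)"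

lemma integrable_gmix:
  assumes [measurable]: "k \<in> borel_measurable M" "S \<in> borel_measurable M" and k: "\<And>b. 0 \<le> k b" "\<And>b. k b \<le> 1" and v: "v > 0"
  shows "integrable M (\<lambda>b. k b * Gphi v (y - S b))"
proof (rule integrable_const_bound[where B="1 / sqrt v"])
  show "AE x in M. norm (k x * Gphi v (y - S x)) \<le> 1 / sqrt v"
    using k mult_mono[OF k(2) Gphi_le[OF v], of ] less_imp_le[OF Gphi_pos[OF v]]
    by (auto simp: abs_mult intro!: AE_I2)
qed measurable

lemma measurable_gmix [measurable]:
  assumes [measurable]: "k \<in> borel_measurable M" "S \<in> borel_measurable M"
  shows "gmix k S v \<in> borel_measurable borel"
  unfolding gmix_def[abs_def] by measurable

lemma gmix_nonneg: "v > 0 \<Longrightarrow> (\<And>b. 0 \<le> k b) \<Longrightarrow> gmix k S v y \<ge> 0"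
  unfolding gmix_def by (intro integral_nonneg_AE AE_I2 mult_nonneg_nonneg) (auto simp: less_imp_le[OF Gphi_pos])

text \<open>With k = 1 the right side is the increment of the distribution function of the smoothed
  law. In this form the growth conditions of the transport bound become pointwise comparisons of
  densities.\<close>

lemma gmix_Icc:
  assumes [measurable]: "k \<in> borel_measurable M" "S \<in> borel_measurable M" and k: "\<And>b. 0 \<le> k b" "\<And>b. k b \<le> 1" and v: "v > 0"
  shows "set_integrable lborel {c..d} (gmix k S v)"
    and "c \<le> d \<Longrightarrow> (LBINT x:{c..d}. gmix k S v x) = (\<integral>b. k b * (GPhi v (d - S b) - GPhi v (c - S b)) \<partial>M)"
proof -
  interpret P: pair_sigma_finite M lborel
    by (intro pair_sigma_finite.intro sigma_finite_measure_axioms lborel.sigma_finite_measure_axioms)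
  have mono: "GPhi v x \<le> GPhi v y" if "x \<le> y" for x y
    using that v by (intro DERIV_nonneg_imp_nondecreasing[OF that]) (auto intro!: exI DERIV_GPhi less_imp_le[OF Gphi_pos])
  have main: "(\<integral>\<^sup>+x. ennreal (indicator {c..d} x *\<^sub>R gmix k S v x) \<partial>lborel)
     = ennreal (\<integral>b. k b * (GPhi v (d - S b) - GPhi v (c - S b)) \<partial>M)" if cd: "c \<le> d"
  proof -
    have "(\<integral>\<^sup>+x. ennreal (indicator {c..d} x *\<^sub>R gmix k S v x) \<partial>lborel)
       = (\<integral>\<^sup>+x. (\<integral>\<^sup>+b. ennreal (k b) * (ennreal (Gphi v (x - S b)) * indicator {c..d} x) \<partial>M) \<partial>lborel)"
    proof (intro nn_integral_cong)
      fix x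
      have "(\<integral>\<^sup>+b. ennreal (k b) * (ennreal (Gphi v (x - S b)) * indicator {c..d} x) \<partial>M)
        = (\<integral>\<^sup>+b. ennreal (k b * Gphi v (x - S b)) * indicator {c..d} x \<partial>M)"
        using k by (intro nn_integral_cong) (simp add: ennreal_mult' mult_ac)
      also have "\<dots> = (\<integral>\<^sup>+b. ennreal (k b * Gphi v (x - S b)) \<partial>M) * indicator {c..d} x"
        by (rule nn_integral_multc) measurable
      also have "(\<integral>\<^sup>+b. ennreal (k b * Gphi v (x - S b)) \<partial>M) = ennreal (gmix k S v x)"
        unfolding gmix_def using v k by (intro nn_integral_eq_integral integrable_gmix) (auto simp: less_imp_le[OF Gphi_pos])
      finally show "ennreal (indicator {c..d} x *\<^sub>R gmix k S v x) = (\<integral>\<^sup>+b. ennreal (k b) * (ennreal (Gphi v (x - S b)) * indicator {c..d} x) \<partial>M)"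
        by (simp add: indicator_def)
    qed
    also have "\<dots> = (\<integral>\<^sup>+b. (\<integral>\<^sup>+x. ennreal (k b) * (ennreal (Gphi v (x - S b)) * indicator {c..d} x) \<partial>lborel) \<partial>M)"
      by (rule P.Fubini') measurable
    also have "\<dots> = (\<integral>\<^sup>+b. ennreal (k b * (GPhi v (d - S b) - GPhi v (c - S b))) \<partial>M)"
      using k mono cd by (intro nn_integral_cong)
       (simp add: nn_integral_cmult nn_integral_Gphi_Icc[OF v cd] ennreal_mult[symmetric])
    also have "\<dots> = ennreal (\<integral>b. k b * (GPhi v (d - S b) - GPhi v (c - S b)) \<partial>M)"
    proof (intro nn_integral_eq_integral integrable_const_bound[where B=1] AE_I2)
      fix b
      have "GPhi v (d - S b) - GPhi v (c - S b) \<le> 1" "0 \<le> GPhi v (d - S b) - GPhi v (c - S b)"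
        using GPhi_nonneg[of v "c - S b"] GPhi_le_1[of v "d - S b"] mono cd by auto
      then show "0 \<le> k b * (GPhi v (d - S b) - GPhi v (c - S b))"
        "norm (k b * (GPhi v (d - S b) - GPhi v (c - S b))) \<le> 1"
        using k mult_le_one[of "k b" "GPhi v (d - S b) - GPhi v (c - S b)"] by (auto simp: abs_mult)
    qed measurable
    finally show ?thesis .
  qed
  show int: "set_integrable lborel {c..d} (gmix k S v)"
  proof (cases "c \<le> d")
    case True
    then show ?thesis unfolding set_integrable_def
      using main[OF True] gmix_nonneg[OF v k(1)]
      by (intro integrableI_nonneg) (auto simp: indicator_def)
  qed (simp add: set_integrable_def)
  assume cd: "c \<le> d"
  have "0 \<le> (\<integral>b. k b * (GPhi v (d - S b) - GPhi v (c - S b)) \<partial>M)"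
    using k mono cd by (intro integral_nonneg_AE AE_I2) auto
  moreover have "ennreal (LBINT x:{c..d}. gmix k S v x) = ennreal (\<integral>b. k b * (GPhi v (d - S b) - GPhi v (c - S b)) \<partial>M)"
    unfolding main[OF cd, symmetric] set_lebesgue_integral_def
    using int gmix_nonneg[OF v k(1)] by (intro nn_integral_eq_integral[symmetric]) (auto simp: set_integrable_def indicator_def)
  moreover have "0 \<le> (LBINT x:{c..d}. gmix k S v x)"
    unfolding set_lebesgue_integral_def using gmix_nonneg[OF v k(1)] by (intro integral_nonneg_AE AE_I2) (auto simp: indicator_def)
  ultimately show "(LBINT x:{c..d}. gmix k S v x) = (\<integral>b. k b * (GPhi v (d - S b) - GPhi v (c - S b)) \<partial>M)"
    by simp
qed

text \<open>\<open>integral_powr_ratio_le\<close> moves the power inside the mixture, where each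
  component costs \<open>psi_const p\<close>. Weights 0 and 1 satisfy k^p k^(1-p) = k, so the bound
  is proportional to the probability of the event selected by \<open>k\<close>.\<close>

lemma psi_mix_powr_le:
  assumes [measurable]: "k \<in> borel_measurable M" "S \<in> borel_measurable M" and k: "\<And>b. k b \<in> {0, 1}"
    and v: "v > 0" and p: "p \<ge> 1"
  shows "(\<integral>\<^sup>+y. ennreal ((\<integral>b. k b * psi p v (y - S b) \<partial>M) powr p * gmix k S v y powr (1 - p)) \<partial>lborel)
    \<le> ennreal (psi_const p * (\<integral>b. k b \<partial>M))"
proof -
  interpret P: pair_sigma_finite M lborel
    by (intro pair_sigma_finite.intro sigma_finite_measure_axioms lborel.sigma_finite_measure_axioms)
  have k01: "0 \<le> k b" "k b \<le> 1" for b using k[of b] by auto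
  have psi_le: "psi p v z \<le> 1 / sqrt v" for z
    using v p by (rule psi_le)
  have int_psi: "integrable M (\<lambda>b. k b * psi p v (y - S b))" for y
  proof (rule integrable_const_bound[where B="1 / sqrt v"])
    show "AE x in M. norm (k x * psi p v (y - S x)) \<le> 1 / sqrt v"
      using k01 mult_mono[OF k01(2) psi_le] less_imp_le[OF psi_pos[OF v]]
      by (auto simp: abs_mult intro!: AE_I2)
  qed measurable
  have "(\<integral>\<^sup>+y. ennreal ((\<integral>b. k b * psi p v (y - S b) \<partial>M) powr p * gmix k S v y powr (1 - p)) \<partial>lborel)
     \<le> (\<integral>\<^sup>+y. (\<integral>\<^sup>+b. ennreal (k b) * ennreal (psi p v (y - S b) powr p * Gphi v (y - S b) powr (1 - p)) \<partial>M) \<partial>lborel)"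
  proof (intro nn_integral_mono)
    fix y
    have "ennreal ((\<integral>b. k b * psi p v (y - S b) \<partial>M) powr p * gmix k S v y powr (1 - p))
       \<le> (\<integral>\<^sup>+b. ennreal ((k b * psi p v (y - S b)) powr p * (k b * Gphi v (y - S b)) powr (1 - p)) \<partial>M)"
      unfolding gmix_def using k01 v Gphi_pos[OF v]
      by (intro integral_powr_ratio_le[OF p int_psi integrable_gmix]) (auto simp: less_imp_le psi_pos less_imp_neq[symmetric])
    also have "\<dots> = (\<integral>\<^sup>+b. ennreal (k b) * ennreal (psi p v (y - S b) powr p * Gphi v (y - S b) powr (1 - p)) \<partial>M)"
    proof (intro nn_integral_cong)
      fix b
      show "ennreal ((k b * psi p v (y - S b)) powr p * (k b * Gphi v (y - S b)) powr (1 - p))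
        = ennreal (k b) * ennreal (psi p v (y - S b) powr p * Gphi v (y - S b) powr (1 - p))"
        using k[of b] by auto
    qed
    finally show "ennreal ((\<integral>b. k b * psi p v (y - S b) \<partial>M) powr p * gmix k S v y powr (1 - p))
      \<le> (\<integral>\<^sup>+b. ennreal (k b) * ennreal (psi p v (y - S b) powr p * Gphi v (y - S b) powr (1 - p)) \<partial>M)" .
  qed
  also have "\<dots> = (\<integral>\<^sup>+b. (\<integral>\<^sup>+y. ennreal (k b) * ennreal (psi p v (y - S b) powr p * Gphi v (y - S b) powr (1 - p)) \<partial>lborel) \<partial>M)"
    by (rule P.Fubini') measurable
  also have "\<dots> = (\<integral>\<^sup>+b. ennreal (k b) * ennreal (psi_const p) \<partial>M)"
    by (intro nn_integral_cong) (simp add: nn_integral_cmult nn_integral_psi[OF v p])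
  also have "\<dots> = (\<integral>\<^sup>+b. ennreal (psi_const p * k b) \<partial>M)"
    using k01 psi_const_pos[of p] by (intro nn_integral_cong) (simp add: ennreal_mult mult.commute)
  also have "\<dots> = ennreal (\<integral>b. psi_const p * k b \<partial>M)"
    using k01 psi_const_pos[of p] by (intro nn_integral_eq_integral integrable_mult_right integrable_const_bound[where B=1])
      (auto simp: less_imp_le)
  finally show ?thesis by simp
qed

end

lemma integrable_bounded_product:
  fixes f :: "real \<Rightarrow> 'a \<Rightarrow> real"
  assumes \<alpha>: "real_distribution \<alpha>" and M: "prob_space M"
    and [measurable]: "case_prod f \<in> borel_measurable (\<alpha> \<Otimes>\<^sub>M M)" and B: "\<And>t \<omega>. \<bar>f t \<omega>\<bar> \<le> B"
  shows "(\<integral>z. f (fst z) (snd z) \<partial>(\<alpha> \<Otimes>\<^sub>M M)) = (\<integral>t. (\<integral>\<omega>. f t \<omega> \<partial>M) \<partial>\<alpha>)"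
    and "integrable (\<alpha> \<Otimes>\<^sub>M M) (\<lambda>z. f (fst z) (snd z))"
    and "integrable \<alpha> (\<lambda>t. \<integral>\<omega>. f t \<omega> \<partial>M)"
proof -
  interpret a: real_distribution \<alpha> by fact
  interpret M: prob_space M by fact
  interpret P: pair_prob_space \<alpha> M ..
  have m: "(\<lambda>z. f (fst z) (snd z)) = case_prod f" by auto
  show i: "integrable (\<alpha> \<Otimes>\<^sub>M M) (\<lambda>z. f (fst z) (snd z))"
    unfolding m using B by (intro P.integrable_const_bound[where B=B]) auto
  then have i': "integrable (\<alpha> \<Otimes>\<^sub>M M) (case_prod f)" by (simp add: m)
  show "(\<integral>z. f (fst z) (snd z) \<partial>(\<alpha> \<Otimes>\<^sub>M M)) = (\<integral>t. (\<integral>\<omega>. f t \<omega> \<partial>M) \<partial>\<alpha>)"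
    unfolding m using P.integral_fst[OF i'] by (simp add: case_prod_beta')
  show "integrable \<alpha> (\<lambda>t. \<integral>\<omega>. f t \<omega> \<partial>M)"
    using P.integrable_fst[OF i'] by simp
qed

text \<open>
  Jensen's inequality for the exponential: a centred perturbation decreases a Gaussian density
  by at most a constant factor.\<close>

lemma (in prob_space) Gphi_shift_ge:
  assumes [measurable]: "\<xi> \<in> borel_measurable M" and bd: "\<And>\<omega>. \<bar>\<xi> \<omega>\<bar> \<le> L"
    and mean: "expectation \<xi> = 0" and var: "expectation (\<lambda>\<omega>. (\<xi> \<omega>)\<^sup>2) \<le> 1" and v: "v \<ge> 1"
  shows "exp (- 1 / 2) * Gphi v z \<le> (\<integral>\<omega>. Gphi v (z - \<xi> \<omega>) \<partial>M)"
proof -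
  have v0: "v > 0" using v by simp
  have i1: "integrable M \<xi>" using bd by (intro integrable_const_bound[where B=L]) auto
  have i2: "integrable M (\<lambda>\<omega>. (\<xi> \<omega>)\<^sup>2)"
    using power_mono[OF bd, where n=2] by (intro integrable_const_bound[where B="L\<^sup>2"]) auto
  define V where "V = expectation (\<lambda>\<omega>. (\<xi> \<omega>)\<^sup>2)"
  define Y where "Y \<omega> = (z * \<xi> \<omega> - (\<xi> \<omega>)\<^sup>2 / 2) / v" for \<omega>
  \<comment> \<open>\<open>Y\<close> is the logarithm of the ratio of the shifted to the unshifted
    density, and \<open>m\<close> is its mean. As V \<le> 1 \<le> v, it is at least -1/2, which
    explains the constant; what follows is the tangent of exp at \<open>m\<close>.\<close>
  define m where "m = - V / (2 * v)"
  have iY: "integrable M Y" unfolding Y_def[abs_def] using i1 i2 by auto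
  have EY: "expectation Y = m"
    unfolding Y_def[abs_def] m_def V_def using i1 i2 mean by simp
  have "V \<le> 1" using var by (simp add: V_def)
  then have "V / (2 * v) \<le> 1 / (2 * 1)" using v by (intro frac_le) (auto simp: V_def)
  then have m_ge: "- 1 / 2 \<le> m" by (simp add: m_def)
  have G: "Gphi v (z - \<xi> \<omega>) = Gphi v z * exp (Y \<omega>)" for \<omega>
  proof -
    have e: "- (z - \<xi> \<omega>)\<^sup>2 / (2 * v) = - z\<^sup>2 / (2 * v) + Y \<omega>"
      using v0 by (simp add: Y_def power2_diff field_simps)
    show ?thesis unfolding Gphi_eq[OF v0] e exp_add by simp
  qed
  have "exp (- 1 / 2) * Gphi v z \<le> exp m * Gphi v z"
    using m_ge Gphi_pos[OF v0] by (intro mult_right_mono) (auto simp: less_imp_le)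
  also have "\<dots> = (\<integral>\<omega>. Gphi v z * (exp m * (1 + (Y \<omega> - m))) \<partial>M)"
    using iY EY by (simp add: prob_space)
  also have "\<dots> \<le> (\<integral>\<omega>. Gphi v (z - \<xi> \<omega>) \<partial>M)"
  proof (intro integral_mono)
    show "integrable M (\<lambda>\<omega>. Gphi v z * (exp m * (1 + (Y \<omega> - m))))" using iY by auto
    show "integrable M (\<lambda>\<omega>. Gphi v (z - \<xi> \<omega>))"
      using integrable_gmix[of "\<lambda>_. 1" \<xi> v z] v0 by simp
    fix \<omega>
    have "exp m * (1 + (Y \<omega> - m)) \<le> exp m * exp (Y \<omega> - m)"
      by (intro mult_left_mono exp_ge_add_one_self) auto
    also have "\<dots> = exp (Y \<omega>)" by (simp add: exp_add[symmetric])
    finally show "Gphi v z * (exp m * (1 + (Y \<omega> - m))) \<le> Gphi v (z - \<xi> \<omega>)"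
      unfolding G using Gphi_pos[OF v0] by (intro mult_left_mono) (auto simp: less_imp_le)
  qed
  finally show ?thesis .
qed

lemma Gphi_var_ge:
  assumes "v > 0" "v \<le> v'" "v' \<le> 2 * v"
  shows "Gphi v z / sqrt 2 \<le> Gphi v' z"
proof -
  have s: "sqrt v' \<le> sqrt 2 * sqrt v" using assms by (simp add: real_sqrt_mult[symmetric])
  have "z\<^sup>2 / (2 * v') \<le> z\<^sup>2 / (2 * v)" using assms by (intro divide_left_mono) auto
  then have "exp (- z\<^sup>2 / (2 * v)) / (sqrt (2 * pi) * (sqrt 2 * sqrt v)) \<le> exp (- z\<^sup>2 / (2 * v')) / (sqrt (2 * pi) * sqrt v')"
    using assms s by (intro frac_le mult_left_mono) auto
  then show ?thesis using assms by (simp add: Gphi_eq mult_ac)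
qed

section \<open>Transport cost of one exchange\<close>

lemma nn_integral_convolution_distr:
  assumes \<alpha>: "real_distribution \<alpha>" and M: "prob_space M" and [measurable]: "\<xi> \<in> borel_measurable M"
    and [measurable]: "f \<in> borel_measurable borel"
  shows "(\<integral>\<^sup>+x. f x \<partial>convolution \<alpha> (distr M borel \<xi>)) = (\<integral>\<^sup>+t. \<integral>\<^sup>+\<omega>. f (t + \<xi> \<omega>) \<partial>M \<partial>\<alpha>)"
proof -
  interpret a: real_distribution \<alpha> by fact
  interpret M: prob_space M by fact
  have "(\<integral>\<^sup>+x. f x \<partial>convolution \<alpha> (distr M borel \<xi>)) = (\<integral>\<^sup>+t. \<integral>\<^sup>+x. f (t + x) \<partial>distr M borel \<xi> \<partial>\<alpha>)"
    by (intro nn_integral_convolution) (auto simp: a.finite_measure_axioms intro!: M.finite_measure_distr)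
  also have "\<dots> = (\<integral>\<^sup>+t. \<integral>\<^sup>+\<omega>. f (t + \<xi> \<omega>) \<partial>M \<partial>\<alpha>)"
    by (intro nn_integral_cong nn_integral_distr) auto
  finally show ?thesis .
qed

lemma convolution_distr_eq:
  assumes \<alpha>: "real_distribution \<alpha>" and M: "prob_space M" and [measurable]: "\<xi> \<in> borel_measurable M"
  shows "convolution \<alpha> (distr M borel \<xi>) = distr (\<alpha> \<Otimes>\<^sub>M M) borel (\<lambda>z. fst z + \<xi> (snd z))"
proof (rule measure_eqI)
  interpret a: real_distribution \<alpha> by fact
  interpret M: prob_space M by fact
  interpret P: pair_prob_space \<alpha> M ..
  have [measurable]: "fst \<in> borel_measurable (\<alpha> \<Otimes>\<^sub>M M)"
    using measurable_fst[of \<alpha> M] by (simp add: measurable_cong_sets[OF refl a.events_eq_borel])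
  fix A assume "A \<in> sets (convolution \<alpha> (distr M borel \<xi>))"
  then have [measurable]: "A \<in> sets borel" by simp
  have "emeasure (convolution \<alpha> (distr M borel \<xi>)) A = (\<integral>\<^sup>+t. \<integral>\<^sup>+\<omega>. indicator A (t + \<xi> \<omega>) \<partial>M \<partial>\<alpha>)"
    by (subst nn_integral_convolution_distr[OF \<alpha> M, symmetric]) auto
  also have "\<dots> = (\<integral>\<^sup>+z. indicator A (fst z + \<xi> (snd z)) \<partial>(\<alpha> \<Otimes>\<^sub>M M))"
    by (subst M.nn_integral_fst[symmetric]) auto
  also have "\<dots> = emeasure (distr (\<alpha> \<Otimes>\<^sub>M M) borel (\<lambda>z. fst z + \<xi> (snd z))) A"
    by (simp add: emeasure_distr nn_integral_distr flip: nn_integral_indicator)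
  finally show "emeasure (convolution \<alpha> (distr M borel \<xi>)) A = emeasure (distr (\<alpha> \<Otimes>\<^sub>M M) borel (\<lambda>z. fst z + \<xi> (snd z))) A" .
qed simp

text \<open>Hypothesis \<open>D\<close> compares the two summands alone; integrating it over
  \<alpha> bounds the difference of the distribution functions of the full sums. The weight is a
  mixture over the same law as this bound, so by \<open>psi_mix_powr_le\<close> the cost does not
  involve \<alpha>. The two terms of \<open>D\<close> get different weights, as the second is
  centred at z - \<eta> and lives on the event |\<eta>| > sqrt v, where the summand is too large for
  a comparison with the unshifted mixture.\<close>

lemma quantile_step:
  fixes \<xi> \<eta> :: "'a \<Rightarrow> real"
  assumes \<alpha>: "real_distribution \<alpha>" and M: "prob_space M"
    and [measurable]: "\<xi> \<in> borel_measurable M" "\<eta> \<in> borel_measurable M"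
    and bd: "\<And>\<omega>. \<bar>\<xi> \<omega>\<bar> \<le> L" "\<And>\<omega>. \<bar>\<eta> \<omega>\<bar> \<le> L"
    and mean: "(\<integral>\<omega>. \<xi> \<omega> \<partial>M) = 0" "(\<integral>\<omega>. \<eta> \<omega> \<partial>M) = 0"
    and var: "(\<integral>\<omega>. (\<xi> \<omega>)\<^sup>2 \<partial>M) \<le> 1" "(\<integral>\<omega>. (\<eta> \<omega>)\<^sup>2 \<partial>M) \<le> 1"
    and v: "1 \<le> v" "v \<le> v'" "v' \<le> 2 * v" and p: "p \<ge> 1"
    and eq: "\<And>\<omega>. \<bar>\<eta> \<omega>\<bar> > sqrt v \<Longrightarrow> \<xi> \<omega> = \<eta> \<omega>"
    and \<kappa>: "\<kappa>1 \<ge> 0" "\<kappa>2 \<ge> 0"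
    and D: "\<And>z. \<bar>(\<integral>\<omega>. GPhi v (z - \<xi> \<omega>) \<partial>M) - (\<integral>\<omega>. GPhi v' (z - \<eta> \<omega>) \<partial>M)\<bar>
      \<le> \<kappa>1 * psi p v z + \<kappa>2 * (\<integral>\<omega>. indicator {\<omega>. \<bar>\<eta> \<omega>\<bar> > sqrt v} \<omega> * psi p v (z - \<eta> \<omega>) \<partial>M)"
  defines "\<mu> \<equiv> gsmooth (convolution \<alpha> (distr M borel \<xi>)) v"
    and "\<nu> \<equiv> gsmooth (convolution \<alpha> (distr M borel \<eta>)) v'"
  shows "(\<integral>\<^sup>+u. ennreal (\<bar>quantile \<mu> u - quantile \<nu> u\<bar> powr p) \<partial>unit_measure)
    \<le> ennreal (2 powr (p - 1) * (exp (- 1 / 2) / sqrt 2 / 2) powr (1 - p) * psi_const p *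
         (\<kappa>1 powr p + \<kappa>2 powr p * measure M {\<omega>\<in>space M. \<bar>\<eta> \<omega>\<bar> > sqrt v}))"
proof -
  interpret a: real_distribution \<alpha> by fact
  interpret M: prob_space M by fact
  interpret P: pair_prob_space \<alpha> M ..
  define B where "B = \<alpha> \<Otimes>\<^sub>M M"
  interpret B: prob_space B unfolding B_def by (rule P.prob_space_axioms)
  have [measurable]: "fst \<in> borel_measurable B"
    using measurable_fst[of \<alpha> M] by (simp add: B_def measurable_cong_sets[OF refl a.events_eq_borel])
  have [measurable]: "snd \<in> measurable B M" unfolding B_def by measurable
  have v0: "v > 0" "v' > 0" using v by auto
  \<comment> \<open>exp(-1/2) is lost by adding a centred summand of variance at most 1, the root of
    2 by raising the variance from \<open>v\<close> to at most 2v.\<close>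
  define c where "c = exp (- 1 / 2) / sqrt 2"
  have c: "c > 0" "c \<le> exp (- 1 / 2)" "c \<le> 1 / sqrt 2"
  proof -
    have "exp (- 1 / 2) \<le> (1::real)" by simp
    moreover have "exp (- 1 / 2) * 1 \<le> exp (- 1 / 2) * sqrt 2" by (intro mult_left_mono) auto
    ultimately show "c > 0" "c \<le> exp (- 1 / 2)" "c \<le> 1 / sqrt 2"
      unfolding c_def by (auto simp: field_simps intro!: divide_right_mono)
  qed
  define A :: "'a \<Rightarrow> real" where "A = indicator {\<omega>. \<bar>\<eta> \<omega>\<bar> > sqrt v}"
  define kA where "kA = (\<lambda>z::real \<times> 'a. A (snd z) :: real)"
  have [measurable]: "A \<in> borel_measurable M"
  proof -
    have "A = (\<lambda>\<omega>. if \<bar>\<eta> \<omega>\<bar> > sqrt v then 1 else 0)" by (auto simp: A_def indicator_def)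
    then show ?thesis by simp
  qed
  have [measurable]: "kA \<in> borel_measurable B" unfolding kA_def by measurable
  have A01: "A \<omega> \<in> {0, 1}" "0 \<le> A \<omega>" "A \<omega> \<le> 1" for \<omega> by (auto simp: A_def indicator_def)
  have kA01: "kA b \<in> {0, 1}" "0 \<le> kA b" "kA b \<le> 1" for b using A01 by (auto simp: kA_def)
  let ?S\<xi> = "\<lambda>z. fst z + \<xi> (snd z)" and ?S\<eta> = "\<lambda>z. fst z + \<eta> (snd z)" and ?T = "\<lambda>z::real \<times> 'a. fst z" and ?o = "\<lambda>z::real \<times> 'a. 1::real"
  have conv: "convolution \<alpha> (distr M borel \<xi>) = distr B borel ?S\<xi>" "convolution \<alpha> (distr M borel \<eta>) = distr B borel ?S\<eta>"
    unfolding B_def by (rule convolution_distr_eq[OF \<alpha> M], measurable)+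
  have rd: "real_distribution (distr B borel ?S\<xi>)" "real_distribution (distr B borel ?S\<eta>)"
    by (rule B.real_distribution_distr, measurable)+
  have \<mu>: "real_distribution \<mu>" "real_distribution \<nu>"
    unfolding \<mu>_def \<nu>_def conv using rd v0 by (auto intro: real_distribution_gsmooth)
  have cdf\<mu>: "cdf \<mu> y = (\<integral>b. GPhi v (y - ?S\<xi> b) \<partial>B)" for y
    unfolding \<mu>_def conv cdf_gsmooth[OF rd(1) v0(1)] by (rule integral_distr) measurable
  have cdf\<nu>: "cdf \<nu> y = (\<integral>b. GPhi v' (y - ?S\<eta> b) \<partial>B)" for y
    unfolding \<nu>_def conv cdf_gsmooth[OF rd(2) v0(2)] by (rule integral_distr) measurable
  have intG: "integrable B (\<lambda>b. GPhi u (y - S b))" if [measurable]: "S \<in> borel_measurable B" for u y S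
    by (intro B.integrable_const_bound[where B=1]) (auto simp: GPhi_nonneg GPhi_le_1)
  have diff\<mu>: "(LBINT x:{c..d}. B.gmix ?o ?S\<xi> v x) = cdf \<mu> d - cdf \<mu> c" if "c \<le> d" for c d
    using B.gmix_Icc(2)[of ?o ?S\<xi> v c d] that v0 intG by (simp add: cdf\<mu>)
  have diff\<nu>: "(LBINT x:{c..d}. B.gmix ?o ?S\<eta> v' x) = cdf \<nu> d - cdf \<nu> c" if "c \<le> d" for c d
    using B.gmix_Icc(2)[of ?o ?S\<eta> v' c d] that v0 intG by (simp add: cdf\<nu>)
  \<comment> \<open>One weight for each term of \<open>D\<close>. Up to the factor \<open>c\<close>
    both lie below the density of \<mu> and that of \<nu>; with halves their sum does so
    too.\<close>
  define w1 where "w1 = B.gmix ?o ?T v"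
  define w2 where "w2 = B.gmix kA ?S\<eta> v"
  define w where "w y = c / 2 * w1 y + c / 2 * w2 y" for y
  have [measurable]: "w1 \<in> borel_measurable borel" "w2 \<in> borel_measurable borel"
    unfolding w1_def w2_def by (intro B.measurable_gmix; measurable)+
  have w2_nonneg: "w2 y \<ge> 0" for y unfolding w2_def using v0 kA01 by (intro B.gmix_nonneg) auto
  have w1_pos: "w1 y > 0" for y
  proof -
    have "w1 y \<noteq> 0"
    proof
      assume "w1 y = 0"
      moreover have "integrable B (\<lambda>b. 1 * Gphi v (y - fst b))" using v0 by (intro B.integrable_gmix) auto
      ultimately have "AE b in B. 1 * Gphi v (y - fst b) = 0"
        unfolding w1_def B.gmix_def using v0
        by (subst (asm) integral_nonneg_eq_0_iff_AE) (auto simp: less_imp_le[OF Gphi_pos])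
      then show False using Gphi_pos[OF v0(1)] by (simp add: less_imp_neq[symmetric])
    qed
    moreover have "w1 y \<ge> 0" unfolding w1_def using v0 by (intro B.gmix_nonneg) auto
    ultimately show ?thesis by simp
  qed
  have w_pos: "w y > 0" for y using w1_pos[of y] w2_nonneg[of y] c unfolding w_def by (intro add_pos_nonneg) auto
  have fub: "B.gmix ?o (\<lambda>z. fst z + f (snd z)) u y = (\<integral>t. (\<integral>\<omega>. Gphi u (y - t - f \<omega>) \<partial>M) \<partial>\<alpha>)"
    "integrable \<alpha> (\<lambda>t. \<integral>\<omega>. Gphi u (y - t - f \<omega>) \<partial>M)"
    if u: "u > 0" and f[measurable]: "f \<in> borel_measurable M" for u y f
  proof -
    have 1: "(\<lambda>(t, \<omega>). Gphi u (y - t - f \<omega>)) \<in> borel_measurable (\<alpha> \<Otimes>\<^sub>M M)"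
      using \<open>fst \<in> borel_measurable B\<close> unfolding B_def[symmetric] by measurable
    have 2: "\<bar>Gphi u (y - t - f \<omega>)\<bar> \<le> 1 / sqrt u" for t \<omega>
      using Gphi_le[OF u] Gphi_pos[OF u] by (simp add: less_imp_le)
    note ibp = integrable_bounded_product[OF \<alpha> M 1 2]
    show "B.gmix ?o (\<lambda>z. fst z + f (snd z)) u y = (\<integral>t. (\<integral>\<omega>. Gphi u (y - t - f \<omega>) \<partial>M) \<partial>\<alpha>)"
      unfolding B.gmix_def using ibp(1) by (simp add: B_def diff_diff_eq)
    show "integrable \<alpha> (\<lambda>t. \<integral>\<omega>. Gphi u (y - t - f \<omega>) \<partial>M)" by (rule ibp(3))
  qed
  have w1_eq: "w1 y = (\<integral>t. Gphi v (y - t) \<partial>\<alpha>)" and w1_int: "integrable \<alpha> (\<lambda>t. Gphi v (y - t))" for y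
    using fub[of v "\<lambda>_. 0" y] v0 by (simp_all add: w1_def M.prob_space)
  \<comment> \<open>For fixed t this is Jensen's inequality in the form
    \<open>Gphi_shift_ge\<close>, combined for \<eta> with the change of variance; integration over
    \<alpha> gives the mixtures.\<close>
  have lowA: "c * w1 y \<le> B.gmix ?o ?S\<xi> v y" "c * w1 y \<le> B.gmix ?o ?S\<eta> v' y" for y
  proof -
    have "c * w1 y = (\<integral>t. c * Gphi v (y - t) \<partial>\<alpha>)" by (simp add: w1_eq)
    also have "\<dots> \<le> (\<integral>t. (\<integral>\<omega>. Gphi v (y - t - \<xi> \<omega>) \<partial>M) \<partial>\<alpha>)"
    proof (intro integral_mono integrable_mult_right w1_int fub)
      fix t
      have "c * Gphi v (y - t) \<le> exp (- 1 / 2) * Gphi v (y - t)"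
        using c Gphi_pos[OF v0(1)] by (intro mult_right_mono) (auto simp: less_imp_le)
      also have "\<dots> \<le> (\<integral>\<omega>. Gphi v (y - t - \<xi> \<omega>) \<partial>M)"
        by (rule M.Gphi_shift_ge[OF _ bd(1) mean(1) var(1) v(1)]) measurable
      finally show "c * Gphi v (y - t) \<le> (\<integral>\<omega>. Gphi v (y - t - \<xi> \<omega>) \<partial>M)" .
    qed (use v0 in auto)
    also have "\<dots> = B.gmix ?o ?S\<xi> v y" using fub(1)[of v \<xi> y] v0 by simp
    finally show "c * w1 y \<le> B.gmix ?o ?S\<xi> v y" .
    have "c * w1 y = (\<integral>t. c * Gphi v (y - t) \<partial>\<alpha>)" by (simp add: w1_eq)
    also have "\<dots> \<le> (\<integral>t. (\<integral>\<omega>. Gphi v' (y - t - \<eta> \<omega>) \<partial>M) \<partial>\<alpha>)"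
    proof (intro integral_mono integrable_mult_right w1_int fub)
      fix t
      have "c * Gphi v (y - t) = exp (- 1 / 2) * (Gphi v (y - t) / sqrt 2)" by (simp add: c_def)
      also have "\<dots> \<le> exp (- 1 / 2) * Gphi v' (y - t)"
        using v v0 by (intro mult_left_mono Gphi_var_ge) auto
      also have "\<dots> \<le> (\<integral>\<omega>. Gphi v' (y - t - \<eta> \<omega>) \<partial>M)"
        using v by (intro M.Gphi_shift_ge[OF _ bd(2) mean(2) var(2)]) auto
      finally show "c * Gphi v (y - t) \<le> (\<integral>\<omega>. Gphi v' (y - t - \<eta> \<omega>) \<partial>M)" .
    qed (use v0 in auto)
    also have "\<dots> = B.gmix ?o ?S\<eta> v' y" using fub(1)[of v' \<eta> y] v0 by simp
    finally show "c * w1 y \<le> B.gmix ?o ?S\<eta> v' y" .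
  qed
  \<comment> \<open>On the event selected by \<open>kA\<close> the two summands coincide, so the
    selected part of the mixture occurs in both densities.\<close>
  have lowB: "c * w2 y \<le> B.gmix ?o ?S\<xi> v y" "c * w2 y \<le> B.gmix ?o ?S\<eta> v' y" for y
  proof -
    have i2: "integrable B (\<lambda>b. kA b * Gphi v (y - ?S\<eta> b))" using kA01 v0 by (intro B.integrable_gmix) auto
    have g1: "integrable B (\<lambda>b. 1 * Gphi v (y - ?S\<xi> b))" "integrable B (\<lambda>b. 1 * Gphi v' (y - ?S\<eta> b))"
      by (rule B.integrable_gmix; (measurable; fail | simp add: v0))+
    have c1: "c \<le> 1" using c(3) by (rule order_trans) simp
    have "c * w2 y = (\<integral>b. c * (kA b * Gphi v (y - ?S\<eta> b)) \<partial>B)" by (simp add: w2_def B.gmix_def)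
    also have "\<dots> \<le> (\<integral>b. 1 * Gphi v (y - ?S\<xi> b) \<partial>B)"
    proof (intro integral_mono integrable_mult_right[OF i2] g1)
      fix b
      show "c * (kA b * Gphi v (y - ?S\<eta> b)) \<le> 1 * Gphi v (y - ?S\<xi> b)"
      proof (cases "\<bar>\<eta> (snd b)\<bar> > sqrt v")
        case True
        then have "\<xi> (snd b) = \<eta> (snd b)" by (rule eq)
        moreover have "c * Gphi v (y - ?S\<eta> b) \<le> 1 * Gphi v (y - ?S\<eta> b)"
          using c1 Gphi_pos[OF v0(1)] by (intro mult_right_mono) (auto simp: less_imp_le)
        ultimately show ?thesis using True by (simp add: kA_def A_def)
      next
        case False
        then show ?thesis using Gphi_pos[OF v0(1)] by (simp add: kA_def A_def less_imp_le)
      qed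
    qed
    finally show "c * w2 y \<le> B.gmix ?o ?S\<xi> v y" by (simp add: B.gmix_def)
    have "c * w2 y = (\<integral>b. c * (kA b * Gphi v (y - ?S\<eta> b)) \<partial>B)" by (simp add: w2_def B.gmix_def)
    also have "\<dots> \<le> (\<integral>b. 1 * Gphi v' (y - ?S\<eta> b) \<partial>B)"
    proof (intro integral_mono integrable_mult_right[OF i2] g1)
      fix b
      have "c * (kA b * Gphi v (y - ?S\<eta> b)) \<le> 1 / sqrt 2 * (1 * Gphi v (y - ?S\<eta> b))"
        using c kA01 Gphi_pos[OF v0(1)] by (intro mult_mono) (auto simp: less_imp_le)
      also have "\<dots> = Gphi v (y - ?S\<eta> b) / sqrt 2" by simp
      also have "\<dots> \<le> Gphi v' (y - ?S\<eta> b)" using v v0 by (intro Gphi_var_ge) auto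
      finally show "c * (kA b * Gphi v (y - ?S\<eta> b)) \<le> 1 * Gphi v' (y - ?S\<eta> b)" by simp
    qed
    finally show "c * w2 y \<le> B.gmix ?o ?S\<eta> v' y" by (simp add: B.gmix_def)
  qed
  have w_le: "w y \<le> B.gmix ?o ?S\<xi> v y" "w y \<le> B.gmix ?o ?S\<eta> v' y" for y
    using lowA[of y] lowB[of y] by (auto simp: w_def)
  have gint: "set_integrable lborel {a..b} (B.gmix ?o ?S\<xi> v)" "set_integrable lborel {a..b} (B.gmix ?o ?S\<eta> v')"
    "set_integrable lborel {a..b} w1" "set_integrable lborel {a..b} w2" for a b
    unfolding w1_def w2_def using v0 kA01 by (auto intro!: B.gmix_Icc(1))
  have w_int: "set_integrable lborel {a..b} w" for a b
    unfolding w_def[abs_def] by (intro set_integral_add set_integrable_mult_right gint)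
  define \<Psi>1 where "\<Psi>1 y = (\<integral>b. 1 * psi p v (y - fst b) \<partial>B)" for y
  define \<Psi>2 where "\<Psi>2 y = (\<integral>b. kA b * psi p v (y - ?S\<eta> b) \<partial>B)" for y
  have psi0: "0 \<le> psi p v z" for z using psi_pos[OF v0(1)] by (simp add: less_imp_le)
  have [measurable]: "\<Psi>1 \<in> borel_measurable borel" "\<Psi>2 \<in> borel_measurable borel"
    unfolding \<Psi>1_def[abs_def] \<Psi>2_def[abs_def] by measurable
  have \<Psi>0: "\<Psi>1 y \<ge> 0" "\<Psi>2 y \<ge> 0" for y
    unfolding \<Psi>1_def \<Psi>2_def using psi0 kA01 by (auto intro!: integral_nonneg_AE)
  have \<Delta>: "\<bar>cdf \<mu> y - cdf \<nu> y\<bar> \<le> \<kappa>1 * \<Psi>1 y + \<kappa>2 * \<Psi>2 y" for y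
  proof -
    have m1: "(\<lambda>(t, \<omega>). GPhi u (y - t - f \<omega>)) \<in> borel_measurable (\<alpha> \<Otimes>\<^sub>M M)"
      if [measurable]: "f \<in> borel_measurable M" for u f
      using \<open>fst \<in> borel_measurable B\<close> unfolding B_def[symmetric] by measurable
    have b1: "\<bar>GPhi u (y - t - f \<omega>)\<bar> \<le> 1" for u t f and \<omega> :: 'a by (simp add: GPhi_nonneg GPhi_le_1)
    have m2: "(\<lambda>(t, \<omega>). A \<omega> * psi p v (y - t - \<eta> \<omega>)) \<in> borel_measurable (\<alpha> \<Otimes>\<^sub>M M)"
      "(\<lambda>(t, \<omega>). psi p v (y - t)) \<in> borel_measurable (\<alpha> \<Otimes>\<^sub>M M)"
      using \<open>fst \<in> borel_measurable B\<close> unfolding B_def[symmetric] by measurable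
    have b2: "\<bar>A \<omega> * psi p v (y - t - \<eta> \<omega>)\<bar> \<le> 1 / sqrt v" "\<bar>psi p v (y - t)\<bar> \<le> 1 / sqrt v" for t \<omega>
      using mult_mono[OF A01(3) psi_le[OF v0(1) p]] A01 psi0 psi_le[OF v0(1) p] by (auto simp: abs_mult)
    note \<xi>i = integrable_bounded_product[OF \<alpha> M m1[OF \<open>\<xi> \<in> borel_measurable M\<close>, of v], where B=1, OF b1[of v _ \<xi>]]
    note \<eta>i = integrable_bounded_product[OF \<alpha> M m1[OF \<open>\<eta> \<in> borel_measurable M\<close>, of v'], where B=1, OF b1[of v' _ \<eta>]]
    note p1 = integrable_bounded_product[OF \<alpha> M m2(2) b2(2)]
    note p2 = integrable_bounded_product[OF \<alpha> M m2(1) b2(1)]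
    have "cdf \<mu> y - cdf \<nu> y = (\<integral>t. (\<integral>\<omega>. GPhi v (y - t - \<xi> \<omega>) \<partial>M) \<partial>\<alpha>) - (\<integral>t. (\<integral>\<omega>. GPhi v' (y - t - \<eta> \<omega>) \<partial>M) \<partial>\<alpha>)"
      unfolding cdf\<mu> cdf\<nu> using \<xi>i(1) \<eta>i(1) by (simp add: B_def diff_diff_eq)
    also have "\<dots> = (\<integral>t. (\<integral>\<omega>. GPhi v (y - t - \<xi> \<omega>) \<partial>M) - (\<integral>\<omega>. GPhi v' (y - t - \<eta> \<omega>) \<partial>M) \<partial>\<alpha>)"
      using \<xi>i(3) \<eta>i(3) by simp
    also have "\<bar>\<dots>\<bar> \<le> (\<integral>t. \<bar>(\<integral>\<omega>. GPhi v (y - t - \<xi> \<omega>) \<partial>M) - (\<integral>\<omega>. GPhi v' (y - t - \<eta> \<omega>) \<partial>M)\<bar> \<partial>\<alpha>)"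
      by (rule integral_abs_bound)
    also have "\<dots> \<le> (\<integral>t. \<kappa>1 * (\<integral>\<omega>. psi p v (y - t) \<partial>M) + \<kappa>2 * (\<integral>\<omega>. A \<omega> * psi p v (y - t - \<eta> \<omega>) \<partial>M) \<partial>\<alpha>)"
      using \<xi>i(3) \<eta>i(3) p1(3) p2(3) D[of "y - _"] by (intro integral_mono) (auto simp: A_def M.prob_space)
    also have "\<dots> = \<kappa>1 * (\<integral>t. (\<integral>\<omega>. psi p v (y - t) \<partial>M) \<partial>\<alpha>) + \<kappa>2 * (\<integral>t. (\<integral>\<omega>. A \<omega> * psi p v (y - t - \<eta> \<omega>) \<partial>M) \<partial>\<alpha>)"
      using p1(3) p2(3) by simp
    also have "\<dots> = \<kappa>1 * \<Psi>1 y + \<kappa>2 * \<Psi>2 y"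
      unfolding p1(1)[symmetric] p2(1)[symmetric] \<Psi>1_def \<Psi>2_def kA_def B_def by (simp add: diff_diff_eq)
    finally show ?thesis .
  qed
  \<comment> \<open>Gaussian densities are positive, so \<open>w2 y = 0\<close> only if the event
    has probability 0. This matters because \<open>0 powr (1 - p)\<close> is 0 and would otherwise
    hide an infinite quotient.\<close>
  have \<Psi>2_zero: "\<Psi>2 y = 0" if "w2 y = 0" for y
  proof -
    have "AE b in B. kA b * Gphi v (y - ?S\<eta> b) = 0"
      using that unfolding w2_def B.gmix_def using v0 kA01
      by (subst (asm) integral_nonneg_eq_0_iff_AE) (auto intro!: B.integrable_gmix mult_nonneg_nonneg simp: less_imp_le[OF Gphi_pos])
    then have "AE b in B. kA b * psi p v (y - ?S\<eta> b) = 0"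
      by eventually_elim (use Gphi_pos[OF v0(1)] in \<open>auto simp: less_imp_neq[symmetric]\<close>)
    then show ?thesis unfolding \<Psi>2_def by (subst integral_cong_AE[where g="\<lambda>_. 0"]) auto
  qed
  define c2 where "c2 = c / 2"
  have c2: "c2 > 0" using c by (simp add: c2_def)
  \<comment> \<open>\<open>w\<close> is at least each of its two parts and 1 - p \<le> 0, so each
    term of the difference may be weighted with its own part.\<close>
  have pw: "\<bar>cdf \<mu> y - cdf \<nu> y\<bar> powr p * w y powr (1 - p) \<le>
     2 powr (p - 1) * c2 powr (1 - p) * \<kappa>1 powr p * (\<Psi>1 y powr p * w1 y powr (1 - p))
     + 2 powr (p - 1) * c2 powr (1 - p) * \<kappa>2 powr p * (\<Psi>2 y powr p * w2 y powr (1 - p))" for y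
  proof -
    have t1: "\<Psi>1 y powr p * w y powr (1 - p) \<le> c2 powr (1 - p) * (\<Psi>1 y powr p * w1 y powr (1 - p))"
    proof -
      have "w y powr (1 - p) \<le> (c2 * w1 y) powr (1 - p)"
        using c c2 w1_pos[of y] w2_nonneg[of y] p by (intro powr_mono2') (auto simp: w_def c2_def)
      also have "\<dots> = c2 powr (1 - p) * w1 y powr (1 - p)" by (rule powr_mult)
      finally have "\<Psi>1 y powr p * w y powr (1 - p) \<le> \<Psi>1 y powr p * (c2 powr (1 - p) * w1 y powr (1 - p))"
        by (intro mult_left_mono) auto
      then show ?thesis by (simp add: mult_ac)
    qed
    have t2: "\<Psi>2 y powr p * w y powr (1 - p) \<le> c2 powr (1 - p) * (\<Psi>2 y powr p * w2 y powr (1 - p))"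
    proof (cases "w2 y = 0")
      case True
      then show ?thesis using \<Psi>2_zero[of y] by simp
    next
      case False
      have "w y powr (1 - p) \<le> (c2 * w2 y) powr (1 - p)"
        using c c2 w1_pos[of y] w2_nonneg[of y] False p by (intro powr_mono2') (auto simp: w_def c2_def)
      also have "\<dots> = c2 powr (1 - p) * w2 y powr (1 - p)" by (rule powr_mult)
      finally have "\<Psi>2 y powr p * w y powr (1 - p) \<le> \<Psi>2 y powr p * (c2 powr (1 - p) * w2 y powr (1 - p))"
        by (intro mult_left_mono) auto
      then show ?thesis by (simp add: mult_ac)
    qed
    have "\<bar>cdf \<mu> y - cdf \<nu> y\<bar> powr p \<le> (\<kappa>1 * \<Psi>1 y + \<kappa>2 * \<Psi>2 y) powr p"
      using \<Delta> p by (intro powr_mono2) auto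
    also have "\<dots> \<le> 2 powr (p - 1) * ((\<kappa>1 * \<Psi>1 y) powr p + (\<kappa>2 * \<Psi>2 y) powr p)"
      using p \<kappa> \<Psi>0 by (intro powr_add_le) auto
    also have "\<dots> = 2 powr (p - 1) * (\<kappa>1 powr p * \<Psi>1 y powr p + \<kappa>2 powr p * \<Psi>2 y powr p)"
      by (simp add: powr_mult)
    finally have "\<bar>cdf \<mu> y - cdf \<nu> y\<bar> powr p * w y powr (1 - p)
       \<le> 2 powr (p - 1) * (\<kappa>1 powr p * \<Psi>1 y powr p + \<kappa>2 powr p * \<Psi>2 y powr p) * w y powr (1 - p)"
      by (intro mult_right_mono) auto
    also have "\<dots> = 2 powr (p - 1) * \<kappa>1 powr p * (\<Psi>1 y powr p * w y powr (1 - p)) + 2 powr (p - 1) * \<kappa>2 powr p * (\<Psi>2 y powr p * w y powr (1 - p))"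
      by (simp add: algebra_simps)
    also have "\<dots> \<le> 2 powr (p - 1) * \<kappa>1 powr p * (c2 powr (1 - p) * (\<Psi>1 y powr p * w1 y powr (1 - p)))
       + 2 powr (p - 1) * \<kappa>2 powr p * (c2 powr (1 - p) * (\<Psi>2 y powr p * w2 y powr (1 - p)))"
      using t1 t2 by (intro add_mono mult_left_mono) auto
    finally show ?thesis by (simp add: mult_ac)
  qed
  define K where "K = 2 powr (p - 1) * c2 powr (1 - p)"
  have K: "K \<ge> 0" by (simp add: K_def)
  have "(\<integral>\<^sup>+u. ennreal (\<bar>quantile \<mu> u - quantile \<nu> u\<bar> powr p) \<partial>unit_measure)
    \<le> (\<integral>\<^sup>+y. ennreal (\<bar>cdf \<mu> y - cdf \<nu> y\<bar> powr p * w y powr (1 - p)) \<partial>lborel)"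
  proof (rule nn_integral_quantile_diff_le[OF p \<mu>])
    show "w \<in> borel_measurable borel" unfolding w_def[abs_def] by measurable
    fix a b :: real assume "a \<le> b"
    show "(LBINT x:{a..b}. w x) \<le> cdf \<mu> b - cdf \<mu> a"
      unfolding diff\<mu>[OF \<open>a \<le> b\<close>, symmetric] by (intro set_integral_mono w_int gint w_le)
    show "(LBINT x:{a..b}. w x) \<le> cdf \<nu> b - cdf \<nu> a"
      unfolding diff\<nu>[OF \<open>a \<le> b\<close>, symmetric] by (intro set_integral_mono w_int gint w_le)
  qed (use w_pos w_int v0 rd in \<open>auto simp: \<mu>_def \<nu>_def conv intro!: isCont_cdf_gsmooth\<close>)
  also have "\<dots> \<le> (\<integral>\<^sup>+y. ennreal (K * \<kappa>1 powr p) * ennreal (\<Psi>1 y powr p * w1 y powr (1 - p))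
      + ennreal (K * \<kappa>2 powr p) * ennreal (\<Psi>2 y powr p * w2 y powr (1 - p)) \<partial>lborel)"
    using pw K by (intro nn_integral_mono)
      (simp add: K_def ennreal_mult[symmetric] ennreal_plus[symmetric] ennreal_leI mult.assoc del: ennreal_plus)
  also have "\<dots> = ennreal (K * \<kappa>1 powr p) * (\<integral>\<^sup>+y. ennreal (\<Psi>1 y powr p * w1 y powr (1 - p)) \<partial>lborel)
      + ennreal (K * \<kappa>2 powr p) * (\<integral>\<^sup>+y. ennreal (\<Psi>2 y powr p * w2 y powr (1 - p)) \<partial>lborel)"
    by (simp add: nn_integral_add nn_integral_cmult)
  also have "\<dots> \<le> ennreal (K * \<kappa>1 powr p) * ennreal (psi_const p * (\<integral>b. 1 \<partial>B))
      + ennreal (K * \<kappa>2 powr p) * ennreal (psi_const p * (\<integral>b. kA b \<partial>B))"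
    unfolding \<Psi>1_def \<Psi>2_def w1_def w2_def
    using kA01 v0 p by (intro add_mono mult_left_mono B.psi_mix_powr_le) auto
  also have "(\<integral>b. kA b \<partial>B) = measure M {\<omega>\<in>space M. \<bar>\<eta> \<omega>\<bar> > sqrt v}"
  proof -
    have "(\<integral>b. kA b \<partial>B) = (\<integral>t. (\<integral>\<omega>. A \<omega> \<partial>M) \<partial>\<alpha>)"
      unfolding kA_def B_def using A01 by (intro integrable_bounded_product(1)[OF \<alpha> M, where B=1]) (auto simp: abs_le_iff)
    also have "\<dots> = (\<integral>\<omega>. A \<omega> \<partial>M)" using a.prob_space by simp
    also have "\<dots> = (\<integral>\<omega>. indicator {\<omega>\<in>space M. \<bar>\<eta> \<omega>\<bar> > sqrt v} \<omega> \<partial>M)"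
      by (intro Bochner_Integration.integral_cong) (auto simp: A_def indicator_def)
    finally show ?thesis by (simp add: M.emeasure_eq_measure)
  qed
  also have "ennreal (K * \<kappa>1 powr p) * ennreal (psi_const p * (\<integral>b. 1 \<partial>B))
      + ennreal (K * \<kappa>2 powr p) * ennreal (psi_const p * measure M {\<omega>\<in>space M. \<bar>\<eta> \<omega>\<bar> > sqrt v})
      = ennreal (K * psi_const p * (\<kappa>1 powr p + \<kappa>2 powr p * measure M {\<omega>\<in>space M. \<bar>\<eta> \<omega>\<bar> > sqrt v}))"
    using K psi_const_pos[of p]
    by (simp add: ennreal_mult[symmetric] ennreal_plus[symmetric] B.prob_space less_imp_le algebra_simps del: ennreal_plus)
  finally show ?thesis by (simp add: K_def c2_def c_def)
qed

text \<open>Fixes one constant from \<open>Gder_bound_by_psi\<close>, so that all estimates of an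
  exchange share it. \<open>K\<close> says how far, in units of sqrt v, the argument may be shifted
  while the bound stays centred at z.\<close>

locale Gder_bound =
  fixes p K C :: real
  assumes p: "p \<ge> 1" and K: "K \<ge> 1" and C: "C > 0"
    and bound: "\<And>v u a z n. v > 0 \<Longrightarrow> v \<le> u \<Longrightarrow> u \<le> (1 + 1 / (6 * p)) * v \<Longrightarrow> \<bar>a\<bar> \<le> K * sqrt v \<Longrightarrow> n \<le> 3
      \<Longrightarrow> \<bar>Gder u (Suc n) (z - a)\<bar> \<le> C * v powr (- real n / 2) * psi p v z"

lemma Gder_bound_exists:
  assumes "p \<ge> 1" "K \<ge> 1"
  obtains C where "Gder_bound p K C"
  using Gder_bound_by_psi[of p K] assms that unfolding Gder_bound_def by fastforce

context Gder_bound
begin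

text \<open>6p \<le> v turns an increase of the variance by at most 1 into an increase by a factor
  of at most 1 + 1/(6p), the range in which \<open>bound\<close> holds.\<close>

lemma Gder_bound_Suc: "\<bar>Gder u (Suc n) z\<bar> \<le> C * v powr (- real n / 2) * psi p v z"
  if "v > 0" "v \<le> u" "u \<le> v + s" "6 * p \<le> v" "s \<le> 1" "n \<le> 3"
proof -
  have "6 * p * s \<le> v" using mult_left_mono[of s 1 "6 * p"] that p by linarith
  then have "s \<le> 1 / (6 * p) * v" using that p by (simp add: field_simps)
  then show ?thesis using bound[of v u 0 n z] that K by (simp add: distrib_right)
qed

lemma bound_shift: "\<bar>Gder u (Suc n) (z - a)\<bar> \<le> C * v powr (- real n / 2) * psi p v z"
  if "v > 0" "v \<le> u" "u \<le> v + s" "6 * p \<le> v" "s \<le> 1" "n \<le> 3" "\<bar>a\<bar> \<le> K * sqrt v"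
proof -
  have "6 * p * s \<le> v" using mult_left_mono[of s 1 "6 * p"] that p by linarith
  then have "s \<le> 1 / (6 * p) * v" using that p by (simp add: field_simps)
  then show ?thesis using bound[of v u a n z] that by (simp add: distrib_right)
qed

lemma GPhi_taylor4:
  assumes v: "v \<ge> 6 * p" and x: "\<bar>x\<bar> \<le> R" "R \<le> sqrt v"
  shows "\<bar>GPhi v (z - x) - (GPhi v z - x * Gphi v z + x\<^sup>2 / 2 * Gder v 2 z - x ^ 3 / 6 * Gder v 3 z)\<bar>
    \<le> C * v powr (- 3 / 2) * psi p v z / 2 * R ^ 4"
proof -
  have v0: "v > 0" using v p by simp
  have "\<bar>Gder v 0 (z - x) - (\<Sum>m<4. Gder v (0 + m) z / fact m * (- x) ^ m)\<bar> \<le> (C * v powr (- 3 / 2) * psi p v z) / fact 4 * \<bar>x\<bar> ^ 4"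
  proof (rule Gder_taylor[OF v0])
    fix a assume "\<bar>a\<bar> \<le> \<bar>x\<bar>"
    then have "\<bar>a\<bar> \<le> 1 * sqrt v" using x by linarith
    also have "\<dots> \<le> K * sqrt v" using K v0 by (intro mult_right_mono) auto
    finally show "\<bar>Gder v (0 + 4) (z - a)\<bar> \<le> C * v powr (- 3 / 2) * psi p v z"
      using bound_shift[of v v 0 3 a z] v v0 by (simp add: numeral_eq_Suc)
  qed auto
  also have "\<dots> \<le> (C * v powr (- 3 / 2) * psi p v z) / 2 * R ^ 4"
    using C psi_pos[OF v0] x by (intro mult_mono divide_left_mono power_mono) (auto simp: less_imp_le fact_numeral)
  also have "(\<Sum>m<4. Gder v (0 + m) z / fact m * (- x) ^ m) = GPhi v z - x * Gphi v z + x\<^sup>2 / 2 * Gder v 2 z - x ^ 3 / 6 * Gder v 3 z"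
  proof -
    have "{..<4::nat} = {0, 1, 2, 3}" by auto
    then show ?thesis by (simp add: fact_numeral power3_eq_cube mult_ac)
  qed
  finally show ?thesis by simp
qed

text \<open>The range K sqrt v, in place of sqrt v, admits summands that are only truncated at the
  order of sqrt n and not confined to a fixed interval.\<close>

lemma GPhi_taylor3:
  assumes v: "v \<ge> 6 * p" and x: "\<bar>x\<bar> \<le> K * sqrt v"
  shows "\<bar>GPhi v (z - x) - (GPhi v z - x * Gphi v z + x\<^sup>2 / 2 * Gder v 2 z)\<bar>
    \<le> C * v powr (- 1) * psi p v z * \<bar>x\<bar> ^ 3"
proof -
  have v0: "v > 0" using v p by simp
  have "\<bar>Gder v 0 (z - x) - (\<Sum>m<3. Gder v (0 + m) z / fact m * (- x) ^ m)\<bar> \<le> (C * v powr (- 1) * psi p v z) / fact 3 * \<bar>x\<bar> ^ 3"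
  proof (rule Gder_taylor[OF v0])
    fix a assume "\<bar>a\<bar> \<le> \<bar>x\<bar>"
    then have "\<bar>a\<bar> \<le> K * sqrt v" using x by linarith
    then show "\<bar>Gder v (0 + 3) (z - a)\<bar> \<le> C * v powr (- 1) * psi p v z"
      using bound_shift[of v v 0 2 a z] v v0 by (simp add: numeral_eq_Suc)
  qed auto
  also have "\<dots> \<le> (C * v powr (- 1) * psi p v z) / 1 * \<bar>x\<bar> ^ 3"
    using C psi_pos[OF v0] x by (intro mult_right_mono divide_left_mono) (auto simp: less_imp_le fact_numeral)
  also have "(\<Sum>m<3. Gder v (0 + m) z / fact m * (- x) ^ m) = GPhi v z - x * Gphi v z + x\<^sup>2 / 2 * Gder v 2 z"
    by (simp add: eval_nat_numeral algebra_simps)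
  finally show ?thesis by simp
qed

lemma GPhi_heat:
  assumes v: "v \<ge> 6 * p" and s: "0 \<le> s" "s \<le> 1"
  shows "\<bar>GPhi (v + s) z - GPhi v z - s / 2 * Gder v 2 z\<bar> \<le> C * v powr (- 3 / 2) * psi p v z"
proof -
  have v0: "v > 0" using v p by simp
  have "\<bar>Gder (v + s) 0 z - Gder v 0 z - s / 2 * Gder v 2 z\<bar> \<le> s\<^sup>2 * (C * v powr (- 3 / 2) * psi p v z)"
  proof (rule GPhi_var_taylor[OF v0 s(1)])
    fix u assume "v \<le> u" "u \<le> v + s"
    then show "\<bar>Gder u 4 z\<bar> \<le> C * v powr (- 3 / 2) * psi p v z"
      using Gder_bound_Suc[of v u s 3 z] v v0 s by (simp add: numeral_eq_Suc)
  qed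
  also have "\<dots> \<le> 1 * (C * v powr (- 3 / 2) * psi p v z)"
    using s C psi_pos[OF v0] by (intro mult_right_mono power_le_one) (auto simp: less_imp_le)
  finally show ?thesis by simp
qed

text \<open>For |x| \<le> sqrt v this is the mixed expansion. For larger x a profile centred at z no
  longer dominates the kernel at z - x, so the value there is bounded on its own by
  \<open>psi\<close> centred at z - x. The two terms at z are then absorbed by x^2, because v < x^2.
  The indicator terms in the exchange bounds originate here.\<close>

lemma GPhi_increment_shift:
  assumes v: "v \<ge> 6 * p" and s: "0 \<le> s" "s \<le> 1"
  shows "\<bar>(GPhi (v + s) (z - x) - GPhi v (z - x)) - (GPhi (v + s) z - GPhi v z) + x * (Gphi (v + s) z - Gphi v z)\<bar>
    \<le> 2 * C * v powr (- 3 / 2) * psi p v z * x\<^sup>2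
      + C * v powr (- 1 / 2) * (if \<bar>x\<bar> > sqrt v then psi p v (z - x) else 0)"
proof (cases "\<bar>x\<bar> > sqrt v")
  case False
  have v0: "v > 0" using v p by simp
  let ?B = "C * v powr (- 3 / 2) * psi p v z"
  have B0: "?B \<ge> 0" using C psi_pos[OF v0] by (auto simp: less_imp_le)
  have "\<bar>(GPhi (v + s) (z - x) - GPhi v (z - x)) - (GPhi (v + s) z - GPhi v z) + x * (Gphi (v + s) z - Gphi v z)\<bar> \<le> s * ?B * x\<^sup>2"
  proof (rule Gder_increment_shift[OF v0 s(1)])
    fix u a assume u: "v \<le> u" "u \<le> v + s" and "\<bar>a\<bar> \<le> \<bar>x\<bar>"
    then have "\<bar>a\<bar> \<le> 1 * sqrt v" using False by linarith
    also have "\<dots> \<le> K * sqrt v" using K v0 by (intro mult_right_mono) auto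
    finally show "\<bar>Gder u 4 (z - a)\<bar> \<le> ?B"
      using bound_shift[of v u s 3 a z] v v0 s u by (simp add: numeral_eq_Suc)
  qed
  also have "\<dots> \<le> 2 * ?B * x\<^sup>2" using s B0 by (intro mult_right_mono) auto
  finally show ?thesis using False by (simp add: mult.assoc)
next
  case True
  have v0: "v > 0" using v p by simp
  have ps: "0 < psi p v z" using psi_pos[OF v0] .
  have G: "\<bar>GPhi (v + s) y - GPhi v y\<bar> \<le> C * v powr (- 1 / 2) * psi p v y" for y
  proof -
    have "\<bar>Gder (v + s) 0 y - Gder v 0 y\<bar> \<le> s * (C * v powr (- 1 / 2) * psi p v y)"
    proof (rule Gder_var_diff_le[OF v0 s(1)])
      fix u assume "v \<le> u" "u \<le> v + s"
      then show "\<bar>Gder u (Suc (Suc 0)) y\<bar> \<le> C * v powr (- 1 / 2) * psi p v y"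
        using Gder_bound_Suc[of v u s "Suc 0" y] v v0 s by simp
    qed simp
    also have "\<dots> \<le> 1 * (C * v powr (- 1 / 2) * psi p v y)"
      using s C psi_pos[OF v0] by (intro mult_right_mono) (auto simp: less_imp_le)
    finally show ?thesis by simp
  qed
  have g: "\<bar>Gphi (v + s) z - Gphi v z\<bar> \<le> C * v powr (- 1) * psi p v z"
  proof -
    have "\<bar>Gder (v + s) (Suc 0) z - Gder v (Suc 0) z\<bar> \<le> s * (C * v powr (- 1) * psi p v z)"
    proof (rule Gder_var_diff_le[OF v0 s(1)])
      fix u assume "v \<le> u" "u \<le> v + s"
      then show "\<bar>Gder u (Suc (Suc (Suc 0))) z\<bar> \<le> C * v powr (- 1) * psi p v z"
        using Gder_bound_Suc[of v u s "Suc (Suc 0)" z] v v0 s by simp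
    qed simp
    also have "\<dots> \<le> 1 * (C * v powr (- 1) * psi p v z)"
      using s C psi_pos[OF v0] by (intro mult_right_mono) (auto simp: less_imp_le)
    finally show ?thesis by simp
  qed
  have xv: "v \<le> x\<^sup>2" using True v0 by (metis abs_ge_zero less_imp_le power2_abs power_mono real_sqrt_ge_zero real_sqrt_pow2)
  \<comment> \<open>Since |x| exceeds sqrt v, missing factors v^(-1/2) may be bought with factors
    |x|, up to x^2, whose mean is under control.\<close>
  have e1: "v powr (- 1 / 2) \<le> v powr (- 3 / 2) * x\<^sup>2"
  proof -
    have "v powr (- 1 / 2) = v powr (- 3 / 2) * v" using v0 by (simp add: powr_mult_base mult.commute)
    also have "\<dots> \<le> v powr (- 3 / 2) * x\<^sup>2" using xv by (intro mult_left_mono) auto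
    finally show ?thesis .
  qed
  have e2: "\<bar>x\<bar> * v powr (- 1) \<le> v powr (- 3 / 2) * x\<^sup>2"
  proof -
    have "v powr (- 1) = v powr (- 3 / 2) * sqrt v" using v0 by (simp add: powr_half_sqrt[symmetric] powr_add[symmetric])
    then have "\<bar>x\<bar> * v powr (- 1) = v powr (- 3 / 2) * (\<bar>x\<bar> * sqrt v)" by simp
    also have "\<dots> \<le> v powr (- 3 / 2) * (\<bar>x\<bar> * \<bar>x\<bar>)" using True by (intro mult_left_mono) auto
    finally show ?thesis by (simp add: power2_eq_square)
  qed
  have "\<bar>(GPhi (v + s) (z - x) - GPhi v (z - x)) - (GPhi (v + s) z - GPhi v z) + x * (Gphi (v + s) z - Gphi v z)\<bar>
     \<le> \<bar>GPhi (v + s) (z - x) - GPhi v (z - x)\<bar> + \<bar>GPhi (v + s) z - GPhi v z\<bar> + \<bar>x\<bar> * \<bar>Gphi (v + s) z - Gphi v z\<bar>"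
    unfolding abs_mult[symmetric] by linarith
  also have "\<dots> \<le> C * v powr (- 1 / 2) * psi p v (z - x) + C * (v powr (- 3 / 2) * x\<^sup>2) * psi p v z + C * (v powr (- 3 / 2) * x\<^sup>2) * psi p v z"
  proof (intro add_mono G)
    have "\<bar>GPhi (v + s) z - GPhi v z\<bar> \<le> C * v powr (- 1 / 2) * psi p v z" by (rule G)
    also have "\<dots> \<le> C * (v powr (- 3 / 2) * x\<^sup>2) * psi p v z" using e1 C ps by (intro mult_right_mono mult_left_mono) auto
    finally show "\<bar>GPhi (v + s) z - GPhi v z\<bar> \<le> C * (v powr (- 3 / 2) * x\<^sup>2) * psi p v z" .
    have "\<bar>x\<bar> * \<bar>Gphi (v + s) z - Gphi v z\<bar> \<le> \<bar>x\<bar> * (C * v powr (- 1) * psi p v z)" using g by (intro mult_left_mono) auto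
    also have "\<dots> = C * (\<bar>x\<bar> * v powr (- 1)) * psi p v z" by simp
    also have "\<dots> \<le> C * (v powr (- 3 / 2) * x\<^sup>2) * psi p v z" using e2 C ps by (intro mult_right_mono mult_left_mono) auto
    finally show "\<bar>x\<bar> * \<bar>Gphi (v + s) z - Gphi v z\<bar> \<le> C * (v powr (- 3 / 2) * x\<^sup>2) * psi p v z" .
  qed
  also have "\<dots> = 2 * C * v powr (- 3 / 2) * psi p v z * x\<^sup>2 + C * v powr (- 1 / 2) * psi p v (z - x)"
    by (simp add: algebra_simps)
  finally show ?thesis using True by simp
qed

lemma integrable_poly_bounded:
  assumes "prob_space M" and [measurable]: "\<xi> \<in> borel_measurable M" and bd: "\<And>\<omega>. \<bar>\<xi> \<omega>\<bar> \<le> L"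
  shows "integrable M (\<lambda>\<omega>. (\<xi> \<omega>) ^ k)" "integrable M (\<lambda>\<omega>. \<bar>\<xi> \<omega>\<bar> ^ k)" "integrable M \<xi>"
    "integrable M (\<lambda>\<omega>. GPhi v (z - \<xi> \<omega>))"
proof -
  interpret prob_space M by fact
  have *: "\<bar>\<xi> \<omega>\<bar> ^ k \<le> L ^ k" for \<omega> k using bd by (intro power_mono) auto
  show "integrable M (\<lambda>\<omega>. (\<xi> \<omega>) ^ k)" "integrable M (\<lambda>\<omega>. \<bar>\<xi> \<omega>\<bar> ^ k)"
    using * by (auto intro!: integrable_const_bound[where B="L ^ k"] simp: power_abs)
  show "integrable M \<xi>" using bd by (intro integrable_const_bound[where B=L]) auto
  show "integrable M (\<lambda>\<omega>. GPhi v (z - \<xi> \<omega>))"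
    by (intro integrable_const_bound[where B=1]) (auto simp: GPhi_nonneg GPhi_le_1)
qed

text \<open>The exchange is split in two: first \<xi> against \<eta> at the same noise, then
  \<open>v\<close> against \<open>v + s\<close> with \<eta> fixed. In the first part only values of
  size at most \<open>R\<close> differ, so a fourth-order remainder R^4 v^(-3/2) arises without a
  fourth moment of the summands. In the second part the mixed expansion calls only for the second
  moment of \<eta>.\<close>

lemma swap_cdf_bound:
  assumes M: "prob_space M" and [measurable]: "\<xi> \<in> borel_measurable M" "\<eta> \<in> borel_measurable M"
    and bd: "\<And>\<omega>. \<bar>\<xi> \<omega>\<bar> \<le> L" "\<And>\<omega>. \<bar>\<eta> \<omega>\<bar> \<le> L"
    and mean: "(\<integral>\<omega>. \<xi> \<omega> \<partial>M) = 0" "(\<integral>\<omega>. \<eta> \<omega> \<partial>M) = 0"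
    and var: "(\<integral>\<omega>. (\<xi> \<omega>)\<^sup>2 \<partial>M) \<le> 1" "(\<integral>\<omega>. (\<xi> \<omega>)\<^sup>2 \<partial>M) - (\<integral>\<omega>. (\<eta> \<omega>)\<^sup>2 \<partial>M) = s" and s: "0 \<le> s" "s \<le> 1"
    and third: "\<bar>(\<integral>\<omega>. (\<xi> \<omega>) ^ 3 \<partial>M) - (\<integral>\<omega>. (\<eta> \<omega>) ^ 3 \<partial>M)\<bar> \<le> d"
    and eq: "\<And>\<omega>. \<xi> \<omega> \<noteq> \<eta> \<omega> \<Longrightarrow> \<bar>\<xi> \<omega>\<bar> \<le> R \<and> \<bar>\<eta> \<omega>\<bar> \<le> R" and R: "R \<le> sqrt v" "0 \<le> R" and v: "6 * p \<le> v"
  shows "\<bar>(\<integral>\<omega>. GPhi v (z - \<xi> \<omega>) \<partial>M) - (\<integral>\<omega>. GPhi (v + s) (z - \<eta> \<omega>) \<partial>M)\<bar>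
      \<le> (C * (R ^ 4 + 3) * v powr (- 3 / 2) + C * d * v powr (- 1)) * psi p v z
       + C * v powr (- 1 / 2) * (\<integral>\<omega>. indicator {\<omega>. \<bar>\<eta> \<omega>\<bar> > sqrt v} \<omega> * psi p v (z - \<eta> \<omega>) \<partial>M)"
proof -
  interpret prob_space M by fact
  have v0: "v > 0" using v p by simp
  have ps: "psi p v z > 0" using psi_pos[OF v0] .
  note i\<xi> = integrable_poly_bounded[OF M \<open>\<xi> \<in> borel_measurable M\<close> bd(1)]
  note i\<eta> = integrable_poly_bounded[OF M \<open>\<eta> \<in> borel_measurable M\<close> bd(2)]
  let ?B = "C * v powr (- 3 / 2) * psi p v z"
  have B0: "?B \<ge> 0" using C ps by (simp add: less_imp_le)
  define P where "P x = - x * Gphi v z + x\<^sup>2 / 2 * Gder v 2 z - x ^ 3 / 6 * Gder v 3 z" for x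
  define G where "G y = GPhi (v + s) y - GPhi v y" for y
  define g where "g = Gphi (v + s) z - Gphi v z"
  define I where "I \<omega> = (indicator {\<omega>. \<bar>\<eta> \<omega>\<bar> > sqrt v} \<omega> * psi p v (z - \<eta> \<omega>) :: real)" for \<omega>
  have iP: "integrable M (\<lambda>\<omega>. P (\<xi> \<omega>))" "integrable M (\<lambda>\<omega>. P (\<eta> \<omega>))"
    unfolding P_def using i\<xi> i\<eta> by auto
  have iG: "integrable M (\<lambda>\<omega>. G (z - \<eta> \<omega>))" unfolding G_def using i\<eta> by auto
  have iI: "integrable M I"
  proof (rule integrable_const_bound[where B="1 / sqrt v"])
    show "AE \<omega> in M. norm (I \<omega>) \<le> 1 / sqrt v"
      using psi_le[OF v0 p] psi_pos[OF v0] v0 by (auto simp: I_def indicator_def less_imp_le intro!: AE_I2)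
    have "I = (\<lambda>\<omega>. if \<bar>\<eta> \<omega>\<bar> > sqrt v then psi p v (z - \<eta> \<omega>) else 0)" by (auto simp: I_def indicator_def)
    then show "I \<in> borel_measurable M" by simp
  qed
  have I0: "I \<omega> \<ge> 0" for \<omega> using psi_pos[OF v0] by (auto simp: I_def indicator_def less_imp_le)
  have t4: "\<bar>GPhi v (z - x) - (GPhi v z + P x)\<bar> \<le> (?B * R ^ 4) / 2" if "\<bar>x\<bar> \<le> R" for x
    using GPhi_taylor4[OF v that R(1), of z] by (simp add: P_def algebra_simps)
  have pw: "\<bar>GPhi v (z - \<xi> \<omega>) - GPhi (v + s) (z - \<eta> \<omega>) - (P (\<xi> \<omega>) - P (\<eta> \<omega>) - (G z - \<eta> \<omega> * g))\<bar>
     \<le> ?B * R ^ 4 + 2 * ?B * (\<eta> \<omega>)\<^sup>2 + C * v powr (- 1 / 2) * I \<omega>" for \<omega>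
  proof -
    have 1: "\<bar>GPhi v (z - \<xi> \<omega>) - GPhi v (z - \<eta> \<omega>) - (P (\<xi> \<omega>) - P (\<eta> \<omega>))\<bar> \<le> ?B * R ^ 4"
    proof (cases "\<xi> \<omega> = \<eta> \<omega>")
      case True
      then show ?thesis using B0 R by simp
    next
      case False
      then show ?thesis
        using t4[of "\<xi> \<omega>"] t4[of "\<eta> \<omega>"] eq[of \<omega>] by linarith
    qed
    have 2: "\<bar>G (z - \<eta> \<omega>) - G z + \<eta> \<omega> * g\<bar> \<le> 2 * ?B * (\<eta> \<omega>)\<^sup>2 + C * v powr (- 1 / 2) * I \<omega>"
    proof -
      have "I \<omega> = (if \<bar>\<eta> \<omega>\<bar> > sqrt v then psi p v (z - \<eta> \<omega>) else 0)" by (simp add: I_def)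
      then show ?thesis unfolding G_def g_def using GPhi_increment_shift[OF v s, of z "\<eta> \<omega>"] by (simp add: mult.assoc)
    qed
    show ?thesis using 1 2 unfolding G_def by linarith
  qed
  \<comment> \<open>Mean of the polynomial parts. The first-order terms vanish by centring, the
    second moments leave s/2 times the second derivative, which the heat equation cancels against
    \<open>G z\<close>, and the third moments leave the term with \<open>d\<close>.\<close>
  define E where "E = s / 2 * Gder v 2 z - ((\<integral>\<omega>. (\<xi> \<omega>) ^ 3 \<partial>M) - (\<integral>\<omega>. (\<eta> \<omega>) ^ 3 \<partial>M)) / 6 * Gder v 3 z - G z"
  have EP: "(\<integral>\<omega>. P (\<xi> \<omega>) - P (\<eta> \<omega>) - (G z - \<eta> \<omega> * g) \<partial>M) = E"
  proof -
    have "(\<integral>\<omega>. P (\<xi> \<omega>) \<partial>M) = (\<integral>\<omega>. (\<xi> \<omega>)\<^sup>2 \<partial>M) / 2 * Gder v 2 z - (\<integral>\<omega>. (\<xi> \<omega>) ^ 3 \<partial>M) / 6 * Gder v 3 z"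
      unfolding P_def using i\<xi> mean by simp
    moreover have "(\<integral>\<omega>. P (\<eta> \<omega>) \<partial>M) = (\<integral>\<omega>. (\<eta> \<omega>)\<^sup>2 \<partial>M) / 2 * Gder v 2 z - (\<integral>\<omega>. (\<eta> \<omega>) ^ 3 \<partial>M) / 6 * Gder v 3 z"
      unfolding P_def using i\<eta> mean by simp
    moreover have "(\<integral>\<omega>. P (\<xi> \<omega>) - P (\<eta> \<omega>) - (G z - \<eta> \<omega> * g) \<partial>M) = (\<integral>\<omega>. P (\<xi> \<omega>) \<partial>M) - (\<integral>\<omega>. P (\<eta> \<omega>) \<partial>M) - G z"
      using iP i\<eta> mean by (simp add: prob_space)
    ultimately show ?thesis unfolding E_def var(2)[symmetric] by (simp add: algebra_simps diff_divide_distrib)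
  qed
  have E_le: "\<bar>E\<bar> \<le> ?B + C * d * v powr (- 1) * psi p v z"
  proof -
    have "\<bar>G z - s / 2 * Gder v 2 z\<bar> \<le> ?B" unfolding G_def by (rule GPhi_heat[OF v s])
    moreover have t:  "\<bar>((\<integral>\<omega>. (\<xi> \<omega>) ^ 3 \<partial>M) - (\<integral>\<omega>. (\<eta> \<omega>) ^ 3 \<partial>M)) / 6 * Gder v 3 z\<bar> \<le> d * (C * v powr (- 1) * psi p v z)"
      unfolding abs_mult
    proof (rule mult_mono)
      show "\<bar>((\<integral>\<omega>. (\<xi> \<omega>) ^ 3 \<partial>M) - (\<integral>\<omega>. (\<eta> \<omega>) ^ 3 \<partial>M)) / 6\<bar> \<le> d"
        by (rule order_trans[OF _ third]) simp
      show "\<bar>Gder v 3 z\<bar> \<le> C * v powr (- 1) * psi p v z"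
        using Gder_bound_Suc[of v v 0 2 z] v v0 by (simp add: numeral_eq_Suc)
    qed (use third in auto)
    moreover have "d * (C * v powr (- 1) * psi p v z) = C * d * v powr (- 1) * psi p v z" by simp
    ultimately show ?thesis unfolding E_def by linarith
  qed
  have eta2: "(\<integral>\<omega>. (\<eta> \<omega>)\<^sup>2 \<partial>M) \<le> 1" using var s by linarith
  have "\<bar>(\<integral>\<omega>. GPhi v (z - \<xi> \<omega>) \<partial>M) - (\<integral>\<omega>. GPhi (v + s) (z - \<eta> \<omega>) \<partial>M) - E\<bar>
     = \<bar>\<integral>\<omega>. GPhi v (z - \<xi> \<omega>) - GPhi (v + s) (z - \<eta> \<omega>) - (P (\<xi> \<omega>) - P (\<eta> \<omega>) - (G z - \<eta> \<omega> * g)) \<partial>M\<bar>"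
    unfolding EP[symmetric] using i\<xi> i\<eta> iP by (simp add: prob_space)
  also have "\<dots> \<le> (\<integral>\<omega>. \<bar>GPhi v (z - \<xi> \<omega>) - GPhi (v + s) (z - \<eta> \<omega>) - (P (\<xi> \<omega>) - P (\<eta> \<omega>) - (G z - \<eta> \<omega> * g))\<bar> \<partial>M)"
    by (rule integral_abs_bound)
  also have "\<dots> \<le> (\<integral>\<omega>. ?B * R ^ 4 + 2 * ?B * (\<eta> \<omega>)\<^sup>2 + C * v powr (- 1 / 2) * I \<omega> \<partial>M)"
    using i\<xi> i\<eta> iP iI by (intro integral_mono pw) auto
  also have "\<dots> = ?B * R ^ 4 + 2 * ?B * (\<integral>\<omega>. (\<eta> \<omega>)\<^sup>2 \<partial>M) + C * v powr (- 1 / 2) * (\<integral>\<omega>. I \<omega> \<partial>M)"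
    using i\<eta> iI by (simp add: prob_space)
  also have "\<dots> \<le> ?B * R ^ 4 + 2 * ?B * 1 + C * v powr (- 1 / 2) * (\<integral>\<omega>. I \<omega> \<partial>M)"
    using eta2 B0 C by (intro add_mono mult_left_mono) auto
  finally have "\<bar>(\<integral>\<omega>. GPhi v (z - \<xi> \<omega>) \<partial>M) - (\<integral>\<omega>. GPhi (v + s) (z - \<eta> \<omega>) \<partial>M)\<bar>
    \<le> ?B * R ^ 4 + 2 * ?B * 1 + C * v powr (- 1 / 2) * (\<integral>\<omega>. I \<omega> \<partial>M) + (?B + C * d * v powr (- 1) * psi p v z)"
    using E_le by linarith
  then show ?thesis unfolding I_def by (simp add: algebra_simps)
qed

text \<open>Comparison with pure noise. Third moments do not match, whence the weaker order v^(-1);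
  this is affordable once \<open>v\<close> is of order n.\<close>

lemma gaussian_swap_cdf_bound:
  assumes M: "prob_space M" and [measurable]: "\<eta> \<in> borel_measurable M"
    and bd: "\<And>\<omega>. \<bar>\<eta> \<omega>\<bar> \<le> K * sqrt v"
    and mean: "(\<integral>\<omega>. \<eta> \<omega> \<partial>M) = 0" and var: "(\<integral>\<omega>. (\<eta> \<omega>)\<^sup>2 \<partial>M) = s" and s: "s \<le> 1" and v: "6 * p \<le> v"
  shows "\<bar>(\<integral>\<omega>. GPhi v (z - \<eta> \<omega>) \<partial>M) - GPhi (v + s) z\<bar>
      \<le> (C * (\<integral>\<omega>. \<bar>\<eta> \<omega>\<bar> ^ 3 \<partial>M) * v powr (- 1) + C * v powr (- 3 / 2)) * psi p v z"
proof -
  interpret prob_space M by fact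
  have v0: "v > 0" using v p by simp
  have s0: "s \<ge> 0" unfolding var[symmetric] by simp
  note i\<eta> = integrable_poly_bounded[OF M \<open>\<eta> \<in> borel_measurable M\<close> bd]
  define P where "P x = GPhi v z - x * Gphi v z + x\<^sup>2 / 2 * Gder v 2 z" for x
  have iP: "integrable M (\<lambda>\<omega>. P (\<eta> \<omega>))" unfolding P_def using i\<eta> by auto
  have EP: "(\<integral>\<omega>. P (\<eta> \<omega>) \<partial>M) = GPhi v z + s / 2 * Gder v 2 z"
    unfolding P_def using i\<eta> mean var by (simp add: prob_space)
  have "\<bar>(\<integral>\<omega>. GPhi v (z - \<eta> \<omega>) \<partial>M) - (GPhi v z + s / 2 * Gder v 2 z)\<bar> = \<bar>\<integral>\<omega>. GPhi v (z - \<eta> \<omega>) - P (\<eta> \<omega>) \<partial>M\<bar>"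
    unfolding EP[symmetric] using i\<eta> iP by simp
  also have "\<dots> \<le> (\<integral>\<omega>. \<bar>GPhi v (z - \<eta> \<omega>) - P (\<eta> \<omega>)\<bar> \<partial>M)" by (rule integral_abs_bound)
  also have "\<dots> \<le> (\<integral>\<omega>. C * v powr (- 1) * psi p v z * \<bar>\<eta> \<omega>\<bar> ^ 3 \<partial>M)"
    using i\<eta> iP unfolding P_def by (intro integral_mono GPhi_taylor3[OF v bd]) auto
  also have "\<dots> = C * v powr (- 1) * psi p v z * (\<integral>\<omega>. \<bar>\<eta> \<omega>\<bar> ^ 3 \<partial>M)" by simp
  finally show ?thesis using GPhi_heat[OF v s0 s, of z] by (simp add: algebra_simps)
qed

end

section \<open>Gaussian approximation of i.i.d. sums\<close>

text \<open>A function of a starting law: the induction over the exchanges can then put a summand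
  that is still to be exchanged into the start.\<close>

definition conv_pow :: "real measure \<Rightarrow> nat \<Rightarrow> real measure \<Rightarrow> real measure" where
  "conv_pow \<mu> n = (\<lambda>\<alpha>. convolution \<alpha> \<mu>) ^^ n"

lemma conv_pow_0 [simp]: "conv_pow \<mu> 0 \<alpha> = \<alpha>"
  by (simp add: conv_pow_def)

lemma conv_pow_Suc: "conv_pow \<mu> (Suc n) \<alpha> = convolution (conv_pow \<mu> n \<alpha>) \<mu>"
  by (simp add: conv_pow_def)

lemma conv_pow_Suc': "conv_pow \<mu> (Suc n) \<alpha> = conv_pow \<mu> n (convolution \<alpha> \<mu>)"
  by (simp only: conv_pow_def funpow_Suc_right o_apply)

lemma convolution_right_commute:
  assumes "real_distribution \<alpha>" "real_distribution \<mu>" "real_distribution \<nu>"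
  shows "convolution (convolution \<alpha> \<mu>) \<nu> = convolution (convolution \<alpha> \<nu>) \<mu>"
proof -
  interpret a: real_distribution \<alpha> by fact
  interpret m: real_distribution \<mu> by fact
  interpret n: real_distribution \<nu> by fact
  have "convolution (convolution \<alpha> \<mu>) \<nu> = convolution \<alpha> (convolution \<mu> \<nu>)"
    by (rule convolution_associative[symmetric]) (simp_all add: a.finite_measure_axioms m.finite_measure_axioms n.finite_measure_axioms)
  also have "convolution \<mu> \<nu> = convolution \<nu> \<mu>"
    by (rule convolution_commutative) (simp_all add: m.finite_measure_axioms n.finite_measure_axioms)
  also have "convolution \<alpha> (convolution \<nu> \<mu>) = convolution (convolution \<alpha> \<nu>) \<mu>"
    by (rule convolution_associative) (simp_all add: a.finite_measure_axioms m.finite_measure_axioms n.finite_measure_axioms)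
  finally show ?thesis .
qed

lemma real_distribution_conv_pow:
  "real_distribution \<alpha> \<Longrightarrow> real_distribution \<mu> \<Longrightarrow> real_distribution (conv_pow \<mu> n \<alpha>)"
  by (induction n) (auto simp: conv_pow_Suc intro: real_distribution_convolution)

lemma conv_pow_commute:
  assumes "real_distribution \<alpha>" "real_distribution \<mu>" "real_distribution \<nu>"
  shows "conv_pow \<nu> n (convolution \<alpha> \<mu>) = convolution (conv_pow \<nu> n \<alpha>) \<mu>"
proof (induction n)
  case (Suc n)
  then show ?case
    using convolution_right_commute[of "conv_pow \<nu> n \<alpha>" \<mu> \<nu>] real_distribution_conv_pow[OF assms(1,3)] assms
    by (simp add: conv_pow_Suc)
qed simp

text \<open>The summands are exchanged one by one while the noise takes over the variance
  \<open>s\<close> each time, so the k-th exchange meets noise v + k s. The step bound is uniform in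
  \<alpha>, which stands for all other summands, and Minkowski's inequality adds the single
  costs.\<close>

lemma quantile_chain:
  fixes c :: "real \<Rightarrow> real"
  assumes p: "p \<ge> 1" and \<mu>: "real_distribution \<mu>" and \<nu>: "real_distribution \<nu>"
    and s: "s \<ge> 0" and v0: "v0 > 0" and c: "\<And>v. v \<ge> v0 \<Longrightarrow> c v > 0"
    and step: "\<And>\<alpha> v. real_distribution \<alpha> \<Longrightarrow> v \<ge> v0 \<Longrightarrow>
      (\<integral>\<^sup>+u. ennreal (\<bar>quantile (gsmooth (convolution \<alpha> \<mu>) v) u - quantile (gsmooth (convolution \<alpha> \<nu>) (v + s)) u\<bar> powr p) \<partial>unit_measure)
       \<le> ennreal (c v powr p)"
  shows "real_distribution \<alpha> \<Longrightarrow> v \<ge> v0 \<Longrightarrow>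
      (\<integral>\<^sup>+u. ennreal (\<bar>quantile (gsmooth (conv_pow \<mu> (Suc n) \<alpha>) v) u - quantile (gsmooth (conv_pow \<nu> (Suc n) \<alpha>) (v + real (Suc n) * s)) u\<bar> powr p) \<partial>unit_measure)
       \<le> ennreal ((\<Sum>k<Suc n. c (v + real k * s)) powr p)"
proof (induction n arbitrary: \<alpha> v)
  case 0
  then show ?case using step[of \<alpha> v] by (simp add: conv_pow_Suc)
next
  case (Suc n)
  let ?N = "Suc n"
  let ?q1 = "quantile (gsmooth (conv_pow \<mu> (Suc ?N) \<alpha>) v)"
  \<comment> \<open>Intermediate law: all summands but one are exchanged, the last one still has law
    \<mu>. The induction hypothesis leads to it with this summand inside the start, and a single
    step leads on from it.\<close>
  let ?q2 = "quantile (gsmooth (conv_pow \<nu> ?N (convolution \<alpha> \<mu>)) (v + real ?N * s))"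
  let ?q3 = "quantile (gsmooth (conv_pow \<nu> (Suc ?N) \<alpha>) (v + real (Suc ?N) * s))"
  have v: "v > 0" "v + real ?N * s \<ge> v0" "v + real (Suc ?N) * s > 0"
    using Suc.prems v0 s by (auto simp: add_increasing2 add_pos_nonneg intro: order_less_le_trans)
  have a: "real_distribution (convolution \<alpha> \<mu>)" using Suc.prems \<mu> by (intro real_distribution_convolution)
  have m: "?q1 \<in> borel_measurable unit_measure" "?q2 \<in> borel_measurable unit_measure" "?q3 \<in> borel_measurable unit_measure"
    using Suc.prems \<mu> \<nu> v v0 a
    by (auto intro!: measurable_quantile real_distribution_gsmooth real_distribution_conv_pow simp del: of_nat_Suc)
  have 1: "(\<integral>\<^sup>+u. ennreal (\<bar>?q1 u - ?q2 u\<bar> powr p) \<partial>unit_measure) \<le> ennreal ((\<Sum>k<?N. c (v + real k * s)) powr p)"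
    using Suc.IH[OF a Suc.prems(2)] by (simp add: conv_pow_Suc')
  have 2: "(\<integral>\<^sup>+u. ennreal (\<bar>?q2 u - ?q3 u\<bar> powr p) \<partial>unit_measure) \<le> ennreal (c (v + real ?N * s) powr p)"
  proof -
    have "v + real ?N * s + s = v + real (Suc ?N) * s" by (simp add: algebra_simps)
    then show ?thesis
      using step[of "conv_pow \<nu> ?N \<alpha>" "v + real ?N * s"] v Suc.prems \<nu>
      by (simp only: conv_pow_commute[OF Suc.prems(1) \<mu> \<nu>] conv_pow_Suc[of \<nu> ?N] real_distribution_conv_pow)
  qed
  have pos: "(\<Sum>k<?N. c (v + real k * s)) > 0"
    using Suc.prems s c by (intro sum_pos) (auto simp: add_increasing2)
  have "(\<integral>\<^sup>+u. ennreal (\<bar>(?q1 u - ?q2 u) + (?q2 u - ?q3 u)\<bar> powr p) \<partial>unit_measure)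
     \<le> ennreal (((\<Sum>k<?N. c (v + real k * s)) + c (v + real ?N * s)) powr p)"
    using m v c by (intro nn_integral_powr_triangle[OF p _ _ pos _ 1 2]) auto
  then show ?case by simp
qed

text \<open>As v0 \<ge> \<tau>^2, the k-th term is at most (\<tau>^2 (k+1))^(-r), so a convergent
  zeta series bounds the sum uniformly in n and in the start.\<close>

lemma sum_shifted_powr_le:
  assumes r: "r > 1" and \<tau>: "\<tau> > 0"
  shows "\<exists>Z\<ge>0. \<forall>n v0. v0 \<ge> \<tau>\<^sup>2 \<longrightarrow> (\<Sum>k<n. (v0 + real k * \<tau>\<^sup>2) powr (- r)) \<le> Z"
proof -
  define Z where "Z = (\<Sum>k. real (Suc k) powr (- r))"
  have summ: "summable (\<lambda>k. real (Suc k) powr (- r))"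
    using r by (subst summable_Suc_iff) (simp add: summable_real_powr_iff)
  have "(\<Sum>k<n. (v0 + real k * \<tau>\<^sup>2) powr (- r)) \<le> (\<tau>\<^sup>2) powr (- r) * Z" if v0: "v0 \<ge> \<tau>\<^sup>2" for n v0
  proof -
    have "(\<Sum>k<n. (v0 + real k * \<tau>\<^sup>2) powr (- r)) \<le> (\<Sum>k<n. (\<tau>\<^sup>2) powr (- r) * real (Suc k) powr (- r))"
    proof (intro sum_mono)
      fix k
      have "(v0 + real k * \<tau>\<^sup>2) powr (- r) \<le> (\<tau>\<^sup>2 * real (Suc k)) powr (- r)"
        using v0 \<tau> r by (intro powr_mono2') (auto simp: algebra_simps intro!: add_pos_nonneg)
      also have "\<dots> = (\<tau>\<^sup>2) powr (- r) * real (Suc k) powr (- r)" by (rule powr_mult)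
      finally show "(v0 + real k * \<tau>\<^sup>2) powr (- r) \<le> (\<tau>\<^sup>2) powr (- r) * real (Suc k) powr (- r)" .
    qed
    also have "\<dots> = (\<tau>\<^sup>2) powr (- r) * (\<Sum>k<n. real (Suc k) powr (- r))" by (simp add: sum_distrib_left)
    also have "\<dots> \<le> (\<tau>\<^sup>2) powr (- r) * Z"
      unfolding Z_def using summ by (intro mult_left_mono sum_le_suminf) auto
    finally show ?thesis .
  qed
  moreover have "(\<tau>\<^sup>2) powr (- r) * Z \<ge> 0" unfolding Z_def using summ by (intro mult_nonneg_nonneg suminf_nonneg) auto
  ultimately show ?thesis by blast
qed

lemma powr_add_ge:
  fixes a b p :: real
  assumes "p \<ge> 1" "a \<ge> 0" "b \<ge> 0"
  shows "a powr p + b powr p \<le> (a + b) powr p"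
proof (cases "a + b = 0")
  case True
  then have "a = 0" "b = 0" using assms by auto
  then show ?thesis by simp
next
  case False
  then have s: "a + b > 0" using assms by simp
  have *: "x powr p \<le> x * (a + b) powr (p - 1)" if "0 \<le> x" "x \<le> a + b" for x
  proof -
    have "x powr p = x * x powr (p - 1)" using that assms by (cases "x = 0") (auto simp: powr_diff)
    also have "\<dots> \<le> x * (a + b) powr (p - 1)" using that assms by (intro mult_left_mono powr_mono2) auto
    finally show ?thesis .
  qed
  have "a powr p + b powr p \<le> a * (a + b) powr (p - 1) + b * (a + b) powr (p - 1)"
    using * assms by (intro add_mono) auto
  also have "\<dots> = (a + b) * (a + b) powr (p - 1)" by (simp add: algebra_simps)
  also have "\<dots> = (a + b) powr p" using s by (simp add: powr_diff)
  finally show ?thesis .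
qed

lemma real_distribution_return: "real_distribution (return borel x)"
proof -
  have "prob_space (return borel x)" by (rule prob_space_return) simp
  then show ?thesis by (simp add: real_distribution_def real_distribution_axioms_def)
qed

lemma conv_pow_zero:
  assumes M: "prob_space M" and \<alpha>: "real_distribution \<alpha>"
  shows "conv_pow (distr M borel (\<lambda>_. 0)) n \<alpha> = \<alpha>"
proof -
  interpret M: prob_space M by fact
  interpret a: real_distribution \<alpha> by fact
  have *: "convolution \<alpha> (distr M borel (\<lambda>_. 0)) = \<alpha>"
  proof (rule measure_eqI)
    fix A assume "A \<in> sets (convolution \<alpha> (distr M borel (\<lambda>_. 0)))"
    then have A: "A \<in> sets borel" by simp
    have "emeasure (convolution \<alpha> (distr M borel (\<lambda>_. 0))) A = (\<integral>\<^sup>+t. \<integral>\<^sup>+\<omega>. indicator A (t + 0) \<partial>M \<partial>\<alpha>)"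
      using A by (subst nn_integral_convolution_distr[OF \<alpha> M, symmetric]) auto
    also have "\<dots> = emeasure \<alpha> A" using A by (simp add: M.emeasure_space_1)
    finally show "emeasure (convolution \<alpha> (distr M borel (\<lambda>_. 0))) A = emeasure \<alpha> A" .
  qed simp
  show ?thesis by (induction n) (simp_all only: conv_pow_0 conv_pow_Suc *)
qed

definition step_const :: "real \<Rightarrow> real" where
  "step_const p = 2 powr (p - 1) * (exp (- 1 / 2) / sqrt 2 / 2) powr (1 - p) * psi_const p"

lemma step_const_pos: "step_const p > 0"
  unfolding step_const_def using psi_const_pos by (intro mult_pos_pos) auto

text \<open>Brings the bound of \<open>quantile_step\<close> into the form c^p that
  \<open>quantile_chain\<close> asks for; superadditivity of t^p merges the two terms.\<close>

lemma step_const_le: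
  assumes "p \<ge> 1" "\<kappa>1 \<ge> 0" "\<kappa>2 \<ge> 0" "q \<ge> 0" "\<kappa>2 * q powr (1 / p) \<le> \<kappa>3"
  shows "step_const p * (\<kappa>1 powr p + \<kappa>2 powr p * q) \<le> (step_const p powr (1 / p) * (\<kappa>1 + \<kappa>3)) powr p"
proof -
  have "\<kappa>2 powr p * q = (\<kappa>2 * q powr (1 / p)) powr p" using assms by (simp add: powr_mult powr_powr)
  also have "\<dots> \<le> \<kappa>3 powr p" using assms by (intro powr_mono2) auto
  finally have "\<kappa>1 powr p + \<kappa>2 powr p * q \<le> \<kappa>1 powr p + \<kappa>3 powr p" by simp
  also have "\<dots> \<le> (\<kappa>1 + \<kappa>3) powr p"
  proof -
    have "0 \<le> \<kappa>3" using assms(3,4,5) by (meson mult_nonneg_nonneg order_trans powr_ge_zero)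
    then show ?thesis using assms by (intro powr_add_ge) auto
  qed
  finally have "step_const p * (\<kappa>1 powr p + \<kappa>2 powr p * q) \<le> step_const p * (\<kappa>1 + \<kappa>3) powr p"
    using step_const_pos[of p] by (intro mult_left_mono) auto
  moreover have "(step_const p powr (1 / p)) powr p = step_const p"
    using assms step_const_pos[of p] by (simp add: powr_powr)
  ultimately show ?thesis by (simp add: powr_mult)
qed

text \<open>
  \<open>\<tau>\<^sup>2\<close> is the part of the variance that each exchange moves into the Gaussian noise, whose variance
  thus grows linearly along the chain.\<close>

lemma quantile_bound_exchange:
  assumes p: "p \<ge> 1" and \<tau>: "0 < \<tau>" "\<tau> \<le> 1" and R: "R \<ge> 0" and c3: "c3 \<ge> 0" and Bm: "Bm \<ge> 0"
  shows "\<exists>C>0. \<forall>(M :: 'a measure) \<xi> \<eta> n. prob_space M \<longrightarrow> n \<ge> 1 \<longrightarrow> \<xi> \<in> borel_measurable M \<longrightarrow> \<eta> \<in> borel_measurable M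
    \<longrightarrow> (\<forall>\<omega>. \<bar>\<eta> \<omega>\<bar> \<le> 2 * sqrt (real n)) \<longrightarrow> (\<integral>\<omega>. \<xi> \<omega> \<partial>M) = 0 \<longrightarrow> (\<integral>\<omega>. \<eta> \<omega> \<partial>M) = 0
    \<longrightarrow> (\<integral>\<omega>. (\<xi> \<omega>)\<^sup>2 \<partial>M) \<le> 1 \<longrightarrow> (\<integral>\<omega>. (\<xi> \<omega>)\<^sup>2 \<partial>M) - (\<integral>\<omega>. (\<eta> \<omega>)\<^sup>2 \<partial>M) = \<tau>\<^sup>2
    \<longrightarrow> \<bar>(\<integral>\<omega>. (\<xi> \<omega>) ^ 3 \<partial>M) - (\<integral>\<omega>. (\<eta> \<omega>) ^ 3 \<partial>M)\<bar> \<le> c3 / real n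
    \<longrightarrow> (\<forall>\<omega>. \<xi> \<omega> \<noteq> \<eta> \<omega> \<longrightarrow> \<bar>\<xi> \<omega>\<bar> \<le> R \<and> \<bar>\<eta> \<omega>\<bar> \<le> R)
    \<longrightarrow> (\<integral>\<omega>. \<bar>\<eta> \<omega>\<bar> powr (p + 2) \<partial>M) \<le> Bm
    \<longrightarrow> (\<integral>\<^sup>+u. ennreal (\<bar>quantile (gsmooth (conv_pow (distr M borel \<xi>) n (return borel 0)) (6 * p + R\<^sup>2)) u
          - quantile (gsmooth (return borel 0) (6 * p + R\<^sup>2 + real n * (\<integral>\<omega>. (\<xi> \<omega>)\<^sup>2 \<partial>M))) u\<bar> powr p) \<partial>unit_measure)
       \<le> ennreal (C powr p)"
proof -
  \<comment> \<open>In the second chain the noise is at least n \<tau>^2, so |\<eta>| \<le> 2 sqrt n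
    is at most (2/\<tau>) sqrt v.\<close>
  define K where "K = max 1 (2 / \<tau>)"
  obtain C where "Gder_bound p K C" using Gder_bound_exists[of p K] p by (auto simp: K_def)
  then interpret Gder_bound p K C .
  obtain Z1 where Z1: "Z1 \<ge> 0" "\<And>n v0. v0 \<ge> \<tau>\<^sup>2 \<Longrightarrow> (\<Sum>k<n. (v0 + real k * \<tau>\<^sup>2) powr (- (3/2))) \<le> Z1"
    using sum_shifted_powr_le[of "3/2" \<tau>] \<tau> by auto
  obtain Z2 where Z2: "Z2 \<ge> 0" "\<And>n v0. v0 \<ge> \<tau>\<^sup>2 \<Longrightarrow> (\<Sum>k<n. (v0 + real k * \<tau>\<^sup>2) powr (- (1 + 1 / p))) \<le> Z2"
    using sum_shifted_powr_le[of "1 + 1 / p" \<tau>] \<tau> p by auto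
  \<comment> \<open>6p admits variance steps up to 1 in \<open>Gder_bound\<close>, and R^2 gives R
    \<le> sqrt v from the start, so that values at which \<xi> and \<eta> differ never exceed sqrt
    v.\<close>
  define v0 where "v0 = 6 * p + R\<^sup>2"
  define S where "S = step_const p powr (1 / p)"
  have S: "S > 0" using step_const_pos[of p] by (simp add: S_def)
  have v0: "v0 \<ge> 6 * p" "v0 \<ge> 1" "R \<le> sqrt v0" "\<tau>\<^sup>2 \<le> v0" "v0 > 0"
  proof -
    show "v0 \<ge> 6 * p" "v0 \<ge> 1" "v0 > 0" using p by (auto simp: v0_def add_increasing2 add_pos_nonneg)
    show "R \<le> sqrt v0" using p by (intro real_le_rsqrt) (simp add: v0_def)
    have "\<tau>\<^sup>2 \<le> 1" using \<tau> by (intro power_le_one) auto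
    then show "\<tau>\<^sup>2 \<le> v0" using \<open>v0 \<ge> 1\<close> by simp
  qed
  \<comment> \<open>The three terms of \<open>C1\<close> stand for the Taylor remainders, summed
    with exponent 3/2, the mismatch of third moments, n times c3/n, and the large values, summed
    with exponent 1 + 1/p. \<open>C2\<close> is n times the cost of an exchange for Gaussian
    noise.\<close>
  define C1 where "C1 = S * (C * (R ^ 4 + 3) * Z1 + C * c3 + C * Bm powr (1 / p) * Z2)"
  define C2 where "C2 = S * C * (Bm + 2) / \<tau>\<^sup>2"
  have C1: "C1 \<ge> 0" unfolding C1_def using S C Z1 Z2 c3 R by (auto intro!: mult_nonneg_nonneg add_nonneg_nonneg)
  have C2: "C2 > 0" unfolding C2_def using S C Bm \<tau> by (auto intro!: divide_pos_pos mult_pos_pos)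
  have main: "(\<integral>\<^sup>+u. ennreal (\<bar>quantile (gsmooth (conv_pow (distr M borel \<xi>) n (return borel 0)) v0) u
          - quantile (gsmooth (return borel 0) (v0 + real n * (\<integral>\<omega>. (\<xi> \<omega>)\<^sup>2 \<partial>M))) u\<bar> powr p) \<partial>unit_measure)
       \<le> ennreal ((C1 + 1 + C2) powr p)"
    if M: "prob_space M" and n: "n \<ge> 1" and [measurable]: "\<xi> \<in> borel_measurable M" "\<eta> \<in> borel_measurable M"
      and bd: "\<And>\<omega>. \<bar>\<eta> \<omega>\<bar> \<le> 2 * sqrt (real n)" and mean: "(\<integral>\<omega>. \<xi> \<omega> \<partial>M) = 0" "(\<integral>\<omega>. \<eta> \<omega> \<partial>M) = 0"
      and var: "(\<integral>\<omega>. (\<xi> \<omega>)\<^sup>2 \<partial>M) \<le> 1" "(\<integral>\<omega>. (\<xi> \<omega>)\<^sup>2 \<partial>M) - (\<integral>\<omega>. (\<eta> \<omega>)\<^sup>2 \<partial>M) = \<tau>\<^sup>2"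
      and third: "\<bar>(\<integral>\<omega>. (\<xi> \<omega>) ^ 3 \<partial>M) - (\<integral>\<omega>. (\<eta> \<omega>) ^ 3 \<partial>M)\<bar> \<le> c3 / real n"
      and eq: "\<And>\<omega>. \<xi> \<omega> \<noteq> \<eta> \<omega> \<Longrightarrow> \<bar>\<xi> \<omega>\<bar> \<le> R \<and> \<bar>\<eta> \<omega>\<bar> \<le> R"
      and mom: "(\<integral>\<omega>. \<bar>\<eta> \<omega>\<bar> powr (p + 2) \<partial>M) \<le> Bm"
    for M :: "'a measure" and \<xi> \<eta> n
  proof -
    interpret prob_space M by fact
    define L where "L = max (2 * sqrt (real n)) R"
    have bdL: "\<bar>\<xi> \<omega>\<bar> \<le> L" "\<bar>\<eta> \<omega>\<bar> \<le> L" for \<omega>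
      using bd[of \<omega>] eq[of \<omega>] by (cases "\<xi> \<omega> = \<eta> \<omega>"; force simp: L_def)+
    have tau2: "0 < \<tau>\<^sup>2" "\<tau>\<^sup>2 \<le> 1" using \<tau> by (auto intro: power_le_one)
    have var\<eta>: "(\<integral>\<omega>. (\<eta> \<omega>)\<^sup>2 \<partial>M) \<le> 1" using var tau2 by linarith
    have imom: "integrable M (\<lambda>\<omega>. \<bar>\<eta> \<omega>\<bar> powr (p + 2))"
      using bd p by (intro integrable_const_bound[where B="(2 * sqrt (real n)) powr (p + 2)"]) (auto intro!: AE_I2 powr_mono2)
    have rd: "real_distribution (distr M borel \<xi>)" "real_distribution (distr M borel \<eta>)" "real_distribution (distr M borel (\<lambda>_. 0))"
      by (rule real_distribution_distr, measurable)+
    note rd0 = real_distribution_return[of 0]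
    define c where "c v = S * (C * (R ^ 4 + 3) * v powr (- (3/2)) + C * (c3 / real n) * v powr (- 1)
       + C * Bm powr (1 / p) * v powr (- (1 + 1 / p)))" for v
    have c_pos: "c v > 0" if "v \<ge> v0" for v
    proof -
      have v: "v > 0" using that v0 by linarith
      have R4: "R ^ 4 + 3 > 0" using R by (intro add_nonneg_pos) auto
      have "0 < C * (R ^ 4 + 3) * v powr (- (3/2))" by (intro mult_pos_pos C R4) (use v in simp)
      moreover have "0 \<le> C * (c3 / real n) * v powr (- 1)" "0 \<le> C * Bm powr (1 / p) * v powr (- (1 + 1 / p))"
        using C c3 by (intro mult_nonneg_nonneg; simp)+
      ultimately show ?thesis unfolding c_def using S by (intro mult_pos_pos) linarith+
    qed
    have step1: "(\<integral>\<^sup>+u. ennreal (\<bar>quantile (gsmooth (convolution \<alpha> (distr M borel \<xi>)) v) u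
        - quantile (gsmooth (convolution \<alpha> (distr M borel \<eta>)) (v + \<tau>\<^sup>2)) u\<bar> powr p) \<partial>unit_measure) \<le> ennreal (c v powr p)"
      if \<alpha>: "real_distribution \<alpha>" and v: "v \<ge> v0" for \<alpha> v
    proof -
      have vv: "6 * p \<le> v" "1 \<le> v" "R \<le> sqrt v" "v > 0"
        using v v0 order_trans[OF v0(3) real_sqrt_le_mono[OF v]] by linarith+
      let ?q = "measure M {\<omega>\<in>space M. \<bar>\<eta> \<omega>\<bar> > sqrt v}"
      have q: "?q \<le> Bm * v powr (- (p + 2) / 2)"
      proof -
        have sv: "sqrt v powr (p + 2) = v powr ((p + 2) / 2)"
          using vv by (simp add: powr_half_sqrt[symmetric] powr_powr)
        have "?q \<le> measure M {\<omega>\<in>space M. \<bar>\<eta> \<omega>\<bar> powr (p + 2) \<ge> v powr ((p + 2) / 2)}"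
          unfolding sv[symmetric] using p vv by (intro finite_measure_mono) (auto intro!: powr_mono2)
        also have "\<dots> \<le> (\<integral>\<omega>. \<bar>\<eta> \<omega>\<bar> powr (p + 2) \<partial>M) / v powr ((p + 2) / 2)"
          using imom vv by (intro integral_Markov_inequality_measure[where A="{}"]) auto
        also have "\<dots> \<le> Bm / v powr ((p + 2) / 2)" using mom by (intro divide_right_mono) auto
        also have "\<dots> = Bm * v powr (- (p + 2) / 2)"
        proof -
          have e: "- (p + 2) / 2 = - ((p + 2) / 2)" by (rule minus_divide_left[symmetric])
          show ?thesis unfolding e powr_minus_divide by simp
        qed
        finally show ?thesis .
      qed
      have "(C * v powr (- 1 / 2)) * ?q powr (1 / p) \<le> (C * v powr (- 1 / 2)) * (Bm * v powr (- (p + 2) / 2)) powr (1 / p)"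
        using q p C by (intro mult_left_mono powr_mono2) auto
      also have "\<dots> = C * Bm powr (1 / p) * (v powr (- 1 / 2) * v powr ((- (p + 2) / 2) * (1 / p)))"
        by (simp add: powr_mult powr_powr)
      \<comment> \<open>The exponent -1/2 - (p+2)/(2p) equals -(1 + 1/p), which is below -1. The
        moment of order p + 2 makes the costs of large values summable.\<close>
      also have "v powr (- 1 / 2) * v powr ((- (p + 2) / 2) * (1 / p)) = v powr (- (1 + 1 / p))"
      proof -
        have "- 1 / 2 + (- (p + 2) / 2) * (1 / p) = - (1 + 1 / p)" using p by (simp add: field_simps)
        then show ?thesis by (simp only: powr_add[symmetric])
      qed
      finally have \<kappa>3: "(C * v powr (- 1 / 2)) * ?q powr (1 / p) \<le> C * Bm powr (1 / p) * v powr (- (1 + 1 / p))" .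
      have "(\<integral>\<^sup>+u. ennreal (\<bar>quantile (gsmooth (convolution \<alpha> (distr M borel \<xi>)) v) u
        - quantile (gsmooth (convolution \<alpha> (distr M borel \<eta>)) (v + \<tau>\<^sup>2)) u\<bar> powr p) \<partial>unit_measure)
        \<le> ennreal (step_const p * ((C * (R ^ 4 + 3) * v powr (- 3 / 2) + C * (c3 / real n) * v powr (- 1)) powr p
            + (C * v powr (- 1 / 2)) powr p * ?q))"
        unfolding step_const_def
      proof (rule quantile_step[OF \<alpha> M _ _ bdL mean var(1) var\<eta> vv(2)])
        show "\<xi> \<omega> = \<eta> \<omega>" if "sqrt v < \<bar>\<eta> \<omega>\<bar>" for \<omega> using eq[of \<omega>] that vv by auto
        show "\<bar>(\<integral>\<omega>. GPhi v (z - \<xi> \<omega>) \<partial>M) - (\<integral>\<omega>. GPhi (v + \<tau>\<^sup>2) (z - \<eta> \<omega>) \<partial>M)\<bar>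
          \<le> (C * (R ^ 4 + 3) * v powr (- 3 / 2) + C * (c3 / real n) * v powr (- 1)) * psi p v z
           + C * v powr (- 1 / 2) * (\<integral>\<omega>. indicator {\<omega>. \<bar>\<eta> \<omega>\<bar> > sqrt v} \<omega> * psi p v (z - \<eta> \<omega>) \<partial>M)" for z
          by (rule swap_cdf_bound[OF M _ _ bdL mean var _ _ third eq vv(3) R vv(1)]) (use tau2 in auto)
      qed (use tau2 vv p C R c3 in auto)
      also have "\<dots> \<le> ennreal ((step_const p powr (1 / p) * ((C * (R ^ 4 + 3) * v powr (- 3 / 2) + C * (c3 / real n) * v powr (- 1)) + C * Bm powr (1 / p) * v powr (- (1 + 1 / p)))) powr p)"
        using C R c3 by (intro ennreal_leI step_const_le p \<kappa>3) auto
      also have "\<dots> = ennreal (c v powr p)" by (simp add: c_def S_def)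
      finally show ?thesis .
    qed
    obtain n' where n': "n = Suc n'" using n by (cases n) auto
    have sum1: "(\<Sum>k<n. c (v0 + real k * \<tau>\<^sup>2)) \<le> C1"
    proof -
      have "(\<Sum>k<n. c (v0 + real k * \<tau>\<^sup>2)) = S * (C * (R ^ 4 + 3) * (\<Sum>k<n. (v0 + real k * \<tau>\<^sup>2) powr (- (3/2)))
         + C * (\<Sum>k<n. (c3 / real n) * (v0 + real k * \<tau>\<^sup>2) powr (- 1)) + C * Bm powr (1 / p) * (\<Sum>k<n. (v0 + real k * \<tau>\<^sup>2) powr (- (1 + 1 / p))))"
        by (simp add: c_def sum_distrib_left sum.distrib algebra_simps)
      also have "\<dots> \<le> S * (C * (R ^ 4 + 3) * Z1 + C * c3 + C * Bm powr (1 / p) * Z2)"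
      proof (intro mult_left_mono add_mono Z1 Z2 v0)
        \<comment> \<open>No summability in v is available for this term; instead each of the n
          exchanges contributes at most c3/n, since v \<ge> 1.\<close>
        have "(\<Sum>k<n. (c3 / real n) * (v0 + real k * \<tau>\<^sup>2) powr (- 1)) \<le> (\<Sum>k<n. (c3 / real n) * 1)"
        proof (intro sum_mono mult_left_mono)
          fix k
          have "1 \<le> v0 + real k * \<tau>\<^sup>2" using v0 by (intro add_increasing2) auto
          then show "(v0 + real k * \<tau>\<^sup>2) powr (- 1) \<le> 1" by (simp add: powr_minus_divide)
        qed (use c3 in auto)
        also have "\<dots> = c3" using n by simp
        finally show "(\<Sum>k<n. (c3 / real n) * (v0 + real k * \<tau>\<^sup>2) powr (- 1)) \<le> c3" .
      qed (use C S R in auto)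
      finally show ?thesis by (simp add: C1_def)
    qed
    have sum1_pos: "(\<Sum>k<n. c (v0 + real k * \<tau>\<^sup>2)) > 0"
      using n tau2 c_pos by (intro sum_pos) (auto simp: lessThan_empty_iff intro!: c_pos)
    \<comment> \<open>Three stations: the sum of copies of \<xi> with noise v0, the sum of copies of
      \<eta> with noise v0 + n \<tau>^2, and pure noise that carries the whole variance.\<close>
    let ?q1 = "quantile (gsmooth (conv_pow (distr M borel \<xi>) n (return borel 0)) v0)"
    let ?q2 = "quantile (gsmooth (conv_pow (distr M borel \<eta>) n (return borel 0)) (v0 + real n * \<tau>\<^sup>2))"
    let ?\<theta> = "\<integral>\<omega>. (\<eta> \<omega>)\<^sup>2 \<partial>M"
    let ?q3 = "quantile (gsmooth (return borel 0) (v0 + real n * \<tau>\<^sup>2 + real n * ?\<theta>))"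
    have A: "(\<integral>\<^sup>+u. ennreal (\<bar>?q1 u - ?q2 u\<bar> powr p) \<partial>unit_measure) \<le> ennreal ((\<Sum>k<n. c (v0 + real k * \<tau>\<^sup>2)) powr p)"
      unfolding n' by (rule quantile_chain[OF p rd(1,2) _ v0(5) c_pos step1 rd0]) (use tau2 in auto)
    have \<theta>0: "?\<theta> \<ge> 0" by simp
    have v1: "v0 + real n * \<tau>\<^sup>2 > 0" using v0 by (intro add_pos_nonneg) auto
    \<comment> \<open>The passage to pure noise is a chain of the same kind with the constant 0 as
      the new summand. Its law is neutral for convolution, and no value of it is large, so the
      second term of the step bound drops out.\<close>
    have step2: "(\<integral>\<^sup>+u. ennreal (\<bar>quantile (gsmooth (convolution \<alpha> (distr M borel \<eta>)) v) u
        - quantile (gsmooth (convolution \<alpha> (distr M borel (\<lambda>_. 0))) (v + ?\<theta>)) u\<bar> powr p) \<partial>unit_measure) \<le> ennreal ((C2 / real n) powr p)"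
      if \<alpha>: "real_distribution \<alpha>" and v: "v \<ge> v0 + real n * \<tau>\<^sup>2" for \<alpha> v
    proof -
      have vn: "real n * \<tau>\<^sup>2 \<le> v" "v0 \<le> v" using v v0 by (auto intro: order_trans[OF _ v])
      then have vv: "6 * p \<le> v" "1 \<le> v" "v > 0" using v0 by auto
      have bdK: "\<bar>\<eta> \<omega>\<bar> \<le> K * sqrt v" for \<omega>
      proof -
        have "\<tau> * sqrt (real n) = sqrt (real n * \<tau>\<^sup>2)" using \<tau> by (simp add: real_sqrt_mult)
        also have "\<dots> \<le> sqrt v" using vn by simp
        finally have "2 * sqrt (real n) \<le> 2 / \<tau> * sqrt v" using \<tau> by (simp add: field_simps)
        also have "\<dots> \<le> K * sqrt v" using vv by (intro mult_right_mono) (auto simp: K_def)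
        finally show ?thesis using bd[of \<omega>] by linarith
      qed
      \<comment> \<open>Here p \<ge> 1 enters: the order p + 2 is at least 3.\<close>
      have m3: "(\<integral>\<omega>. \<bar>\<eta> \<omega>\<bar> ^ 3 \<partial>M) \<le> 1 + Bm"
      proof -
        have "(\<integral>\<omega>. \<bar>\<eta> \<omega>\<bar> ^ 3 \<partial>M) \<le> (\<integral>\<omega>. 1 + \<bar>\<eta> \<omega>\<bar> powr (p + 2) \<partial>M)"
        proof (intro integral_mono)
          show "integrable M (\<lambda>\<omega>. \<bar>\<eta> \<omega>\<bar> ^ 3)" using integrable_poly_bounded(2)[OF M _ bd] by simp
          fix \<omega>
          show "\<bar>\<eta> \<omega>\<bar> ^ 3 \<le> 1 + \<bar>\<eta> \<omega>\<bar> powr (p + 2)"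
          proof (cases "\<bar>\<eta> \<omega>\<bar> \<le> 1")
            case True
            then have "\<bar>\<eta> \<omega>\<bar> ^ 3 \<le> 1" by (intro power_le_one) auto
            then show ?thesis by (simp add: add_increasing2)
          next
            case False
            then have "\<bar>\<eta> \<omega>\<bar> ^ 3 = \<bar>\<eta> \<omega>\<bar> powr 3" by simp
            also have "\<dots> \<le> \<bar>\<eta> \<omega>\<bar> powr (p + 2)" using p False by (intro powr_mono) auto
            finally show ?thesis by simp
          qed
        qed (use imom in auto)
        also have "\<dots> \<le> 1 + Bm" using imom mom by (simp add: prob_space)
        finally show ?thesis .
      qed
      let ?\<kappa> = "C * (\<integral>\<omega>. \<bar>\<eta> \<omega>\<bar> ^ 3 \<partial>M) * v powr (- 1) + C * v powr (- 3 / 2)"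
      have "(\<integral>\<^sup>+u. ennreal (\<bar>quantile (gsmooth (convolution \<alpha> (distr M borel \<eta>)) v) u
        - quantile (gsmooth (convolution \<alpha> (distr M borel (\<lambda>_. 0))) (v + ?\<theta>)) u\<bar> powr p) \<partial>unit_measure)
        \<le> ennreal (step_const p * (?\<kappa> powr p + 0 powr p * measure M {\<omega>\<in>space M. \<bar>0::real\<bar> > sqrt v}))"
        unfolding step_const_def
      proof (rule quantile_step[OF \<alpha> M _ _ bdL(2), where \<eta>="\<lambda>_. 0"])
        show "\<bar>(\<integral>\<omega>. GPhi v (z - \<eta> \<omega>) \<partial>M) - (\<integral>\<omega>. GPhi (v + ?\<theta>) (z - 0) \<partial>M)\<bar>
          \<le> ?\<kappa> * psi p v z + 0 * (\<integral>\<omega>. indicator {\<omega>. \<bar>0::real\<bar> > sqrt v} \<omega> * psi p v (z - 0) \<partial>M)" for z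
          using gaussian_swap_cdf_bound[OF M _ bdK mean(2) refl var\<eta> vv(1), of z] by (simp add: prob_space)
        show "\<bar>0::real\<bar> \<le> L" using R by (simp add: L_def)
        show "0 \<le> ?\<kappa>" using C by (intro add_nonneg_nonneg mult_nonneg_nonneg) auto
      qed (use mean var\<eta> vv p \<theta>0 in auto)
      also have "\<dots> \<le> ennreal ((step_const p powr (1 / p) * (?\<kappa> + 0)) powr p)"
        using C by (intro ennreal_leI step_const_le p add_nonneg_nonneg mult_nonneg_nonneg) auto
      also have "\<dots> \<le> ennreal ((C2 / real n) powr p)"
      proof (intro ennreal_leI powr_mono2)
        have "?\<kappa> \<le> C * (1 + Bm) * v powr (- 1) + C * v powr (- 1)"
          using C m3 vv by (intro add_mono mult_left_mono mult_right_mono powr_mono) auto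
        also have "\<dots> = C * (Bm + 2) * (1 / v)" using vv by (simp add: powr_minus_divide algebra_simps)
        also have "\<dots> \<le> C * (Bm + 2) * (1 / (real n * \<tau>\<^sup>2))"
          using vn vv(3) C Bm tau2 n by (intro mult_left_mono divide_left_mono mult_pos_pos) auto
        finally have "S * (?\<kappa> + 0) \<le> S * (C * (Bm + 2) * (1 / (real n * \<tau>\<^sup>2)))" using S by (intro mult_left_mono) auto
        then show "step_const p powr (1 / p) * (?\<kappa> + 0) \<le> C2 / real n" by (simp add: C2_def S_def mult_ac)
      qed (use p C in \<open>auto intro!: add_nonneg_nonneg mult_nonneg_nonneg\<close>)
      finally show ?thesis .
    qed
    have B: "(\<integral>\<^sup>+u. ennreal (\<bar>?q2 u - ?q3 u\<bar> powr p) \<partial>unit_measure) \<le> ennreal (C2 powr p)"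
    proof -
      have "(\<integral>\<^sup>+u. ennreal (\<bar>?q2 u - quantile (gsmooth (conv_pow (distr M borel (\<lambda>_. 0)) n (return borel 0)) (v0 + real n * \<tau>\<^sup>2 + real n * ?\<theta>)) u\<bar> powr p) \<partial>unit_measure)
        \<le> ennreal ((\<Sum>k<n. C2 / real n) powr p)"
        using quantile_chain[OF p rd(2,3) \<theta>0 v1 _ step2 rd0 order.refl, of n'] C2 n unfolding n' by (simp del: distr_const)
      moreover have "(\<Sum>k<n. C2 / real n) = C2" using n by simp
      ultimately show ?thesis by (simp only: conv_pow_zero[OF M rd0])
    qed
    have m: "?q1 \<in> borel_measurable unit_measure" "?q2 \<in> borel_measurable unit_measure" "?q3 \<in> borel_measurable unit_measure"
      using rd rd0 v0 v1 \<theta>0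
      by (auto intro!: measurable_quantile real_distribution_gsmooth real_distribution_conv_pow add_pos_nonneg)
    have "(\<integral>\<^sup>+u. ennreal (\<bar>(?q1 u - ?q2 u) + (?q2 u - ?q3 u)\<bar> powr p) \<partial>unit_measure)
      \<le> ennreal (((\<Sum>k<n. c (v0 + real k * \<tau>\<^sup>2)) + C2) powr p)"
      using m by (intro nn_integral_powr_triangle[OF p _ _ sum1_pos C2 A B]) auto
    also have "\<dots> \<le> ennreal ((C1 + 1 + C2) powr p)"
      using sum1 sum1_pos C2 p by (intro ennreal_leI powr_mono2) auto
    also have "v0 + real n * \<tau>\<^sup>2 + real n * ?\<theta> = v0 + real n * (\<integral>\<omega>. (\<xi> \<omega>)\<^sup>2 \<partial>M)"
      unfolding var(2)[symmetric] by (simp add: algebra_simps)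
    finally show ?thesis by simp
  qed
  show ?thesis
    using C1 C2 main unfolding v0_def by (intro exI[of _ "C1 + 1 + C2"]) (auto simp: add_pos_pos)
qed

text \<open>For masses b/(a+b) at a and a/(a+b) at -b with a, b > 0 the mean is 0, the second moment
  is ab and the third is ab(a - b). So ab = V and a - b = \<kappa>/V are required, and
  \<open>a\<close> is the positive root of t^2 - (\<kappa>/V) t - V.\<close>

lemma two_point_moments:
  fixes V \<kappa> :: real
  assumes V: "V > 0"
  obtains w c d where "0 \<le> w" "w \<le> 1" "w * c + (1 - w) * d = 0" "w * c\<^sup>2 + (1 - w) * d\<^sup>2 = V"
    "w * c ^ 3 + (1 - w) * d ^ 3 = \<kappa>"
proof -
  define k where "k = \<kappa> / V"
  define S where "S = sqrt (k\<^sup>2 + 4 * V)"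
  define a where "a = (k + S) / 2"
  define b where "b = V / a"
  have S2: "S\<^sup>2 = k\<^sup>2 + 4 * V" using V by (simp add: S_def)
  have "\<bar>k\<bar> < S" unfolding S_def using V by (intro real_less_rsqrt) simp
  then have a: "a > 0" by (simp add: a_def)
  then have b: "b > 0" using V by (simp add: b_def)
  have ab: "a * b = V" using a by (simp add: b_def)
  have "a\<^sup>2 - k * a = V" using S2 by (simp add: a_def power2_eq_square algebra_simps)
  then have "a * (a - b) = a * k" using ab by (simp add: power2_eq_square algebra_simps)
  then have amb: "a - b = k" using a by simp
  define w where "w = b / (a + b)"
  have w1: "1 - w = a / (a + b)" using a b by (simp add: w_def field_simps)
  show ?thesis
  proof (rule that[of w a "- b"])
    show "0 \<le> w" "w \<le> 1" using a b by (auto simp: w_def)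
    show "w * a + (1 - w) * - b = 0" unfolding w1 by (simp add: w_def)
    have "w * a\<^sup>2 + (1 - w) * (- b)\<^sup>2 = (b * a\<^sup>2 + a * b\<^sup>2) / (a + b)"
      unfolding w1 by (simp add: w_def add_divide_distrib)
    also have "b * a\<^sup>2 + a * b\<^sup>2 = (a * b) * (a + b)" by (simp add: power2_eq_square algebra_simps)
    finally show "w * a\<^sup>2 + (1 - w) * (- b)\<^sup>2 = V" using a b ab by simp
    have "w * a ^ 3 + (1 - w) * (- b) ^ 3 = (b * a ^ 3 - a * b ^ 3) / (a + b)"
      unfolding w1 by (simp add: w_def diff_divide_distrib)
    also have "b * a ^ 3 - a * b ^ 3 = (a * b) * (a - b) * (a + b)" by (simp add: power3_eq_cube algebra_simps)
    finally show "w * a ^ 3 + (1 - w) * (- b) ^ 3 = \<kappa>" using a b ab amb V by (simp add: k_def)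
  qed
qed

text \<open>The difference of the two sides is the squared mass of [-R, R] times the conditional
  variance on it. By dominated convergence it tends to 1 as R grows, so some bounded interval
  carries variance that can be given away.\<close>

lemma (in real_distribution) truncated_variance_pos:
  assumes i1: "integrable M (\<lambda>x. x)" and m1: "(\<integral>x. x \<partial>M) = 0" and i2: "integrable M (\<lambda>x. x\<^sup>2)" and m2: "(\<integral>x. x\<^sup>2 \<partial>M) = 1"
  obtains R where "R \<ge> (1::real)" "measure M {- R..R} > 0"
    "measure M {- R..R} * (\<integral>x. indicator {- R..R} x * x\<^sup>2 \<partial>M) > (\<integral>x. indicator {- R..R} x * x \<partial>M)\<^sup>2"
proof -
  have ev: "eventually (\<lambda>k. indicator {- real k..real k} x = (1::real)) sequentially" for x :: real
    using eventually_ge_at_top[of "nat \<lceil>\<bar>x\<bar>\<rceil>"] by eventually_elim (auto simp: indicator_def ceiling_le_iff nat_le_iff abs_le_iff)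
  have lim: "(\<lambda>k. \<integral>x. indicator {- real k..real k} x * f x \<partial>M) \<longlonglongrightarrow> (\<integral>x. f x \<partial>M)"
    if f: "integrable M f" for f :: "real \<Rightarrow> real"
  proof (rule integral_dominated_convergence[where w="\<lambda>x. \<bar>f x\<bar>"])
    show "AE x in M. (\<lambda>k. indicator {- real k..real k} x * f x) \<longlonglongrightarrow> f x"
    proof (rule AE_I2)
      fix x
      show "(\<lambda>k. indicator {- real k..real k} x * f x) \<longlonglongrightarrow> f x"
        by (rule tendsto_eventually) (use ev[of x] in eventually_elim, simp)
    qed
  qed (use f in \<open>auto simp: indicator_def intro!: borel_measurable_times borel_measurable_indicator\<close>)
  have l0: "(\<lambda>k. measure M {- real k..real k}) \<longlonglongrightarrow> 1"
    using lim[of "\<lambda>_. 1"] prob_space by simp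
  have "(\<lambda>k. measure M {- real k..real k} * (\<integral>x. indicator {- real k..real k} x * x\<^sup>2 \<partial>M)
      - (\<integral>x. indicator {- real k..real k} x * x \<partial>M)\<^sup>2) \<longlonglongrightarrow> 1 * 1 - 0\<^sup>2"
    using lim[OF i1] lim[OF i2] l0 unfolding m1 m2 by (intro tendsto_intros)
  then have "eventually (\<lambda>k. measure M {- real k..real k} * (\<integral>x. indicator {- real k..real k} x * x\<^sup>2 \<partial>M)
      - (\<integral>x. indicator {- real k..real k} x * x \<partial>M)\<^sup>2 > 0) sequentially"
    by (rule order_tendstoD) simp
  moreover have "eventually (\<lambda>k. measure M {- real k..real k} > 0) sequentially"
    by (rule order_tendstoD[OF l0]) simp
  moreover have "eventually (\<lambda>k::nat. k \<ge> 1) sequentially" by (rule eventually_ge_at_top)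
  ultimately have "eventually (\<lambda>k. k \<ge> 1 \<and> measure M {- real k..real k} > 0 \<and>
    measure M {- real k..real k} * (\<integral>x. indicator {- real k..real k} x * x\<^sup>2 \<partial>M)
      - (\<integral>x. indicator {- real k..real k} x * x \<partial>M)\<^sup>2 > 0) sequentially"
    by eventually_elim auto
  then obtain k :: nat where "k \<ge> 1" "measure M {- real k..real k} > 0"
    "measure M {- real k..real k} * (\<integral>x. indicator {- real k..real k} x * x\<^sup>2 \<partial>M)
      - (\<integral>x. indicator {- real k..real k} x * x \<partial>M)\<^sup>2 > 0"
    by (auto dest!: eventually_happens)
  then show ?thesis by (intro that[of "real k"]) auto
qed

text \<open>Intended for summands that are rarely nonzero, with \<open>a\<close> and
  \<open>b\<close> of order 1/n. The convexity factor 2^(p-1) is lost only when the added summand is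
  nonzero, so a step multiplies the moment by 1 + 2^(p-1) a, and n steps by at most exp(2^(p-1) n
  a).\<close>

lemma moment_conv_pow_le:
  assumes \<mu>: "real_distribution \<mu>" and p: "p \<ge> 1"
    and \<pi>: "(\<integral>\<^sup>+x. indicator (- {0}) x \<partial>\<mu>) \<le> ennreal a" and a: "a \<ge> 0"
    and m: "(\<integral>\<^sup>+x. ennreal (\<bar>x\<bar> powr p) \<partial>\<mu>) \<le> ennreal b" and b: "b \<ge> 0"
  shows "(\<integral>\<^sup>+x. ennreal (\<bar>x\<bar> powr p) \<partial>conv_pow \<mu> n (return borel 0))
    \<le> ennreal (real n * (2 powr (p - 1) * b) * exp (2 powr (p - 1) * (real n * a)))"
proof -
  interpret real_distribution \<mu> by fact
  define c where "c = 2 powr (p - 1)"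
  have c: "c \<ge> 1" unfolding c_def using p by (intro ge_one_powr_ge_zero) auto
  have u1: "emeasure \<mu> UNIV = 1" using emeasure_space_1 by simp
  have rdn: "real_distribution (conv_pow \<mu> n (return borel 0))" for n
    by (intro real_distribution_conv_pow real_distribution_return \<mu>)
  have "(\<integral>\<^sup>+x. ennreal (\<bar>x\<bar> powr p) \<partial>conv_pow \<mu> n (return borel 0)) \<le> ennreal (real n * (c * b) * (1 + c * a) ^ n)"
  proof (induction n)
    case 0
    have "(\<integral>\<^sup>+x. ennreal (\<bar>x\<bar> powr p) \<partial>return borel (0::real)) = ennreal (\<bar>0\<bar> powr p)"
      by (intro nn_integral_return) auto
    then show ?case by simp
  next
    case (Suc n)
    interpret A: real_distribution "conv_pow \<mu> n (return borel 0)" by (rule rdn)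
    let ?A = "conv_pow \<mu> n (return borel 0)"
    let ?m = "\<integral>\<^sup>+x. ennreal (\<bar>x\<bar> powr p) \<partial>?A"
    \<comment> \<open>At y = 0 nothing is lost: the factor in front of |t|^p is 1 there. A plain
      convexity bound would grow geometrically in n.\<close>
    have pw: "ennreal (\<bar>t + y\<bar> powr p) \<le> ennreal (\<bar>t\<bar> powr p) + (ennreal c * ennreal (\<bar>t\<bar> powr p) * indicator (- {0}) y + ennreal c * ennreal (\<bar>y\<bar> powr p))" for t y
    proof (cases "y = 0")
      case False
      have "\<bar>t + y\<bar> powr p \<le> (\<bar>t\<bar> + \<bar>y\<bar>) powr p" using p by (intro powr_mono2) auto
      also have "\<dots> \<le> c * (\<bar>t\<bar> powr p + \<bar>y\<bar> powr p)" unfolding c_def using p by (intro powr_add_le) auto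
      also have "\<dots> \<le> \<bar>t\<bar> powr p + (c * \<bar>t\<bar> powr p + c * \<bar>y\<bar> powr p)" by (simp add: algebra_simps)
      finally show ?thesis using False c
        by (simp add: ennreal_mult[symmetric] ennreal_plus[symmetric] ennreal_leI del: ennreal_plus)
    qed simp
    have "(\<integral>\<^sup>+x. ennreal (\<bar>x\<bar> powr p) \<partial>conv_pow \<mu> (Suc n) (return borel 0)) = (\<integral>\<^sup>+t. \<integral>\<^sup>+y. ennreal (\<bar>t + y\<bar> powr p) \<partial>\<mu> \<partial>?A)"
      unfolding conv_pow_Suc by (intro nn_integral_convolution) (auto simp: A.finite_measure_axioms finite_measure_axioms)
    also have "\<dots> \<le> (\<integral>\<^sup>+t. \<integral>\<^sup>+y. ennreal (\<bar>t\<bar> powr p) + (ennreal c * ennreal (\<bar>t\<bar> powr p) * indicator (- {0}) y + ennreal c * ennreal (\<bar>y\<bar> powr p)) \<partial>\<mu> \<partial>?A)"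
      by (intro nn_integral_mono pw)
    also have "\<dots> = (\<integral>\<^sup>+t. ennreal (\<bar>t\<bar> powr p) + (ennreal c * ennreal (\<bar>t\<bar> powr p) * (\<integral>\<^sup>+y. indicator (- {0}) y \<partial>\<mu>) + ennreal c * (\<integral>\<^sup>+y. ennreal (\<bar>y\<bar> powr p) \<partial>\<mu>)) \<partial>?A)"
      by (intro nn_integral_cong) (subst nn_integral_add; simp add: nn_integral_add nn_integral_cmult u1)
    also have "\<dots> \<le> (\<integral>\<^sup>+t. ennreal (\<bar>t\<bar> powr p) + (ennreal c * ennreal (\<bar>t\<bar> powr p) * ennreal a + ennreal c * ennreal b) \<partial>?A)"
      by (intro nn_integral_mono add_mono mult_left_mono order.refl \<pi> m) auto
    also have "\<dots> = (\<integral>\<^sup>+t. ennreal (1 + c * a) * ennreal (\<bar>t\<bar> powr p) + ennreal (c * b) \<partial>?A)"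
      using a b c by (intro nn_integral_cong) (simp add: ennreal_mult[symmetric] ennreal_plus[symmetric] algebra_simps del: ennreal_plus)
    also have "\<dots> = ennreal (1 + c * a) * ?m + ennreal (c * b)"
      by (subst nn_integral_add) (auto simp: nn_integral_cmult A.emeasure_space_1[simplified])
    also have "\<dots> \<le> ennreal (1 + c * a) * ennreal (real n * (c * b) * (1 + c * a) ^ n) + ennreal (c * b)"
      by (intro add_mono mult_left_mono Suc.IH) auto
    also have "\<dots> = ennreal (real n * (c * b) * (1 + c * a) ^ Suc n + c * b)"
      using a b c by (simp add: ennreal_mult[symmetric] ennreal_plus[symmetric] mult_ac del: ennreal_plus)
    also have "\<dots> \<le> ennreal (real (Suc n) * (c * b) * (1 + c * a) ^ Suc n)"
    proof (rule ennreal_leI)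
      have "c * b * 1 \<le> c * b * (1 + c * a) ^ Suc n" using a b c by (intro mult_left_mono one_le_power) auto
      then show "real n * (c * b) * (1 + c * a) ^ Suc n + c * b \<le> real (Suc n) * (c * b) * (1 + c * a) ^ Suc n"
        by (simp add: algebra_simps)
    qed
    finally show ?case .
  qed
  also have "\<dots> \<le> ennreal (real n * (c * b) * exp (c * (real n * a)))"
  proof (intro ennreal_leI mult_left_mono)
    have "(1 + c * a) ^ n \<le> exp (c * a) ^ n" using a c by (intro power_mono exp_ge_add_one_self) auto
    then show "(1 + c * a) ^ n \<le> exp (c * (real n * a))" by (simp add: exp_of_nat_mult[symmetric] mult_ac)
  qed (use b c in auto)
  finally show ?thesis by (simp add: c_def)
qed

section \<open>Sums of independent variables and couplings on a given space\<close>

lemma (in prob_space) distr_sum_conv_pow: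
  fixes Y :: "nat \<Rightarrow> 'a \<Rightarrow> real"
  assumes ind: "indep_vars (\<lambda>_. borel) Y {1..n}" and [measurable]: "\<And>i. i \<in> {1..n} \<Longrightarrow> Y i \<in> borel_measurable M"
    and id: "\<And>i. i \<in> {1..n} \<Longrightarrow> distr M borel (Y i) = \<mu>"
  shows "distr M borel (\<lambda>\<omega>. \<Sum>i\<in>{1..n}. Y i \<omega>) = conv_pow \<mu> n (return borel 0)"
  using assms
proof (induction n)
  case 0
  then show ?case by simp
next
  case (Suc n)
  have m: "Y i \<in> borel_measurable M" if "i \<in> {1..Suc n}" for i using Suc.prems(2)[OF that] .
  have iv: "indep_var borel (Y (Suc n)) borel (\<lambda>\<omega>. \<Sum>i\<in>{1..n}. Y i \<omega>)"
    by (rule indep_vars_sum) (use Suc.prems in \<open>auto simp: atLeastAtMostSuc_conv\<close>)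
  have IH: "distr M borel (\<lambda>\<omega>. \<Sum>i\<in>{1..n}. Y i \<omega>) = conv_pow \<mu> n (return borel 0)"
    by (rule Suc.IH) (use Suc.prems in \<open>auto intro: indep_vars_subset\<close>)
  have mu: "distr M borel (Y (Suc n)) = \<mu>" using Suc.prems(3)[of "Suc n"] by simp
  have ms: "(\<lambda>\<omega>. \<Sum>i\<in>{1..n}. Y i \<omega>) \<in> borel_measurable M"
    by (intro borel_measurable_sum m) auto
  have rd: "real_distribution (distr M borel (Y (Suc n)))" "real_distribution (distr M borel (\<lambda>\<omega>. \<Sum>i\<in>{1..n}. Y i \<omega>))"
    using m[of "Suc n"] ms by auto
  have "distr M borel (\<lambda>\<omega>. \<Sum>i\<in>{1..Suc n}. Y i \<omega>) = distr M borel (\<lambda>\<omega>. Y (Suc n) \<omega> + (\<Sum>i\<in>{1..n}. Y i \<omega>))"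
    by (simp add: add.commute)
  also have "\<dots> = convolution (distr M borel (Y (Suc n))) (distr M borel (\<lambda>\<omega>. \<Sum>i\<in>{1..n}. Y i \<omega>))"
    using iv m ms by (intro sum_indep_random_variable) auto
  also have "\<dots> = convolution (distr M borel (\<lambda>\<omega>. \<Sum>i\<in>{1..n}. Y i \<omega>)) (distr M borel (Y (Suc n)))"
    using rd by (intro convolution_commutative) (auto simp: real_distribution_def prob_space.finite_measure)
  also have "\<dots> = conv_pow \<mu> (Suc n) (return borel 0)" unfolding IH mu conv_pow_Suc ..
  finally show ?case .
qed

text \<open>The quantile coupling realised on a given space with a prescribed first variable: as the
  distribution function of \<open>Y\<close> is continuous, \<open>cdf \<mu> (Y b)\<close> is uniform
  and can be fed into the quantile function of \<nu>. The sum itself, and not only its law, must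
  enter the coupling, because the remainder of the U-statistic is a function of the same
  sample.\<close>

lemma quantile_transform:
  fixes Y :: "'a \<Rightarrow> real"
  assumes B: "prob_space B" and [measurable]: "Y \<in> borel_measurable B" and Y: "distr B borel Y = \<mu>"
    and \<mu>: "real_distribution \<mu>" and cont: "\<And>x. isCont (cdf \<mu>) x" and \<nu>: "real_distribution \<nu>"
  obtains Z where "Z \<in> borel_measurable B" "distr B borel Z = \<nu>"
    "(\<integral>\<^sup>+b. ennreal (\<bar>Y b - Z b\<bar> powr p) \<partial>B)
      = (\<integral>\<^sup>+u. ennreal (\<bar>quantile \<mu> u - quantile \<nu> u\<bar> powr p) \<partial>unit_measure)"
proof -
  \<comment> \<open>The values 0 and 1 of a distribution function lie outside the domain on which
    \<open>quantile\<close> is meaningful; there 0 is assigned, which makes the map Borel on the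
    whole line.\<close>
  define q where "q u = (if u \<in> {0<..<1} then quantile \<nu> u else 0)" for u
  have eqs: "sets unit_measure = sets (restrict_space borel {0<..<1})"
    unfolding unit_measure_def by (intro sets_restrict_space_cong) auto
  have "quantile \<nu> \<in> borel_measurable (restrict_space borel {0<..<1})"
    using measurable_quantile[OF \<nu>] eqs measurable_cong_sets by blast
  then have q[measurable]: "q \<in> borel_measurable borel"
    unfolding q_def[abs_def] by (subst (asm) measurable_restrict_space_iff[where c=0]) auto
  have [measurable]: "cdf \<mu> \<in> borel_measurable borel" by (rule real_distribution_cdf_measurable[OF \<mu>])
  have qm[measurable]: "quantile \<mu> \<in> borel_measurable unit_measure" by (rule measurable_quantile[OF \<mu>])
  have qc: "q (cdf \<mu> (quantile \<mu> u)) = quantile \<nu> u" if "u \<in> space unit_measure" for u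
    using that cdf_quantile[OF \<mu> _ cont] by (simp add: q_def space_unit_measure)
  show ?thesis
  proof (rule that[of "\<lambda>b. q (cdf \<mu> (Y b))"])
    show "(\<lambda>b. q (cdf \<mu> (Y b))) \<in> borel_measurable B" by measurable
    have "distr B borel (\<lambda>b. q (cdf \<mu> (Y b))) = distr (distr B borel Y) borel (\<lambda>y. q (cdf \<mu> y))"
      by (simp add: distr_distr o_def)
    also have "\<dots> = distr (distr unit_measure borel (quantile \<mu>)) borel (\<lambda>y. q (cdf \<mu> y))"
      unfolding Y distr_quantile[OF \<mu>] ..
    also have "\<dots> = distr unit_measure borel (\<lambda>u. q (cdf \<mu> (quantile \<mu> u)))"
      by (simp add: distr_distr o_def)
    also have "\<dots> = distr unit_measure borel (quantile \<nu>)" by (intro distr_cong refl qc)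
    also have "\<dots> = \<nu>" by (rule distr_quantile[OF \<nu>])
    finally show "distr B borel (\<lambda>b. q (cdf \<mu> (Y b))) = \<nu>" .
    have "(\<integral>\<^sup>+b. ennreal (\<bar>Y b - q (cdf \<mu> (Y b))\<bar> powr p) \<partial>B) = (\<integral>\<^sup>+y. ennreal (\<bar>y - q (cdf \<mu> y)\<bar> powr p) \<partial>distr B borel Y)"
      by (simp add: nn_integral_distr)
    also have "\<dots> = (\<integral>\<^sup>+y. ennreal (\<bar>y - q (cdf \<mu> y)\<bar> powr p) \<partial>distr unit_measure borel (quantile \<mu>))"
      unfolding Y distr_quantile[OF \<mu>] ..
    also have "\<dots> = (\<integral>\<^sup>+u. ennreal (\<bar>quantile \<mu> u - quantile \<nu> u\<bar> powr p) \<partial>unit_measure)"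
      by (subst nn_integral_distr) (auto intro!: nn_integral_cong simp: qc)
    finally show "(\<integral>\<^sup>+b. ennreal (\<bar>Y b - q (cdf \<mu> (Y b))\<bar> powr p) \<partial>B)
      = (\<integral>\<^sup>+u. ennreal (\<bar>quantile \<mu> u - quantile \<nu> u\<bar> powr p) \<partial>unit_measure)" .
  qed
qed

text \<open>The exchange is built on the space of x and an independent coin. When |x| \<le> R0 the
  summand is replaced by a two-point variable with the conditional mean and third moment of \<nu> on
  that interval and half its conditional variance; otherwise it is kept. Since R0 does not depend on
  n the replaced values stay bounded, and lattice laws are covered as well.\<close>

lemma truncated_coupling:
  fixes \<nu> :: "real measure" and p :: real
  assumes p: "p \<ge> 1" and \<nu>: "real_distribution \<nu>"
    and mean: "(\<integral>x. x \<partial>\<nu>) = 0" and var: "(\<integral>x. x\<^sup>2 \<partial>\<nu>) = 1" and mom: "integrable \<nu> (\<lambda>x. \<bar>x\<bar> powr (p + 2))"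
  defines "T \<equiv> \<lambda>n x. if \<bar>x\<bar> \<le> sqrt (real n) then x else 0"
  defines "\<mu> \<equiv> \<lambda>n. \<integral>x. T n x \<partial>\<nu>"
  defines "\<theta> \<equiv> \<lambda>n. \<integral>x. (T n x - \<mu> n)\<^sup>2 \<partial>\<nu>"
  shows "\<exists>v0 C N. v0 > 0 \<and> C > 0 \<and> N \<ge> 1 \<and> (\<forall>n\<ge>N.
      real n * \<bar>\<mu> n\<bar> \<le> C \<and> sqrt (real n) * \<bar>1 - \<theta> n\<bar> \<le> C
      \<and> real n * measure \<nu> {x. \<bar>x\<bar> > sqrt (real n)} \<le> C
      \<and> (\<integral>\<^sup>+x. ennreal (\<bar>x - T n x\<bar> powr p) \<partial>\<nu>) \<le> ennreal (C / real n)
      \<and> (\<integral>\<^sup>+u. ennreal (\<bar>quantile (gsmooth (conv_pow (distr \<nu> borel (\<lambda>x. T n x - \<mu> n)) n (return borel 0)) v0) u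
          - quantile (gsmooth (return borel 0) (v0 + real n * \<theta> n)) u\<bar> powr p) \<partial>unit_measure) \<le> ennreal C)"
proof -
  interpret real_distribution \<nu> by fact
  have pU: "measure \<nu> UNIV = 1" using prob_space by simp
  define B where "B = (\<integral>x. \<bar>x\<bar> powr (p + 2) \<partial>\<nu>)"
  have B0: "B \<ge> 0" by (simp add: B_def)
  have le1: "\<bar>x\<bar> powr a \<le> 1 + \<bar>x\<bar> powr (p + 2)" if "0 \<le> a" "a \<le> p + 2" for a x :: real
  proof (cases "\<bar>x\<bar> \<le> 1")
    case True
    then have "\<bar>x\<bar> powr a \<le> 1 powr a" using that by (intro powr_mono2) auto
    then show ?thesis by (simp add: add_increasing2)
  next
    case False
    then have "\<bar>x\<bar> powr a \<le> \<bar>x\<bar> powr (p + 2)" using that by (intro powr_mono) auto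
    then show ?thesis by simp
  qed
  have ip: "integrable \<nu> (\<lambda>x. \<bar>x\<bar> powr a)" if "0 \<le> a" "a \<le> p + 2" for a
    by (rule Bochner_Integration.integrable_bound[of _ "\<lambda>x. 1 + \<bar>x\<bar> powr (p + 2)"]) (use mom le1[OF that] in auto)
  have i1: "integrable \<nu> (\<lambda>x. x)"
    by (rule Bochner_Integration.integrable_bound[OF ip[of 1]]) (use p in auto)
  have i2: "integrable \<nu> (\<lambda>x. x\<^sup>2)"
    by (rule Bochner_Integration.integrable_bound[OF ip[of 2]]) (use p in auto)
  obtain R0 where R0: "R0 \<ge> 1" "measure \<nu> {- R0..R0} > 0"
    "measure \<nu> {- R0..R0} * (\<integral>x. indicator {- R0..R0} x * x\<^sup>2 \<partial>\<nu>) > (\<integral>x. indicator {- R0..R0} x * x \<partial>\<nu>)\<^sup>2"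
    by (rule truncated_variance_pos[OF i1 mean i2 var])
  define q where "q = measure \<nu> {- R0..R0}"
  define a1 where "a1 = (\<integral>x. indicator {- R0..R0} x * x \<partial>\<nu>)"
  define a2 where "a2 = (\<integral>x. indicator {- R0..R0} x * x\<^sup>2 \<partial>\<nu>)"
  define a3 where "a3 = (\<integral>x. indicator {- R0..R0} x * x ^ 3 \<partial>\<nu>)"
  \<comment> \<open>q^2 times the conditional variance of \<nu> on [-R0, R0].\<close>
  define D where "D = q * a2 - a1\<^sup>2"
  have q: "0 < q" "q \<le> 1" using R0 by (auto simp: q_def)
  have D: "D > 0" using R0 by (simp add: D_def q_def a1_def a2_def)
  have a2: "0 \<le> a2" "a2 \<le> 1"
  proof -
    show "0 \<le> a2" unfolding a2_def by (intro integral_nonneg_AE AE_I2) auto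
    have "a2 \<le> (\<integral>x. x\<^sup>2 \<partial>\<nu>)" unfolding a2_def
      by (intro integral_mono Bochner_Integration.integrable_bound[OF i2] i2) (auto simp: indicator_def)
    then show "a2 \<le> 1" by (simp add: var)
  qed
  \<comment> \<open>The conditional mean; \<open>V\<close> is half the conditional variance D/q^2,
    the other half goes into the noise.\<close>
  define m1 where "m1 = a1 / q"
  define V where "V = D / (2 * q\<^sup>2)"
  have V: "V > 0" using D q by (simp add: V_def)
  \<comment> \<open>The third central moment is prescribed so that after the shift by
    \<open>m1\<close> the third raw moment becomes a3/q, the conditional one.\<close>
  obtain w y z where w: "0 \<le> w" "w \<le> 1" and w1: "w * y + (1 - w) * z = 0" and w2: "w * y\<^sup>2 + (1 - w) * z\<^sup>2 = V"
    and w3: "w * y ^ 3 + (1 - w) * z ^ 3 = a3 / q - m1 ^ 3 - 3 * m1 * V"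
    using two_point_moments[OF V, of "a3 / q - m1 ^ 3 - 3 * m1 * V"] by blast
  define Y where "Y b = m1 + (if b then y else z)" for b :: bool
  define EY where "EY f = w * f (Y True) + (1 - w) * f (Y False)" for f :: "real \<Rightarrow> real"
  have EY1: "EY (\<lambda>y. y) = m1" using w1 by (simp add: EY_def Y_def algebra_simps)
  have EY2: "EY (\<lambda>y. y\<^sup>2) = m1\<^sup>2 + V"
  proof -
    have "EY (\<lambda>y. y\<^sup>2) = m1\<^sup>2 + 2 * m1 * (w * y + (1 - w) * z) + (w * y\<^sup>2 + (1 - w) * z\<^sup>2)"
      by (simp add: EY_def Y_def power2_eq_square algebra_simps)
    then show ?thesis unfolding w1 w2 by simp
  qed
  have EY3: "EY (\<lambda>y. y ^ 3) = a3 / q"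
  proof -
    have "EY (\<lambda>y. y ^ 3) = m1 ^ 3 + 3 * m1\<^sup>2 * (w * y + (1 - w) * z) + 3 * m1 * (w * y\<^sup>2 + (1 - w) * z\<^sup>2) + (w * y ^ 3 + (1 - w) * z ^ 3)"
      by (simp add: EY_def Y_def power2_eq_square power3_eq_cube algebra_simps)
    then show ?thesis unfolding w1 w2 w3 by simp
  qed
  \<comment> \<open>\<tau>^2 is the variance given away per summand: an event of mass q loses D/(2
    q^2).\<close>
  define \<tau> where "\<tau> = sqrt (D / (2 * q))"
  have \<tau>2: "\<tau>\<^sup>2 = D / (2 * q)" using D q by (simp add: \<tau>_def)
  have \<tau>: "0 < \<tau>" "\<tau> \<le> 1"
  proof -
    show "0 < \<tau>" using D q by (simp add: \<tau>_def)
    have "D \<le> q * 1" unfolding D_def using mult_left_mono[of a2 1 q] q a2 zero_le_power2[of a1] by linarith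
    then have "D / (2 * q) \<le> 1" using q by (simp add: field_simps)
    then show "\<tau> \<le> 1" by (simp add: \<tau>_def)
  qed
  define y0 where "y0 = max \<bar>Y True\<bar> \<bar>Y False\<bar>"
  have y0: "\<bar>Y b\<bar> \<le> y0" for b by (cases b) (auto simp: y0_def)
  have y00: "y0 \<ge> 0" using y0[of True] by linarith
  \<comment> \<open>The extra 1 allows for centring by \<open>\<mu> n\<close>, which moves values by
    at most 1.\<close>
  define R where "R = max R0 y0 + 1"
  have R: "R \<ge> 2" "R \<ge> 0" using R0 by (auto simp: R_def)
  \<comment> \<open>Conditional third moments agree before centring. Centring by
    \<open>\<mu> n\<close> brings in second moments, which differ, and so leaves a mismatch 3 |\<mu>
    n| \<tau>^2 with |\<mu> n| \<le> B/n.\<close>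
  define c3 where "c3 = 3 * B"
  define Bm where "Bm = 2 powr (p + 1) * (B + y0 powr (p + 2) + 1)"
  have c3: "c3 \<ge> 0" "Bm \<ge> 0" using B0 by (auto simp: c3_def Bm_def)
  obtain C where C: "C > 0" and core: "\<And>(M :: (real \<times> bool) measure) \<xi> \<eta> n. prob_space M \<Longrightarrow> n \<ge> 1 \<Longrightarrow> \<xi> \<in> borel_measurable M \<Longrightarrow> \<eta> \<in> borel_measurable M
    \<Longrightarrow> (\<forall>\<omega>. \<bar>\<eta> \<omega>\<bar> \<le> 2 * sqrt (real n)) \<Longrightarrow> (\<integral>\<omega>. \<xi> \<omega> \<partial>M) = 0 \<Longrightarrow> (\<integral>\<omega>. \<eta> \<omega> \<partial>M) = 0
    \<Longrightarrow> (\<integral>\<omega>. (\<xi> \<omega>)\<^sup>2 \<partial>M) \<le> 1 \<Longrightarrow> (\<integral>\<omega>. (\<xi> \<omega>)\<^sup>2 \<partial>M) - (\<integral>\<omega>. (\<eta> \<omega>)\<^sup>2 \<partial>M) = \<tau>\<^sup>2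
    \<Longrightarrow> \<bar>(\<integral>\<omega>. (\<xi> \<omega>) ^ 3 \<partial>M) - (\<integral>\<omega>. (\<eta> \<omega>) ^ 3 \<partial>M)\<bar> \<le> c3 / real n
    \<Longrightarrow> (\<forall>\<omega>. \<xi> \<omega> \<noteq> \<eta> \<omega> \<longrightarrow> \<bar>\<xi> \<omega>\<bar> \<le> R \<and> \<bar>\<eta> \<omega>\<bar> \<le> R)
    \<Longrightarrow> (\<integral>\<omega>. \<bar>\<eta> \<omega>\<bar> powr (p + 2) \<partial>M) \<le> Bm
    \<Longrightarrow> (\<integral>\<^sup>+u. ennreal (\<bar>quantile (gsmooth (conv_pow (distr M borel \<xi>) n (return borel 0)) (6 * p + R\<^sup>2)) u
          - quantile (gsmooth (return borel 0) (6 * p + R\<^sup>2 + real n * (\<integral>\<omega>. (\<xi> \<omega>)\<^sup>2 \<partial>M))) u\<bar> powr p) \<partial>unit_measure)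
       \<le> ennreal (C powr p)"
    using quantile_bound_exchange[OF p \<tau> R(2) c3, where 'a="real \<times> bool"] by meson
  define \<Omega> where "\<Omega> = \<nu> \<Otimes>\<^sub>M measure_pmf (bernoulli_pmf w)"
  interpret pm: prob_space "measure_pmf (bernoulli_pmf w)" by (rule prob_space_measure_pmf)
  interpret PP: pair_prob_space \<nu> "measure_pmf (bernoulli_pmf w)" ..
  interpret \<Omega>: prob_space \<Omega> unfolding \<Omega>_def by (rule PP.prob_space_axioms)
  have [measurable]: "fst \<in> borel_measurable \<Omega>"
    using measurable_fst[of \<nu> "measure_pmf (bernoulli_pmf w)"] by (simp add: \<Omega>_def measurable_cong_sets[OF refl events_eq_borel])
  have [measurable]: "snd \<in> measurable \<Omega> (count_space UNIV)"
    unfolding \<Omega>_def by measurable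
  have fubini: "(\<integral>\<omega>. f (fst \<omega>) (snd \<omega>) \<partial>\<Omega>) = (\<integral>x. w * f x True + (1 - w) * f x False \<partial>\<nu>)"
    if "case_prod f \<in> borel_measurable \<Omega>" "\<And>x b. \<bar>f x b\<bar> \<le> L" for f :: "real \<Rightarrow> bool \<Rightarrow> real" and L
    using integrable_bounded_product(1)[OF \<nu> prob_space_measure_pmf[of "bernoulli_pmf w"], where f=f and B=L] that w unfolding \<Omega>_def
    by (simp add: integral_bernoulli_pmf mult.commute)
  \<comment> \<open>n \<ge> R^2 puts [-R0, R0] and both replacement points below the truncation
    level sqrt n.\<close>
  define N where "N = nat \<lceil>R\<^sup>2\<rceil> + 1"
  define v0 where "v0 = 6 * p + R\<^sup>2"
  define K where "K = C powr p + 2 * B + B\<^sup>2 + 1"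
  have K: "K > 0" "B \<le> K" "B + B\<^sup>2 \<le> K" "C powr p \<le> K" using B0 by (auto simp: K_def add_nonneg_pos)
  have main: "real n * \<bar>\<mu> n\<bar> \<le> K \<and> sqrt (real n) * \<bar>1 - \<theta> n\<bar> \<le> K
      \<and> real n * measure \<nu> {x. \<bar>x\<bar> > sqrt (real n)} \<le> K
      \<and> (\<integral>\<^sup>+x. ennreal (\<bar>x - T n x\<bar> powr p) \<partial>\<nu>) \<le> ennreal (K / real n)
      \<and> (\<integral>\<^sup>+u. ennreal (\<bar>quantile (gsmooth (conv_pow (distr \<nu> borel (\<lambda>x. T n x - \<mu> n)) n (return borel 0)) v0) u
          - quantile (gsmooth (return borel 0) (v0 + real n * \<theta> n)) u\<bar> powr p) \<partial>unit_measure) \<le> ennreal K"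
    if n: "n \<ge> N" for n
  proof -
    have "R\<^sup>2 \<le> real n" using n unfolding N_def by linarith
    then have sR: "R \<le> sqrt (real n)" by (rule real_le_rsqrt)
    define s where "s = sqrt (real n)"
    have s: "R \<le> s" "s \<ge> 2" "s\<^sup>2 = real n" "real n > 0" "n \<ge> 1" using sR R n by (auto simp: s_def N_def)
    have Tm[measurable]: "T n \<in> borel_measurable borel" unfolding T_def by measurable
    have Tle: "\<bar>T n x\<bar> \<le> s" "\<bar>T n x\<bar> \<le> \<bar>x\<bar>" for x using s by (auto simp: T_def s_def)
    \<comment> \<open>|x|^a is |x|^(p+2) divided by |x|^(p+2-a), and |x| > s wherever x is cut off.
      Used with a = 1 for the bias, a = 2 for the variance and a = p for the moment of the
      tail.\<close>
    have tail: "\<bar>x - T n x\<bar> powr a \<le> \<bar>x\<bar> powr (p + 2) * s powr (- (p + 2 - a))" if "0 < a" "a \<le> p + 2" for x a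
    proof (cases "\<bar>x\<bar> \<le> s")
      case False
      then have "s powr (p + 2 - a) \<le> \<bar>x\<bar> powr (p + 2 - a)" using s that by (intro powr_mono2) auto
      then have "\<bar>x\<bar> powr a * s powr (p + 2 - a) \<le> \<bar>x\<bar> powr a * \<bar>x\<bar> powr (p + 2 - a)" by (intro mult_left_mono) auto
      also have "\<dots> = \<bar>x\<bar> powr (p + 2)" by (simp add: powr_add[symmetric])
      finally have h: "\<bar>x\<bar> powr a * s powr (p + 2 - a) \<le> \<bar>x\<bar> powr (p + 2)" .
      have e: "s powr (- (p + 2 - a)) = 1 / s powr (p + 2 - a)" by (rule powr_minus_divide)
      have "T n x = 0" using False by (simp add: T_def s_def)
      moreover have "s powr (p + 2 - a) > 0" using s by simp
      ultimately show ?thesis unfolding e using h by (simp add: pos_le_divide_eq)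
    qed (use that in \<open>simp add: T_def s_def\<close>)
    have itail: "(\<integral>x. \<bar>x - T n x\<bar> powr a \<partial>\<nu>) \<le> B * s powr (- (p + 2 - a))" if "0 < a" "a \<le> p + 2" for a
    proof -
      have "(\<integral>x. \<bar>x - T n x\<bar> powr a \<partial>\<nu>) \<le> (\<integral>x. \<bar>x\<bar> powr (p + 2) * s powr (- (p + 2 - a)) \<partial>\<nu>)"
        using tail[OF that] mom by (intro integral_mono' ) auto
      then show ?thesis by (simp add: B_def)
    qed
    have sp: "s powr (- 2) = 1 / real n" "s powr (- 3) \<le> 1 / real n" "s powr (- (p + 1)) \<le> 1 / real n" "s powr (- p) \<le> 1 / s" "s powr (- (p + 2)) \<le> 1 / real n"
    proof -
      show e: "s powr (- 2) = 1 / real n" using s by (simp add: powr_minus_divide)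
      show "s powr (- 3) \<le> 1 / real n" "s powr (- (p + 1)) \<le> 1 / real n" "s powr (- (p + 2)) \<le> 1 / real n"
        unfolding e[symmetric] using s p by (auto intro!: powr_mono)
      have "s powr (- p) \<le> s powr (- 1)" using s p by (intro powr_mono) auto
      then show "s powr (- p) \<le> 1 / s" using s by (simp add: powr_minus_divide)
    qed
    have iT: "integrable \<nu> (T n)" using Tle by (intro integrable_const_bound[where B=s]) auto
    have iT2: "integrable \<nu> (\<lambda>x. (T n x)\<^sup>2)"
      using power_mono[OF Tle(1), where n=2] by (intro integrable_const_bound[where B="s\<^sup>2"]) auto
    have \<mu>_le: "\<bar>\<mu> n\<bar> \<le> B / real n"
    proof -
      have "\<mu> n = - (\<integral>x. x - T n x \<partial>\<nu>)" using i1 iT mean by (simp add: \<mu>_def)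
      then have "\<bar>\<mu> n\<bar> \<le> (\<integral>x. \<bar>x - T n x\<bar> \<partial>\<nu>)" using integral_abs_bound[of \<nu> "\<lambda>x. x - T n x"] by simp
      also have "\<dots> \<le> B * s powr (- (p + 1))"
      proof -
        have e: "p + 2 - 1 = p + 1" by simp
        show ?thesis using itail[of 1, unfolded e] p by simp
      qed
      also have "\<dots> \<le> B * (1 / real n)" using sp B0 by (intro mult_left_mono) auto
      finally show ?thesis by simp
    qed
    have T2le: "(\<integral>x. (T n x)\<^sup>2 \<partial>\<nu>) \<le> 1"
      unfolding var[symmetric] using iT2 i2 power_mono[OF Tle(2), where n=2] by (intro integral_mono) auto
    \<comment> \<open>The bound B/n may still exceed 1, so this one comes from the second moment
      through |t| \<le> (1 + t^2)/2.\<close>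
    have \<mu>1: "\<bar>\<mu> n\<bar> \<le> 1"
    proof -
      have "\<bar>\<mu> n\<bar> \<le> (\<integral>x. \<bar>T n x\<bar> \<partial>\<nu>)" unfolding \<mu>_def by (rule integral_abs_bound)
      also have "\<dots> \<le> (\<integral>x. (1 + (T n x)\<^sup>2) / 2 \<partial>\<nu>)"
      proof (rule integral_mono)
        show "\<bar>T n x\<bar> \<le> (1 + (T n x)\<^sup>2) / 2" for x
          using zero_le_power2[of "\<bar>T n x\<bar> - 1"] by (simp add: power2_eq_square algebra_simps abs_mult_self_eq)
      qed (use iT iT2 in auto)
      also have "\<dots> \<le> 1" using iT2 T2le by (simp add: pU)
      finally show ?thesis .
    qed
    have \<theta>_eq: "\<theta> n = (\<integral>x. (T n x)\<^sup>2 \<partial>\<nu>) - (\<mu> n)\<^sup>2"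
    proof -
      have "\<theta> n = (\<integral>x. (T n x)\<^sup>2 - 2 * \<mu> n * T n x + (\<mu> n)\<^sup>2 \<partial>\<nu>)"
        unfolding \<theta>_def by (simp add: power2_diff algebra_simps)
      also have "\<dots> = (\<integral>x. (T n x)\<^sup>2 \<partial>\<nu>) - 2 * \<mu> n * \<mu> n + (\<mu> n)\<^sup>2"
        using iT iT2 by (simp add: \<mu>_def pU)
      finally show ?thesis by (simp add: power2_eq_square)
    qed
    have \<theta>_le: "\<theta> n \<le> 1" using T2le zero_le_power2[of "\<mu> n"] unfolding \<theta>_eq by linarith
    \<comment> \<open>Variance is lost to the cut-off tail, at most B s^(-p) \<le> B/s, and to the
      squared bias, at most B^2/s.\<close>
    have \<theta>_diff: "sqrt (real n) * \<bar>1 - \<theta> n\<bar> \<le> B + B\<^sup>2"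
    proof -
      have "1 - (\<integral>x. (T n x)\<^sup>2 \<partial>\<nu>) = (\<integral>x. x\<^sup>2 - (T n x)\<^sup>2 \<partial>\<nu>)" using iT2 i2 var by simp
      also have "\<dots> = (\<integral>x. \<bar>x - T n x\<bar> powr 2 \<partial>\<nu>)"
        by (intro Bochner_Integration.integral_cong) (auto simp: T_def)
      also have "\<dots> \<le> B * s powr (- p)" using itail[of 2] p by simp
      also have "\<dots> \<le> B * (1 / s)" using sp B0 by (intro mult_left_mono) auto
      finally have 1: "1 - (\<integral>x. (T n x)\<^sup>2 \<partial>\<nu>) \<le> B / s" by simp
      have "(\<mu> n)\<^sup>2 \<le> (B / real n)\<^sup>2" using \<mu>_le B0 s by (intro power2_le_iff_abs_le[THEN iffD2]) auto
      also have "\<dots> = B\<^sup>2 / (real n * real n)" by (simp add: power2_eq_square)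
      also have "\<dots> \<le> B\<^sup>2 / (s * 1)"
      proof (intro divide_left_mono mult_mono)
        have "s * 1 \<le> s * s" using s by (intro mult_left_mono) auto
        then show "s \<le> real n" using s(3) by (simp add: power2_eq_square)
      qed (use s in auto)
      finally have 2: "(\<mu> n)\<^sup>2 \<le> B\<^sup>2 / s" by simp
      have "\<bar>1 - \<theta> n\<bar> \<le> B / s + B\<^sup>2 / s" using 1 2 \<theta>_le by (simp add: \<theta>_eq)
      then have "s * \<bar>1 - \<theta> n\<bar> \<le> s * (B / s + B\<^sup>2 / s)" using s by (intro mult_left_mono) auto
      also have "\<dots> = B + B\<^sup>2" using s by (simp add: distrib_left)
      finally show ?thesis by (simp add: s_def)
    qed
    have tp: "real n * measure \<nu> {x. \<bar>x\<bar> > sqrt (real n)} \<le> B"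
    proof -
      have "measure \<nu> {x. \<bar>x\<bar> > s} = (\<integral>x. indicator {x. \<bar>x\<bar> > s} x \<partial>\<nu>)" by simp
      also have "\<dots> \<le> (\<integral>x. \<bar>x\<bar> powr (p + 2) * s powr (- (p + 2)) \<partial>\<nu>)"
      proof (rule integral_mono')
        fix x
        show "indicator {x. \<bar>x\<bar> > s} x \<le> \<bar>x\<bar> powr (p + 2) * s powr (- (p + 2))"
        proof (cases "\<bar>x\<bar> > s")
          case True
          then have "s powr (p + 2) \<le> \<bar>x\<bar> powr (p + 2)" using s p by (intro powr_mono2) auto
          moreover have e: "s powr (- (p + 2)) = 1 / s powr (p + 2)" by (rule powr_minus_divide)
          moreover have "s powr (p + 2) > 0" using s by simp
          ultimately show ?thesis unfolding e using True by simp
        qed simp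
      qed (use mom in auto)
      also have "\<dots> = B * s powr (- (p + 2))" by (simp add: B_def)
      also have "\<dots> \<le> B * (1 / real n)" using sp B0 by (intro mult_left_mono) auto
      finally show ?thesis using s by (simp add: s_def field_simps)
    qed
    have tm: "(\<integral>\<^sup>+x. ennreal (\<bar>x - T n x\<bar> powr p) \<partial>\<nu>) \<le> ennreal (K / real n)"
    proof -
      have "integrable \<nu> (\<lambda>x. \<bar>x - T n x\<bar> powr p)"
        by (rule Bochner_Integration.integrable_bound[OF ip[of p]]) (use p in \<open>auto simp: T_def\<close>)
      then have "(\<integral>\<^sup>+x. ennreal (\<bar>x - T n x\<bar> powr p) \<partial>\<nu>) = ennreal (\<integral>x. \<bar>x - T n x\<bar> powr p \<partial>\<nu>)"
        by (intro nn_integral_eq_integral) auto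
      also have "\<dots> \<le> ennreal (B * (1 / real n))" using itail[of p] p sp by (intro ennreal_leI) auto
      also have "\<dots> \<le> ennreal (K / real n)" using K s by (intro ennreal_leI) (simp add: divide_right_mono)
      finally show ?thesis .
    qed
    define \<xi> where "\<xi> = (\<lambda>\<omega>::real \<times> bool. T n (fst \<omega>) - \<mu> n)"
    define \<eta> where "\<eta> = (\<lambda>\<omega>::real \<times> bool. (if \<bar>fst \<omega>\<bar> \<le> R0 then Y (snd \<omega>) else T n (fst \<omega>)) - \<mu> n)"
    have \<xi>m[measurable]: "\<xi> \<in> borel_measurable \<Omega>" unfolding \<xi>_def by measurable
    have [measurable]: "(\<lambda>\<omega>. Y (snd \<omega>)) \<in> borel_measurable \<Omega>"
      by (rule measurable_compose[OF \<open>snd \<in> measurable \<Omega> (count_space UNIV)\<close>]) simp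
    have \<eta>m[measurable]: "\<eta> \<in> borel_measurable \<Omega>" unfolding \<eta>_def by measurable
    have R0s: "R0 \<le> s" "y0 \<le> s" using s by (auto simp: R_def)
    have \<xi>bd: "\<bar>\<xi> \<omega>\<bar> \<le> 2 * s" for \<omega> using Tle(1)[of "fst \<omega>"] \<mu>1 s unfolding \<xi>_def by linarith
    have \<eta>bd: "\<bar>\<eta> \<omega>\<bar> \<le> 2 * s" for \<omega>
      using Tle(1)[of "fst \<omega>"] y0[of "snd \<omega>"] \<mu>1 s R0s unfolding \<eta>_def by (auto simp: abs_le_iff)
    have neq: "\<bar>\<xi> \<omega>\<bar> \<le> R \<and> \<bar>\<eta> \<omega>\<bar> \<le> R" if "\<xi> \<omega> \<noteq> \<eta> \<omega>" for \<omega>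
    proof -
      have "\<bar>fst \<omega>\<bar> \<le> R0" using that by (auto simp: \<xi>_def \<eta>_def split: if_splits)
      moreover have "R0 + 1 \<le> R" "y0 + 1 \<le> R" by (auto simp: R_def)
      moreover have "\<eta> \<omega> = Y (snd \<omega>) - \<mu> n" using \<open>\<bar>fst \<omega>\<bar> \<le> R0\<close> by (simp add: \<eta>_def)
      moreover have "\<xi> \<omega> = T n (fst \<omega>) - \<mu> n" by (simp add: \<xi>_def)
      ultimately show ?thesis using y0[of "snd \<omega>"] \<mu>1 Tle(2)[of "fst \<omega>"] by linarith
    qed
    have pw: "\<bar>x ^ k\<bar> \<le> (2 * s) ^ k" if "\<bar>x\<bar> \<le> 2 * s" for x k
      unfolding power_abs using that by (intro power_mono) auto
    have \<xi>int: "(\<integral>\<omega>. g (\<xi> \<omega>) \<partial>\<Omega>) = (\<integral>x. g (T n x - \<mu> n) \<partial>\<nu>)"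
      if [measurable]: "g \<in> borel_measurable borel" and "\<And>x. \<bar>x\<bar> \<le> 2 * s \<Longrightarrow> \<bar>g x\<bar> \<le> L" for g :: "real \<Rightarrow> real" and L
    proof -
      have "(\<integral>\<omega>. g (\<xi> \<omega>) \<partial>\<Omega>) = (\<integral>x. w * g (T n x - \<mu> n) + (1 - w) * g (T n x - \<mu> n) \<partial>\<nu>)"
        unfolding \<xi>_def
        by (rule fubini[of "\<lambda>x _. g (T n x - \<mu> n)" L]) (use \<xi>bd in \<open>auto simp: \<xi>_def case_prod_beta intro!: that\<close>)
      then show ?thesis by (simp add: algebra_simps)
    qed
    have ia: "integrable \<nu> (\<lambda>x. indicator {- R0..R0} x * x ^ k)" for k
    proof (rule integrable_const_bound[where B="R0 ^ k"])
      show "AE x in \<nu>. norm (indicator {- R0..R0} x * x ^ k) \<le> R0 ^ k"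
        using R0 by (auto simp: indicator_def power_abs intro!: AE_I2 power_mono)
    qed simp
    have ia': "integrable \<nu> (\<lambda>x. indicator {- R0..R0} x :: real)" "integrable \<nu> (\<lambda>x. indicator {- R0..R0} x * x)"
      "integrable \<nu> (\<lambda>x. indicator {- R0..R0} x * x\<^sup>2)" "integrable \<nu> (\<lambda>x. indicator {- R0..R0} x * x ^ 3)"
      using ia[of 0] ia[of 1] ia[of 2] ia[of 3] by auto
    \<comment> \<open>\<xi> and \<eta> agree unless |x| \<le> R0, and truncation does not act there,
      so every difference of moments reduces to moments of \<nu> on this interval and of
      \<open>Y\<close>.\<close>
    have \<xi>\<eta>int: "(\<integral>\<omega>. g (\<xi> \<omega>) \<partial>\<Omega>) - (\<integral>\<omega>. g (\<eta> \<omega>) \<partial>\<Omega>) = (\<integral>x. indicator {- R0..R0} x * g (x - \<mu> n) \<partial>\<nu>) - q * EY (\<lambda>y. g (y - \<mu> n))"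
      if gm[measurable]: "g \<in> borel_measurable borel" and gb: "\<And>x. \<bar>x\<bar> \<le> 2 * s \<Longrightarrow> \<bar>g x\<bar> \<le> L" for g :: "real \<Rightarrow> real" and L
    proof -
      have i\<xi>: "integrable \<Omega> (\<lambda>\<omega>. g (\<xi> \<omega>))" "integrable \<Omega> (\<lambda>\<omega>. g (\<eta> \<omega>))"
        using \<xi>bd \<eta>bd gb by (auto intro!: \<Omega>.integrable_const_bound[where B=L])
      have ig: "integrable \<nu> (\<lambda>x. indicator {- R0..R0} x * g (x - \<mu> n))"
      proof (rule integrable_const_bound[where B=L])
        have "L \<ge> 0" using gb[of 0] s by auto
        then show "AE x in \<nu>. norm (indicator {- R0..R0} x * g (x - \<mu> n)) \<le> L"
          using gb \<mu>1 R0s s by (auto simp: indicator_def abs_le_iff intro!: AE_I2)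
      qed simp
      have "(\<integral>\<omega>. g (\<xi> \<omega>) \<partial>\<Omega>) - (\<integral>\<omega>. g (\<eta> \<omega>) \<partial>\<Omega>) = (\<integral>\<omega>. (\<lambda>x b. g (\<xi> (x, b)) - g (\<eta> (x, b))) (fst \<omega>) (snd \<omega>) \<partial>\<Omega>)"
        using i\<xi> by simp
      also have "\<dots> = (\<integral>x. w * (g (\<xi> (x, True)) - g (\<eta> (x, True))) + (1 - w) * (g (\<xi> (x, False)) - g (\<eta> (x, False))) \<partial>\<nu>)"
      proof (rule fubini[of "\<lambda>x b. g (\<xi> (x, b)) - g (\<eta> (x, b))" "2 * L"])
        fix x b
        show "\<bar>g (\<xi> (x, b)) - g (\<eta> (x, b))\<bar> \<le> 2 * L" using gb[OF \<xi>bd, of "(x, b)"] gb[OF \<eta>bd, of "(x, b)"] by linarith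
      qed (simp add: case_prod_beta', measurable)
      also have "\<dots> = (\<integral>x. indicator {- R0..R0} x * g (x - \<mu> n) - EY (\<lambda>y. g (y - \<mu> n)) * indicator {- R0..R0} x \<partial>\<nu>)"
      proof (intro Bochner_Integration.integral_cong refl)
        fix x
        show "w * (g (\<xi> (x, True)) - g (\<eta> (x, True))) + (1 - w) * (g (\<xi> (x, False)) - g (\<eta> (x, False)))
          = indicator {- R0..R0} x * g (x - \<mu> n) - EY (\<lambda>y. g (y - \<mu> n)) * indicator {- R0..R0} x"
        proof (cases "\<bar>x\<bar> \<le> R0")
          case True
          then have "T n x = x" "x \<in> {- R0..R0}" using R0s by (auto simp: T_def s_def)
          then show ?thesis using True by (simp add: \<xi>_def \<eta>_def EY_def algebra_simps)
        next
          case False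
          then have "x \<notin> {- R0..R0}" by auto
          then show ?thesis using False by (simp add: \<xi>_def \<eta>_def)
        qed
      qed
      also have "\<dots> = (\<integral>x. indicator {- R0..R0} x * g (x - \<mu> n) \<partial>\<nu>) - q * EY (\<lambda>y. g (y - \<mu> n))"
        using ig ia' by (simp add: q_def)
      finally show ?thesis .
    qed
    have e\<xi>: "(\<integral>\<omega>. \<xi> \<omega> \<partial>\<Omega>) = 0"
      using \<xi>int[of "\<lambda>x. x" "2 * s"] iT by (simp add: \<mu>_def pU)
    have d1: "(\<integral>\<omega>. \<xi> \<omega> \<partial>\<Omega>) - (\<integral>\<omega>. \<eta> \<omega> \<partial>\<Omega>) = 0"
    proof -
      have "(\<integral>x. indicator {- R0..R0} x * (x - \<mu> n) \<partial>\<nu>) = a1 - \<mu> n * q"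
        using ia' by (simp add: right_diff_distrib a1_def q_def)
      moreover have "EY (\<lambda>y. y - \<mu> n) = m1 - \<mu> n" unfolding EY1[symmetric] by (simp add: EY_def algebra_simps)
      moreover have "(\<integral>\<omega>. \<xi> \<omega> \<partial>\<Omega>) - (\<integral>\<omega>. \<eta> \<omega> \<partial>\<Omega>) = (\<integral>x. indicator {- R0..R0} x * (x - \<mu> n) \<partial>\<nu>) - q * EY (\<lambda>y. y - \<mu> n)"
        by (rule \<xi>\<eta>int[of "\<lambda>x. x" "2 * s"]) auto
      moreover have "q * m1 = a1" using q by (simp add: m1_def)
      ultimately show ?thesis by (simp add: right_diff_distrib)
    qed
    have d2: "(\<integral>\<omega>. (\<xi> \<omega>)\<^sup>2 \<partial>\<Omega>) - (\<integral>\<omega>. (\<eta> \<omega>)\<^sup>2 \<partial>\<Omega>) = \<tau>\<^sup>2"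
    proof -
      have "(\<integral>x. indicator {- R0..R0} x * (x - \<mu> n)\<^sup>2 \<partial>\<nu>)
        = (\<integral>x. indicator {- R0..R0} x * x\<^sup>2 - 2 * \<mu> n * (indicator {- R0..R0} x * x) + (\<mu> n)\<^sup>2 * indicator {- R0..R0} x \<partial>\<nu>)"
        by (simp add: power2_diff algebra_simps)
      also have "\<dots> = a2 - 2 * \<mu> n * a1 + (\<mu> n)\<^sup>2 * q"
        using ia' by (simp add: a1_def a2_def q_def)
      finally have 1: "(\<integral>x. indicator {- R0..R0} x * (x - \<mu> n)\<^sup>2 \<partial>\<nu>) = a2 - 2 * \<mu> n * a1 + (\<mu> n)\<^sup>2 * q" .
      have "EY (\<lambda>y. (y - \<mu> n)\<^sup>2) = EY (\<lambda>y. y\<^sup>2) - 2 * \<mu> n * EY (\<lambda>y. y) + (\<mu> n)\<^sup>2"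
        by (simp add: EY_def power2_eq_square algebra_simps)
      then have 2: "EY (\<lambda>y. (y - \<mu> n)\<^sup>2) = m1\<^sup>2 + V - 2 * \<mu> n * m1 + (\<mu> n)\<^sup>2" unfolding EY1 EY2 .
      have "(\<integral>\<omega>. (\<xi> \<omega>)\<^sup>2 \<partial>\<Omega>) - (\<integral>\<omega>. (\<eta> \<omega>)\<^sup>2 \<partial>\<Omega>) = a2 - 2 * \<mu> n * a1 + (\<mu> n)\<^sup>2 * q - q * (m1\<^sup>2 + V - 2 * \<mu> n * m1 + (\<mu> n)\<^sup>2)"
        unfolding 1[symmetric] 2[symmetric]
        by (rule \<xi>\<eta>int[OF _ pw]) measurable
      also have "\<dots> = a2 - q * m1\<^sup>2 - q * V" using q by (simp add: m1_def algebra_simps)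
      also have "q * m1\<^sup>2 = a1\<^sup>2 / q" using q by (simp add: m1_def power2_eq_square)
      also have "q * V = D / (2 * q)" using q by (simp add: V_def power2_eq_square)
      also have "a2 - a1\<^sup>2 / q = D / q" using q by (simp add: D_def diff_divide_distrib)
      also have "D / q - D / (2 * q) = \<tau>\<^sup>2" unfolding \<tau>2 using q by (simp add: field_simps)
      finally show ?thesis .
    qed
    have d3: "(\<integral>\<omega>. (\<xi> \<omega>) ^ 3 \<partial>\<Omega>) - (\<integral>\<omega>. (\<eta> \<omega>) ^ 3 \<partial>\<Omega>) = - 3 * \<mu> n * \<tau>\<^sup>2"
    proof -
      have "(\<integral>x. indicator {- R0..R0} x * (x - \<mu> n) ^ 3 \<partial>\<nu>)
        = (\<integral>x. indicator {- R0..R0} x * x ^ 3 - 3 * \<mu> n * (indicator {- R0..R0} x * x\<^sup>2) + 3 * (\<mu> n)\<^sup>2 * (indicator {- R0..R0} x * x) - (\<mu> n) ^ 3 * indicator {- R0..R0} x \<partial>\<nu>)"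
        by (simp add: power3_eq_cube power2_eq_square algebra_simps)
      also have "\<dots> = a3 - 3 * \<mu> n * a2 + 3 * (\<mu> n)\<^sup>2 * a1 - (\<mu> n) ^ 3 * q"
        using ia' by (simp add: a1_def a2_def a3_def q_def)
      finally have 1: "(\<integral>x. indicator {- R0..R0} x * (x - \<mu> n) ^ 3 \<partial>\<nu>) = a3 - 3 * \<mu> n * a2 + 3 * (\<mu> n)\<^sup>2 * a1 - (\<mu> n) ^ 3 * q" .
      have "EY (\<lambda>y. (y - \<mu> n) ^ 3) = EY (\<lambda>y. y ^ 3) - 3 * \<mu> n * EY (\<lambda>y. y\<^sup>2) + 3 * (\<mu> n)\<^sup>2 * EY (\<lambda>y. y) - (\<mu> n) ^ 3"
        by (simp add: EY_def power2_eq_square power3_eq_cube algebra_simps)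
      then have 2: "EY (\<lambda>y. (y - \<mu> n) ^ 3) = a3 / q - 3 * \<mu> n * (m1\<^sup>2 + V) + 3 * (\<mu> n)\<^sup>2 * m1 - (\<mu> n) ^ 3" unfolding EY1 EY2 EY3 .
      have "(\<integral>\<omega>. (\<xi> \<omega>) ^ 3 \<partial>\<Omega>) - (\<integral>\<omega>. (\<eta> \<omega>) ^ 3 \<partial>\<Omega>) = a3 - 3 * \<mu> n * a2 + 3 * (\<mu> n)\<^sup>2 * a1 - (\<mu> n) ^ 3 * q
          - q * (a3 / q - 3 * \<mu> n * (m1\<^sup>2 + V) + 3 * (\<mu> n)\<^sup>2 * m1 - (\<mu> n) ^ 3)"
        unfolding 1[symmetric] 2[symmetric]
        by (rule \<xi>\<eta>int[OF _ pw]) measurable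
      also have "\<dots> = - 3 * \<mu> n * (a2 - q * m1\<^sup>2 - q * V)" using q by (simp add: m1_def algebra_simps)
      also have "q * m1\<^sup>2 = a1\<^sup>2 / q" using q by (simp add: m1_def power2_eq_square)
      also have "q * V = D / (2 * q)" using q by (simp add: V_def power2_eq_square)
      also have "a2 - a1\<^sup>2 / q = D / q" using q by (simp add: D_def diff_divide_distrib)
      also have "D / q - D / (2 * q) = \<tau>\<^sup>2" unfolding \<tau>2 using q by (simp add: field_simps)
      finally show ?thesis .
    qed
    have \<theta>\<xi>: "(\<integral>\<omega>. (\<xi> \<omega>)\<^sup>2 \<partial>\<Omega>) = \<theta> n"
      unfolding \<theta>_def by (rule \<xi>int[OF _ pw]) measurable
    have law: "distr \<Omega> borel \<xi> = distr \<nu> borel (\<lambda>x. T n x - \<mu> n)"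
    proof -
      have "distr \<Omega> borel \<xi> = distr (distr \<Omega> \<nu> fst) borel (\<lambda>x. T n x - \<mu> n)"
        unfolding \<xi>_def by (subst distr_distr) (auto simp: o_def \<Omega>_def)
      also have "distr \<Omega> \<nu> fst = \<nu>" unfolding \<Omega>_def by (rule prob_space.distr_pair_fst[OF prob_space_measure_pmf])
      finally show ?thesis .
    qed
    have m\<eta>: "(\<integral>\<omega>. \<bar>\<eta> \<omega>\<bar> powr (p + 2) \<partial>\<Omega>) \<le> Bm"
    proof -
      have "(\<integral>\<omega>. \<bar>\<eta> \<omega>\<bar> powr (p + 2) \<partial>\<Omega>) = (\<integral>x. w * \<bar>\<eta> (x, True)\<bar> powr (p + 2) + (1 - w) * \<bar>\<eta> (x, False)\<bar> powr (p + 2) \<partial>\<nu>)"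
      proof -
        have "(\<lambda>(x, b). \<bar>\<eta> (x, b)\<bar> powr (p + 2)) \<in> borel_measurable \<Omega>" by (simp add: case_prod_beta', measurable)
        moreover have "\<bar>\<bar>\<eta> (x, b)\<bar> powr (p + 2)\<bar> \<le> (2 * s) powr (p + 2)" for x b using \<eta>bd p by (auto intro!: powr_mono2)
        ultimately have "(\<integral>\<omega>. \<bar>\<eta> (fst \<omega>, snd \<omega>)\<bar> powr (p + 2) \<partial>\<Omega>) = (\<integral>x. w * \<bar>\<eta> (x, True)\<bar> powr (p + 2) + (1 - w) * \<bar>\<eta> (x, False)\<bar> powr (p + 2) \<partial>\<nu>)"
          by (rule fubini)
        then show ?thesis by simp
      qed
      also have "\<dots> \<le> (\<integral>x. 2 powr (p + 1) * (\<bar>x\<bar> powr (p + 2) + y0 powr (p + 2) + 1) \<partial>\<nu>)"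
      proof (rule integral_mono')
        fix x
        have b: "\<bar>\<eta> (x, b)\<bar> powr (p + 2) \<le> 2 powr (p + 1) * (\<bar>x\<bar> powr (p + 2) + y0 powr (p + 2) + 1)" for b
        proof -
          have "\<bar>\<eta> (x, b)\<bar> \<le> max \<bar>x\<bar> y0 + 1" using y0[of b] \<mu>1 Tle(2)[of x] by (auto simp: \<eta>_def abs_le_iff)
          then have "\<bar>\<eta> (x, b)\<bar> powr (p + 2) \<le> (max \<bar>x\<bar> y0 + 1) powr (p + 2)" using p by (intro powr_mono2) auto
          also have "\<dots> \<le> 2 powr (p + 2 - 1) * ((max \<bar>x\<bar> y0) powr (p + 2) + 1 powr (p + 2))"
            using p by (intro powr_add_le) auto
          also have "\<dots> \<le> 2 powr (p + 1) * (\<bar>x\<bar> powr (p + 2) + y0 powr (p + 2) + 1)"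
            by (auto simp: max_def add.commute intro!: mult_left_mono)
          finally show ?thesis .
        qed
        have "w * \<bar>\<eta> (x, True)\<bar> powr (p + 2) + (1 - w) * \<bar>\<eta> (x, False)\<bar> powr (p + 2)
          \<le> w * (2 powr (p + 1) * (\<bar>x\<bar> powr (p + 2) + y0 powr (p + 2) + 1)) + (1 - w) * (2 powr (p + 1) * (\<bar>x\<bar> powr (p + 2) + y0 powr (p + 2) + 1))"
          using w b by (intro add_mono mult_left_mono) auto
        also have "\<dots> = 2 powr (p + 1) * (\<bar>x\<bar> powr (p + 2) + y0 powr (p + 2) + 1)" by (simp add: algebra_simps)
        finally show "w * \<bar>\<eta> (x, True)\<bar> powr (p + 2) + (1 - w) * \<bar>\<eta> (x, False)\<bar> powr (p + 2)
          \<le> 2 powr (p + 1) * (\<bar>x\<bar> powr (p + 2) + y0 powr (p + 2) + 1)" .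
      qed (use mom in auto)
      also have "\<dots> = Bm" using mom by (simp add: Bm_def B_def pU)
      finally show ?thesis .
    qed
    have t3: "\<bar>(\<integral>\<omega>. (\<xi> \<omega>) ^ 3 \<partial>\<Omega>) - (\<integral>\<omega>. (\<eta> \<omega>) ^ 3 \<partial>\<Omega>)\<bar> \<le> c3 / real n"
    proof -
      have "\<bar>- 3 * \<mu> n * \<tau>\<^sup>2\<bar> = 3 * \<bar>\<mu> n\<bar> * \<tau>\<^sup>2" by (simp add: abs_mult)
      also have "\<dots> \<le> 3 * (B / real n) * 1"
        using \<mu>_le \<tau> B0 s by (intro mult_mono power_le_one) auto
      finally show ?thesis unfolding d3 by (simp add: c3_def)
    qed
    have "(\<integral>\<^sup>+u. ennreal (\<bar>quantile (gsmooth (conv_pow (distr \<Omega> borel \<xi>) n (return borel 0)) (6 * p + R\<^sup>2)) u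
          - quantile (gsmooth (return borel 0) (6 * p + R\<^sup>2 + real n * (\<integral>\<omega>. (\<xi> \<omega>)\<^sup>2 \<partial>\<Omega>))) u\<bar> powr p) \<partial>unit_measure)
       \<le> ennreal (C powr p)"
      by (rule core[OF \<Omega>.prob_space_axioms s(5) \<xi>m \<eta>m _ e\<xi> _ _ d2 t3 _ m\<eta>])
        (use \<eta>bd d1 e\<xi> \<theta>\<xi> \<theta>_le neq in \<open>auto simp: s_def\<close>)
    then have fin: "(\<integral>\<^sup>+u. ennreal (\<bar>quantile (gsmooth (conv_pow (distr \<nu> borel (\<lambda>x. T n x - \<mu> n)) n (return borel 0)) v0) u
          - quantile (gsmooth (return borel 0) (v0 + real n * \<theta> n)) u\<bar> powr p) \<partial>unit_measure) \<le> ennreal K"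
      unfolding law \<theta>\<xi> v0_def using K by (auto intro: order_trans ennreal_leI)
    have nm: "real n * \<bar>\<mu> n\<bar> \<le> K" using \<mu>_le s K by (simp add: field_simps)
    show ?thesis using fin nm \<theta>_diff tp tm K by auto
  qed
  have "v0 > 0" using p by (simp add: v0_def add_pos_nonneg)
  moreover have "N \<ge> 1" by (simp add: N_def)
  ultimately show ?thesis using K(1) main by blast
qed

section \<open>Coupling an i.i.d. sum with a Gaussian variable\<close>

lemma prob_space_std_normal_distribution: "prob_space std_normal_distribution"
  by (rule prob_space_normal_density) simp

lemma distr_std_normal_scale:
  assumes s: "s > 0"
  shows "distr std_normal_distribution borel (\<lambda>z. s * z) = density lborel (\<lambda>x. ennreal (normal_density 0 s x))"
proof (rule measure_eqI)
  fix A assume "A \<in> sets (distr std_normal_distribution borel (\<lambda>z. s * z))"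
  then have [measurable]: "A \<in> sets borel" by simp
  have "emeasure (density lborel (\<lambda>x. ennreal (normal_density 0 s x))) A
     = (\<integral>\<^sup>+t. ennreal (normal_density 0 s t) * indicator A t \<partial>lborel)"
    by (simp add: emeasure_density)
  also have "\<dots> = ennreal s * (\<integral>\<^sup>+t. ennreal (normal_density 0 s (s * t)) * indicator A (s * t) \<partial>lborel)"
    using s by (subst nn_integral_real_affine[where c=s and t=0]) auto
  also have "\<dots> = (\<integral>\<^sup>+t. ennreal s * (ennreal (normal_density 0 s (s * t)) * indicator A (s * t)) \<partial>lborel)"
    by (rule nn_integral_cmult[symmetric]) measurable
  also have "\<dots> = (\<integral>\<^sup>+t. ennreal (std_normal_density t) * indicator A (s * t) \<partial>lborel)"
  proof (intro nn_integral_cong)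
    fix t
    have "s * normal_density 0 s (s * t) = std_normal_density t"
      using s by (simp add: normal_density_def power_mult_distrib real_sqrt_mult)
    then show "ennreal s * (ennreal (normal_density 0 s (s * t)) * indicator A (s * t)) = ennreal (std_normal_density t) * indicator A (s * t)"
      using s by (simp add: mult.assoc[symmetric] ennreal_mult[symmetric])
  qed
  also have "\<dots> = (\<integral>\<^sup>+t. indicator A (s * t) \<partial>std_normal_distribution)"
    by (simp add: nn_integral_density)
  also have "\<dots> = emeasure (distr std_normal_distribution borel (\<lambda>z. s * z)) A"
    by (simp add: emeasure_distr nn_integral_distr flip: nn_integral_indicator)
  finally show "emeasure (distr std_normal_distribution borel (\<lambda>z. s * z)) A = emeasure (density lborel (\<lambda>x. ennreal (normal_density 0 s x))) A" ..
qed simp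

lemma gsmooth_return:
  assumes "v > 0"
  shows "gsmooth (return borel 0) v = distr std_normal_distribution borel (\<lambda>z. sqrt v * z)"
proof -
  interpret G: real_distribution "distr std_normal_distribution borel (\<lambda>z. sqrt v * z)"
    by (intro prob_space.real_distribution_distr prob_space_std_normal_distribution) simp
  have "gsmooth (return borel 0) v = convolution (return borel 0) (distr std_normal_distribution borel (\<lambda>z. sqrt v * z))"
    unfolding gsmooth_def using assms by (simp add: distr_std_normal_scale)
  also have "\<dots> = distr std_normal_distribution borel (\<lambda>z. sqrt v * z)"
  proof (rule measure_eqI)
    interpret R: real_distribution "return borel (0::real)" by (rule real_distribution_return)
    let ?G = "distr std_normal_distribution borel (\<lambda>z. sqrt v * z)"
    fix A assume "A \<in> sets (convolution (return borel 0) ?G)"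
    then have [measurable]: "A \<in> sets borel" by simp
    have "emeasure (convolution (return borel 0) ?G) A = (\<integral>\<^sup>+x. indicator A x \<partial>convolution (return borel 0) ?G)" by simp
    also have "\<dots> = (\<integral>\<^sup>+x. \<integral>\<^sup>+y. indicator A (x + y) \<partial>?G \<partial>return borel 0)"
      by (intro nn_integral_convolution) (auto simp: R.finite_measure_axioms G.finite_measure_axioms)
    also have "\<dots> = (\<integral>\<^sup>+y. indicator A (0 + y) \<partial>?G)"
      by (rule nn_integral_return) (auto intro!: G.borel_measurable_nn_integral)
    finally show "emeasure (convolution (return borel 0) ?G) A = emeasure ?G A" by simp
  qed simp
  finally show ?thesis .
qed

text \<open>Realises the smoothed law by an additional standard normal coordinate, so that
  \<open>quantile_transform\<close> can start from a variable on the enlarged sample space.\<close>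

lemma gsmooth_distr:
  assumes M: "prob_space M" and [measurable]: "S \<in> borel_measurable M" and v: "v > 0"
  shows "gsmooth (distr M borel S) v = distr (M \<Otimes>\<^sub>M std_normal_distribution) borel (\<lambda>\<omega>. S (fst \<omega>) + sqrt v * snd \<omega>)"
proof (rule measure_eqI)
  interpret M: prob_space M by fact
  interpret G: prob_space std_normal_distribution by (rule prob_space_std_normal_distribution)
  interpret S: real_distribution "distr M borel S" by auto
  have [measurable]: "snd \<in> borel_measurable (M \<Otimes>\<^sub>M std_normal_distribution)"
    using measurable_snd[of M std_normal_distribution] by simp
  fix A assume "A \<in> sets (gsmooth (distr M borel S) v)"
  then have [measurable]: "A \<in> sets borel" by (simp add: gsmooth_def)
  have "emeasure (gsmooth (distr M borel S) v) A = (\<integral>\<^sup>+x. indicator A x \<partial>convolution (distr M borel S) (distr std_normal_distribution borel (\<lambda>z. sqrt v * z)))"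
    using v by (simp add: gsmooth_def distr_std_normal_scale)
  also have "\<dots> = (\<integral>\<^sup>+t. \<integral>\<^sup>+z. indicator A (t + sqrt v * z) \<partial>std_normal_distribution \<partial>distr M borel S)"
    by (intro nn_integral_convolution_distr S.real_distribution_axioms G.prob_space_axioms) auto
  also have "\<dots> = (\<integral>\<^sup>+\<omega>. \<integral>\<^sup>+z. indicator A (S \<omega> + sqrt v * z) \<partial>std_normal_distribution \<partial>M)"
    by (intro nn_integral_distr) (auto intro!: G.borel_measurable_nn_integral)
  also have "\<dots> = (\<integral>\<^sup>+\<omega>. indicator A (S (fst \<omega>) + sqrt v * snd \<omega>) \<partial>(M \<Otimes>\<^sub>M std_normal_distribution))"
    by (subst G.nn_integral_fst[symmetric]) auto
  also have "\<dots> = emeasure (distr (M \<Otimes>\<^sub>M std_normal_distribution) borel (\<lambda>\<omega>. S (fst \<omega>) + sqrt v * snd \<omega>)) A"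
    by (simp add: emeasure_distr nn_integral_distr flip: nn_integral_indicator)
  finally show "emeasure (gsmooth (distr M borel S) v) A = emeasure (distr (M \<Otimes>\<^sub>M std_normal_distribution) borel (\<lambda>\<omega>. S (fst \<omega>) + sqrt v * snd \<omega>)) A" .
qed (simp add: gsmooth_def)

lemma nn_integral_std_normal_powr:
  assumes "p \<ge> 1"
  obtains m where "m \<ge> 0" "(\<integral>\<^sup>+z. ennreal (\<bar>z\<bar> powr p) \<partial>std_normal_distribution) = ennreal m"
proof -
  define k where "k = nat \<lceil>p\<rceil>"
  have pk: "p \<le> real k" by (simp add: k_def real_nat_ceiling_ge)
  have le: "\<bar>z\<bar> powr p \<le> 1 + \<bar>z\<bar> ^ k" for z :: real
  proof (cases "\<bar>z\<bar> \<le> 1")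
    case True
    then have "\<bar>z\<bar> powr p \<le> 1 powr p" using assms by (intro powr_mono2) auto
    then show ?thesis by (simp add: add_increasing2)
  next
    case False
    then have "\<bar>z\<bar> powr p \<le> \<bar>z\<bar> powr real k" using pk by (intro powr_mono) auto
    then show ?thesis using False by (simp add: powr_realpow)
  qed
  have "integrable lborel (\<lambda>z. std_normal_density z * \<bar>z\<bar> powr p)"
  proof (rule Bochner_Integration.integrable_bound)
    show "integrable lborel (\<lambda>z. std_normal_density z + std_normal_density z * \<bar>z\<bar> ^ k)"
      using integrable_std_normal_moment_abs[of k] by auto
    show "AE z in lborel. norm (std_normal_density z * \<bar>z\<bar> powr p) \<le> norm (std_normal_density z + std_normal_density z * \<bar>z\<bar> ^ k)"
    proof (rule AE_I2)
      fix z :: real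
      have "std_normal_density z * \<bar>z\<bar> powr p \<le> std_normal_density z * (1 + \<bar>z\<bar> ^ k)"
        by (intro mult_left_mono le) auto
      then show "norm (std_normal_density z * \<bar>z\<bar> powr p) \<le> norm (std_normal_density z + std_normal_density z * \<bar>z\<bar> ^ k)"
        by (simp add: abs_mult algebra_simps)
    qed
  qed simp
  then have "(\<integral>\<^sup>+z. ennreal (std_normal_density z * \<bar>z\<bar> powr p) \<partial>lborel) = ennreal (\<integral>z. std_normal_density z * \<bar>z\<bar> powr p \<partial>lborel)"
    by (intro nn_integral_eq_integral) auto
  moreover have "(\<integral>\<^sup>+z. ennreal (\<bar>z\<bar> powr p) \<partial>std_normal_distribution) = (\<integral>\<^sup>+z. ennreal (std_normal_density z * \<bar>z\<bar> powr p) \<partial>lborel)"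
    by (subst nn_integral_density) (auto simp: ennreal_mult)
  ultimately show ?thesis by (intro that[of "\<integral>z. std_normal_density z * \<bar>z\<bar> powr p \<partial>lborel"]) auto
qed

lemma abs_sum5_powr_le:
  fixes a b c d e p :: real
  assumes p: "p \<ge> 1"
  shows "\<bar>a + b + c + d + e\<bar> powr p \<le> 5 powr p * (\<bar>a\<bar> powr p + \<bar>b\<bar> powr p + \<bar>c\<bar> powr p + \<bar>d\<bar> powr p + \<bar>e\<bar> powr p)"
proof -
  define m where "m = Max {\<bar>a\<bar>, \<bar>b\<bar>, \<bar>c\<bar>, \<bar>d\<bar>, \<bar>e\<bar>}"
  have m: "m \<in> {\<bar>a\<bar>, \<bar>b\<bar>, \<bar>c\<bar>, \<bar>d\<bar>, \<bar>e\<bar>}" unfolding m_def by (intro Max_in) auto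
  have le: "x \<le> m" if "x \<in> {\<bar>a\<bar>, \<bar>b\<bar>, \<bar>c\<bar>, \<bar>d\<bar>, \<bar>e\<bar>}" for x
    unfolding m_def using that by (intro Max_ge) auto
  have "\<bar>a + b + c + d + e\<bar> \<le> 5 * m"
    using le[of "\<bar>a\<bar>"] le[of "\<bar>b\<bar>"] le[of "\<bar>c\<bar>"] le[of "\<bar>d\<bar>"] le[of "\<bar>e\<bar>"] by simp
  then have "\<bar>a + b + c + d + e\<bar> powr p \<le> (5 * m) powr p" using p by (intro powr_mono2) auto
  also have "\<dots> = 5 powr p * m powr p" by (rule powr_mult)
  also have "\<dots> \<le> 5 powr p * (\<bar>a\<bar> powr p + \<bar>b\<bar> powr p + \<bar>c\<bar> powr p + \<bar>d\<bar> powr p + \<bar>e\<bar> powr p)"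
    using m by (intro mult_left_mono) (auto simp: add_increasing add_increasing2)
  finally show ?thesis .
qed

text \<open>The bound does not grow with n although nothing is normalised; a division by sqrt n
  later gives the rate. The space is enlarged by one standard normal variable, which serves as the
  smoothing noise of variance v0 and is removed again at bounded cost.\<close>

theorem (in prob_space) iid_gaussian_coupling:
  fixes \<zeta> :: "nat \<Rightarrow> 'a \<Rightarrow> real" and p :: real
  assumes p: "p \<ge> 1" and ind: "indep_vars (\<lambda>_. borel) \<zeta> {1..}"
    and id: "\<And>i. i \<ge> 1 \<Longrightarrow> distr M borel (\<zeta> i) = \<nu>"
    and mean: "(\<integral>x. x \<partial>\<nu>) = 0" and var: "(\<integral>x. x\<^sup>2 \<partial>\<nu>) = 1" and mom: "integrable \<nu> (\<lambda>x. \<bar>x\<bar> powr (p + 2))"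
  shows "\<exists>C>0. \<exists>N. \<forall>n\<ge>N. \<exists>Z. Z \<in> borel_measurable (M \<Otimes>\<^sub>M std_normal_distribution) \<and> distr (M \<Otimes>\<^sub>M std_normal_distribution) borel Z = std_normal_distribution
    \<and> (\<integral>\<^sup>+\<omega>. ennreal (\<bar>(\<Sum>i\<in>{1..n}. \<zeta> i (fst \<omega>)) - sqrt (real n) * Z \<omega>\<bar> powr p) \<partial>(M \<Otimes>\<^sub>M std_normal_distribution)) \<le> ennreal C"
proof -
  have \<zeta>m: "\<zeta> i \<in> borel_measurable M" if "i \<ge> 1" for i using ind that unfolding indep_vars_def by auto
  have \<nu>: "real_distribution \<nu>" unfolding id[of 1, symmetric, simplified] using \<zeta>m[of 1] by auto
  define T where "T n x = (if \<bar>x\<bar> \<le> sqrt (real n) then x else 0)" for n x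
  define \<mu> where "\<mu> n = (\<integral>x. T n x \<partial>\<nu>)" for n
  define \<theta> where "\<theta> n = (\<integral>x. (T n x - \<mu> n)\<^sup>2 \<partial>\<nu>)" for n
  have [measurable]: "T n \<in> borel_measurable borel" for n unfolding T_def by measurable
  obtain v0 C N where v0: "v0 > 0" and C: "C > 0" and N: "N \<ge> 1" and tc: "\<And>n. n \<ge> N \<Longrightarrow>
      real n * \<bar>\<mu> n\<bar> \<le> C \<and> sqrt (real n) * \<bar>1 - \<theta> n\<bar> \<le> C
      \<and> real n * measure \<nu> {x. \<bar>x\<bar> > sqrt (real n)} \<le> C
      \<and> (\<integral>\<^sup>+x. ennreal (\<bar>x - T n x\<bar> powr p) \<partial>\<nu>) \<le> ennreal (C / real n)
      \<and> (\<integral>\<^sup>+u. ennreal (\<bar>quantile (gsmooth (conv_pow (distr \<nu> borel (\<lambda>x. T n x - \<mu> n)) n (return borel 0)) v0) u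
          - quantile (gsmooth (return borel 0) (v0 + real n * \<theta> n)) u\<bar> powr p) \<partial>unit_measure) \<le> ennreal C"
    using truncated_coupling[OF p \<nu> mean var mom] unfolding \<theta>_def[abs_def] \<mu>_def[abs_def] T_def[abs_def] by blast
  obtain m where m: "m \<ge> 0" "(\<integral>\<^sup>+z. ennreal (\<bar>z\<bar> powr p) \<partial>std_normal_distribution) = ennreal m"
    by (rule nn_integral_std_normal_powr[OF p])
  define c where "c = 2 powr (p - 1)"
  define K where "K = 5 powr p * (c * C * exp (c * C) + C powr p + sqrt v0 powr p * m + C + (v0 + C) powr p * m)"
  interpret G: prob_space std_normal_distribution by (rule prob_space_std_normal_distribution)
  interpret PB: pair_prob_space M std_normal_distribution ..
  define B where "B = M \<Otimes>\<^sub>M std_normal_distribution"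
  interpret B: prob_space B unfolding B_def by (rule PB.prob_space_axioms)
  have fstm[measurable]: "fst \<in> measurable B M" unfolding B_def by measurable
  have sndm[measurable]: "snd \<in> borel_measurable B"
    using measurable_snd[of M std_normal_distribution] by (simp add: B_def)
  have int_fst: "(\<integral>\<^sup>+\<omega>. f (fst \<omega>) \<partial>B) = (\<integral>\<^sup>+\<omega>. f \<omega> \<partial>M)" if "f \<in> borel_measurable M" for f
  proof -
    have [measurable]: "f \<in> borel_measurable M" by (rule that)
    have g1: "emeasure std_normal_distribution UNIV = 1" using G.emeasure_space_1 by simp
    have "(\<lambda>\<omega>. f (fst \<omega>)) \<in> borel_measurable (M \<Otimes>\<^sub>M std_normal_distribution)" by measurable
    then have "(\<integral>\<^sup>+\<omega>. f (fst \<omega>) \<partial>B) = (\<integral>\<^sup>+\<omega>. \<integral>\<^sup>+z. f \<omega> \<partial>std_normal_distribution \<partial>M)"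
      unfolding B_def by (subst G.nn_integral_fst[symmetric]) simp_all
    then show ?thesis by (simp add: g1)
  qed
  have int_snd: "(\<integral>\<^sup>+\<omega>. f (snd \<omega>) \<partial>B) = (\<integral>\<^sup>+z. f z \<partial>std_normal_distribution)" if [measurable]: "f \<in> borel_measurable borel" for f
    unfolding B_def by (subst G.nn_integral_fst[symmetric]) (use sndm in \<open>auto simp: B_def emeasure_space_1\<close>)
  have main: "\<exists>Z. Z \<in> borel_measurable B \<and> distr B borel Z = std_normal_distribution
    \<and> (\<integral>\<^sup>+\<omega>. ennreal (\<bar>(\<Sum>i\<in>{1..n}. \<zeta> i (fst \<omega>)) - sqrt (real n) * Z \<omega>\<bar> powr p) \<partial>B) \<le> ennreal K" if n: "n \<ge> N" for n
  proof -
    note t = tc[OF n]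
    have n0: "real n > 0" using n N by simp
    define \<xi> where "\<xi> i \<omega> = T n (\<zeta> i \<omega>) - \<mu> n" for i \<omega>
    define \<delta> where "\<delta> i \<omega> = \<zeta> i \<omega> - T n (\<zeta> i \<omega>)" for i \<omega>
    have ind_n: "indep_vars (\<lambda>_. borel) \<zeta> {1..n}" using ind by (rule indep_vars_subset) auto
    have law: "distr M borel (\<lambda>\<omega>. \<Sum>i\<in>{1..n}. f (\<zeta> i \<omega>)) = conv_pow (distr \<nu> borel f) n (return borel 0)"
      if [measurable]: "f \<in> borel_measurable borel" for f :: "real \<Rightarrow> real"
    proof (rule distr_sum_conv_pow)
      show "indep_vars (\<lambda>_. borel) (\<lambda>i \<omega>. f (\<zeta> i \<omega>)) {1..n}"
        using ind_n by (rule indep_vars_compose2) auto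
      fix i assume i: "i \<in> {1..n}"
      have [measurable]: "\<zeta> i \<in> borel_measurable M" using i by (intro \<zeta>m) auto
      show "(\<lambda>\<omega>. f (\<zeta> i \<omega>)) \<in> borel_measurable M" by measurable
      show "distr M borel (\<lambda>\<omega>. f (\<zeta> i \<omega>)) = distr \<nu> borel f"
        unfolding id[of i, symmetric, OF conjunct1[OF i[unfolded atLeastAtMost_iff]]]
        by (subst distr_distr) (auto simp: o_def)
    qed
    define S\<xi> where "S\<xi> \<omega> = (\<Sum>i\<in>{1..n}. \<xi> i \<omega>)" for \<omega>
    define S\<delta> where "S\<delta> \<omega> = (\<Sum>i\<in>{1..n}. \<delta> i \<omega>)" for \<omega>
    have [measurable]: "S\<xi> \<in> borel_measurable M" "S\<delta> \<in> borel_measurable M" "(\<lambda>\<omega>. \<Sum>i\<in>{1..n}. \<zeta> i \<omega>) \<in> borel_measurable M"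
      unfolding S\<xi>_def[abs_def] S\<delta>_def[abs_def] \<xi>_def \<delta>_def
      by (auto intro!: borel_measurable_sum borel_measurable_diff measurable_compose[OF \<zeta>m] \<zeta>m)
    have law\<xi>: "distr M borel S\<xi> = conv_pow (distr \<nu> borel (\<lambda>x. T n x - \<mu> n)) n (return borel 0)"
      unfolding S\<xi>_def[abs_def] \<xi>_def by (rule law) measurable
    have law\<delta>: "distr M borel S\<delta> = conv_pow (distr \<nu> borel (\<lambda>x. x - T n x)) n (return borel 0)"
      unfolding S\<delta>_def[abs_def] \<delta>_def by (rule law) measurable
    define V where "V = v0 + real n * \<theta> n"
    have \<theta>0: "\<theta> n \<ge> 0" unfolding \<theta>_def by simp
    have V: "V > 0" unfolding V_def using v0 \<theta>0 n0 by (intro add_pos_nonneg) auto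
    define Y where "Y \<omega> = S\<xi> (fst \<omega>) + sqrt v0 * snd \<omega>" for \<omega>
    have [measurable]: "Y \<in> borel_measurable B" unfolding Y_def[abs_def] by measurable
    have lawY: "distr B borel Y = gsmooth (conv_pow (distr \<nu> borel (\<lambda>x. T n x - \<mu> n)) n (return borel 0)) v0"
      unfolding law\<xi>[symmetric] Y_def[abs_def] B_def by (rule gsmooth_distr[OF prob_space_axioms _ v0, symmetric]) measurable
    have rd: "real_distribution (distr M borel S\<xi>)" by auto
    obtain Z' where Z'[measurable]: "Z' \<in> borel_measurable B" and lawZ': "distr B borel Z' = gsmooth (return borel 0) V"
      and dist: "(\<integral>\<^sup>+b. ennreal (\<bar>Y b - Z' b\<bar> powr p) \<partial>B)
      = (\<integral>\<^sup>+u. ennreal (\<bar>quantile (gsmooth (conv_pow (distr \<nu> borel (\<lambda>x. T n x - \<mu> n)) n (return borel 0)) v0) u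
          - quantile (gsmooth (return borel 0) V) u\<bar> powr p) \<partial>unit_measure)"
    proof (rule quantile_transform[OF B.prob_space_axioms \<open>Y \<in> borel_measurable B\<close> lawY])
      show "real_distribution (gsmooth (conv_pow (distr \<nu> borel (\<lambda>x. T n x - \<mu> n)) n (return borel 0)) v0)"
        unfolding law\<xi>[symmetric] by (rule real_distribution_gsmooth[OF rd v0])
      show "isCont (cdf (gsmooth (conv_pow (distr \<nu> borel (\<lambda>x. T n x - \<mu> n)) n (return borel 0)) v0)) x" for x
        unfolding law\<xi>[symmetric] by (rule isCont_cdf_gsmooth[OF rd v0])
      show "real_distribution (gsmooth (return borel 0) V)"
        by (rule real_distribution_gsmooth[OF real_distribution_return V])
    qed blast
    define Z where "Z \<omega> = Z' \<omega> / sqrt V" for \<omega>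
    have [measurable]: "Z \<in> borel_measurable B" unfolding Z_def[abs_def] by measurable
    have lawZ: "distr B borel Z = std_normal_distribution"
    proof -
      have "distr B borel Z = distr (distr B borel Z') borel (\<lambda>x. x / sqrt V)"
        unfolding Z_def[abs_def] by (simp add: distr_distr o_def)
      also have "\<dots> = distr std_normal_distribution borel (\<lambda>z. z)"
        unfolding lawZ' gsmooth_return[OF V] using V by (simp add: distr_distr o_def)
      also have "\<dots> = std_normal_distribution" by (rule distr_id2) simp
      finally show ?thesis .
    qed
    \<comment> \<open>By the difference of squares this is |V - n| divided by sqrt V + sqrt n, and
      |V - n| \<le> v0 + n |1 - \<theta> n| is of order sqrt n.\<close>
    have sVn: "\<bar>sqrt V - sqrt (real n)\<bar> \<le> v0 + C"
    proof -
      have sn: "sqrt (real n) \<ge> 1" using n0 n N by simp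
      have "(sqrt V - sqrt (real n)) * (sqrt V + sqrt (real n)) = V - real n"
        using V n0 by (simp add: algebra_simps)
      then have "\<bar>sqrt V - sqrt (real n)\<bar> * (sqrt V + sqrt (real n)) = \<bar>V - real n\<bar>"
        using V by (metis abs_mult abs_of_nonneg add_nonneg_nonneg less_imp_le of_nat_0_le_iff real_sqrt_ge_zero)
      moreover have "\<bar>sqrt V - sqrt (real n)\<bar> * sqrt (real n) \<le> \<bar>sqrt V - sqrt (real n)\<bar> * (sqrt V + sqrt (real n))"
        using V by (intro mult_left_mono) auto
      moreover have "\<bar>V - real n\<bar> \<le> v0 * sqrt (real n) + C * sqrt (real n)"
      proof -
        have "V - real n = v0 - real n * (1 - \<theta> n)" by (simp add: V_def algebra_simps)
        moreover have "\<bar>real n * (1 - \<theta> n)\<bar> = real n * \<bar>1 - \<theta> n\<bar>" by (simp add: abs_mult)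
        ultimately have "\<bar>V - real n\<bar> \<le> v0 + real n * \<bar>1 - \<theta> n\<bar>" using v0 by linarith
        also have "real n * \<bar>1 - \<theta> n\<bar> = sqrt (real n) * (sqrt (real n) * \<bar>1 - \<theta> n\<bar>)" using n0 by (simp add: mult.assoc[symmetric])
        also have "\<dots> \<le> sqrt (real n) * C" using t by (intro mult_left_mono) auto
        also have "v0 \<le> v0 * sqrt (real n)" using v0 sn by simp
        finally show ?thesis by (simp add: mult.commute)
      qed
      ultimately have "\<bar>sqrt V - sqrt (real n)\<bar> * sqrt (real n) \<le> (v0 + C) * sqrt (real n)" by (simp add: distrib_right)
      then show ?thesis using sn by simp
    qed
    \<comment> \<open>A cut-off part is nonzero with probability O(1/n) and has p-th moment O(1/n),
      so \<open>moment_conv_pow_le\<close> bounds the sum of n of them uniformly.\<close>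
    have I1: "(\<integral>\<^sup>+\<omega>. ennreal (\<bar>S\<delta> (fst \<omega>)\<bar> powr p) \<partial>B) \<le> ennreal (c * C * exp (c * C))"
    proof -
      have dm[measurable]: "(\<lambda>x. x - T n x) \<in> borel_measurable \<nu>"
        using \<nu> by (simp add: measurable_cong_sets[OF real_distribution.events_eq_borel refl])
      have "(\<integral>\<^sup>+\<omega>. ennreal (\<bar>S\<delta> (fst \<omega>)\<bar> powr p) \<partial>B) = (\<integral>\<^sup>+\<omega>. ennreal (\<bar>S\<delta> \<omega>\<bar> powr p) \<partial>M)"
        by (rule int_fst) measurable
      also have "\<dots> = (\<integral>\<^sup>+x. ennreal (\<bar>x\<bar> powr p) \<partial>distr M borel S\<delta>)" by (simp add: nn_integral_distr)
      also have "\<dots> \<le> ennreal (real n * (2 powr (p - 1) * (C / real n)) * exp (2 powr (p - 1) * (real n * (C / real n))))"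
        unfolding law\<delta>
      proof (rule moment_conv_pow_le[OF _ p])
        show "real_distribution (distr \<nu> borel (\<lambda>x. x - T n x))"
          using \<nu> dm by (intro prob_space.real_distribution_distr) (auto simp: real_distribution_def)
        interpret \<nu>: real_distribution \<nu> by fact
        have "(\<integral>\<^sup>+x. indicator (- {0}) x \<partial>distr \<nu> borel (\<lambda>x. x - T n x)) = (\<integral>\<^sup>+x. indicator (- {0}) (x - T n x) \<partial>\<nu>)"
          by (subst nn_integral_distr) auto
        also have "\<dots> \<le> (\<integral>\<^sup>+x. indicator {x. \<bar>x\<bar> > sqrt (real n)} x \<partial>\<nu>)"
          by (intro nn_integral_mono) (auto simp: indicator_def T_def)
        also have "\<dots> = ennreal (measure \<nu> {x. \<bar>x\<bar> > sqrt (real n)})" by (simp add: \<nu>.emeasure_eq_measure)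
        also have "\<dots> \<le> ennreal (C / real n)" using t n0 by (intro ennreal_leI) (simp add: field_simps)
        finally show "(\<integral>\<^sup>+x. indicator (- {0}) x \<partial>distr \<nu> borel (\<lambda>x. x - T n x)) \<le> ennreal (C / real n)" .
        show "(\<integral>\<^sup>+x. ennreal (\<bar>x\<bar> powr p) \<partial>distr \<nu> borel (\<lambda>x. x - T n x)) \<le> ennreal (C / real n)"
          using t by (subst nn_integral_distr) auto
      qed (use C n0 in auto)
      also have "\<dots> = ennreal (c * C * exp (c * C))" using n0 by (simp add: c_def)
      finally show ?thesis .
    qed
    have I2: "(\<integral>\<^sup>+\<omega>. ennreal (\<bar>real n * \<mu> n\<bar> powr p) \<partial>B) \<le> ennreal (C powr p)"
      using t p by (simp add: B.emeasure_space_1) (intro ennreal_leI powr_mono2, auto simp: abs_mult)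
    have I3: "(\<integral>\<^sup>+\<omega>. ennreal (\<bar>- (sqrt v0 * snd \<omega>)\<bar> powr p) \<partial>B) = ennreal (sqrt v0 powr p * m)"
    proof -
      have "(\<integral>\<^sup>+\<omega>. ennreal (\<bar>- (sqrt v0 * snd \<omega>)\<bar> powr p) \<partial>B) = (\<integral>\<^sup>+z. ennreal (sqrt v0 powr p) * ennreal (\<bar>z\<bar> powr p) \<partial>std_normal_distribution)"
        using v0 int_snd[of "\<lambda>z. ennreal (sqrt v0 powr p) * ennreal (\<bar>z\<bar> powr p)"] by (simp add: abs_mult powr_mult ennreal_mult)
      also have "\<dots> = ennreal (sqrt v0 powr p * m)" using m by (simp add: nn_integral_cmult ennreal_mult)
      finally show ?thesis .
    qed
    have I4: "(\<integral>\<^sup>+\<omega>. ennreal (\<bar>Y \<omega> - Z' \<omega>\<bar> powr p) \<partial>B) \<le> ennreal C"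
      unfolding dist V_def using t by blast
    have I5: "(\<integral>\<^sup>+\<omega>. ennreal (\<bar>(sqrt V - sqrt (real n)) * Z \<omega>\<bar> powr p) \<partial>B) \<le> ennreal ((v0 + C) powr p * m)"
    proof -
      have "(\<integral>\<^sup>+\<omega>. ennreal (\<bar>(sqrt V - sqrt (real n)) * Z \<omega>\<bar> powr p) \<partial>B) \<le> (\<integral>\<^sup>+\<omega>. ennreal ((v0 + C) powr p) * ennreal (\<bar>Z \<omega>\<bar> powr p) \<partial>B)"
        using sVn p by (intro nn_integral_mono) (auto simp: abs_mult powr_mult ennreal_mult[symmetric] intro!: ennreal_leI mult_right_mono powr_mono2)
      also have "\<dots> = ennreal ((v0 + C) powr p) * (\<integral>\<^sup>+z. ennreal (\<bar>z\<bar> powr p) \<partial>distr B borel Z)"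
        by (simp add: nn_integral_cmult nn_integral_distr)
      also have "\<dots> = ennreal ((v0 + C) powr p * m)" unfolding lawZ m(2) using m by (simp add: ennreal_mult)
      finally show ?thesis .
    qed
    \<comment> \<open>In this order: cut-off parts, bias, added noise, quantile coupling, and the
      correction of the variance from \<open>V\<close> to n.\<close>
    have decomp: "(\<Sum>i\<in>{1..n}. \<zeta> i (fst \<omega>)) - sqrt (real n) * Z \<omega>
      = S\<delta> (fst \<omega>) + real n * \<mu> n + - (sqrt v0 * snd \<omega>) + (Y \<omega> - Z' \<omega>) + (sqrt V - sqrt (real n)) * Z \<omega>" for \<omega>
    proof -
      have "(\<Sum>i\<in>{1..n}. \<zeta> i (fst \<omega>)) = S\<delta> (fst \<omega>) + S\<xi> (fst \<omega>) + real n * \<mu> n"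
        by (simp add: S\<delta>_def S\<xi>_def \<xi>_def \<delta>_def sum_subtractf)
      moreover have "sqrt V * Z \<omega> = Z' \<omega>" using V by (simp add: Z_def)
      ultimately show ?thesis by (simp add: Y_def algebra_simps)
    qed
    have "(\<integral>\<^sup>+\<omega>. ennreal (\<bar>(\<Sum>i\<in>{1..n}. \<zeta> i (fst \<omega>)) - sqrt (real n) * Z \<omega>\<bar> powr p) \<partial>B)
      \<le> (\<integral>\<^sup>+\<omega>. ennreal (5 powr p) * (ennreal (\<bar>S\<delta> (fst \<omega>)\<bar> powr p) + ennreal (\<bar>real n * \<mu> n\<bar> powr p) + ennreal (\<bar>- (sqrt v0 * snd \<omega>)\<bar> powr p)
         + ennreal (\<bar>Y \<omega> - Z' \<omega>\<bar> powr p) + ennreal (\<bar>(sqrt V - sqrt (real n)) * Z \<omega>\<bar> powr p)) \<partial>B)"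
    proof (intro nn_integral_mono)
      fix \<omega>
      show "ennreal (\<bar>(\<Sum>i\<in>{1..n}. \<zeta> i (fst \<omega>)) - sqrt (real n) * Z \<omega>\<bar> powr p) \<le> ennreal (5 powr p) * (ennreal (\<bar>S\<delta> (fst \<omega>)\<bar> powr p) + ennreal (\<bar>real n * \<mu> n\<bar> powr p) + ennreal (\<bar>- (sqrt v0 * snd \<omega>)\<bar> powr p)
         + ennreal (\<bar>Y \<omega> - Z' \<omega>\<bar> powr p) + ennreal (\<bar>(sqrt V - sqrt (real n)) * Z \<omega>\<bar> powr p))"
        unfolding decomp
        using ennreal_leI[OF abs_sum5_powr_le[OF p, of "S\<delta> (fst \<omega>)" "real n * \<mu> n" "- (sqrt v0 * snd \<omega>)" "Y \<omega> - Z' \<omega>" "(sqrt V - sqrt (real n)) * Z \<omega>"]]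
        by (simp only: ennreal_mult ennreal_plus powr_ge_zero add_nonneg_nonneg)
    qed
    also have "\<dots> = ennreal (5 powr p) * ((\<integral>\<^sup>+\<omega>. ennreal (\<bar>S\<delta> (fst \<omega>)\<bar> powr p) \<partial>B) + (\<integral>\<^sup>+\<omega>. ennreal (\<bar>real n * \<mu> n\<bar> powr p) \<partial>B)
       + (\<integral>\<^sup>+\<omega>. ennreal (\<bar>- (sqrt v0 * snd \<omega>)\<bar> powr p) \<partial>B) + (\<integral>\<^sup>+\<omega>. ennreal (\<bar>Y \<omega> - Z' \<omega>\<bar> powr p) \<partial>B)
       + (\<integral>\<^sup>+\<omega>. ennreal (\<bar>(sqrt V - sqrt (real n)) * Z \<omega>\<bar> powr p) \<partial>B))"
      by (subst nn_integral_cmult, measurable) (subst nn_integral_add, measurable, (simp; fail)?)+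
    also have "\<dots> \<le> ennreal (5 powr p) * (ennreal (c * C * exp (c * C)) + ennreal (C powr p) + ennreal (sqrt v0 powr p * m) + ennreal C + ennreal ((v0 + C) powr p * m))"
      using I1 I2 I3 I4 I5 by (intro mult_left_mono add_mono) auto
    also have "\<dots> = ennreal K"
      using C m by (simp add: K_def c_def ennreal_mult[symmetric] ennreal_plus[symmetric] del: ennreal_plus)
    finally show ?thesis using lawZ by (intro exI[of _ Z]) auto
  qed
  have "K \<ge> 0" using C m by (auto simp: K_def c_def intro!: mult_nonneg_nonneg add_nonneg_nonneg)
  then have "K + 1 > 0" "ennreal K \<le> ennreal (K + 1)" by (auto intro: ennreal_leI)
  then show ?thesis using main unfolding B_def by (meson order_trans)
qed

section \<open>Hoeffding projection\<close>

text \<open>All moments are computed on the canonical product of copies of \<mu>; the sample enters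
  later through its joint law only.\<close>

locale U_kernel = real_distribution \<mu> for \<mu> +
  fixes m :: nat and h :: "(nat \<Rightarrow> real) \<Rightarrow> real"
  assumes m: "m \<ge> 1" and h_borel: "h \<in> borel_measurable (PiM {..<m} (\<lambda>_. borel))" and symm: "symmetric_kernel m h"
begin

sublocale PS: product_prob_space "\<lambda>_::nat. \<mu>" by standard

abbreviation PI :: "nat set \<Rightarrow> (nat \<Rightarrow> real) measure" where
  "PI I \<equiv> PiM I (\<lambda>_. \<mu>)"

lemma sets_PI: "sets (PiM I (\<lambda>_. borel)) = sets (PI I)"
  by (intro sets_PiM_cong) auto

lemma h_meas [measurable]: "h \<in> borel_measurable (PI {..<m})"
  using h_borel measurable_cong_sets[OF sets_PI refl] by blast

lemma prob_space_PI: "prob_space (PI I)"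
  by (intro prob_space_PiM prob_space_axioms)

text \<open>Explicit version of the conditional expectation given one argument, obtained by
  integrating out the others. Position 0 is singled out; \<open>kernel_reindex\<close> shows that by
  symmetry any other gives the same function. Where a section is not integrable the value is 0 by
  convention.\<close>

definition ghat :: "real \<Rightarrow> real" where
  "ghat y = (\<integral>x. h (\<lambda>j\<in>{..<m}. if j = 0 then y else x j) \<partial>PI {1..<m})"

lemma pair_meas: "(\<lambda>z. \<lambda>j\<in>{..<m}. if j = 0 then fst z else snd z j) \<in> measurable (borel \<Otimes>\<^sub>M PI {1..<m}) (PI {..<m})"
proof (rule measurable_restrict)
  fix j assume j: "j \<in> {..<m}"
  show "(\<lambda>z. if j = 0 then fst z else snd z j) \<in> borel \<Otimes>\<^sub>M PI {1..<m} \<rightarrow>\<^sub>M \<mu>"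
  proof (cases "j = 0")
    case False
    then have "j \<in> {1..<m}" using j by auto
    then have "(\<lambda>x. x j) \<in> PI {1..<m} \<rightarrow>\<^sub>M \<mu>" by (rule measurable_component_singleton)
    then have "(\<lambda>z. snd z j) \<in> borel \<Otimes>\<^sub>M PI {1..<m} \<rightarrow>\<^sub>M \<mu>" by (rule measurable_compose[OF measurable_snd])
    then show ?thesis using False by simp
  qed simp
qed

lemma h_pair_meas: "(\<lambda>z. h (\<lambda>j\<in>{..<m}. if j = 0 then fst z else snd z j)) \<in> borel_measurable (borel \<Otimes>\<^sub>M PI {1..<m})"
  by (rule measurable_compose[OF pair_meas h_meas])

lemma h_section_meas: "(\<lambda>x. h (\<lambda>j\<in>{..<m}. if j = 0 then y else x j)) \<in> borel_measurable (PI {1..<m})"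
  using measurable_compose[OF measurable_Pair1' h_pair_meas, of y] by (simp cong: if_cong)

lemma ghat_meas [measurable]: "ghat \<in> borel_measurable borel"
proof -
  interpret S: prob_space "PI {1..<m}" by (rule prob_space_PI)
  have "(\<lambda>y. \<integral>x. (\<lambda>z. h (\<lambda>j\<in>{..<m}. if j = 0 then fst z else snd z j)) (y, x) \<partial>PI {1..<m}) \<in> borel_measurable borel"
    by (rule S.borel_measurable_lebesgue_integral) (use h_pair_meas in \<open>simp add: case_prod_beta'\<close>)
  then show ?thesis by (simp add: ghat_def[abs_def] cong: if_cong)
qed

lemma index_split: "{..<m} = {0} \<union> {1..<m}" "{0} \<inter> {1..<m} = {}"
  using m by auto

lemma merge_eq: "merge {0} {1..<m} (x, y) = (\<lambda>j\<in>{..<m}. if j = 0 then x 0 else y j)"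
  using m by (auto simp: merge_def fun_eq_iff)

lemma nn_integral_split:
  assumes [measurable]: "f \<in> borel_measurable (PI {..<m})"
  shows "(\<integral>\<^sup>+x. f x \<partial>PI {..<m}) = (\<integral>\<^sup>+y. \<integral>\<^sup>+x. f (\<lambda>j\<in>{..<m}. if j = 0 then y else x j) \<partial>PI {1..<m} \<partial>\<mu>)"
proof -
  interpret S: prob_space "PI {1..<m}" by (rule prob_space_PI)
  have fm: "f \<in> borel_measurable (PI ({0} \<union> {1..<m}))" using assms index_split(1) by simp
  have "(\<integral>\<^sup>+x. f x \<partial>PI {..<m}) = (\<integral>\<^sup>+x. \<integral>\<^sup>+y. f (merge {0} {1..<m} (x, y)) \<partial>PI {1..<m} \<partial>PI {0})"
    unfolding index_split(1) by (rule PS.product_nn_integral_fold[OF index_split(2) _ _ fm]) auto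
  also have "\<dots> = (\<integral>\<^sup>+x. (\<lambda>u. \<integral>\<^sup>+y. f (\<lambda>j\<in>{..<m}. if j = 0 then u else y j) \<partial>PI {1..<m}) (x 0) \<partial>PI {0})"
    by (simp only: merge_eq)
  also have "\<dots> = (\<integral>\<^sup>+y. \<integral>\<^sup>+x. f (\<lambda>j\<in>{..<m}. if j = 0 then y else x j) \<partial>PI {1..<m} \<partial>\<mu>)"
  proof (rule PS.product_nn_integral_singleton)
    have "(\<lambda>z. f (\<lambda>j\<in>{..<m}. if j = 0 then fst z else snd z j)) \<in> borel_measurable (borel \<Otimes>\<^sub>M PI {1..<m})"
      by (rule measurable_compose[OF pair_meas assms])
    then have "(\<lambda>y. \<integral>\<^sup>+x. (\<lambda>z. f (\<lambda>j\<in>{..<m}. if j = 0 then fst z else snd z j)) (y, x) \<partial>PI {1..<m}) \<in> borel_measurable borel"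
      by (intro S.borel_measurable_nn_integral) (simp add: case_prod_beta')
    then show "(\<lambda>u. \<integral>\<^sup>+y. f (\<lambda>j\<in>{..<m}. if j = 0 then u else y j) \<partial>PI {1..<m}) \<in> borel_measurable \<mu>"
      by (simp cong: if_cong)
  qed
  finally show ?thesis .
qed

lemma integral_split:
  fixes f :: "(nat \<Rightarrow> real) \<Rightarrow> real"
  assumes f: "integrable (PI {..<m}) f"
  shows "(\<integral>x. f x \<partial>PI {..<m}) = (\<integral>y. \<integral>x. f (\<lambda>j\<in>{..<m}. if j = 0 then y else x j) \<partial>PI {1..<m} \<partial>\<mu>)"
proof -
  interpret S: prob_space "PI {1..<m}" by (rule prob_space_PI)
  have fm[measurable]: "f \<in> borel_measurable (PI {..<m})" using f by auto
  have fi: "integrable (PI ({0} \<union> {1..<m})) f" using f index_split(1) by simp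
  have "(\<integral>x. f x \<partial>PI {..<m}) = (\<integral>x. \<integral>y. f (merge {0} {1..<m} (x, y)) \<partial>PI {1..<m} \<partial>PI {0})"
    unfolding index_split(1) by (rule PS.product_integral_fold[OF index_split(2) _ _ fi]) auto
  also have "\<dots> = (\<integral>x. (\<lambda>u. \<integral>y. f (\<lambda>j\<in>{..<m}. if j = 0 then u else y j) \<partial>PI {1..<m}) (x 0) \<partial>PI {0})"
    by (simp only: merge_eq)
  also have "\<dots> = (\<integral>y. \<integral>x. f (\<lambda>j\<in>{..<m}. if j = 0 then y else x j) \<partial>PI {1..<m} \<partial>\<mu>)"
  proof (rule PS.product_integral_singleton)
    have "(\<lambda>z. f (\<lambda>j\<in>{..<m}. if j = 0 then fst z else snd z j)) \<in> borel_measurable (borel \<Otimes>\<^sub>M PI {1..<m})"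
      by (rule measurable_compose[OF pair_meas fm])
    then have "(\<lambda>y. \<integral>x. (\<lambda>z. f (\<lambda>j\<in>{..<m}. if j = 0 then fst z else snd z j)) (y, x) \<partial>PI {1..<m}) \<in> borel_measurable borel"
      by (intro S.borel_measurable_lebesgue_integral) (simp add: case_prod_beta')
    then show "(\<lambda>u. \<integral>y. f (\<lambda>j\<in>{..<m}. if j = 0 then u else y j) \<partial>PI {1..<m}) \<in> borel_measurable \<mu>"
      by (simp cong: if_cong)
  qed
  finally show ?thesis .
qed

text \<open>Conditional Jensen inequality; for each y it is \<open>integral_powr_ratio_le\<close>
  with w = 1.\<close>

lemma ghat_moment_le:
  assumes a: "a \<ge> 1"
  shows "(\<integral>\<^sup>+y. ennreal (\<bar>ghat y\<bar> powr a) \<partial>\<mu>) \<le> (\<integral>\<^sup>+x. ennreal (\<bar>h x\<bar> powr a) \<partial>PI {..<m})"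
proof -
  interpret S: prob_space "PI {1..<m}" by (rule prob_space_PI)
  have "ennreal (\<bar>ghat y\<bar> powr a) \<le> (\<integral>\<^sup>+x. ennreal (\<bar>h (\<lambda>j\<in>{..<m}. if j = 0 then y else x j)\<bar> powr a) \<partial>PI {1..<m})" for y
  proof (cases "integrable (PI {1..<m}) (\<lambda>x. h (\<lambda>j\<in>{..<m}. if j = 0 then y else x j))")
    case True
    let ?f = "\<lambda>x. \<bar>h (\<lambda>j\<in>{..<m}. if j = 0 then y else x j)\<bar>"
    have "\<bar>ghat y\<bar> powr a \<le> (\<integral>x. ?f x \<partial>PI {1..<m}) powr a"
      unfolding ghat_def using a by (intro powr_mono2 integral_abs_bound) auto
    moreover have "(\<integral>x. 1 \<partial>PI {1..<m}) = (1::real)" using S.prob_space by simp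
    ultimately have "ennreal (\<bar>ghat y\<bar> powr a) \<le> ennreal ((\<integral>x. ?f x \<partial>PI {1..<m}) powr a * (\<integral>x. 1 \<partial>PI {1..<m}) powr (1 - a))"
      by (simp only: powr_one_eq_one mult_1_right ennreal_leI)
    also have "\<dots> \<le> (\<integral>\<^sup>+x. ennreal (?f x powr a * 1 powr (1 - a)) \<partial>PI {1..<m})"
      using True a by (intro integral_powr_ratio_le S.integrable_const) auto
    finally show ?thesis by simp
  next
    \<comment> \<open>The Bochner integral defaults to 0 here, so the left side vanishes.\<close>
    case False
    then show ?thesis using a by (simp add: ghat_def not_integrable_integral_eq)
  qed
  then have "(\<integral>\<^sup>+y. ennreal (\<bar>ghat y\<bar> powr a) \<partial>\<mu>) \<le> (\<integral>\<^sup>+y. \<integral>\<^sup>+x. ennreal (\<bar>h (\<lambda>j\<in>{..<m}. if j = 0 then y else x j)\<bar> powr a) \<partial>PI {1..<m} \<partial>\<mu>)"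
    by (intro nn_integral_mono)
  also have "\<dots> = (\<integral>\<^sup>+x. ennreal (\<bar>h x\<bar> powr a) \<partial>PI {..<m})"
    by (rule nn_integral_split[symmetric]) measurable
  finally show ?thesis .
qed

text \<open>\<open>ghat\<close> singles out position 0, whereas here the argument in position
  \<open>j0\<close> is kept. Symmetry moves the position, and the product measure is invariant under
  injective renaming of coordinates. Both sides become the same Bochner integral, so the equality
  covers sections that are not integrable.\<close>

lemma kernel_reindex:
  assumes i: "inj_on i {..<m}" and j0: "j0 < m" and J: "J = i ` {..<m} - {i j0}" and I: "i j0 \<in> I" "I \<inter> J = {}"
  shows "(\<integral>y. h (\<lambda>j\<in>{..<m}. merge I J (x, y) (i j)) \<partial>PI J) = ghat (x (i j0))"
proof -
  define \<pi> where "\<pi> = Transposition.transpose 0 j0"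
  have \<pi>: "\<pi> permutes {..<m}" unfolding \<pi>_def using j0 m by (intro permutes_swap_id) auto
  define i' where "i' = i \<circ> \<pi>"
  have i'0: "i' 0 = i j0" by (simp add: i'_def \<pi>_def)
  have inj': "inj_on i' {..<m}" unfolding i'_def
    using \<pi> i by (intro comp_inj_on) (auto simp: permutes_image permutes_inj_on)
  have im: "i' ` {..<m} = i ` {..<m}" unfolding i'_def image_comp[symmetric] permutes_image[OF \<pi>] ..
  have "i' ` {1..<m} = i' ` {..<m} - {i' 0}"
  proof -
    have "i' ` {1..<m} = i' ` ({..<m} - {0})" by (rule arg_cong[where f="image i'"]) auto
    also have "\<dots> = i' ` {..<m} - i' ` {0}" using m by (intro inj_on_image_set_diff[OF inj']) auto
    finally show ?thesis by simp
  qed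
  then have imJ: "i' ` {1..<m} = J" using J im i'0 by simp
  have re: "distr (PI J) (PI {1..<m}) (\<lambda>\<omega>. \<lambda>j\<in>{1..<m}. \<omega> (i' j)) = PI {1..<m}"
    by (rule distr_PiM_reindex[of J "\<lambda>_. \<mu>" i' "{1..<m}"]) (auto intro!: prob_space_axioms inj_on_subset[OF inj'] simp: imJ[symmetric])
  have meas: "(\<lambda>\<omega>. \<lambda>j\<in>{1..<m}. \<omega> (i' j)) \<in> measurable (PI J) (PI {1..<m})"
    by (intro measurable_restrict measurable_component_singleton) (use imJ in auto)
  have "ghat (x (i j0)) = (\<integral>u. h (\<lambda>j\<in>{..<m}. if j = 0 then x (i j0) else u j) \<partial>distr (PI J) (PI {1..<m}) (\<lambda>\<omega>. \<lambda>j\<in>{1..<m}. \<omega> (i' j)))"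
    unfolding re ghat_def ..
  also have "\<dots> = (\<integral>y. h (\<lambda>j\<in>{..<m}. if j = 0 then x (i j0) else (\<lambda>j\<in>{1..<m}. y (i' j)) j) \<partial>PI J)"
    by (rule integral_distr[OF meas h_section_meas])
  also have "\<dots> = (\<integral>y. h (\<lambda>j\<in>{..<m}. merge I J (x, y) (i j)) \<partial>PI J)"
  proof (intro Bochner_Integration.integral_cong refl)
    fix y
    let ?z = "merge I J (x, y)"
    have "h (\<lambda>j\<in>{..<m}. ?z (i j)) = h (\<lambda>j\<in>{..<m}. (\<lambda>j\<in>{..<m}. ?z (i j)) (\<pi> j))"
      by (rule symm[unfolded symmetric_kernel_def, rule_format, OF \<pi>, symmetric]) auto
    also have "(\<lambda>j\<in>{..<m}. (\<lambda>j\<in>{..<m}. ?z (i j)) (\<pi> j)) = (\<lambda>j\<in>{..<m}. if j = 0 then x (i j0) else (\<lambda>j\<in>{1..<m}. y (i' j)) j)"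
    proof (rule restrict_ext)
      fix j assume j: "j \<in> {..<m}"
      have pj: "\<pi> j \<in> {..<m}" using permutes_in_image[OF \<pi>] j by auto
      show "(\<lambda>j\<in>{..<m}. ?z (i j)) (\<pi> j) = (if j = 0 then x (i j0) else (\<lambda>j\<in>{1..<m}. y (i' j)) j)"
      proof (cases "j = 0")
        case True
        have "i (\<pi> 0) = i j0" using i'0 by (simp add: i'_def)
        then show ?thesis using pj I(1) True by (simp add: merge_def)
      next
        case False
        then have jj: "j \<in> {1..<m}" using j by auto
        then have "i' j \<in> J" using imJ by auto
        moreover have "i' j \<notin> I" using calculation I(2) by auto
        ultimately show ?thesis using False jj pj by (simp add: i'_def merge_def)
      qed
    qed
    finally show "h (\<lambda>j\<in>{..<m}. if j = 0 then x (i j0) else (\<lambda>j\<in>{1..<m}. y (i' j)) j) = h (\<lambda>j\<in>{..<m}. ?z (i j))" ..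
  qed
  finally show ?thesis ..
qed

text \<open>The part of order two and higher in Hoeffding's decomposition. The constant term is
  absent because the kernel is centred wherever this is applied.\<close>

definition resid :: "(nat \<Rightarrow> nat) \<Rightarrow> (nat \<Rightarrow> real) \<Rightarrow> real" where
  "resid i x = h (\<lambda>j\<in>{..<m}. x (i j)) - (\<Sum>j<m. ghat (x (i j)))"

lemma resid_cong: "(\<And>k. k \<in> i ` {..<m} \<Longrightarrow> x k = y k) \<Longrightarrow> resid i x = resid i y"
  unfolding resid_def by (auto intro!: arg_cong[where f=h] arg_cong2[where f="(-)"] restrict_ext sum.cong)

lemma reindex_meas:
  assumes "i ` {..<m} \<subseteq> N"
  shows "(\<lambda>x. \<lambda>j\<in>{..<m}. x (i j)) \<in> measurable (PI N) (PI {..<m})"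
  by (intro measurable_restrict measurable_component_singleton) (use assms in auto)

lemma component_meas: "k \<in> N \<Longrightarrow> (\<lambda>x. x k) \<in> borel_measurable (PI N)"
  using measurable_component_singleton[of k N "\<lambda>_. \<mu>"] by simp

lemma resid_meas:
  assumes "i ` {..<m} \<subseteq> N"
  shows "resid i \<in> borel_measurable (PI N)"
proof -
  have "(\<lambda>x. x (i j)) \<in> borel_measurable (PI N)" if "j < m" for j using assms that by (intro component_meas) auto
  then show ?thesis unfolding resid_def[abs_def]
    by (intro borel_measurable_diff borel_measurable_sum measurable_compose[OF reindex_meas[OF assms] h_meas] measurable_compose[OF _ ghat_meas]) auto
qed

text \<open>Keep the coordinate that the tuple may share with the other factors and integrate out
  its remaining ones, which do not occur in \<open>R\<close>. The kernel integrates to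
  \<open>ghat\<close> of the kept coordinate, the terms \<open>ghat\<close> of the others to 0, and
  the two copies of \<open>ghat\<close> cancel.\<close>

lemma resid_orthogonal:
  assumes ig: "integrable \<mu> ghat" and g0: "(\<integral>y. ghat y \<partial>\<mu>) = 0"
    and N: "finite N" and i: "inj_on i {..<m}" "i ` {..<m} \<subseteq> N"
    and R: "\<And>x y. (\<And>k. k \<in> B \<Longrightarrow> x k = y k) \<Longrightarrow> R x = R y" and B: "B \<subseteq> N" and c: "card (i ` {..<m} \<inter> B) \<le> 1"
    and int: "integrable (PI N) (\<lambda>x. resid i x * R x)"
  shows "(\<integral>x. resid i x * R x \<partial>PI N) = 0"
proof -
  let ?A = "i ` {..<m}"
  have fin: "finite (?A \<inter> B)" by simp
  \<comment> \<open>The position of the shared index, or any position if there is none.\<close>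
  obtain j0 where j0: "j0 < m" "?A \<inter> B \<subseteq> {i j0}"
  proof (cases "?A \<inter> B = {}")
    case True
    then show ?thesis using that[of 0] m by auto
  next
    case False
    then have "card (?A \<inter> B) = 1" using c fin by (simp add: le_Suc_eq)
    then obtain k where k: "?A \<inter> B = {k}" by (auto simp: card_1_singleton_iff)
    then obtain j where "j < m" "k = i j" by auto
    then show ?thesis using that[of j] k by auto
  qed
  define J where "J = ?A - {i j0}"
  define I where "I = N - J"
  have IJ: "I \<inter> J = {}" "I \<union> J = N" "finite I" "finite J" "i j0 \<in> I"
    using N i j0 by (auto simp: I_def J_def)
  have BI: "B \<subseteq> I" using B j0 by (auto simp: I_def J_def)
  have "(\<integral>x. resid i x * R x \<partial>PI N) = (\<integral>x. \<integral>y. resid i (merge I J (x, y)) * R (merge I J (x, y)) \<partial>PI J \<partial>PI I)"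
    using PS.product_integral_fold[OF IJ(1,3,4), of "\<lambda>x. resid i x * R x"] int IJ(2) by simp
  also have "\<dots> = (\<integral>x. 0 \<partial>PI I)"
  proof (intro Bochner_Integration.integral_cong refl)
    fix x
    interpret SJ: prob_space "PI J" by (rule prob_space_PI)
    \<comment> \<open>\<open>R\<close> sees only coordinates in \<open>I\<close>, so every second
      component gives the same value; \<open>undefined\<close> stands for one of them.\<close>
    define c where "c = R (merge I J (x, undefined))"
    have Rc: "R (merge I J (x, y)) = c" for y
      unfolding c_def using BI by (intro R) (auto simp: merge_def)
    let ?H = "\<lambda>y. h (\<lambda>j\<in>{..<m}. merge I J (x, y) (i j))"
    let ?G = "\<lambda>y. \<Sum>j<m. ghat (merge I J (x, y) (i j))"
    have gj: "integrable (PI J) (\<lambda>y. ghat (y k))" "(\<integral>y. ghat (y k) \<partial>PI J) = 0" if "k \<in> J" for k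
    proof -
      have d: "distr (PI J) \<mu> (\<lambda>y. y k) = \<mu>" by (rule distr_PiM_component[OF prob_space_axioms that])
      have mk: "(\<lambda>y. y k) \<in> PI J \<rightarrow>\<^sub>M \<mu>" using that by (rule measurable_component_singleton)
      show "integrable (PI J) (\<lambda>y. ghat (y k))"
        using integrable_distr[OF mk, of ghat] ig d by simp
      have "(\<integral>y. ghat (y k) \<partial>PI J) = (\<integral>u. ghat u \<partial>distr (PI J) \<mu> (\<lambda>y. y k))"
        by (rule integral_distr[OF mk, symmetric]) simp
      then show "(\<integral>y. ghat (y k) \<partial>PI J) = 0" using g0 d by simp
    qed
    have mj: "merge I J (x, y) (i j) = (if j = j0 then x (i j0) else y (i j))" if "j < m" for j y
    proof -
      have "j \<noteq> j0 \<Longrightarrow> i j \<in> J" using that i j0 by (auto simp: J_def inj_on_def)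
      moreover have "j \<noteq> j0 \<Longrightarrow> i j \<notin> I" using calculation IJ by auto
      ultimately show ?thesis using IJ by (auto simp: merge_def)
    qed
    have iJ: "i j \<in> J" if "j < m" "j \<noteq> j0" for j using that i j0 by (auto simp: J_def inj_on_def)
    have iG1: "integrable (PI J) (\<lambda>y. ghat (merge I J (x, y) (i j)))" if "j < m" for j
      using that gj(1)[OF iJ[OF that]] by (cases "j = j0") (simp_all add: mj)
    have iG: "integrable (PI J) ?G" using iG1 by (intro Bochner_Integration.integrable_sum) auto
    have EG: "(\<integral>y. ?G y \<partial>PI J) = ghat (x (i j0))"
    proof -
      have "(\<integral>y. ?G y \<partial>PI J) = (\<Sum>j<m. \<integral>y. ghat (merge I J (x, y) (i j)) \<partial>PI J)"
        using iG1 by (intro Bochner_Integration.integral_sum) auto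
      also have "\<dots> = (\<Sum>j<m. if j = j0 then ghat (x (i j0)) else 0)"
        using gj(2) iJ by (intro sum.cong) (auto simp: mj SJ.prob_space)
      also have "\<dots> = ghat (x (i j0))" using j0 by simp
      finally show ?thesis .
    qed
    have EH: "(\<integral>y. ?H y \<partial>PI J) = ghat (x (i j0))"
      by (rule kernel_reindex[OF i(1) j0(1) J_def IJ(5,1)])
    \<comment> \<open>If the section of the kernel is not integrable, neither is the difference, and
      its integral is 0 by convention.\<close>
    have "(\<integral>y. ?H y - ?G y \<partial>PI J) = 0"
    proof (cases "integrable (PI J) ?H")
      case True
      then show ?thesis using iG EG EH by simp
    next
      case False
      then have "\<not> integrable (PI J) (\<lambda>y. ?H y - ?G y)"
        using Bochner_Integration.integrable_add[OF _ iG, of "\<lambda>y. ?H y - ?G y"] by auto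
      then show ?thesis by (rule not_integrable_integral_eq)
    qed
    then show "(\<integral>y. resid i (merge I J (x, y)) * R (merge I J (x, y)) \<partial>PI J) = 0"
      unfolding Rc resid_def by simp
  qed
  finally show ?thesis by simp
qed

end

text \<open>Double counting with the multiplicity \<open>d u\<close>. It sums to |L| m over the
  union \<open>U\<close>, and to at least 2 |L| over the set \<open>S\<close> of points covered
  twice or more, since each set contains two of them. Pointwise 2 \<le> 2 d u, and 2 + d u \<le> 2 d
  u on \<open>S\<close>; summation gives 2 |U| + 2 |L| \<le> 2 |L| m.\<close>

lemma card_Union_overlapping:
  fixes A :: "'i \<Rightarrow> 'b set"
  assumes L: "finite L" and A: "\<And>l. l \<in> L \<Longrightarrow> finite (A l)" "\<And>l. l \<in> L \<Longrightarrow> card (A l) = m"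
    and overlap: "\<And>l. l \<in> L \<Longrightarrow> card (A l \<inter> (\<Union>l'\<in>L - {l}. A l')) \<ge> 2"
  shows "card (\<Union>l\<in>L. A l) + card L \<le> card L * m"
proof -
  define U where "U = (\<Union>l\<in>L. A l)"
  define d where "d u = (\<Sum>l\<in>L. if u \<in> A l then 1 else 0 :: nat)" for u
  define S where "S = {u \<in> U. d u \<ge> 2}"
  have U: "finite U" using L A by (simp add: U_def)
  have d_card: "d u = card {l \<in> L. u \<in> A l}" for u
    unfolding d_def using L by (simp add: sum.If_cases Int_def)
  have AS: "card (A l \<inter> S) \<ge> 2" if l: "l \<in> L" for l
  proof -
    have "A l \<inter> (\<Union>l'\<in>L - {l}. A l') \<subseteq> A l \<inter> S"
    proof
      fix u assume "u \<in> A l \<inter> (\<Union>l'\<in>L - {l}. A l')"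
      then obtain l' where l': "u \<in> A l" "l' \<in> L" "l' \<noteq> l" "u \<in> A l'" by auto
      have "card {l, l'} \<le> card {l \<in> L. u \<in> A l}" using l l' L by (intro card_mono) auto
      then have "d u \<ge> 2" using l' by (simp add: d_card)
      then show "u \<in> A l \<inter> S" using l l' by (auto simp: S_def U_def)
    qed
    then have "card (A l \<inter> (\<Union>l'\<in>L - {l}. A l')) \<le> card (A l \<inter> S)" using A(1)[OF l] by (intro card_mono) auto
    then show ?thesis using overlap[OF l] by linarith
  qed
  have swap: "(\<Sum>u\<in>V. d u) = (\<Sum>l\<in>L. card (A l \<inter> V))" if V: "V \<subseteq> U" for V
  proof -
    have fV: "finite V" using V U finite_subset by auto
    have "(\<Sum>u\<in>V. d u) = (\<Sum>l\<in>L. \<Sum>u\<in>V. if u \<in> A l then 1 else 0)" unfolding d_def by (rule sum.swap)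
    also have "\<dots> = (\<Sum>l\<in>L. card (A l \<inter> V))"
      using fV by (intro sum.cong) (auto simp: sum.If_cases Int_def conj_commute)
    finally show ?thesis .
  qed
  have "2 * card U + (\<Sum>u\<in>S. d u) = (\<Sum>u\<in>U. 2 + (if u \<in> S then d u else 0))"
  proof -
    have "(\<Sum>u\<in>S. d u) = (\<Sum>u\<in>U. if u \<in> S then d u else 0)"
      using U by (intro sum.mono_neutral_cong_left) (auto simp: S_def)
    then show ?thesis by (simp only: sum.distrib) simp
  qed
  also have "\<dots> \<le> (\<Sum>u\<in>U. 2 * d u)"
  proof (intro sum_mono)
    fix u assume u: "u \<in> U"
    then obtain l where "l \<in> L" "u \<in> A l" by (auto simp: U_def)
    then have "{l \<in> L. u \<in> A l} \<noteq> {}" by auto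
    then have "d u \<ge> 1" using L by (simp add: d_card Suc_le_eq card_gt_0_iff)
    then show "2 + (if u \<in> S then d u else 0) \<le> 2 * d u" using u by (auto simp: S_def)
  qed
  finally have 1: "2 * card U + (\<Sum>u\<in>S. d u) \<le> 2 * (\<Sum>u\<in>U. d u)" by (simp add: sum_distrib_left)
  have 2: "(\<Sum>u\<in>U. d u) = card L * m"
  proof -
    have "(\<Sum>u\<in>U. d u) = (\<Sum>l\<in>L. card (A l \<inter> U))" by (rule swap) simp
    also have "\<dots> = (\<Sum>l\<in>L. m)"
    proof (intro sum.cong refl)
      fix l assume l: "l \<in> L"
      then have "A l \<inter> U = A l" by (auto simp: U_def)
      then show "card (A l \<inter> U) = m" using A(2)[OF l] by simp
    qed
    finally show ?thesis by simp
  qed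
  have 3: "2 * card L \<le> (\<Sum>u\<in>S. d u)"
  proof -
    have "(\<Sum>l\<in>L. 2) \<le> (\<Sum>l\<in>L. card (A l \<inter> S))" using AS by (intro sum_mono) auto
    then show ?thesis using swap[of S] by (simp add: S_def)
  qed
  show ?thesis using 1 2 3 unfolding U_def[symmetric] by linarith
qed

text \<open>
  A family is determined by an enumeration of its support by \<open>{..<s}\<close> and a pattern of positions.\<close>

lemma card_families_small_support:
  fixes T :: "(nat \<Rightarrow> nat) set"
  assumes T: "T \<subseteq> {..<m} \<rightarrow>\<^sub>E {1..n}" and m: "m \<ge> 1" and q: "q \<ge> 1"
  shows "finite {F \<in> {..<q} \<rightarrow>\<^sub>E T. card (\<Union>l<q. F l ` {..<m}) \<le> s}"
    and "card {F \<in> {..<q} \<rightarrow>\<^sub>E T. card (\<Union>l<q. F l ` {..<m}) \<le> s} \<le> n ^ s * (s ^ m) ^ q"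
proof -
  let ?G = "{F \<in> {..<q} \<rightarrow>\<^sub>E T. card (\<Union>l<q. F l ` {..<m}) \<le> s}"
  let ?P = "({..<s} \<rightarrow>\<^sub>E {1..n}) \<times> ({..<q} \<rightarrow>\<^sub>E ({..<m} \<rightarrow>\<^sub>E {..<s}))"
  let ?\<Phi> = "\<lambda>(f, c). \<lambda>l\<in>{..<q}. \<lambda>j\<in>{..<m}. f (c l j) :: nat"
  have finP: "finite ?P" by (intro finite_cartesian_product finite_PiE) auto
  have sub: "?G \<subseteq> ?\<Phi> ` ?P"
  proof
    fix F assume F: "F \<in> ?G"
    define U where "U = (\<Union>l<q. F l ` {..<m})"
    have FT: "F l \<in> {..<m} \<rightarrow>\<^sub>E {1..n}" if "l < q" for l using F T that by (auto simp: PiE_iff)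
    have "F 0 0 \<in> U" unfolding U_def using m q by (intro UN_I[of 0] imageI) auto
    then have U: "finite U" "U \<subseteq> {1..n}" "card U \<le> s" "U \<noteq> {}"
      using F FT by (auto simp: U_def PiE_iff)
    obtain b where b: "bij_betw b {0..<card U} U" using ex_bij_betw_nat_finite[OF U(1)] by auto
    have c0: "0 < card U" using U by (simp add: card_gt_0_iff)
    \<comment> \<open>When the support has fewer than \<open>s\<close> elements the enumeration is
      padded with its first value, so that every family is coded with exactly \<open>s\<close>
      slots.\<close>
    define f where "f = (\<lambda>k\<in>{..<s}. if k < card U then b k else b 0)"
    have bU: "b k \<in> U" if "k < card U" for k using b that by (auto simp: bij_betw_def)
    have f: "f \<in> {..<s} \<rightarrow>\<^sub>E {1..n}"
    proof -
      have "b k \<in> {1..n}" if "k < card U" for k using bU[OF that] U(2) by auto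
      then show ?thesis unfolding f_def using c0 by (intro restrict_PiE_iff[THEN iffD2]) (auto simp del: atLeastAtMost_iff)
    qed
    have ex: "\<exists>k<s. f k = u" if "u \<in> U" for u
    proof -
      have "u \<in> b ` {0..<card U}" using b that by (simp add: bij_betw_def)
      then obtain k where "k < card U" "b k = u" by auto
      then show ?thesis using U(3) by (intro exI[of _ k]) (auto simp: f_def)
    qed
    define c where "c = (\<lambda>l\<in>{..<q}. \<lambda>j\<in>{..<m}. SOME k. k < s \<and> f k = F l j)"
    have ck: "(SOME k. k < s \<and> f k = F l j) < s" "f (SOME k. k < s \<and> f k = F l j) = F l j" if "l < q" "j < m" for l j
    proof -
      have "F l j \<in> U" using that by (auto simp: U_def)
      from someI_ex[OF ex[OF this]] show "(SOME k. k < s \<and> f k = F l j) < s" "f (SOME k. k < s \<and> f k = F l j) = F l j" by auto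
    qed
    have c: "c \<in> {..<q} \<rightarrow>\<^sub>E ({..<m} \<rightarrow>\<^sub>E {..<s})"
      unfolding c_def using ck(1) by (intro restrict_PiE_iff[THEN iffD2] ballI) auto
    have "?\<Phi> (f, c) = F"
    proof (rule ext)
      fix l
      show "?\<Phi> (f, c) l = F l"
      proof (cases "l < q")
        case True
        have "?\<Phi> (f, c) l = (\<lambda>j\<in>{..<m}. f (SOME k. k < s \<and> f k = F l j))" using True by (auto simp: c_def intro!: restrict_ext)
        also have "\<dots> = (\<lambda>j\<in>{..<m}. F l j)" using ck(2)[OF True] by (intro restrict_ext) auto
        also have "\<dots> = F l" using FT[OF True] by (rule PiE_restrict)
        finally show ?thesis .
      next
        case False
        then show ?thesis using F by (auto simp: PiE_iff extensional_def)
      qed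
    qed
    then show "F \<in> ?\<Phi> ` ?P" using f c by (intro image_eqI[of _ _ "(f, c)"]) (auto simp only: mem_Sigma_iff)
  qed
  show "finite ?G" by (rule finite_subset[OF sub]) (intro finite_imageI finP)
  have "card ?G \<le> card (?\<Phi> ` ?P)" by (intro card_mono sub finite_imageI finP)
  also have "\<dots> \<le> card ?P" by (rule card_image_le[OF finP])
  also have "\<dots> = n ^ s * (s ^ m) ^ q" by (simp add: card_cartesian_product card_PiE)
  finally show "card ?G \<le> n ^ s * (s ^ m) ^ q" .
qed

text \<open>A product is at most a power of its largest factor, and that power is one term of the
  sum. The exception is genuine: the empty product is 1, the empty sum 0.\<close>

lemma abs_prod_le_sum_power:
  fixes a :: "'i \<Rightarrow> real"
  assumes L: "finite L"
  shows "\<bar>\<Prod>l\<in>L. a l\<bar> \<le> (\<Sum>l\<in>L. \<bar>a l\<bar> ^ card L) \<or> L = {}"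
proof (cases "L = {}")
  case False
  define c where "c = Max ((\<lambda>l. \<bar>a l\<bar>) ` L)"
  have "c \<in> (\<lambda>l. \<bar>a l\<bar>) ` L" unfolding c_def using L False by (intro Max_in) auto
  then obtain l0 where l0: "l0 \<in> L" "c = \<bar>a l0\<bar>" by auto
  have "\<bar>\<Prod>l\<in>L. a l\<bar> = (\<Prod>l\<in>L. \<bar>a l\<bar>)" by (simp add: abs_prod)
  also have "\<dots> \<le> (\<Prod>l\<in>L. c)" unfolding c_def using L by (intro prod_mono) auto
  also have "\<dots> = \<bar>a l0\<bar> ^ card L" using l0 by simp
  also have "\<dots> \<le> (\<Sum>l\<in>L. \<bar>a l\<bar> ^ card L)" using l0 L by (intro member_le_sum) auto
  finally show ?thesis by simp
qed simp

lemma abs_sum_power_le: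
  fixes a :: "'i \<Rightarrow> real"
  assumes L: "finite L" and q: "q \<ge> 1"
  shows "\<bar>\<Sum>l\<in>L. a l\<bar> ^ q \<le> real (card L) ^ q * (\<Sum>l\<in>L. \<bar>a l\<bar> ^ q)"
proof (cases "L = {}")
  case True
  then show ?thesis using q by (simp add: power_0_left)
next
  case False
  define c where "c = Max ((\<lambda>l. \<bar>a l\<bar>) ` L)"
  have "c \<in> (\<lambda>l. \<bar>a l\<bar>) ` L" unfolding c_def using L False by (intro Max_in) auto
  then obtain l0 where l0: "l0 \<in> L" "c = \<bar>a l0\<bar>" by auto
  have "\<bar>\<Sum>l\<in>L. a l\<bar> \<le> (\<Sum>l\<in>L. \<bar>a l\<bar>)" by (rule sum_abs)
  also have "\<dots> \<le> (\<Sum>l\<in>L. c)" unfolding c_def using L by (intro sum_mono) auto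
  finally have "\<bar>\<Sum>l\<in>L. a l\<bar> ^ q \<le> (real (card L) * c) ^ q" by (intro power_mono) auto
  also have "\<dots> = real (card L) ^ q * \<bar>a l0\<bar> ^ q" using l0 by (simp add: power_mult_distrib)
  also have "\<dots> \<le> real (card L) ^ q * (\<Sum>l\<in>L. \<bar>a l\<bar> ^ q)" using l0 L by (intro mult_left_mono member_le_sum) auto
  finally show ?thesis .
qed

section \<open>Even moments of the remainder\<close>

context U_kernel
begin

lemma finite_increasing_tuples: "finite (increasing_tuples m n)"
  by (rule finite_subset[of _ "{..<m} \<rightarrow>\<^sub>E {1..n}"]) (auto simp: increasing_tuples_def intro: finite_PiE)

lemma integrable_power_lower:
  fixes f :: "'b \<Rightarrow> real"
  assumes "finite_measure P" "f \<in> borel_measurable P" "integrable P (\<lambda>x. f x ^ (2 * r))" "r \<ge> 1"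
  shows "integrable P f"
proof (rule Bochner_Integration.integrable_bound[OF _ assms(2)])
  interpret finite_measure P by fact
  show "integrable P (\<lambda>x. 1 + f x ^ (2 * r))" using assms(3) by auto
  show "AE x in P. norm (f x) \<le> norm (1 + f x ^ (2 * r))"
  proof (intro AE_I2)
    fix x
    have "\<bar>f x\<bar> \<le> 1 + \<bar>f x\<bar> ^ (2 * r)"
    proof (cases "\<bar>f x\<bar> \<le> 1")
      case False
      then show ?thesis using power_increasing[of 1 "2 * r" "\<bar>f x\<bar>"] assms(4) by simp
    qed (simp add: add_increasing2)
    then show "norm (f x) \<le> norm (1 + f x ^ (2 * r))" by (simp add: power_mult)
  qed
qed

lemma reindex_law:
  assumes i: "inj_on i {..<m}" "i ` {..<m} \<subseteq> N"
  shows "distr (PI N) (PI {..<m}) (\<lambda>x. \<lambda>j\<in>{..<m}. x (i j)) = PI {..<m}"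
  by (rule distr_PiM_reindex[of N "\<lambda>_. \<mu>" i "{..<m}"]) (use i prob_space_axioms in auto)

context
  fixes r :: nat
  assumes r: "r \<ge> 1" and hr: "integrable (PI {..<m}) (\<lambda>x. h x ^ (2 * r))"
begin

lemma h_integrable: "integrable (PI {..<m}) h"
  using r hr by (intro integrable_power_lower[OF prob_space.finite_measure[OF prob_space_PI] _ hr]) auto

lemma ghat_power_integrable: "integrable \<mu> (\<lambda>y. ghat y ^ (2 * r))"
proof (rule integrableI_bounded)
  have "(\<integral>\<^sup>+y. ennreal (norm (ghat y ^ (2 * r))) \<partial>\<mu>) = (\<integral>\<^sup>+y. ennreal (\<bar>ghat y\<bar> powr real (2 * r)) \<partial>\<mu>)"
    using r by (intro nn_integral_cong arg_cong[where f=ennreal]) (simp add: powr_realpow' power_abs del: of_nat_mult)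
  also have "\<dots> \<le> (\<integral>\<^sup>+x. ennreal (\<bar>h x\<bar> powr real (2 * r)) \<partial>PI {..<m})"
    using r by (intro ghat_moment_le) simp
  also have "\<dots> = (\<integral>\<^sup>+x. ennreal (norm (h x ^ (2 * r))) \<partial>PI {..<m})"
    using r by (intro nn_integral_cong arg_cong[where f=ennreal]) (simp add: powr_realpow' power_abs del: of_nat_mult)
  also have "\<dots> < \<infinity>" using hr by (simp add: integrable_iff_bounded)
  finally show "(\<integral>\<^sup>+y. ennreal (norm (ghat y ^ (2 * r))) \<partial>\<mu>) < \<infinity>" .
qed measurable

lemma ghat_integrable: "integrable \<mu> ghat"
  using r by (intro integrable_power_lower[OF finite_measure_axioms _ ghat_power_integrable]) auto

text \<open>Comes from (a - b)^(2r) \<le> 2^(2r) (a^(2r) + b^(2r)) and a bound of the same kind for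
  the sum of m terms. It depends neither on the tuple nor on n.\<close>

definition resid_bound :: real where
  "resid_bound = 2 ^ (2 * r) * ((\<integral>x. h x ^ (2 * r) \<partial>PI {..<m}) + real m ^ (2 * r) * (real m * (\<integral>y. ghat y ^ (2 * r) \<partial>\<mu>)))"

lemma resid_power:
  assumes i: "inj_on i {..<m}" "i ` {..<m} \<subseteq> N"
  shows "integrable (PI N) (\<lambda>x. resid i x ^ (2 * r))" "(\<integral>x. resid i x ^ (2 * r) \<partial>PI N) \<le> resid_bound"
proof -
  let ?q = "2 * r"
  have hm: "(\<lambda>x. h x ^ ?q) \<in> borel_measurable (PI {..<m})" by measurable
  have H: "integrable (PI N) (\<lambda>x. h (\<lambda>j\<in>{..<m}. x (i j)) ^ ?q)"
    "(\<integral>x. h (\<lambda>j\<in>{..<m}. x (i j)) ^ ?q \<partial>PI N) = (\<integral>x. h x ^ ?q \<partial>PI {..<m})"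
    using integrable_distr[OF reindex_meas[OF i(2)], of "\<lambda>x. h x ^ ?q"] hr integral_distr[OF reindex_meas[OF i(2)] hm]
    by (simp_all add: reindex_law[OF i])
  have G: "integrable (PI N) (\<lambda>x. ghat (x k) ^ ?q)" "(\<integral>x. ghat (x k) ^ ?q \<partial>PI N) = (\<integral>y. ghat y ^ ?q \<partial>\<mu>)" if k: "k \<in> N" for k
  proof -
    have d: "distr (PI N) \<mu> (\<lambda>y. y k) = \<mu>" by (rule distr_PiM_component[OF prob_space_axioms k])
    have mk: "(\<lambda>y. y k) \<in> PI N \<rightarrow>\<^sub>M \<mu>" using k by (rule measurable_component_singleton)
    show "integrable (PI N) (\<lambda>x. ghat (x k) ^ ?q)"
      using integrable_distr[OF mk, of "\<lambda>y. ghat y ^ ?q"] ghat_power_integrable d by simp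
    have "(\<integral>x. ghat (x k) ^ ?q \<partial>PI N) = (\<integral>u. ghat u ^ ?q \<partial>distr (PI N) \<mu> (\<lambda>y. y k))"
      by (rule integral_distr[OF mk, symmetric]) simp
    then show "(\<integral>x. ghat (x k) ^ ?q \<partial>PI N) = (\<integral>y. ghat y ^ ?q \<partial>\<mu>)" using d by simp
  qed
  let ?dom = "\<lambda>x. 2 ^ ?q * (h (\<lambda>j\<in>{..<m}. x (i j)) ^ ?q + real m ^ ?q * (\<Sum>j<m. ghat (x (i j)) ^ ?q))"
  have ij: "i j \<in> N" if "j \<in> {..<m}" for j using i(2) that by auto
  have dom_int: "integrable (PI N) ?dom"
    using H(1) G(1) ij by (intro integrable_mult_right Bochner_Integration.integrable_add Bochner_Integration.integrable_sum) auto
  have le: "resid i x ^ ?q \<le> ?dom x" for x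
  proof -
    let ?a = "h (\<lambda>j\<in>{..<m}. x (i j))" and ?b = "\<Sum>j<m. ghat (x (i j))"
    have "resid i x ^ ?q = \<bar>?a - ?b\<bar> ^ ?q" by (simp add: resid_def power_mult)
    also have "\<dots> \<le> (2 * max \<bar>?a\<bar> \<bar>?b\<bar>) ^ ?q" by (intro power_mono) auto
    also have "\<dots> = 2 ^ ?q * max \<bar>?a\<bar> \<bar>?b\<bar> ^ ?q" by (rule power_mult_distrib)
    also have "\<dots> \<le> 2 ^ ?q * (\<bar>?a\<bar> ^ ?q + \<bar>?b\<bar> ^ ?q)" by (intro mult_left_mono) (auto simp: max_def)
    also have "\<dots> \<le> 2 ^ ?q * (\<bar>?a\<bar> ^ ?q + real (card {..<m}) ^ ?q * (\<Sum>j<m. \<bar>ghat (x (i j))\<bar> ^ ?q))"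
      using r by (intro mult_left_mono add_left_mono abs_sum_power_le) auto
    also have "\<dots> = ?dom x" by (simp add: power_mult)
    finally show ?thesis .
  qed
  show int: "integrable (PI N) (\<lambda>x. resid i x ^ ?q)"
  proof (rule Bochner_Integration.integrable_bound[OF dom_int])
    show "(\<lambda>x. resid i x ^ ?q) \<in> borel_measurable (PI N)" by (intro borel_measurable_power resid_meas[OF i(2)])
    show "AE x in PI N. norm (resid i x ^ ?q) \<le> norm (?dom x)"
    proof (rule AE_I2)
      fix x
      have "norm (resid i x ^ ?q) = resid i x ^ ?q" by (simp add: power_mult)
      also note le[of x]
      also have "?dom x \<le> norm (?dom x)" unfolding real_norm_def by (rule abs_ge_self)
      finally show "norm (resid i x ^ ?q) \<le> norm (?dom x)" .
    qed
  qed
  have "(\<integral>x. resid i x ^ ?q \<partial>PI N) \<le> (\<integral>x. ?dom x \<partial>PI N)"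
    using int dom_int le by (intro integral_mono) auto
  also have "\<dots> = 2 ^ ?q * ((\<integral>x. h (\<lambda>j\<in>{..<m}. x (i j)) ^ ?q \<partial>PI N) + real m ^ ?q * (\<Sum>j<m. \<integral>x. ghat (x (i j)) ^ ?q \<partial>PI N))"
  proof -
    have S: "integrable (PI N) (\<lambda>x. \<Sum>j<m. ghat (x (i j)) ^ ?q)"
      "(\<integral>x. (\<Sum>j<m. ghat (x (i j)) ^ ?q) \<partial>PI N) = (\<Sum>j<m. \<integral>x. ghat (x (i j)) ^ ?q \<partial>PI N)"
      using G(1) ij by (intro Bochner_Integration.integrable_sum Bochner_Integration.integral_sum; auto)+
    show ?thesis
      unfolding integral_mult_right_zero Bochner_Integration.integral_add[OF H(1) integrable_mult_right[OF S(1)]] S(2) ..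
  qed
  also have "\<dots> = resid_bound"
    using H(2) G(2) ij by (simp add: resid_bound_def)
  finally show "(\<integral>x. resid i x ^ ?q \<partial>PI N) \<le> resid_bound" .
qed

text \<open>The first factor of the constant counts the position patterns of a family, the second
  bounds the mean of one product through the 2r-th moments of its factors. An integer exponent lets
  the power expand into products; an even one lets it stand for an absolute moment.\<close>

lemma resid_sum_moment:
  assumes h0: "(\<integral>x. h x \<partial>PI {..<m}) = 0"
  shows "integrable (PI {1..n}) (\<lambda>x. (\<Sum>i\<in>increasing_tuples m n. resid i x) ^ (2 * r))"
    and "(\<integral>x. (\<Sum>i\<in>increasing_tuples m n. resid i x) ^ (2 * r) \<partial>PI {1..n})
      \<le> real ((2 * r * (m - 1)) ^ m) ^ (2 * r) * (real (2 * r) * resid_bound) * real n ^ (2 * r * (m - 1))"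
proof -
  define q where "q = 2 * r"
  define s where "s = q * (m - 1)"
  let ?T = "increasing_tuples m n"
  let ?N = "{1..n}"
  have q: "q \<ge> 1" "2 * r = q" using r by (auto simp: q_def)
  have g0: "(\<integral>y. ghat y \<partial>\<mu>) = 0"
    using integral_split[OF h_integrable] h0 by (simp add: ghat_def)
  have T: "i \<in> {..<m} \<rightarrow>\<^sub>E {1..n}" "inj_on i {..<m}" "i ` {..<m} \<subseteq> ?N" if "i \<in> ?T" for i
    using that by (auto simp: increasing_tuples_def strict_mono_on_imp_inj_on)
  have expand: "(\<Sum>i\<in>?T. resid i x) ^ q = (\<Sum>F\<in>{..<q} \<rightarrow>\<^sub>E ?T. \<Prod>l<q. resid (F l) x)" for x
    using prod_sum_PiE[of "{..<q}" "\<lambda>_. ?T" "\<lambda>_ i. resid i x"] finite_increasing_tuples by simp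
  have FT: "F l \<in> ?T" if "F \<in> {..<q} \<rightarrow>\<^sub>E ?T" "l < q" for F l using that by auto
  let ?pr = "\<lambda>F x. \<Prod>l<q. resid (F l) x"
  let ?dm = "\<lambda>F x. \<Sum>l<q. resid (F l) x ^ q"
  have dom: "\<bar>?pr F x\<bar> \<le> ?dm F x" for F x
    using abs_prod_le_sum_power[of "{..<q}" "\<lambda>l. resid (F l) x"] q(1) by (auto simp: q_def power_mult lessThan_empty_iff)
  have dm_int: "integrable (PI ?N) (?dm F)" if F: "F \<in> {..<q} \<rightarrow>\<^sub>E ?T" for F
    using resid_power(1)[OF T(2,3)[OF FT[OF F]]] by (intro Bochner_Integration.integrable_sum) (auto simp: q(2))
  have pr_meas: "?pr F \<in> borel_measurable (PI ?N)" if F: "F \<in> {..<q} \<rightarrow>\<^sub>E ?T" for F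
    by (intro borel_measurable_prod resid_meas T(3) FT[OF F]) auto
  have pr_int: "integrable (PI ?N) (?pr F)" if F: "F \<in> {..<q} \<rightarrow>\<^sub>E ?T" for F
    by (rule Bochner_Integration.integrable_bound[OF dm_int[OF F] pr_meas[OF F]]) (auto intro!: AE_I2 order_trans[OF dom abs_ge_self])
  have pr_le: "(\<integral>x. ?pr F x \<partial>PI ?N) \<le> real q * resid_bound" if F: "F \<in> {..<q} \<rightarrow>\<^sub>E ?T" for F
  proof -
    have "(\<integral>x. ?pr F x \<partial>PI ?N) \<le> (\<integral>x. ?dm F x \<partial>PI ?N)"
      using pr_int[OF F] dm_int[OF F] by (intro integral_mono) (auto intro: order_trans[OF abs_ge_self dom])
    also have "\<dots> = (\<Sum>l<q. \<integral>x. resid (F l) x ^ q \<partial>PI ?N)"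
      using resid_power(1)[OF T(2,3)[OF FT[OF F]]] by (intro Bochner_Integration.integral_sum) (auto simp: q(2))
    also have "\<dots> \<le> (\<Sum>l<q. resid_bound)"
      using resid_power(2)[OF T(2,3)[OF FT[OF F]]] by (intro sum_mono) (auto simp: q(2))
    finally show ?thesis by simp
  qed
  \<comment> \<open>Contrapositive of \<open>card_Union_overlapping\<close>: a support of more than
    \<open>s\<close> indices forces a tuple that meets the others in at most one index.\<close>
  have pr_0: "(\<integral>x. ?pr F x \<partial>PI ?N) = 0" if F: "F \<in> {..<q} \<rightarrow>\<^sub>E ?T" and bad: "\<not> card (\<Union>l<q. F l ` {..<m}) \<le> s" for F
  proof -
    have "\<exists>l0<q. card (F l0 ` {..<m} \<inter> (\<Union>l\<in>{..<q} - {l0}. F l ` {..<m})) \<le> 1"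
    proof (rule ccontr)
      assume "\<not> ?thesis"
      then have "card (\<Union>l\<in>{..<q}. F l ` {..<m}) + card {..<q} \<le> card {..<q} * m"
        using T(2)[OF FT[OF F]] by (intro card_Union_overlapping) (auto simp: card_image not_le Suc_le_eq)
      then have "card (\<Union>l<q. F l ` {..<m}) \<le> s" by (simp add: s_def algebra_simps diff_mult_distrib2)
      then show False using bad by simp
    qed
    then obtain l0 where l0: "l0 < q" "card (F l0 ` {..<m} \<inter> (\<Union>l\<in>{..<q} - {l0}. F l ` {..<m})) \<le> 1" by auto
    let ?R = "\<lambda>x. \<Prod>l\<in>{..<q} - {l0}. resid (F l) x"
    have split: "?pr F x = resid (F l0) x * ?R x" for x using l0 by (intro prod.remove) auto
    have "(\<integral>x. resid (F l0) x * ?R x \<partial>PI ?N) = 0"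
    proof (rule resid_orthogonal[OF ghat_integrable g0 _ T(2,3)[OF FT[OF F l0(1)]] _ _ l0(2)])
      show "integrable (PI ?N) (\<lambda>x. resid (F l0) x * ?R x)" using pr_int[OF F] by (simp only: split)
      show "?R x = ?R y" if "\<And>k. k \<in> (\<Union>l\<in>{..<q} - {l0}. F l ` {..<m}) \<Longrightarrow> x k = y k" for x y
        using that by (intro prod.cong refl resid_cong) auto
      show "(\<Union>l\<in>{..<q} - {l0}. F l ` {..<m}) \<subseteq> ?N" using T(3)[OF FT[OF F]] by auto
    qed simp
    then show ?thesis by (simp only: split)
  qed
  show "integrable (PI ?N) (\<lambda>x. (\<Sum>i\<in>?T. resid i x) ^ (2 * r))"
    unfolding q(2) expand using pr_int by (intro Bochner_Integration.integrable_sum) auto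
  let ?G = "{F \<in> {..<q} \<rightarrow>\<^sub>E ?T. card (\<Union>l<q. F l ` {..<m}) \<le> s}"
  have Tsub: "?T \<subseteq> {..<m} \<rightarrow>\<^sub>E {1..n}" using T(1) by auto
  have finF: "finite ({..<q} \<rightarrow>\<^sub>E ?T)" using finite_increasing_tuples by (intro finite_PiE) auto
  have rb: "resid_bound \<ge> 0" unfolding resid_bound_def by (intro mult_nonneg_nonneg add_nonneg_nonneg integral_nonneg) (auto simp: power_mult)
  have "(\<integral>x. (\<Sum>i\<in>?T. resid i x) ^ q \<partial>PI ?N) = (\<Sum>F\<in>{..<q} \<rightarrow>\<^sub>E ?T. \<integral>x. ?pr F x \<partial>PI ?N)"
    unfolding expand using pr_int by (intro Bochner_Integration.integral_sum) auto
  also have "\<dots> = (\<Sum>F\<in>?G. \<integral>x. ?pr F x \<partial>PI ?N)"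
    using finF pr_0 by (intro sum.mono_neutral_right) auto
  also have "\<dots> \<le> (\<Sum>F\<in>?G. real q * resid_bound)" using pr_le by (intro sum_mono) auto
  also have "\<dots> = real (card ?G) * (real q * resid_bound)" by simp
  also have "\<dots> \<le> real (n ^ s * (s ^ m) ^ q) * (real q * resid_bound)"
    using card_families_small_support(2)[OF Tsub m q(1), of s] rb by (intro mult_right_mono) (simp_all only: of_nat_le_iff, simp)
  finally show "(\<integral>x. (\<Sum>i\<in>?T. resid i x) ^ (2 * r) \<partial>PI ?N)
      \<le> real ((2 * r * (m - 1)) ^ m) ^ (2 * r) * (real (2 * r) * resid_bound) * real n ^ (2 * r * (m - 1))"
    unfolding q(2) s_def[symmetric] by (simp add: mult_ac)
qed

end

end

text \<open>A tuple through k corresponds to the set of its other m - 1 entries; sorting that set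
  together with k recovers the tuple.\<close>

lemma card_increasing_tuples_containing:
  assumes k: "k \<in> {1..n}" and m: "m \<ge> 1"
  shows "card {i \<in> increasing_tuples m n. k \<in> i ` {..<m}} = (n - 1) choose (m - 1)"
proof -
  let ?A = "{i \<in> increasing_tuples m n. k \<in> i ` {..<m}}"
  let ?B = "{B. B \<subseteq> {1..n} - {k} \<and> card B = m - 1}"
  let ?f = "\<lambda>i. i ` {..<m} - {k}"
  let ?g = "\<lambda>B. \<lambda>j\<in>{..<m}. sorted_list_of_set (insert k B) ! j"
  have B: "finite (insert k B)" "card (insert k B) = m" if "B \<in> ?B" for B
  proof -
    have "finite B" using that finite_subset by blast
    then show "finite (insert k B)" "card (insert k B) = m" using that m by (auto simp: card_insert_if)
  qed
  have g_image: "?g B ` {..<m} = insert k B" if "B \<in> ?B" for B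
  proof -
    have "?g B ` {..<m} = (!) (sorted_list_of_set (insert k B)) ` {..<m}" by (intro image_cong) auto
    also have "\<dots> = set (sorted_list_of_set (insert k B))"
    proof -
      have "(!) l ` {..<length l} = set l" for l :: "nat list" by (auto simp: set_conv_nth)
      then show ?thesis using B(2)[OF that] by (metis length_sorted_list_of_set)
    qed
    finally show ?thesis by (simp only: set_sorted_list_of_set[OF B(1)[OF that]])
  qed
  have "bij_betw ?f ?A ?B"
  proof (rule bij_betw_byWitness[where f' = ?g])
    show "\<forall>i\<in>?A. ?g (?f i) = i"
    proof
      fix i assume i: "i \<in> ?A"
      have ins: "insert k (?f i) = i ` {..<m}" using i by auto
      have mono: "i a < i b" if "a < b" "b < m" for a b
        using i that by (auto simp: increasing_tuples_def strict_mono_on_def)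
      have "sorted_list_of_set (i ` {..<m}) = map i [0..<m]"
      proof (rule strict_sorted_equal)
        show "sorted_wrt (<) (map i [0..<m])" by (auto simp: sorted_wrt_iff_nth_less mono)
        show "sorted_wrt (<) (sorted_list_of_set (i ` {..<m}))" by (rule strict_sorted_list_of_set)
        show "set (sorted_list_of_set (i ` {..<m})) = set (map i [0..<m])" by (simp add: lessThan_atLeast0)
      qed
      then have "?g (?f i) = (\<lambda>j\<in>{..<m}. map i [0..<m] ! j)" unfolding ins by simp
      also have "\<dots> = (\<lambda>j\<in>{..<m}. i j)" by (intro restrict_ext) auto
      also have "\<dots> = i" using i by (intro PiE_restrict[of _ _ "\<lambda>_. {1..n}"]) (auto simp: increasing_tuples_def)
      finally show "?g (?f i) = i" .
    qed
    show "\<forall>B\<in>?B. ?f (?g B) = B"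
    proof
      fix B assume b: "B \<in> ?B"
      then have "k \<notin> B" by auto
      then show "?f (?g B) = B" unfolding g_image[OF b] by auto
    qed
    show "?f ` ?A \<subseteq> ?B"
    proof
      fix B assume "B \<in> ?f ` ?A"
      then obtain i where i: "i \<in> ?A" "B = ?f i" by auto
      then have "inj_on i {..<m}" by (auto simp: increasing_tuples_def strict_mono_on_imp_inj_on)
      then have "card (i ` {..<m}) = m" by (simp add: card_image)
      moreover have "k \<in> i ` {..<m}" "i ` {..<m} \<subseteq> {1..n}" using i by (auto simp: increasing_tuples_def)
      ultimately show "B \<in> ?B" using i(2) by (auto simp: card_Diff_singleton)
    qed
    show "?g ` ?B \<subseteq> ?A"
    proof
      fix i assume "i \<in> ?g ` ?B"
      then obtain B where b: "B \<in> ?B" "i = ?g B" by auto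
      let ?l = "sorted_list_of_set (insert k B)"
      have len: "length ?l = m" using B(2)[OF b(1)] by (simp del: sorted_list_of_set_insert_remove)
      have img: "i ` {..<m} = insert k B" unfolding b(2) by (rule g_image[OF b(1)])
      have sub: "i ` {..<m} \<subseteq> {1..n}" unfolding img using b(1) k by auto
      have str: "sorted_wrt (<) ?l" by (rule strict_sorted_list_of_set)
      have "strict_mono_on {..<m} i"
      proof (rule strict_mono_onI)
        fix a c assume ac: "a \<in> {..<m}" "c \<in> {..<m}" "a < c"
        then have "?l ! a < ?l ! c" using str len by (simp add: sorted_wrt_iff_nth_less del: sorted_list_of_set_insert_remove)
        then show "i a < i c" using ac by (simp add: b(2) del: sorted_list_of_set_insert_remove)
      qed
      moreover have "i \<in> {..<m} \<rightarrow>\<^sub>E {1..n}"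
        using sub unfolding b(2) by (intro restrict_PiE_iff[THEN iffD2] ballI) (auto simp del: sorted_list_of_set_insert_remove atLeastAtMost_iff)
      ultimately show "i \<in> ?A" using img by (auto simp: increasing_tuples_def)
    qed
  qed
  then have "card ?A = card ?B" by (rule bij_betw_same_card)
  also have "\<dots> = card ({1..n} - {k}) choose (m - 1)" by (rule n_subsets) simp
  also have "card ({1..n} - {k}) = n - 1" using k by (simp add: card_Diff_singleton)
  finally show ?thesis .
qed

text \<open>All indices occur in equally many tuples, so the first-order part of the statistic is a
  multiple of an i.i.d. sum.\<close>

lemma sum_increasing_tuples_components:
  fixes f :: "nat \<Rightarrow> real"
  assumes m: "m \<ge> 1"
  shows "(\<Sum>i\<in>increasing_tuples m n. \<Sum>j<m. f (i j)) = real ((n - 1) choose (m - 1)) * (\<Sum>k\<in>{1..n}. f k)"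
proof -
  let ?T = "increasing_tuples m n"
  have fin: "finite ?T"
    by (rule finite_subset[of _ "{..<m} \<rightarrow>\<^sub>E {1..n}"]) (auto simp: increasing_tuples_def intro: finite_PiE)
  have "(\<Sum>i\<in>?T. \<Sum>j<m. f (i j)) = (\<Sum>i\<in>?T. \<Sum>k\<in>{1..n}. if k \<in> i ` {..<m} then f k else 0)"
  proof (rule sum.cong[OF refl])
    fix i assume i: "i \<in> ?T"
    then have inj: "inj_on i {..<m}" and sub: "i ` {..<m} \<subseteq> {1..n}"
      by (auto simp: increasing_tuples_def strict_mono_on_imp_inj_on)
    have "(\<Sum>j<m. f (i j)) = (\<Sum>k\<in>i ` {..<m}. f k)" using inj by (simp add: sum.reindex)
    also have "\<dots> = (\<Sum>k\<in>{1..n}. if k \<in> i ` {..<m} then f k else 0)"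
      using sub by (intro sum.mono_neutral_cong_left) auto
    finally show "(\<Sum>j<m. f (i j)) = (\<Sum>k\<in>{1..n}. if k \<in> i ` {..<m} then f k else 0)" .
  qed
  also have "\<dots> = (\<Sum>k\<in>{1..n}. \<Sum>i\<in>?T. if k \<in> i ` {..<m} then f k else 0)" by (rule sum.swap)
  also have "\<dots> = (\<Sum>k\<in>{1..n}. real ((n - 1) choose (m - 1)) * f k)"
  proof (intro sum.cong refl)
    fix k assume k: "k \<in> {1..n}"
    have "(\<Sum>i\<in>?T. if k \<in> i ` {..<m} then f k else 0) = (\<Sum>i\<in>{i \<in> ?T. k \<in> i ` {..<m}}. f k)"
      using fin by (intro sum.mono_neutral_cong_right) auto
    also have "\<dots> = real ((n - 1) choose (m - 1)) * f k"
      using card_increasing_tuples_containing[OF k m] by simp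
    finally show "(\<Sum>i\<in>?T. if k \<in> i ` {..<m} then f k else 0) = real ((n - 1) choose (m - 1)) * f k" .
  qed
  finally show ?thesis by (simp add: sum_distrib_left)
qed

text \<open>Serves to compare the standard deviation of the statistic with that of its first-order
  part, which takes the two-sided form. The Cauchy-Schwarz inequality is derived on the way.\<close>

lemma L2_triangle:
  fixes f g :: "'b \<Rightarrow> real"
  assumes meas[measurable]: "f \<in> borel_measurable P" "g \<in> borel_measurable P"
    and f: "integrable P (\<lambda>x. (f x)\<^sup>2)" and g: "integrable P (\<lambda>x. (g x)\<^sup>2)"
  shows "integrable P (\<lambda>x. (f x + g x)\<^sup>2)"
    and "\<bar>sqrt (\<integral>x. (f x + g x)\<^sup>2 \<partial>P) - sqrt (\<integral>x. (g x)\<^sup>2 \<partial>P)\<bar> \<le> sqrt (\<integral>x. (f x)\<^sup>2 \<partial>P)"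
proof -
  have fg: "integrable P (\<lambda>x. f x * g x)"
  proof (rule Bochner_Integration.integrable_bound[OF Bochner_Integration.integrable_add[OF f g]])
    show "AE x in P. norm (f x * g x) \<le> norm ((f x)\<^sup>2 + (g x)\<^sup>2)"
    proof (rule AE_I2)
      fix x
      have "0 \<le> (\<bar>f x\<bar> - \<bar>g x\<bar>)\<^sup>2" by simp
      then have "2 * (\<bar>f x\<bar> * \<bar>g x\<bar>) \<le> (f x)\<^sup>2 + (g x)\<^sup>2" by (simp add: power2_diff)
      moreover have "0 \<le> \<bar>f x\<bar> * \<bar>g x\<bar>" by simp
      ultimately have "\<bar>f x\<bar> * \<bar>g x\<bar> \<le> (f x)\<^sup>2 + (g x)\<^sup>2" by linarith
      then show "norm (f x * g x) \<le> norm ((f x)\<^sup>2 + (g x)\<^sup>2)"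
        unfolding real_norm_def abs_mult by (rule order_trans[OF _ abs_ge_self])
    qed
  qed measurable
  have comb: "integrable P (\<lambda>x. (s * f x + t * g x)\<^sup>2)"
    "(\<integral>x. (s * f x + t * g x)\<^sup>2 \<partial>P) = s\<^sup>2 * (\<integral>x. (f x)\<^sup>2 \<partial>P) + 2 * s * t * (\<integral>x. f x * g x \<partial>P) + t\<^sup>2 * (\<integral>x. (g x)\<^sup>2 \<partial>P)" for s t
  proof -
    have eq: "(\<lambda>x. (s * f x + t * g x)\<^sup>2) = (\<lambda>x. s\<^sup>2 * (f x)\<^sup>2 + 2 * s * t * (f x * g x) + t\<^sup>2 * (g x)\<^sup>2)"
      by (auto simp: power2_eq_square algebra_simps)
    show "integrable P (\<lambda>x. (s * f x + t * g x)\<^sup>2)" unfolding eq using f g fg by auto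
    show "(\<integral>x. (s * f x + t * g x)\<^sup>2 \<partial>P) = s\<^sup>2 * (\<integral>x. (f x)\<^sup>2 \<partial>P) + 2 * s * t * (\<integral>x. f x * g x \<partial>P) + t\<^sup>2 * (\<integral>x. (g x)\<^sup>2 \<partial>P)"
      unfolding eq using f g fg by simp
  qed
  show "integrable P (\<lambda>x. (f x + g x)\<^sup>2)" using comb(1)[of 1 1] by simp
  define A B C where "A = (\<integral>x. (f x)\<^sup>2 \<partial>P)" and "B = (\<integral>x. (g x)\<^sup>2 \<partial>P)" and "C = (\<integral>x. f x * g x \<partial>P)"
  have AB: "A \<ge> 0" "B \<ge> 0" by (simp_all add: A_def B_def)
  have D: "(\<integral>x. (f x + g x)\<^sup>2 \<partial>P) = A + 2 * C + B"
    using comb(2)[of 1 1] by (simp add: A_def B_def C_def)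
  have C0: "C = 0" if "A = 0 \<or> B = 0"
  proof -
    have "AE x in P. f x * g x = 0"
      using that integral_nonneg_eq_0_iff_AE[OF f] integral_nonneg_eq_0_iff_AE[OF g] by (auto simp: A_def B_def)
    then have "(\<integral>x. f x * g x \<partial>P) = (\<integral>x. 0 \<partial>P)" by (intro integral_cong_AE) auto
    then show ?thesis by (simp add: C_def)
  qed
  have C: "\<bar>C\<bar> \<le> sqrt A * sqrt B"
  proof (cases "A = 0 \<or> B = 0")
    case True
    then show ?thesis using C0 AB by simp
  next
    case False
    then have pos: "sqrt A * sqrt B > 0" using AB by simp
    \<comment> \<open>Each function is scaled by the norm of the other, so both squares integrate to
      A B. The choices s = 1 and s = -1 then bound \<open>C\<close> from below and from
      above.\<close>
    have "0 \<le> (\<integral>x. (sqrt B * f x + s * sqrt A * g x)\<^sup>2 \<partial>P)" for s by simp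
    then have q: "0 \<le> B * A + 2 * sqrt B * (s * sqrt A) * C + s\<^sup>2 * A * B" for s
      unfolding comb(2) using AB by (simp add: A_def B_def C_def power_mult_distrib)
    have BA: "B * A = (sqrt A * sqrt B) * (sqrt A * sqrt B)" using AB by (simp add: mult_ac)
    have "0 \<le> (sqrt A * sqrt B) * (sqrt A * sqrt B + C)" using q[of 1] BA by (simp add: algebra_simps)
    moreover have "0 \<le> (sqrt A * sqrt B) * (sqrt A * sqrt B - C)" using q[of "-1"] BA by (simp add: algebra_simps)
    ultimately show ?thesis using pos by (simp add: zero_le_mult_iff abs_le_iff)
  qed
  have up: "A + 2 * C + B \<le> (sqrt A + sqrt B)\<^sup>2" using C AB by (simp add: power2_sum)
  have lo: "(sqrt A - sqrt B)\<^sup>2 \<le> A + 2 * C + B" using C AB by (simp add: power2_diff)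
  have "sqrt (A + 2 * C + B) \<le> sqrt A + sqrt B"
    using up AB by (intro real_le_lsqrt) auto
  moreover have "\<bar>sqrt A - sqrt B\<bar> \<le> sqrt (A + 2 * C + B)"
    using lo by (intro real_le_rsqrt) simp
  ultimately show "\<bar>sqrt (\<integral>x. (f x + g x)\<^sup>2 \<partial>P) - sqrt (\<integral>x. (g x)\<^sup>2 \<partial>P)\<bar> \<le> sqrt (\<integral>x. (f x)\<^sup>2 \<partial>P)"
    unfolding D A_def[symmetric] B_def[symmetric] by linarith
qed

section \<open>Variance of the statistic and size of the normalised remainder\<close>

context U_kernel
begin

lemma ghat_sum_square:
  assumes g2: "integrable \<mu> (\<lambda>y. (ghat y)\<^sup>2)" and g1: "integrable \<mu> ghat" and g0: "(\<integral>y. ghat y \<partial>\<mu>) = 0"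
    and N: "finite N"
  shows "integrable (PI N) (\<lambda>x. (\<Sum>k\<in>N. ghat (x k))\<^sup>2)"
    and "(\<integral>x. (\<Sum>k\<in>N. ghat (x k))\<^sup>2 \<partial>PI N) = real (card N) * (\<integral>y. (ghat y)\<^sup>2 \<partial>\<mu>)"
proof -
  have diag: "integrable (PI N) (\<lambda>x. ghat (x k) * ghat (x k))" "(\<integral>x. ghat (x k) * ghat (x k) \<partial>PI N) = (\<integral>y. (ghat y)\<^sup>2 \<partial>\<mu>)" if k: "k \<in> N" for k
  proof -
    have d: "distr (PI N) \<mu> (\<lambda>y. y k) = \<mu>" by (rule distr_PiM_component[OF prob_space_axioms k])
    have mk: "(\<lambda>y. y k) \<in> PI N \<rightarrow>\<^sub>M \<mu>" using k by (rule measurable_component_singleton)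
    show "integrable (PI N) (\<lambda>x. ghat (x k) * ghat (x k))"
      using integrable_distr[OF mk, of "\<lambda>y. (ghat y)\<^sup>2"] g2 d by (simp add: power2_eq_square)
    have "(\<integral>x. (ghat (x k))\<^sup>2 \<partial>PI N) = (\<integral>u. (ghat u)\<^sup>2 \<partial>distr (PI N) \<mu> (\<lambda>y. y k))"
      by (rule integral_distr[OF mk, symmetric]) simp
    then show "(\<integral>x. ghat (x k) * ghat (x k) \<partial>PI N) = (\<integral>y. (ghat y)\<^sup>2 \<partial>\<mu>)" using d by (simp add: power2_eq_square)
  qed
  have off: "integrable (PI N) (\<lambda>x. ghat (x k) * ghat (x l))" "(\<integral>x. ghat (x k) * ghat (x l) \<partial>PI N) = 0" if kl: "k \<in> N" "l \<in> N" "k \<noteq> l" for k l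
  proof -
    let ?f = "\<lambda>i y. if i = k \<or> i = l then ghat y else 1"
    have int: "integrable \<mu> (?f i)" for i using g1 by (cases "i = k \<or> i = l") auto
    have eq: "(\<lambda>x. ghat (x k) * ghat (x l)) = (\<lambda>x. \<Prod>i\<in>N. ?f i (x i))"
    proof
      fix x :: "nat \<Rightarrow> real"
      have "(\<Prod>i\<in>N. ?f i (x i)) = (\<Prod>i\<in>{k, l}. ghat (x i))"
        using kl N by (intro prod.mono_neutral_cong_right) auto
      then show "ghat (x k) * ghat (x l) = (\<Prod>i\<in>N. ?f i (x i))" using kl by simp
    qed
    show "integrable (PI N) (\<lambda>x. ghat (x k) * ghat (x l))"
      unfolding eq by (rule PS.product_integrable_prod[OF N int])
    have "(\<integral>x. ghat (x k) * ghat (x l) \<partial>PI N) = (\<Prod>i\<in>N. \<integral>y. ?f i y \<partial>\<mu>)"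
      unfolding eq by (rule PS.product_integral_prod[OF N int])
    also have "\<dots> = 0" using kl N g0 by (intro prod_zero bexI[of _ k]) auto
    finally show "(\<integral>x. ghat (x k) * ghat (x l) \<partial>PI N) = 0" .
  qed
  have all: "integrable (PI N) (\<lambda>x. ghat (x k) * ghat (x l))" if "k \<in> N" "l \<in> N" for k l
    using diag(1) off(1) that by (cases "k = l") auto
  have eq: "(\<lambda>x. (\<Sum>k\<in>N. ghat (x k))\<^sup>2) = (\<lambda>x. \<Sum>k\<in>N. \<Sum>l\<in>N. ghat (x k) * ghat (x l))"
    by (simp add: power2_eq_square sum_product)
  show "integrable (PI N) (\<lambda>x. (\<Sum>k\<in>N. ghat (x k))\<^sup>2)"
    unfolding eq using all by (intro Bochner_Integration.integrable_sum) auto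
  have "(\<integral>x. (\<Sum>k\<in>N. ghat (x k))\<^sup>2 \<partial>PI N) = (\<Sum>k\<in>N. \<Sum>l\<in>N. \<integral>x. ghat (x k) * ghat (x l) \<partial>PI N)"
    unfolding eq using all by (subst Bochner_Integration.integral_sum, auto intro!: Bochner_Integration.integrable_sum sum.cong Bochner_Integration.integral_sum)
  also have "\<dots> = (\<Sum>k\<in>N. \<Sum>l\<in>N. if l = k then \<integral>y. (ghat y)\<^sup>2 \<partial>\<mu> else 0)"
    using diag(2) off(2) by (intro sum.cong refl) auto
  also have "\<dots> = real (card N) * (\<integral>y. (ghat y)\<^sup>2 \<partial>\<mu>)" using N by simp
  finally show "(\<integral>x. (\<Sum>k\<in>N. ghat (x k))\<^sup>2 \<partial>PI N) = real (card N) * (\<integral>y. (ghat y)\<^sup>2 \<partial>\<mu>)" .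
qed

lemma hajek_decomposition:
  "(\<Sum>i\<in>increasing_tuples m n. h (\<lambda>j\<in>{..<m}. x (i j)))
    = (\<Sum>i\<in>increasing_tuples m n. resid i x) + real ((n - 1) choose (m - 1)) * (\<Sum>k\<in>{1..n}. ghat (x k))"
  using sum_increasing_tuples_components[OF m, of "\<lambda>k. ghat (x k)"] by (simp add: resid_def sum_subtractf)

lemma power_kernel_integrable:
  assumes p: "p \<ge> 1" and hp: "integrable (PI {..<m}) (\<lambda>x. \<bar>h x\<bar> powr (p + 2))" and r: "r \<ge> 1" "real (2 * r) \<le> p + 2"
  shows "integrable (PI {..<m}) (\<lambda>x. h x ^ (2 * r))"
proof (rule Bochner_Integration.integrable_bound)
  interpret S: prob_space "PI {..<m}" by (rule prob_space_PI)
  show "integrable (PI {..<m}) (\<lambda>x. 1 + \<bar>h x\<bar> powr (p + 2))" using hp by simp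
  show "AE x in PI {..<m}. norm (h x ^ (2 * r)) \<le> norm (1 + \<bar>h x\<bar> powr (p + 2))"
  proof (rule AE_I2)
    fix x
    have "\<bar>h x\<bar> ^ (2 * r) \<le> 1 + \<bar>h x\<bar> powr (p + 2)"
    proof (cases "\<bar>h x\<bar> \<le> 1")
      case True
      then have "\<bar>h x\<bar> ^ (2 * r) \<le> 1" by (intro power_le_one) auto
      then show ?thesis by (rule add_increasing2[OF powr_ge_zero])
    next
      case False
      then have "\<bar>h x\<bar> ^ (2 * r) = \<bar>h x\<bar> powr real (2 * r)" by (subst powr_realpow) auto
      also have "\<dots> \<le> \<bar>h x\<bar> powr (p + 2)" using False r by (intro powr_mono) auto
      finally show ?thesis by simp
    qed
    then show "norm (h x ^ (2 * r)) \<le> norm (1 + \<bar>h x\<bar> powr (p + 2))" by (simp add: power_abs)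
  qed
qed measurable

text \<open>The first-order part has standard deviation of order n^(m-1/2), the remainder has order
  at most n^(m-1) in L^2 and in L^(2r). So \<open>\<sigma> n\<close> differs from the former by a
  relative error of order n^(-1/2), and the normalised remainder is of the same order in
  L^p.\<close>

theorem normal_form:
  assumes p: "p \<ge> 1" and m2: "m \<ge> 2" and hp: "integrable (PI {..<m}) (\<lambda>x. \<bar>h x\<bar> powr (p + 2))"
    and h0: "(\<integral>x. h x \<partial>PI {..<m}) = 0" and nondeg: "(\<integral>y. (ghat y)\<^sup>2 \<partial>\<mu>) > 0"
  defines "\<sigma> \<equiv> \<lambda>n. sqrt (\<integral>x. (\<Sum>i\<in>increasing_tuples m n. h (\<lambda>j\<in>{..<m}. x (i j)))\<^sup>2 \<partial>PI {1..n})"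
  shows "\<exists>C>0. \<exists>N. \<forall>n\<ge>N. \<sigma> n > 0
    \<and> \<bar>real ((n - 1) choose (m - 1)) * sqrt (real n) * sqrt (\<integral>y. (ghat y)\<^sup>2 \<partial>\<mu>) / \<sigma> n - 1\<bar> \<le> C / sqrt (real n)
    \<and> (\<integral>\<^sup>+x. ennreal (\<bar>(\<Sum>i\<in>increasing_tuples m n. resid i x) / \<sigma> n\<bar> powr p) \<partial>PI {1..n}) \<le> ennreal (C * real n powr (- p / 2))"
proof -
  \<comment> \<open>The least r with p \<le> 2r. It also satisfies 2r \<le> p + 2, so the moment
    condition provides this even moment.\<close>
  define r where "r = nat \<lceil>p / 2\<rceil>"
  have r: "r \<ge> 1" "p \<le> real (2 * r)" "real (2 * r) \<le> p + 2"
    using p unfolding r_def by linarith+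
  have h2: "integrable (PI {..<m}) (\<lambda>x. h x ^ (2 * 1))" using p by (intro power_kernel_integrable[OF p hp]) auto
  have hr: "integrable (PI {..<m}) (\<lambda>x. h x ^ (2 * r))" by (rule power_kernel_integrable[OF p hp r(1,3)])
  have g1: "integrable \<mu> ghat" by (rule ghat_integrable[OF _ h2]) simp
  have g2: "integrable \<mu> (\<lambda>y. (ghat y)\<^sup>2)" using ghat_power_integrable[OF _ h2] by simp
  have g0: "(\<integral>y. ghat y \<partial>\<mu>) = 0"
    using integral_split[OF h_integrable[OF _ h2]] h0 by (simp add: ghat_def)
  let ?R = "\<lambda>n x. \<Sum>i\<in>increasing_tuples m n. resid i x"
  have mom: "\<exists>K\<ge>0. \<forall>n. integrable (PI {1..n}) (\<lambda>x. ?R n x ^ (2 * r)) \<and> (\<integral>x. ?R n x ^ (2 * r) \<partial>PI {1..n}) \<le> K * real n ^ (2 * r * (m - 1))"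
    if r: "r \<ge> 1" and hr: "integrable (PI {..<m}) (\<lambda>x. h x ^ (2 * r))" for r
  proof -
    let ?K = "real ((2 * r * (m - 1)) ^ m) ^ (2 * r) * (real (2 * r) * resid_bound r)"
    have "integrable (PI {1..n}) (\<lambda>x. ?R n x ^ (2 * r)) \<and> (\<integral>x. ?R n x ^ (2 * r) \<partial>PI {1..n}) \<le> \<bar>?K\<bar> * real n ^ (2 * r * (m - 1))" for n
    proof (intro conjI)
      show "integrable (PI {1..n}) (\<lambda>x. ?R n x ^ (2 * r))" by (rule resid_sum_moment(1)[OF r hr h0])
      have "?K * real n ^ (2 * r * (m - 1)) \<le> \<bar>?K\<bar> * real n ^ (2 * r * (m - 1))" by (intro mult_right_mono abs_ge_self) simp
      then show "(\<integral>x. ?R n x ^ (2 * r) \<partial>PI {1..n}) \<le> \<bar>?K\<bar> * real n ^ (2 * r * (m - 1))"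
        using resid_sum_moment(2)[OF r hr h0, of n] by linarith
    qed
    then show ?thesis by (intro exI[of _ "\<bar>?K\<bar>"]) auto
  qed
  obtain K1 where K1: "K1 \<ge> 0" "\<And>n. integrable (PI {1..n}) (\<lambda>x. (?R n x)\<^sup>2)" "\<And>n. (\<integral>x. (?R n x)\<^sup>2 \<partial>PI {1..n}) \<le> K1 * real n ^ (2 * (m - 1))"
    using mom[OF _ h2] by auto
  obtain K where K: "K \<ge> 0" "\<And>n. integrable (PI {1..n}) (\<lambda>x. ?R n x ^ (2 * r))" "\<And>n. (\<integral>x. ?R n x ^ (2 * r) \<partial>PI {1..n}) \<le> K * real n ^ (2 * r * (m - 1))"
    using mom[OF r(1) hr] by auto
  define v where "v = sqrt (\<integral>y. (ghat y)\<^sup>2 \<partial>\<mu>)"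
  have v: "v > 0" using nondeg by (simp add: v_def)
  \<comment> \<open>The binomial coefficient is at least (n/(2m))^(m-1), so the first-order part has
    standard deviation at least a n^(m-1/2).\<close>
  define a where "a = v / (2 * real m) ^ (m - 1)"
  have a: "a > 0" using v m2 by (simp add: a_def)
  define C where "C = 2 * sqrt K1 / a + (2 / a) powr p * (1 + K) + 1"
  \<comment> \<open>The second bound makes the deviation sqrt K1 n^(m-1) at most half of the lower
    bound a n^(m-1/2).\<close>
  define N where "N = max (m + 1) (nat \<lceil>(2 * sqrt K1 / a)\<^sup>2\<rceil>)"
  have C1: "2 * sqrt K1 / a \<le> C" "(2 / a) powr p * (1 + K) \<le> C" "C > 0"
    using a K1(1) K(1) unfolding C_def by (auto intro!: add_nonneg_pos add_nonneg_nonneg mult_nonneg_nonneg)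
  have "\<sigma> n > 0
    \<and> \<bar>real ((n - 1) choose (m - 1)) * sqrt (real n) * v / \<sigma> n - 1\<bar> \<le> C / sqrt (real n)
    \<and> (\<integral>\<^sup>+x. ennreal (\<bar>?R n x / \<sigma> n\<bar> powr p) \<partial>PI {1..n}) \<le> ennreal (C * real n powr (- p / 2))" if n: "n \<ge> N" for n
  proof -
    define b where "b = real ((n - 1) choose (m - 1))"
    define u where "u = real n ^ (m - 1)"
    let ?S = "\<lambda>x. \<Sum>k\<in>{1..n}. ghat (x k)"
    have nm: "n \<ge> m + 1" and n2: "(2 * sqrt K1 / a)\<^sup>2 \<le> real n"
    proof -
      show "n \<ge> m + 1" using n by (simp add: N_def)
      have "nat \<lceil>(2 * sqrt K1 / a)\<^sup>2\<rceil> \<le> n" using n by (simp add: N_def)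
      then show "(2 * sqrt K1 / a)\<^sup>2 \<le> real n" by linarith
    qed
    have n0: "real n > 0" using nm by simp
    have u: "u > 0" using n0 by (simp add: u_def)
    have b: "u / (2 * real m) ^ (m - 1) \<le> b"
    proof -
      have "real n / 2 / real m \<le> real (n - 1) / real (m - 1)"
      proof (rule frac_le)
        show "0 < real (m - 1)" using m2 by simp
        show "real (m - 1) \<le> real m" by simp
      qed (use nm m2 in auto)
      then have "(real n / 2 / real m) ^ (m - 1) \<le> (real (n - 1) / real (m - 1)) ^ (m - 1)" by (intro power_mono) auto
      also have "\<dots> \<le> b" unfolding b_def using nm by (intro binomial_ge_n_over_k_pow_k) simp
      finally show ?thesis by (simp add: u_def power_divide power_mult_distrib)
    qed
    have Rm: "?R n \<in> borel_measurable (PI {1..n})"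
      by (intro borel_measurable_sum resid_meas) (auto simp: increasing_tuples_def)
    have Sm: "?S \<in> borel_measurable (PI {1..n})"
      by (intro borel_measurable_sum measurable_compose[OF component_meas ghat_meas]) auto
    have S2: "integrable (PI {1..n}) (\<lambda>x. (b * ?S x)\<^sup>2)" "(\<integral>x. (b * ?S x)\<^sup>2 \<partial>PI {1..n}) = b\<^sup>2 * (real n * v\<^sup>2)"
      using ghat_sum_square[OF g2 g1 g0, of "{1..n}"] by (simp_all add: power_mult_distrib v_def)
    have "\<bar>\<sigma> n - b * sqrt (real n) * v\<bar> \<le> sqrt (\<integral>x. (?R n x)\<^sup>2 \<partial>PI {1..n})"
      using L2_triangle(2)[OF Rm borel_measurable_times[OF borel_measurable_const Sm] K1(2) S2(1)]
      unfolding \<sigma>_def hajek_decomposition b_def[symmetric] S2(2)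
      using v by (simp add: real_sqrt_mult b_def mult_ac)
    also have "\<dots> \<le> sqrt (K1 * real n ^ (2 * (m - 1)))" by (intro real_sqrt_le_mono K1(3))
    also have "\<dots> = sqrt K1 * u"
      using u by (simp add: real_sqrt_mult u_def power_mult mult.commute[of 2])
    finally have dev: "\<bar>\<sigma> n - b * sqrt (real n) * v\<bar> \<le> sqrt K1 * u" .
    have lead: "a * u * sqrt (real n) \<le> b * sqrt (real n) * v"
    proof -
      have "a * u = u / (2 * real m) ^ (m - 1) * v" by (simp add: a_def)
      also have "\<dots> \<le> b * v" using b v by (intro mult_right_mono) auto
      finally have "a * u * sqrt (real n) \<le> b * v * sqrt (real n)" by (intro mult_right_mono) auto
      then show ?thesis by (simp add: mult_ac)
    qed
    have half: "sqrt K1 * u \<le> a / 2 * u * sqrt (real n)"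
    proof -
      have "2 * sqrt K1 / a \<le> sqrt (real n)" using n2 by (intro real_le_rsqrt)
      then have "sqrt K1 \<le> a / 2 * sqrt (real n)" using a by (simp add: field_simps)
      then have "sqrt K1 * u \<le> a / 2 * sqrt (real n) * u" using u by (intro mult_right_mono) auto
      then show ?thesis by (simp add: mult_ac)
    qed
    have big: "a / 2 * u * sqrt (real n) \<le> \<sigma> n"
    proof -
      have "a / 2 * u * sqrt (real n) + a / 2 * u * sqrt (real n) = a * u * sqrt (real n)" by simp
      then show ?thesis using dev lead half unfolding abs_le_iff by linarith
    qed
    have pos: "a / 2 * u * sqrt (real n) > 0" using a u n0 by simp
    have sp: "\<sigma> n > 0" using big pos by linarith
    have A: "\<bar>b * sqrt (real n) * v / \<sigma> n - 1\<bar> \<le> C / sqrt (real n)"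
    proof -
      have "\<bar>b * sqrt (real n) * v / \<sigma> n - 1\<bar> = \<bar>\<sigma> n - b * sqrt (real n) * v\<bar> / \<sigma> n"
      proof -
        have "b * sqrt (real n) * v / \<sigma> n - 1 = (b * sqrt (real n) * v - \<sigma> n) / \<sigma> n"
          using sp by (simp add: diff_divide_distrib)
        then show ?thesis unfolding abs_minus_commute[of "\<sigma> n"] using sp by (simp only: abs_divide abs_of_pos)
      qed
      also have "\<dots> \<le> (sqrt K1 * u) / (a / 2 * u * sqrt (real n))"
        using dev big pos by (intro frac_le) auto
      also have "\<dots> = 2 * sqrt K1 / a / sqrt (real n)" using u a by (simp add: field_simps)
      also have "\<dots> \<le> C / sqrt (real n)" using C1(1) by (intro divide_right_mono) auto
      finally show ?thesis .
    qed
    have "(\<integral>\<^sup>+x. ennreal (\<bar>?R n x / \<sigma> n\<bar> powr p) \<partial>PI {1..n}) \<le> (\<integral>\<^sup>+x. ennreal ((2 / a) powr p * real n powr (- p / 2)) * ennreal (1 + ?R n x ^ (2 * r) / u ^ (2 * r)) \<partial>PI {1..n})"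
    proof (rule nn_integral_mono)
      fix x
      define y where "y = \<bar>?R n x\<bar> / u"
      have y: "y \<ge> 0" using u by (simp add: y_def)
      have "\<bar>?R n x / \<sigma> n\<bar> \<le> \<bar>?R n x\<bar> / (a / 2 * u * sqrt (real n))"
        unfolding abs_divide abs_of_pos[OF sp] using big pos by (intro frac_le) auto
      also have "\<dots> = 2 / a * real n powr (- 1 / 2) * y"
        using n0 by (simp add: y_def powr_minus_divide powr_half_sqrt field_simps)
      finally have "\<bar>?R n x / \<sigma> n\<bar> powr p \<le> (2 / a * real n powr (- 1 / 2) * y) powr p"
        using p by (intro powr_mono2) auto
      also have "\<dots> = (2 / a) powr p * real n powr (- p / 2) * y powr p"
        using a n0 y by (simp add: powr_mult powr_powr powr_divide)
      also have "y powr p \<le> 1 + y ^ (2 * r)"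
      proof (cases "y \<le> 1")
        case True
        then have "y powr p \<le> 1" using y p powr_mono2[of p y 1] by simp
        then show ?thesis using y by (simp add: add_increasing2)
      next
        case False
        then have "y powr p \<le> y powr real (2 * r)" using r by (intro powr_mono) auto
        also have "\<dots> = y ^ (2 * r)" using False by (intro powr_realpow) simp
        finally show ?thesis by simp
      qed
      also have "y ^ (2 * r) = ?R n x ^ (2 * r) / u ^ (2 * r)" by (simp add: y_def power_divide power_mult)
      finally have "\<bar>?R n x / \<sigma> n\<bar> powr p \<le> (2 / a) powr p * real n powr (- p / 2) * (1 + ?R n x ^ (2 * r) / u ^ (2 * r))"
        by (simp add: mult_left_mono)
      then show "ennreal (\<bar>?R n x / \<sigma> n\<bar> powr p) \<le> ennreal ((2 / a) powr p * real n powr (- p / 2)) * ennreal (1 + ?R n x ^ (2 * r) / u ^ (2 * r))"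
        using u by (subst ennreal_mult[symmetric]) (auto simp: power_mult intro!: ennreal_leI add_nonneg_nonneg divide_nonneg_nonneg)
    qed
    also have "\<dots> = ennreal ((2 / a) powr p * real n powr (- p / 2)) * (\<integral>\<^sup>+x. ennreal (1 + ?R n x ^ (2 * r) / u ^ (2 * r)) \<partial>PI {1..n})"
      by (intro nn_integral_cmult measurable_compose[OF _ measurable_ennreal] borel_measurable_add borel_measurable_const
        borel_measurable_divide borel_measurable_power Rm)
    also have "(\<integral>\<^sup>+x. ennreal (1 + ?R n x ^ (2 * r) / u ^ (2 * r)) \<partial>PI {1..n}) \<le> ennreal (1 + K)"
    proof -
      interpret S: prob_space "PI {1..n}" by (rule prob_space_PI)
      have "(\<integral>\<^sup>+x. ennreal (1 + ?R n x ^ (2 * r) / u ^ (2 * r)) \<partial>PI {1..n}) = ennreal (\<integral>x. 1 + ?R n x ^ (2 * r) / u ^ (2 * r) \<partial>PI {1..n})"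
      proof (rule nn_integral_eq_integral)
        show "integrable (PI {1..n}) (\<lambda>x. 1 + ?R n x ^ (2 * r) / u ^ (2 * r))"
          by (intro Bochner_Integration.integrable_add S.integrable_const integrable_divide_zero K(2))
        have "0 \<le> 1 + ?R n x ^ (2 * r) / u ^ (2 * r)" for x
          by (intro add_nonneg_nonneg divide_nonneg_nonneg zero_le_even_power') simp
        then show "AE x in PI {1..n}. 0 \<le> 1 + ?R n x ^ (2 * r) / u ^ (2 * r)" by simp
      qed
      also have "(\<integral>x. 1 + ?R n x ^ (2 * r) / u ^ (2 * r) \<partial>PI {1..n}) = 1 + (\<integral>x. ?R n x ^ (2 * r) \<partial>PI {1..n}) / u ^ (2 * r)"
      proof -
        have "(\<integral>x. 1 + ?R n x ^ (2 * r) / u ^ (2 * r) \<partial>PI {1..n}) = (\<integral>x. 1 \<partial>PI {1..n}) + (\<integral>x. ?R n x ^ (2 * r) / u ^ (2 * r) \<partial>PI {1..n})"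
          by (rule Bochner_Integration.integral_add[OF S.integrable_const integrable_divide_zero[OF K(2)]])
        moreover have "(\<integral>x. 1 \<partial>PI {1..n}) = (1::real)" using S.prob_space by simp
        ultimately show ?thesis by (simp only: integral_divide_zero)
      qed
      also have "\<dots> \<le> 1 + K"
        using K(1) K(3)[of n] u n0 by (simp add: divide_le_eq u_def power_mult[symmetric] mult_ac)
      finally show ?thesis by (simp add: ennreal_leI)
    qed
    also have "ennreal ((2 / a) powr p * real n powr (- p / 2)) * ennreal (1 + K) = ennreal ((2 / a) powr p * (1 + K) * real n powr (- p / 2))"
      using K(1) by (subst ennreal_mult[symmetric]) (auto simp: mult_ac)
    also have "\<dots> \<le> ennreal (C * real n powr (- p / 2))"
      using C1(2) by (intro ennreal_leI mult_right_mono) auto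
    finally have B: "(\<integral>\<^sup>+x. ennreal (\<bar>?R n x / \<sigma> n\<bar> powr p) \<partial>PI {1..n}) \<le> ennreal (C * real n powr (- p / 2))"
      by (simp add: mult_left_mono)
    show ?thesis using sp A B unfolding b_def by blast
  qed
  then show ?thesis using C1(3) unfolding v_def by blast
qed

end

section \<open>Rate of convergence\<close>

lemma wasserstein_le_coupling:
  assumes p: "p \<ge> 1" and K: "K \<ge> 0" and \<gamma>: "\<gamma> \<in> couplings \<nu> \<mu>"
    and le: "(\<integral>\<^sup>+(x, y). ennreal (\<bar>x - y\<bar> powr p) \<partial>\<gamma>) \<le> ennreal (K powr p)"
  shows "wasserstein p \<nu> \<mu> \<le> ennreal K"
proof -
  let ?a = "\<integral>\<^sup>+(x, y). ennreal (\<bar>x - y\<bar> powr p) \<partial>\<gamma>"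
  have fin: "?a \<noteq> \<infinity>" using le by (metis ennreal_less_top infinity_ennreal_def leD)
  have "enn2real ?a \<le> K powr p" using le by (intro enn2real_leI) auto
  then have "enn2real ?a powr (1 / p) \<le> (K powr p) powr (1 / p)" using p by (intro powr_mono2) auto
  also have "\<dots> = K" using p K by (simp add: powr_powr)
  finally have "ennroot p ?a \<le> ennreal K" using fin by (simp add: ennroot_def ennreal_leI)
  then show ?thesis unfolding wasserstein_def using \<gamma> by (rule INF_lower2[rotated])
qed

section \<open>From the product space to the sample\<close>

context U_kernel
begin

text \<open>Identifies \<open>ghat\<close> with the conditional expectation used in the theorem.
  Sets of the generated algebra are preimages of Borel sets \<open>B\<close>, and the indicator of
  \<open>B\<close> involves coordinate 0 only, so \<open>integral_split\<close> takes it out of the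
  inner integral.\<close>

lemma cond_exp_first_coordinate:
  assumes M: "prob_space M" and \<Xi>: "\<Xi> \<in> M \<rightarrow>\<^sub>M PI {..<m}" and law: "distr M (PI {..<m}) \<Xi> = PI {..<m}"
    and h: "integrable (PI {..<m}) h" and gi: "integrable \<mu> ghat"
  shows "AE \<omega> in M. real_cond_exp M (vimage_algebra (space M) (\<lambda>\<omega>. \<Xi> \<omega> 0) borel) (\<lambda>\<omega>. h (\<Xi> \<omega>)) \<omega> = ghat (\<Xi> \<omega> 0)"
proof -
  interpret M: prob_space M by fact
  let ?X = "\<lambda>\<omega>. \<Xi> \<omega> 0"
  let ?F = "vimage_algebra (space M) ?X borel"
  have m0: "0 \<in> {..<m}" using m by simp
  have X: "?X \<in> borel_measurable M"
    by (rule measurable_compose[OF \<Xi> component_meas[OF m0]])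
  have lawX: "distr M borel ?X = \<mu>"
  proof -
    have "distr (distr M (PI {..<m}) \<Xi>) \<mu> (\<lambda>x. x 0) = distr M \<mu> ((\<lambda>x. x 0) \<circ> \<Xi>)"
      using \<Xi> m0 by (intro distr_distr measurable_component_singleton)
    moreover have "distr (PI {..<m}) \<mu> (\<lambda>x. x 0) = \<mu>" by (rule distr_PiM_component[OF prob_space_axioms m0])
    moreover have "distr M \<mu> ((\<lambda>x. x 0) \<circ> \<Xi>) = distr M borel ?X" by (rule distr_cong) auto
    ultimately show ?thesis using law by simp
  qed
  have sub: "subalgebra M ?F"
    unfolding subalgebra_def using X by (auto simp: sets_vimage_algebra2 intro: measurable_sets)
  interpret F: finite_measure_subalgebra M ?F by unfold_locales (rule sub)
  show ?thesis
  proof (rule F.real_cond_exp_charact)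
    show "integrable M (\<lambda>\<omega>. h (\<Xi> \<omega>))" using integrable_distr[OF \<Xi>, of h] h law by simp
    show "integrable M (\<lambda>\<omega>. ghat (\<Xi> \<omega> 0))" using integrable_distr[OF X, of ghat] gi lawX by simp
    show "(\<lambda>\<omega>. ghat (\<Xi> \<omega> 0)) \<in> borel_measurable ?F"
      by (rule measurable_compose[OF measurable_vimage_algebra1 ghat_meas]) auto
    fix A assume "A \<in> sets ?F"
    then obtain B where B: "B \<in> sets borel" "A = ?X -` B \<inter> space M" by (auto simp: sets_vimage_algebra2)
    have m1: "(\<lambda>x. indicator B (x 0) * h x) \<in> borel_measurable (PI {..<m})"
      using B(1) by (intro borel_measurable_times measurable_compose[OF component_meas[OF m0]] h_meas) auto
    have i1: "integrable (PI {..<m}) (\<lambda>x. indicator B (x 0) * h x)"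
      by (rule Bochner_Integration.integrable_bound[OF h m1]) (auto simp: indicator_def)
    have "(\<integral>\<omega>\<in>A. h (\<Xi> \<omega>) \<partial>M) = (\<integral>\<omega>. indicator B (\<Xi> \<omega> 0) * h (\<Xi> \<omega>) \<partial>M)"
      unfolding set_lebesgue_integral_def B(2) by (intro Bochner_Integration.integral_cong) (auto simp: indicator_def)
    also have "\<dots> = (\<integral>x. indicator B (x 0) * h x \<partial>distr M (PI {..<m}) \<Xi>)"
      by (rule integral_distr[OF \<Xi> m1, symmetric])
    also have "\<dots> = (\<integral>x. indicator B (x 0) * h x \<partial>PI {..<m})" unfolding law ..
    also have "\<dots> = (\<integral>y. \<integral>x. indicator B y * h (\<lambda>j\<in>{..<m}. if j = 0 then y else x j) \<partial>PI {1..<m} \<partial>\<mu>)"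
      using integral_split[OF i1] m by simp
    also have "\<dots> = (\<integral>y. indicator B y * ghat y \<partial>\<mu>)" by (simp add: ghat_def)
    also have "\<dots> = (\<integral>y. indicator B y * ghat y \<partial>distr M borel ?X)" unfolding lawX ..
    also have "\<dots> = (\<integral>\<omega>. indicator B (\<Xi> \<omega> 0) * ghat (\<Xi> \<omega> 0) \<partial>M)"
      using B(1) by (intro integral_distr[OF X] borel_measurable_times) auto
    also have "\<dots> = (\<integral>\<omega>\<in>A. ghat (\<Xi> \<omega> 0) \<partial>M)"
      unfolding set_lebesgue_integral_def B(2) by (intro Bochner_Integration.integral_cong) (auto simp: indicator_def)
    finally show "(\<integral>\<omega>\<in>A. h (\<Xi> \<omega>) \<partial>M) = (\<integral>\<omega>\<in>A. ghat (\<Xi> \<omega> 0) \<partial>M)" .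
  qed
qed

lemma kernel_sum_expectation:
  assumes h: "integrable (PI {..<m}) h"
  shows "(\<integral>x. (\<Sum>i\<in>increasing_tuples m n. h (\<lambda>j\<in>{..<m}. x (i j))) \<partial>PI {1..n})
    = real (card (increasing_tuples m n)) * (\<integral>x. h x \<partial>PI {..<m})"
proof -
  have T: "inj_on i {..<m}" "i ` {..<m} \<subseteq> {1..n}" if "i \<in> increasing_tuples m n" for i
    using that by (auto simp: increasing_tuples_def strict_mono_on_imp_inj_on)
  have H: "integrable (PI {1..n}) (\<lambda>x. h (\<lambda>j\<in>{..<m}. x (i j)))"
    "(\<integral>x. h (\<lambda>j\<in>{..<m}. x (i j)) \<partial>PI {1..n}) = (\<integral>x. h x \<partial>PI {..<m})" if i: "i \<in> increasing_tuples m n" for i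
    using integrable_distr[OF reindex_meas[OF T(2)[OF i]], of h] h integral_distr[OF reindex_meas[OF T(2)[OF i]] h_meas]
    unfolding reindex_law[OF T[OF i]] by simp_all
  show ?thesis
    using H by (subst Bochner_Integration.integral_sum) simp_all
qed

lemma kernel_sum_meas:
  "(\<lambda>x. \<Sum>i\<in>increasing_tuples m n. h (\<lambda>j\<in>{..<m}. x (i j))) \<in> borel_measurable (PI {1..n})"
  by (intro borel_measurable_sum measurable_compose[OF reindex_meas h_meas]) (auto simp: increasing_tuples_def)

end

lemma (in prob_space) iid_tuple_law:
  assumes ind: "indep_vars (\<lambda>_. borel) X {1..}" and id: "\<And>i. i \<ge> 1 \<Longrightarrow> distr M borel (X i) = \<mu>" and n: "n \<ge> (1::nat)"
  shows "(\<lambda>\<omega>. \<lambda>i\<in>{1..n}. X i \<omega>) \<in> M \<rightarrow>\<^sub>M PiM {1..n} (\<lambda>_. \<mu>)"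
    and "distr M (PiM {1..n} (\<lambda>_. \<mu>)) (\<lambda>\<omega>. \<lambda>i\<in>{1..n}. X i \<omega>) = PiM {1..n} (\<lambda>_. \<mu>)"
proof -
  have Xm: "X i \<in> borel_measurable M" if "i \<ge> 1" for i using ind that unfolding indep_vars_def by auto
  have s: "sets \<mu> = sets borel" using id[of 1] by (metis order_refl sets_distr)
  show "(\<lambda>\<omega>. \<lambda>i\<in>{1..n}. X i \<omega>) \<in> M \<rightarrow>\<^sub>M PiM {1..n} (\<lambda>_. \<mu>)"
    using Xm by (intro measurable_restrict) (simp add: measurable_cong_sets[OF refl s])
  have sP: "sets (PiM {1..n} (\<lambda>_. \<mu>)) = sets (PiM {1..n} (\<lambda>_. borel))" using s by (intro sets_PiM_cong) auto
  have "indep_vars (\<lambda>_. borel) X {1..n}" by (rule indep_vars_subset[OF ind]) auto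
  then have "distr M (PiM {1..n} (\<lambda>_. borel)) (\<lambda>\<omega>. \<lambda>i\<in>{1..n}. X i \<omega>) = PiM {1..n} (\<lambda>i. distr M borel (X i))"
    using n Xm by (subst (asm) indep_vars_iff_distr_eq_PiM') auto
  also have "\<dots> = PiM {1..n} (\<lambda>_. \<mu>)" using id by (intro PiM_cong) auto
  finally show "distr M (PiM {1..n} (\<lambda>_. \<mu>)) (\<lambda>\<omega>. \<lambda>i\<in>{1..n}. X i \<omega>) = PiM {1..n} (\<lambda>_. \<mu>)"
    using distr_cong[OF refl sP, of M] by metis
qed

theorem corollary5p2:
  fixes M :: "'a measure" and X :: "nat \<Rightarrow> 'a \<Rightarrow> real"
    and p :: real and m :: nat
    and h :: "(nat \<Rightarrow> real) \<Rightarrow> real" and g :: "real \<Rightarrow> real"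
  defines "H \<equiv> (\<lambda>\<omega>. h (\<lambda>j\<in>{..<m}. X (Suc j) \<omega>))"
  assumes "prob_space M"
    and "p \<ge> 1" and "m \<ge> 2"
    and indep: "prob_space.indep_vars M (\<lambda>_. borel) X {1..}"
    and ident: "\<And>i. i \<ge> 1 \<Longrightarrow> distr M borel (X i) = distr M borel (X 1)"
    and meas: "h \<in> borel_measurable (PiM {..<m} (\<lambda>_. borel))"
    and symm: "symmetric_kernel m h"
    and mean_zero: "prob_space.expectation M H = 0"
    and moment: "integrable M (\<lambda>\<omega>. \<bar>H \<omega>\<bar> powr (p + 2))"
    and g: "cond_exp_given M H (X 1) g"
    and nondegenerate: "prob_space.expectation M (\<lambda>\<omega>. (g (X 1 \<omega>))\<^sup>2) > 0"
  shows "\<exists>C::real. \<forall>\<^sub>F n in sequentially.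
    wasserstein p (distr M borel (W M X h m n)) (density lborel (\<lambda>x. ennreal (std_normal_density x)))
      \<le> ennreal (C * real n powr (- 1 / 2))"
proof -
  interpret prob_space M by fact
  note p = \<open>p \<ge> 1\<close> and m2 = \<open>m \<ge> 2\<close>
  define \<mu> where "\<mu> = distr M borel (X 1)"
  have Xm: "X i \<in> borel_measurable M" if "i \<ge> 1" for i using indep that unfolding indep_vars_def by auto
  have id: "distr M borel (X i) = \<mu>" if "i \<ge> 1" for i using ident[OF that] by (simp add: \<mu>_def)
  have rd: "real_distribution \<mu>" unfolding \<mu>_def using Xm[of 1] by simp
  interpret U: U_kernel \<mu> m h
    using rd m2 meas symm by (simp add: U_kernel_def U_kernel_axioms_def)
  define \<Xi> where "\<Xi> n = (\<lambda>\<omega>. \<lambda>i\<in>{1..n}. X i \<omega>)" for n :: nat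
  have \<Xi>m: "\<Xi> n \<in> M \<rightarrow>\<^sub>M U.PI {1..n}" and \<Xi>law: "distr M (U.PI {1..n}) (\<Xi> n) = U.PI {1..n}" if "n \<ge> 1" for n
    unfolding \<Xi>_def using iid_tuple_law[OF indep id that] by blast+
  \<comment> \<open>Position j of the kernel carries variable j + 1: kernel positions start at 0,
    sample indices at 1.\<close>
  define \<Xi>' where "\<Xi>' = (\<lambda>\<omega>. \<lambda>j\<in>{..<m}. X (Suc j) \<omega>)"
  have \<Xi>'_eq: "\<Xi>' = (\<lambda>x. \<lambda>j\<in>{..<m}. x (Suc j)) \<circ> \<Xi> m"
    by (rule ext) (auto simp: \<Xi>'_def \<Xi>_def intro!: restrict_ext)
  have Suc_im: "Suc ` {..<m} \<subseteq> {1..m}" by auto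
  have \<Xi>'m: "\<Xi>' \<in> M \<rightarrow>\<^sub>M U.PI {..<m}"
    unfolding \<Xi>'_eq using m2 by (intro measurable_comp[OF \<Xi>m U.reindex_meas[OF Suc_im]]) simp
  have \<Xi>'law: "distr M (U.PI {..<m}) \<Xi>' = U.PI {..<m}"
  proof -
    have m1: "m \<ge> 1" using m2 by simp
    show ?thesis
      using distr_distr[OF U.reindex_meas[OF Suc_im] \<Xi>m[OF m1]]
      unfolding \<Xi>'_eq \<Xi>law[OF m1] U.reindex_law[OF inj_Suc Suc_im] by simp
  qed
  have H: "H = (\<lambda>\<omega>. h (\<Xi>' \<omega>))" by (simp add: H_def \<Xi>'_def)
  have hp: "integrable (U.PI {..<m}) (\<lambda>x. \<bar>h x\<bar> powr (p + 2))"
    using moment integrable_distr_eq[OF \<Xi>'m, of "\<lambda>x. \<bar>h x\<bar> powr (p + 2)"] U.h_meas unfolding \<Xi>'law H by simp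
  have h0: "(\<integral>x. h x \<partial>U.PI {..<m}) = 0"
    using mean_zero integral_distr[OF \<Xi>'m U.h_meas] unfolding \<Xi>'law H by simp
  have h2: "integrable (U.PI {..<m}) (\<lambda>x. h x ^ (2 * 1))" using p by (intro U.power_kernel_integrable[OF p hp]) auto
  have h1: "integrable (U.PI {..<m}) h" by (rule U.h_integrable[OF _ h2]) simp
  have g1: "integrable \<mu> U.ghat" by (rule U.ghat_integrable[OF _ h2]) simp
  have g2: "integrable \<mu> (\<lambda>y. (U.ghat y)\<^sup>2)" using U.ghat_power_integrable[OF _ h2] by simp
  have g0: "(\<integral>y. U.ghat y \<partial>\<mu>) = 0"
    using U.integral_split[OF h1] h0 by (simp add: U.ghat_def)
  \<comment> \<open>\<open>g\<close> is an arbitrary version and agrees with \<open>ghat\<close>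
    only almost everywhere under the law of the first variable, which is all that the second moment
    sees.\<close>
  have nondeg: "(\<integral>y. (U.ghat y)\<^sup>2 \<partial>\<mu>) > 0"
  proof -
    have X0: "(\<lambda>\<omega>. \<Xi>' \<omega> 0) = X 1" using m2 by (simp add: \<Xi>'_def)
    have "AE \<omega> in M. real_cond_exp M (vimage_algebra (space M) (X 1) borel) H \<omega> = U.ghat (X 1 \<omega>)"
      using U.cond_exp_first_coordinate[OF prob_space_axioms \<Xi>'m \<Xi>'law h1 g1] X0 m2 unfolding H by (simp add: \<Xi>'_def)
    moreover have "AE \<omega> in M. g (X 1 \<omega>) = real_cond_exp M (vimage_algebra (space M) (X 1) borel) H \<omega>"
      using g by (auto simp: cond_exp_given_def)
    ultimately have ae: "AE \<omega> in M. (g (X 1 \<omega>))\<^sup>2 = (U.ghat (X 1 \<omega>))\<^sup>2" by eventually_elim simp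
    have gm: "g \<in> borel_measurable borel" using g by (auto simp: cond_exp_given_def)
    have X1: "X 1 \<in> borel_measurable M" by (rule Xm) simp
    have "(\<integral>\<omega>. (g (X 1 \<omega>))\<^sup>2 \<partial>M) = (\<integral>\<omega>. (U.ghat (X 1 \<omega>))\<^sup>2 \<partial>M)"
      by (rule integral_cong_AE[OF _ _ ae]) (intro borel_measurable_power measurable_compose[OF X1] gm U.ghat_meas)+
    also have "\<dots> = (\<integral>y. (U.ghat y)\<^sup>2 \<partial>distr M borel (X 1))"
      by (rule integral_distr[OF X1, symmetric]) (intro borel_measurable_power U.ghat_meas)
    also have "\<dots> = (\<integral>y. (U.ghat y)\<^sup>2 \<partial>\<mu>)" by (simp only: id order_refl)
    finally show ?thesis using nondegenerate by simp
  qed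
  define v where "v = sqrt (\<integral>y. (U.ghat y)\<^sup>2 \<partial>\<mu>)"
  have v: "v > 0" "v\<^sup>2 = (\<integral>y. (U.ghat y)\<^sup>2 \<partial>\<mu>)" using nondeg by (simp_all add: v_def)
  define Us where "Us n x = (\<Sum>i\<in>increasing_tuples m n. h (\<lambda>j\<in>{..<m}. x (i j)))" for n x
  define Rs where "Rs n x = (\<Sum>i\<in>increasing_tuples m n. U.resid i x)" for n x
  have U_sum_eq: "U_sum X h m n \<omega> = Us n (\<Xi> n \<omega>)" for n \<omega>
    unfolding U_sum_def Us_def
    by (intro sum.cong refl arg_cong[where f=h] restrict_ext) (auto simp: \<Xi>_def increasing_tuples_def)
  have Usm: "Us n \<in> borel_measurable (U.PI {1..n})" for n
    unfolding Us_def[abs_def] by (rule U.kernel_sum_meas)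
  \<comment> \<open>The statistic is centred, so its variance is its second moment, and this can be
    computed on the product space.\<close>
  have sigma: "U_sigma M X h m n = sqrt (\<integral>x. (Us n x)\<^sup>2 \<partial>U.PI {1..n})" if n: "n \<ge> 1" for n
  proof -
    have "expectation (U_sum X h m n) = (\<integral>x. Us n x \<partial>U.PI {1..n})"
      using integral_distr[OF \<Xi>m[OF n] Usm] unfolding \<Xi>law[OF n] U_sum_eq[abs_def] by simp
    also have "\<dots> = 0" unfolding Us_def using U.kernel_sum_expectation[OF h1, of n] h0 by simp
    finally have "variance (U_sum X h m n) = (\<integral>\<omega>. (Us n (\<Xi> n \<omega>))\<^sup>2 \<partial>M)" by (simp add: U_sum_eq)
    also have "\<dots> = (\<integral>x. (Us n x)\<^sup>2 \<partial>U.PI {1..n})"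
      using integral_distr[OF \<Xi>m[OF n] borel_measurable_power[OF Usm[of n], of 2]] unfolding \<Xi>law[OF n] by simp
    finally show ?thesis by (simp add: U_sigma_def)
  qed
  obtain C1 N1 where C1: "C1 > 0" and nf: "\<And>n. n \<ge> N1 \<Longrightarrow> sqrt (\<integral>x. (Us n x)\<^sup>2 \<partial>U.PI {1..n}) > 0
    \<and> \<bar>real ((n - 1) choose (m - 1)) * sqrt (real n) * v / sqrt (\<integral>x. (Us n x)\<^sup>2 \<partial>U.PI {1..n}) - 1\<bar> \<le> C1 / sqrt (real n)
    \<and> (\<integral>\<^sup>+x. ennreal (\<bar>Rs n x / sqrt (\<integral>x. (Us n x)\<^sup>2 \<partial>U.PI {1..n})\<bar> powr p) \<partial>U.PI {1..n}) \<le> ennreal (C1 * real n powr (- p / 2))"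
    using U.normal_form[OF p m2 hp h0 nondeg] unfolding v_def Us_def Rs_def by blast
  \<comment> \<open>Standardised first-order terms. Their moment of order p + 2 comes from that of
    the kernel by \<open>ghat_moment_le\<close>.\<close>
  define \<zeta> where "\<zeta> i \<omega> = U.ghat (X i \<omega>) / v" for i \<omega>
  define \<nu> where "\<nu> = distr \<mu> borel (\<lambda>y. U.ghat y / v)"
  have gv: "(\<lambda>y. U.ghat y / v) \<in> borel_measurable \<mu>" by simp
  have \<zeta>ind: "indep_vars (\<lambda>_. borel) \<zeta> {1..}"
    unfolding \<zeta>_def[abs_def] by (rule indep_vars_compose2[OF indep, of "\<lambda>_ y. U.ghat y / v"]) simp
  have \<zeta>id: "distr M borel (\<zeta> i) = \<nu>" if i: "i \<ge> 1" for i
  proof -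
    have "(\<lambda>y. U.ghat y / v) \<in> borel_measurable borel" by simp
    from distr_distr[OF this Xm[OF i]] show ?thesis
      unfolding \<nu>_def \<zeta>_def[abs_def] by (simp only: id[OF i] comp_def)
  qed
  have \<nu>mean: "(\<integral>x. x \<partial>\<nu>) = 0"
    unfolding \<nu>_def using g0 by (subst integral_distr[OF gv]) simp_all
  have \<nu>var: "(\<integral>x. x\<^sup>2 \<partial>\<nu>) = 1"
    unfolding \<nu>_def using v nondeg by (subst integral_distr[OF gv]) (simp_all add: power_divide)
  have \<nu>mom: "integrable \<nu> (\<lambda>x. \<bar>x\<bar> powr (p + 2))"
  proof -
    have "(\<integral>\<^sup>+y. ennreal (\<bar>U.ghat y\<bar> powr (p + 2)) \<partial>\<mu>) \<le> (\<integral>\<^sup>+x. ennreal (\<bar>h x\<bar> powr (p + 2)) \<partial>U.PI {..<m})"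
      using p by (intro U.ghat_moment_le) simp
    also have "\<dots> < \<infinity>" using hp by (simp add: integrable_iff_bounded)
    finally have "integrable \<mu> (\<lambda>y. \<bar>U.ghat y\<bar> powr (p + 2))" by (simp add: integrable_iff_bounded)
    then have "integrable \<mu> (\<lambda>y. \<bar>U.ghat y / v\<bar> powr (p + 2))" using v by (simp add: abs_divide powr_divide)
    then show ?thesis unfolding \<nu>_def by (subst integrable_distr_eq[OF gv]) simp_all
  qed
  obtain C2 N2 where C2: "C2 > 0" and cpl: "\<And>n. n \<ge> N2 \<Longrightarrow> \<exists>Z. Z \<in> borel_measurable (M \<Otimes>\<^sub>M std_normal_distribution) \<and> distr (M \<Otimes>\<^sub>M std_normal_distribution) borel Z = std_normal_distribution
    \<and> (\<integral>\<^sup>+\<omega>. ennreal (\<bar>(\<Sum>i\<in>{1..n}. \<zeta> i (fst \<omega>)) - sqrt (real n) * Z \<omega>\<bar> powr p) \<partial>(M \<Otimes>\<^sub>M std_normal_distribution)) \<le> ennreal C2"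
    using iid_gaussian_coupling[OF p \<zeta>ind \<zeta>id \<nu>mean \<nu>var \<nu>mom] by blast
  obtain m0 where m0: "m0 \<ge> 0" "(\<integral>\<^sup>+z. ennreal (\<bar>z\<bar> powr p) \<partial>std_normal_distribution) = ennreal m0"
    by (rule nn_integral_std_normal_powr[OF p])
  define D where "D = 5 powr p * (C1 + (1 + C1) powr p * C2 + C1 powr p * m0)"
  have D: "D > 0" unfolding D_def using C1 C2 m0 by (intro mult_pos_pos add_pos_nonneg mult_nonneg_nonneg) auto
  interpret G: prob_space std_normal_distribution by (rule prob_space_std_normal_distribution)
  interpret PB: pair_prob_space M std_normal_distribution ..
  have "wasserstein p (distr M borel (W M X h m n)) std_normal_distribution \<le> ennreal (D powr (1 / p) * real n powr (- 1 / 2))"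
    if n: "n \<ge> max 1 (max N1 N2)" for n
  proof -
    have n1: "n \<ge> 1" "real n > 0" using n by auto
    let ?B = "M \<Otimes>\<^sub>M std_normal_distribution"
    define \<sigma> where "\<sigma> = U_sigma M X h m n"
    define b where "b = real ((n - 1) choose (m - 1))"
    \<comment> \<open>Ratio of the standard deviation of the first-order part to \<sigma>; it
      differs from 1 by O(n^(-1/2)).\<close>
    define c where "c = b * sqrt (real n) * v / \<sigma>"
    have \<sigma>: "\<sigma> > 0" and c: "\<bar>c - 1\<bar> \<le> C1 / sqrt (real n)"
      and I1: "(\<integral>\<^sup>+x. ennreal (\<bar>Rs n x / \<sigma>\<bar> powr p) \<partial>U.PI {1..n}) \<le> ennreal (C1 * real n powr (- p / 2))"
      using nf[of n] n unfolding sigma[OF n1(1), folded \<sigma>_def, symmetric] c_def b_def by auto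
    obtain Z where Z[measurable]: "Z \<in> borel_measurable ?B" and lawZ: "distr ?B borel Z = std_normal_distribution"
      and I2: "(\<integral>\<^sup>+\<omega>. ennreal (\<bar>(\<Sum>i\<in>{1..n}. \<zeta> i (fst \<omega>)) - sqrt (real n) * Z \<omega>\<bar> powr p) \<partial>?B) \<le> ennreal C2"
      using cpl[of n] n by auto
    let ?W = "W M X h m n"
    have Wm: "?W \<in> borel_measurable M"
      unfolding W_def[abs_def] U_sum_eq by (intro borel_measurable_divide measurable_compose[OF \<Xi>m[OF n1(1)] Usm]) simp
    have WB[measurable]: "(\<lambda>\<omega>. ?W (fst \<omega>)) \<in> borel_measurable ?B" by (rule measurable_compose[OF measurable_fst Wm])
    have fstlaw: "distr ?B M fst = M" by (rule G.distr_pair_fst)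
    define \<gamma> where "\<gamma> = distr ?B (borel \<Otimes>\<^sub>M borel) (\<lambda>\<omega>. (?W (fst \<omega>), Z \<omega>))"
    have \<gamma>: "\<gamma> \<in> couplings (distr M borel ?W) std_normal_distribution"
    proof -
      have "distr \<gamma> borel fst = distr ?B borel (\<lambda>\<omega>. ?W (fst \<omega>))"
        unfolding \<gamma>_def by (subst distr_distr) (simp_all add: comp_def)
      also have "\<dots> = distr (distr ?B M fst) borel ?W" using Wm by (subst distr_distr) (simp_all add: comp_def)
      finally have "distr \<gamma> borel fst = distr M borel ?W" unfolding fstlaw .
      moreover have "distr \<gamma> borel snd = std_normal_distribution"
        unfolding \<gamma>_def by (subst distr_distr) (simp_all add: comp_def lawZ)
      ultimately show ?thesis by (simp add: couplings_def \<gamma>_def)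
    qed
    have Rm: "Rs n \<in> borel_measurable (U.PI {1..n})"
      unfolding Rs_def[abs_def] by (intro borel_measurable_sum U.resid_meas) (auto simp: increasing_tuples_def)
    let ?R = "\<lambda>\<omega>. Rs n (\<Xi> n (fst \<omega>)) / \<sigma>"
    let ?S = "\<lambda>\<omega>. (\<Sum>i\<in>{1..n}. \<zeta> i (fst \<omega>)) - sqrt (real n) * Z \<omega>"
    have RB[measurable]: "?R \<in> borel_measurable ?B"
      by (intro borel_measurable_divide measurable_compose[OF measurable_compose[OF measurable_fst \<Xi>m[OF n1(1)]] Rm]) simp
    have \<zeta>m: "\<zeta> i \<in> borel_measurable M" if "i \<ge> 1" for i using \<zeta>ind that unfolding indep_vars_def by auto
    have SB[measurable]: "?S \<in> borel_measurable ?B"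
      by (intro borel_measurable_diff borel_measurable_sum borel_measurable_times measurable_compose[OF measurable_fst \<zeta>m] Z) auto
    \<comment> \<open>Remainder, coupling error of the i.i.d. sum, and scale correction; the two
      zeros fill up the five terms of \<open>abs_sum5_powr_le\<close>.\<close>
    have decomp: "?W (fst \<omega>) - Z \<omega> = ?R \<omega> + c / sqrt (real n) * ?S \<omega> + (c - 1) * Z \<omega> + 0 + 0" for \<omega>
    proof -
      have "(\<Sum>k\<in>{1..n}. U.ghat (\<Xi> n (fst \<omega>) k)) = v * (\<Sum>k\<in>{1..n}. \<zeta> k (fst \<omega>))"
        using v(1) by (simp add: sum_distrib_left \<zeta>_def \<Xi>_def)
      then have "Us n (\<Xi> n (fst \<omega>)) = Rs n (\<Xi> n (fst \<omega>)) + b * (v * (\<Sum>k\<in>{1..n}. \<zeta> k (fst \<omega>)))"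
        using U.hajek_decomposition[where n = n and x = "\<Xi> n (fst \<omega>)"] by (simp add: Us_def Rs_def b_def)
      then have "?W (fst \<omega>) = ?R \<omega> + b * v / \<sigma> * (\<Sum>k\<in>{1..n}. \<zeta> k (fst \<omega>))"
        by (simp add: W_def U_sum_eq \<sigma>_def add_divide_distrib)
      moreover have "b * v / \<sigma> = c / sqrt (real n)" using n1 by (simp add: c_def)
      moreover have "c / sqrt (real n) * (sqrt (real n) * Z \<omega>) = c * Z \<omega>" using n1 by simp
      ultimately show ?thesis by (simp only: right_diff_distrib left_diff_distrib)
    qed
    \<comment> \<open>The p-th power of the rate n^(-1/2); each of the three terms is a constant
      times \<open>q\<close>.\<close>
    define q where "q = real n powr (- p / 2)"
    have q: "q > 0" using n1 by (simp add: q_def)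
    have qs: "(a / sqrt (real n)) powr p = a powr p * q" if "a \<ge> 0" for a
      using that n1 by (simp add: q_def powr_divide powr_half_sqrt[symmetric] powr_powr powr_minus_divide)
    have J1: "(\<integral>\<^sup>+\<omega>. ennreal (\<bar>?R \<omega>\<bar> powr p) \<partial>?B) \<le> ennreal (C1 * q)"
    proof -
      have "(\<integral>\<^sup>+\<omega>. ennreal (\<bar>?R \<omega>\<bar> powr p) \<partial>?B) = (\<integral>\<^sup>+\<omega>. ennreal (\<bar>Rs n (\<Xi> n \<omega>) / \<sigma>\<bar> powr p) \<partial>distr ?B M fst)"
        using measurable_compose[OF \<Xi>m[OF n1(1)] Rm] by (subst nn_integral_distr) simp_all
      also have "\<dots> = (\<integral>\<^sup>+x. ennreal (\<bar>Rs n x / \<sigma>\<bar> powr p) \<partial>distr M (U.PI {1..n}) (\<Xi> n))"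
        unfolding fstlaw using \<Xi>m[OF n1(1)] Rm by (subst nn_integral_distr) simp_all
      finally show ?thesis using I1 unfolding \<Xi>law[OF n1(1)] q_def by simp
    qed
    have J2: "(\<integral>\<^sup>+\<omega>. ennreal (\<bar>c / sqrt (real n) * ?S \<omega>\<bar> powr p) \<partial>?B) \<le> ennreal ((1 + C1) powr p * C2 * q)"
    proof -
      have "C1 / sqrt (real n) \<le> C1" using C1 n1 by (simp add: divide_le_eq)
      then have c': "\<bar>c\<bar> \<le> 1 + C1" using c by linarith
      have "(\<integral>\<^sup>+\<omega>. ennreal (\<bar>c / sqrt (real n) * ?S \<omega>\<bar> powr p) \<partial>?B) \<le> (\<integral>\<^sup>+\<omega>. ennreal ((1 + C1) powr p * q) * ennreal (\<bar>?S \<omega>\<bar> powr p) \<partial>?B)"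
      proof (rule nn_integral_mono)
        fix \<omega>
        have "\<bar>c / sqrt (real n) * ?S \<omega>\<bar> powr p = (\<bar>c\<bar> / sqrt (real n)) powr p * \<bar>?S \<omega>\<bar> powr p"
          by (subst powr_mult[symmetric]) (auto simp: abs_mult abs_divide)
        also have "\<dots> \<le> ((1 + C1) / sqrt (real n)) powr p * \<bar>?S \<omega>\<bar> powr p"
          using c' p by (intro mult_right_mono powr_mono2 divide_right_mono) auto
        also have "\<dots> = (1 + C1) powr p * q * \<bar>?S \<omega>\<bar> powr p" using C1 by (subst qs) auto
        finally show "ennreal (\<bar>c / sqrt (real n) * ?S \<omega>\<bar> powr p) \<le> ennreal ((1 + C1) powr p * q) * ennreal (\<bar>?S \<omega>\<bar> powr p)"
          using q by (subst ennreal_mult[symmetric]) (auto intro: ennreal_leI)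
      qed
      also have "\<dots> = ennreal ((1 + C1) powr p * q) * (\<integral>\<^sup>+\<omega>. ennreal (\<bar>?S \<omega>\<bar> powr p) \<partial>?B)"
        by (rule nn_integral_cmult) measurable
      also have "\<dots> \<le> ennreal ((1 + C1) powr p * q) * ennreal C2" by (rule mult_left_mono[OF I2]) simp
      also have "\<dots> = ennreal ((1 + C1) powr p * C2 * q)"
        using q C2 by (subst ennreal_mult[symmetric]) (auto simp: mult_ac)
      finally show ?thesis .
    qed
    have J3: "(\<integral>\<^sup>+\<omega>. ennreal (\<bar>(c - 1) * Z \<omega>\<bar> powr p) \<partial>?B) \<le> ennreal (C1 powr p * m0 * q)"
    proof -
      have "(\<integral>\<^sup>+\<omega>. ennreal (\<bar>(c - 1) * Z \<omega>\<bar> powr p) \<partial>?B) \<le> (\<integral>\<^sup>+\<omega>. ennreal (C1 powr p * q) * ennreal (\<bar>Z \<omega>\<bar> powr p) \<partial>?B)"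
      proof (rule nn_integral_mono)
        fix \<omega>
        have "\<bar>(c - 1) * Z \<omega>\<bar> powr p = \<bar>c - 1\<bar> powr p * \<bar>Z \<omega>\<bar> powr p" by (simp add: abs_mult powr_mult)
        also have "\<dots> \<le> (C1 / sqrt (real n)) powr p * \<bar>Z \<omega>\<bar> powr p"
          using c p by (intro mult_right_mono powr_mono2) auto
        also have "\<dots> = C1 powr p * q * \<bar>Z \<omega>\<bar> powr p" using C1 by (subst qs) auto
        finally show "ennreal (\<bar>(c - 1) * Z \<omega>\<bar> powr p) \<le> ennreal (C1 powr p * q) * ennreal (\<bar>Z \<omega>\<bar> powr p)"
          using q by (subst ennreal_mult[symmetric]) (auto intro: ennreal_leI)
      qed
      also have "\<dots> = ennreal (C1 powr p * q) * (\<integral>\<^sup>+\<omega>. ennreal (\<bar>Z \<omega>\<bar> powr p) \<partial>?B)"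
        by (rule nn_integral_cmult) measurable
      also have "(\<integral>\<^sup>+\<omega>. ennreal (\<bar>Z \<omega>\<bar> powr p) \<partial>?B) = (\<integral>\<^sup>+z. ennreal (\<bar>z\<bar> powr p) \<partial>distr ?B borel Z)"
        by (subst nn_integral_distr) simp_all
      also have "\<dots> = ennreal m0" unfolding lawZ by (rule m0(2))
      also have "ennreal (C1 powr p * q) * ennreal m0 = ennreal (C1 powr p * m0 * q)"
        using q m0 by (subst ennreal_mult[symmetric]) (auto simp: mult_ac)
      finally show ?thesis .
    qed
    have "(\<integral>\<^sup>+(x, y). ennreal (\<bar>x - y\<bar> powr p) \<partial>\<gamma>) = (\<integral>\<^sup>+\<omega>. ennreal (\<bar>?W (fst \<omega>) - Z \<omega>\<bar> powr p) \<partial>?B)"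
      unfolding \<gamma>_def by (subst nn_integral_distr) simp_all
    also have "\<dots> \<le> (\<integral>\<^sup>+\<omega>. ennreal (5 powr p) * (ennreal (\<bar>?R \<omega>\<bar> powr p) + (ennreal (\<bar>c / sqrt (real n) * ?S \<omega>\<bar> powr p) + ennreal (\<bar>(c - 1) * Z \<omega>\<bar> powr p))) \<partial>?B)"
    proof (rule nn_integral_mono)
      fix \<omega>
      have "\<bar>?W (fst \<omega>) - Z \<omega>\<bar> powr p \<le> 5 powr p * (\<bar>?R \<omega>\<bar> powr p + (\<bar>c / sqrt (real n) * ?S \<omega>\<bar> powr p + \<bar>(c - 1) * Z \<omega>\<bar> powr p))"
        unfolding decomp using abs_sum5_powr_le[OF p, of "?R \<omega>" "c / sqrt (real n) * ?S \<omega>" "(c - 1) * Z \<omega>" 0 0]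
        by (simp only: abs_zero powr_zero_eq_one powr_0 add_0_right add.assoc)
      from ennreal_leI[OF this]
      show "ennreal (\<bar>?W (fst \<omega>) - Z \<omega>\<bar> powr p) \<le> ennreal (5 powr p) * (ennreal (\<bar>?R \<omega>\<bar> powr p) + (ennreal (\<bar>c / sqrt (real n) * ?S \<omega>\<bar> powr p) + ennreal (\<bar>(c - 1) * Z \<omega>\<bar> powr p)))"
        by (simp only: ennreal_mult ennreal_plus powr_ge_zero add_nonneg_nonneg)
    qed
    also have "\<dots> = ennreal (5 powr p) * ((\<integral>\<^sup>+\<omega>. ennreal (\<bar>?R \<omega>\<bar> powr p) \<partial>?B)
      + ((\<integral>\<^sup>+\<omega>. ennreal (\<bar>c / sqrt (real n) * ?S \<omega>\<bar> powr p) \<partial>?B) + (\<integral>\<^sup>+\<omega>. ennreal (\<bar>(c - 1) * Z \<omega>\<bar> powr p) \<partial>?B)))"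
      by (subst nn_integral_cmult, measurable) (subst nn_integral_add, measurable)+
    also have "\<dots> \<le> ennreal (5 powr p) * (ennreal (C1 * q) + (ennreal ((1 + C1) powr p * C2 * q) + ennreal (C1 powr p * m0 * q)))"
      by (intro mult_left_mono add_mono J1 J2 J3) simp
    also have "\<dots> = ennreal (D * q)"
    proof -
      have nn: "C1 * q \<ge> 0" "(1 + C1) powr p * C2 * q \<ge> 0" "C1 powr p * m0 * q \<ge> 0" using C1 C2 m0 q by auto
      have "D * q = 5 powr p * (C1 * q + ((1 + C1) powr p * C2 * q + C1 powr p * m0 * q))"
        by (simp add: D_def algebra_simps)
      then show ?thesis using nn by (simp only: ennreal_mult ennreal_plus powr_ge_zero add_nonneg_nonneg)
    qed
    also have "D * q = (D powr (1 / p) * real n powr (- 1 / 2)) powr p"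
      using D p n1 by (simp add: q_def powr_mult powr_powr)
    finally show ?thesis
      using D by (intro wasserstein_le_coupling[OF p _ \<gamma>]) auto
  qed
  then show ?thesis unfolding eventually_sequentially by blast
qed

end
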